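(* Let $\mathbb P_N$ be the measures described in the context and suppose that assumptions (A1), (A2), (A3) stated there hold. In addition suppose that, with $\hat n_i=n_i(N)/N$, $|\hat n_i-\nu_i|\le A_7N^{-1}\log N$ for some positive constants $A_7$ and $\nu_i$, $i=1,\dots,k$, with $\sum_i\nu_i=1$. Let $\mu_N=\frac1N\sum_{i=1}^N\delta(\ell_i)$, with $(\ell_1,\dots,\ell_N)$ distributed according to $\mathbb P_N$. Then there is a deterministic probability measure $\mu(x)dx$, depending on $\nu_1,\dots,\nu_k$, such that $\mu_N$ concentrate (in probability) near $\mu$. More precisely, for each Lipschitz function $f$ defined in a real neighborhood of $\bigcup_{i=1}^k[\hat a_i,\hat b_i]$ and each $\varepsilon>0$ the random variables $$N^{1/2-\varepsilon}\left|\int_{\mathbb R}f(x)\mu_N(dx)-\int_{\mathbb R}f(x)\mu(x)dx\right|$$ converge to $0$ as $N\to\infty$ in probability and in the sense of moments.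
   Context: Finite system. Fix $k\in\mathbb N$, $\theta>0$. For each $N$ let $q=q_N\in(0,1)$, $M=M_N\in\mathbb N$ with $M\ge N-1$, $u=u_N\in[0,1)$; integers $n_1(N),\dots,n_k(N)$, $N_j=\sum_{i\le j}n_i(N)$, $N_0=0$, $N_k=N$; integers $a_i=a_i(N),b_i=b_i(N)$ with $0\le a_i\le b_i-1\le M-N+1$ and $b_i\le a_{i+1}$. The state space $\mathfrak X^\theta_N$ is the set of $(\ell_1,\dots,\ell_N)$ with $\ell_i=q^{-\lambda_i}+uq^{\lambda_i}$, $\lambda_i=x_i+(i-1)\theta$, $x_1\le\dots\le x_N$ integers, and $a_j\le x_i\le b_j-1$ whenever $N_{j-1}+1\le i\le N_j$. Put $\alpha_i(N)=q^{-a_i-N_{i-1}\theta}+uq^{a_i+N_{i-1}\theta}$, $\beta_i(N)=q^{-b_i-(N_i-1)\theta}+uq^{b_i+(N_i-1)\theta}$, and let $\beta_i^-(N)$ be the largest element of $\{q^{-x-(N_i-1)\theta}+uq^{x+(N_i-1)\theta}:x\in\mathbb Z\}$ (the points with $x\ge0$) less than $\beta_i(N)$, i.e. the value with $b_i$ replaced by $b_i-1$. The measure on $\mathfrak X^\theta_N$ is $$\mathbb P_N(\ell)=\frac1{Z_N}\prod_{i<j}H(\ell_i,\ell_j)\prod_{i=1}^Nw(\ell_i;N),$$ $$H(\ell_i,\ell_j)=q^{-2\theta\lambda_j}\frac{\Gamma_q(\lambda_j-\lambda_i+1)\Gamma_q(\lambda_j-\lambda_i+\theta)}{\Gamma_q(\lambda_j-\lambda_i)\Gamma_q(\lambda_j-\lambda_i+1-\theta)}\cdot\frac{\Gamma_q(\lambda_j+\lambda_i+v+1)\Gamma_q(\lambda_j+\lambda_i+v+\theta)}{\Gamma_q(\lambda_j+\lambda_i+v)\Gamma_q(\lambda_j+\lambda_i+v+1-\theta)},$$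 where $q^v=u$ (for $u=0$ the last fraction is a constant and is dropped), $\Gamma_q(x)=(1-q)^{1-x}\frac{(q;q)_\infty}{(q^x;q)_\infty}$, $(a;q)_\infty=\prod_{j\ge0}(1-aq^j)$, and $w(\cdot;N)>0$ on $\bigcup_i[\alpha_i(N),\beta_i^-(N)]$. (A1) There are fixed $\mathsf q\in(0,1)$, $\mathsf M\ge1$, $\mathsf u\in[0,1)$ and $A_1>0$ with $\max(N^2|q_N-\mathsf q^{1/N}|,|M_N-N\mathsf M|,N|u_N-\mathsf u|)\le A_1$. (A2) There are $1+\mathsf u\le\hat a_1<\hat b_1<\hat a_2<\dots<\hat a_k<\hat b_k\le\mathsf q^{-\mathsf M-\theta+1}+\mathsf u\mathsf q^{\mathsf M+\theta-1}$ and $A_2>0$ with $|\alpha_i(N)-\hat a_i|,|\beta_i(N)-\hat b_i|\le A_2N^{-1}\log N$. On $[\alpha_i(N),\beta_i^-(N)]$, $w(x;N)=\exp(-NV_N(x))$ with $V_N$ continuous and $|V_N-V|\le A_3N^{-1}\log N$, where $V$ is continuous (on a real interval containing all intervals considered) with $|V|\le A_4$; $V$ is differentiable and $|V'(s)|\le A_5\big[1+\sum_{i=1}^k(|\log|s-\hat a_i||+|\log|s-\hat b_i||)\big]$ for $s\in[1+\mathsf u,\mathsf q^{-\mathsf M-\theta+1}+\mathsf u\mathsf q^{\mathsf M+\theta-1}]$. Here $A_3,A_4,A_5>0$ are constants. (A3) With $\sigma_{\mathsf q}(x)=\mathsf q^{-x}+\mathsf u\mathsf q^x$ (a bijection of $[0,\mathsf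 M+\theta-1]$ onto $[1+\mathsf u,\mathsf q^{-\mathsf M-\theta+1}+\mathsf u\mathsf q^{\mathsf M+\theta-1}]$), there is $A_6>0$ such that for all large $N$ and all $i$: $A_6<n_i(N)/N<\theta^{-1}[\sigma_{\mathsf q}^{-1}(\hat b_i)-\sigma_{\mathsf q}^{-1}(\hat a_i)]-A_6$. *)

theory Defs
  imports "HOL-Probability.Probability"
begin

definition qpochhammer_inf :: "real \<Rightarrow> real \<Rightarrow> real" where
  "qpochhammer_inf a q = (\<Prod>j. 1 - a * q ^ j)"

definition q_Gamma :: "real \<Rightarrow> real \<Rightarrow> real" where
  "q_Gamma q x = (1 - q) powr (1 - x) * qpochhammer_inf q q / qpochhammer_inf (q powr x) q"

definition quad_lattice :: "real \<Rightarrow> real \<Rightarrow> real \<Rightarrow> real" where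
  "quad_lattice q u x = q powr (- x) + u * q powr x"

lemma quad_lattice_strict_mono:
  assumes "0 < q" "q < 1" "0 \<le> u" "u < 1"
  shows "strict_mono_on {0..} (quad_lattice q u)"
proof (rule strict_mono_onI)
  fix x y :: real
  assume xy: "x \<in> {0..}" "y \<in> {0..}" "x < y"
  define s t where "s = q powr x" and "t = q powr y"
  have t: "0 < t" "t < s" "s \<le> 1"
    using xy assms by (auto simp: s_def t_def powr_le1 intro: powr_less_mono')
  have "u * (s * t) < 1"
  proof -
    have "s * t \<le> 1" "0 < s * t" using t by (auto intro: mult_le_one)
    hence "u * (s * t) \<le> u" using assms by (simp add: mult_left_le)
    thus ?thesis using assms by linarith
  qed
  hence "0 < (s - t) * (1 - u * (s * t)) / (s * t)"
    using t by simp
  also have "\<dots> = (1 / t + u * t) - (1 / s + u * s)"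
    using t by (simp add: field_simps)
  finally show "quad_lattice q u x < quad_lattice q u y"
    by (simp add: quad_lattice_def powr_minus s_def t_def divide_simps)
qed

(* The inverse of quad_lattice on the half-line x >= 0. On values in
   [1 + u, quad_lattice q u c] it agrees with the inverse of the restriction to [0, c]. *)
definition quad_lattice_inv :: "real \<Rightarrow> real \<Rightarrow> real \<Rightarrow> real" where
  "quad_lattice_inv q u l = the_inv_into {0..} (quad_lattice q u) l"

lemma quad_lattice_inv_quad_lattice:
  assumes "0 < q" "q < 1" "0 \<le> u" "u < 1" "0 \<le> x"
  shows "quad_lattice_inv q u (quad_lattice q u x) = x"
  unfolding quad_lattice_inv_def
  using assms quad_lattice_strict_mono[of q u]
  by (intro the_inv_into_f_f strict_mono_on_imp_inj_on) auto

(* Throughout, the components of a configuration and the blocks are indexed from 1,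
   and n i is the number of particles in block i. *)
definition block_end :: "(nat \<Rightarrow> nat) \<Rightarrow> nat \<Rightarrow> nat" where
  "block_end n j = (\<Sum>i = 1..j. n i)"

definition alpha_pt :: "real \<Rightarrow> real \<Rightarrow> real \<Rightarrow> (nat \<Rightarrow> nat) \<Rightarrow> (nat \<Rightarrow> int) \<Rightarrow> nat \<Rightarrow> real" where
  "alpha_pt \<theta> q u n a i = quad_lattice q u (of_int (a i) + real (block_end n (i - 1)) * \<theta>)"

definition beta_pt :: "real \<Rightarrow> real \<Rightarrow> real \<Rightarrow> (nat \<Rightarrow> nat) \<Rightarrow> (nat \<Rightarrow> int) \<Rightarrow> nat \<Rightarrow> real" where
  "beta_pt \<theta> q u n b i = quad_lattice q u (of_int (b i) + (real (block_end n i) - 1) * \<theta>)"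

definition beta_minus_pt :: "real \<Rightarrow> real \<Rightarrow> real \<Rightarrow> (nat \<Rightarrow> nat) \<Rightarrow> (nat \<Rightarrow> int) \<Rightarrow> nat \<Rightarrow> real" where
  "beta_minus_pt \<theta> q u n b i = beta_pt \<theta> q u n (\<lambda>j. b j - 1) i"

definition finite_system ::
  "nat \<Rightarrow> real \<Rightarrow> nat \<Rightarrow> real \<Rightarrow> nat \<Rightarrow> real \<Rightarrow> (nat \<Rightarrow> nat) \<Rightarrow> (nat \<Rightarrow> int) \<Rightarrow> (nat \<Rightarrow> int) \<Rightarrow> (real \<Rightarrow> real) \<Rightarrow> bool"
where
  "finite_system k \<theta> N q M u n a b w \<longleftrightarrow>
     0 < q \<and> q < 1 \<and> int M \<ge> int N - 1 \<and> 0 \<le> u \<and> u < 1 \<and>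
     block_end n k = N \<and>
     (\<forall>i\<in>{1..k}. 0 \<le> a i \<and> a i \<le> b i - 1 \<and> b i - 1 \<le> int M - int N + 1) \<and>
     (\<forall>i\<in>{1..<k}. b i \<le> a (i + 1)) \<and>
     (\<forall>i\<in>{1..k}. \<forall>x\<in>{alpha_pt \<theta> q u n a i..beta_minus_pt \<theta> q u n b i}. 0 < w x)"

(* N-tuples are represented as functions that are undefined outside {1..N}. *)
definition state_space ::
  "nat \<Rightarrow> real \<Rightarrow> nat \<Rightarrow> real \<Rightarrow> real \<Rightarrow> (nat \<Rightarrow> nat) \<Rightarrow> (nat \<Rightarrow> int) \<Rightarrow> (nat \<Rightarrow> int) \<Rightarrow> (nat \<Rightarrow> real) set"
where
  "state_space k \<theta> N q u n a b =
     {restrict (\<lambda>i. quad_lattice q u (of_int (x i) + (real i - 1) * \<theta>)) {1..N} | x :: nat \<Rightarrow> int.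
        (\<forall>i\<in>{1..N}. \<forall>j\<in>{1..N}. i \<le> j \<longrightarrow> x i \<le> x j) \<and>
        (\<forall>j\<in>{1..k}. \<forall>i\<in>{block_end n (j - 1) + 1..block_end n j}. a j \<le> x i \<and> x i \<le> b j - 1)}"

definition interaction_H :: "real \<Rightarrow> real \<Rightarrow> real \<Rightarrow> real \<Rightarrow> real \<Rightarrow> real" where
  "interaction_H \<theta> q u li lj =
     (let x = quad_lattice_inv q u li; y = quad_lattice_inv q u lj; v = log q u
      in q powr (- 2 * \<theta> * y) *
         (q_Gamma q (y - x + 1) * q_Gamma q (y - x + \<theta>) /
           (q_Gamma q (y - x) * q_Gamma q (y - x + 1 - \<theta>))) *
         (if u = 0 then 1
          else q_Gamma q (y + x + v + 1) * q_Gamma q (y + x + v + \<theta>) /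
            (q_Gamma q (y + x + v) * q_Gamma q (y + x + v + 1 - \<theta>))))"

definition gibbs_weight ::
  "real \<Rightarrow> nat \<Rightarrow> real \<Rightarrow> real \<Rightarrow> (real \<Rightarrow> real) \<Rightarrow> (nat \<Rightarrow> real) \<Rightarrow> real" where
  "gibbs_weight \<theta> N q u w l =
     (\<Prod>(i, j)\<in>{(i, j). 1 \<le> i \<and> i < j \<and> j \<le> N}. interaction_H \<theta> q u (l i) (l j)) *
     (\<Prod>i = 1..N. w (l i))"

definition partition_fun ::
  "nat \<Rightarrow> real \<Rightarrow> nat \<Rightarrow> real \<Rightarrow> real \<Rightarrow> (nat \<Rightarrow> nat) \<Rightarrow> (nat \<Rightarrow> int) \<Rightarrow> (nat \<Rightarrow> int) \<Rightarrow> (real \<Rightarrow> real) \<Rightarrow> real"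
where
  "partition_fun k \<theta> N q u n a b w =
     (\<Sum>l\<in>state_space k \<theta> N q u n a b. gibbs_weight \<theta> N q u w l)"

definition ensemble ::
  "nat \<Rightarrow> real \<Rightarrow> nat \<Rightarrow> real \<Rightarrow> real \<Rightarrow> (nat \<Rightarrow> nat) \<Rightarrow> (nat \<Rightarrow> int) \<Rightarrow> (nat \<Rightarrow> int) \<Rightarrow> (real \<Rightarrow> real) \<Rightarrow> (nat \<Rightarrow> real) measure"
where
  "ensemble k \<theta> N q u n a b w =
     point_measure (state_space k \<theta> N q u n a b)
       (\<lambda>l. ennreal (gibbs_weight \<theta> N q u w l / partition_fun k \<theta> N q u n a b w))"

(* A pmf rather than a Borel measure, so that every real function is integrable with
   respect to it, including one that is not Borel away from the atoms. *)
definition empirical_measure :: "nat \<Rightarrow> (nat \<Rightarrow> real) \<Rightarrow> real pmf" where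
  "empirical_measure N l = map_pmf l (pmf_of_set {1..N})"

end

theory Submission
  imports Defs
begin

text \<open>The lattice repulsion is, up to a configuration-independent factor and \<open>exp (O (N log N))\<close>,
  \<open>\<bar>\<ell>\<^sub>i - \<ell>\<^sub>j\<bar>\<close> to the power \<open>2\<theta>\<close>, so a weight is \<open>exp (- N\<^sup>2 J F)\<close> with \<open>F\<close> the empirical distribution function and \<open>J\<close> a logarithmic energy.
  For \<open>d \<le> R\<close> one has \<open>ln (R / d) - 1 + d / R = \<integral> (t - d)\<^sub>+ / t\<^sup>2 dt\<close> over \<open>t \<le> R\<close>, where
  \<open>(t - \<bar>x - y\<bar>)\<^sub>+\<close> is the length of the set of \<open>z\<close> with \<open>x, y \<in> (z, z + t]\<close>. Integrated against \<open>dF dF\<close>, the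
  logarithm becomes \<open>\<integral>\<integral> ((F (z + t) - F z) / t)\<^sup>2\<close> plus \<open>2/R \<integral> (F\<^sup>2 - F)\<close>. Hence \<open>J\<close> is strongly convex in
  \<open>L\<^sup>2\<close>, and cutting the integral off at \<open>t\<close> of the order of the lattice spacing makes it finite on step functions,
  with modulus of continuity \<open>O (ln N)\<close> in the sup norm.
  Discretising near-minimisers and regularising configurations costs \<open>O (ln N / N)\<close> in the sup norm, so strong
  convexity and a count of configurations give concentration at the scale \<open>N\<^sup>-\<^sup>1\<^sup>/\<^sup>2\<close> in \<open>L\<^sup>2\<close>, which controls Lipschitz test functions.\<close>

section \<open>Ratios of q-Gamma functions\<close>

text \<open>The obstacle is that the two objects to be compared do not meet: configurations are step
  functions, whose uncut logarithmic energy is infinite, while the variational problem lives on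
  Lipschitz functions. The cutoff mediates: it affects a configuration only on the diagonal, and a
  Lipschitz function only by \<open>O(1 / N)\<close>. The Lipschitz constant comes from the lattice.
  Successive \<open>\<lambda>\<close> differ by at least \<theta>, so in the rescaled coordinate the
  density is at most 1 / \<theta>; the filling fractions prescribe the values at the block ends.
  Consistency of these constraints is read off from existing configurations as N grows. The scale is
  a balance. A sup-norm error \<open>ln N / N\<close> times the modulus \<open>ln N\<close> costs
  \<open>N (ln N)\<^sup>2\<close> in the exponent, the configurations number only
  \<open>exp (O (N ln N))\<close>, and a deviation \<rho> gains a multiple of
  \<open>N\<^sup>2 \<rho>\<^sup>2\<close>, which wins at \<open>\<rho> = N powr (e - 1 / 2)\<close>.
  The potential has a derivative with logarithmic singularities only, so integration by parts makes
  it linear in F. Moments follow since the exceptional probability is at most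
  \<open>exp (- N)\<close> and the variables grow polynomially.\<close>

lemma qpochhammer_inf_powr:
  assumes q: "0 < q" "q < 1" and w: "0 < w"
  shows "0 < qpochhammer_inf (q powr w) q"
    and "(\<lambda>n. \<Sum>j<n. ln (1 - q powr (w + real j))) \<longlonglongrightarrow> ln (qpochhammer_inf (q powr w) q)"
proof -
  have eq: "1 - q powr w * q ^ j = 1 - q powr (w + real j)" for j
    using q by (simp add: powr_add powr_realpow)
  have pos: "0 < 1 - q powr (w + real j)" for j
    using q w powr_less_mono'[of q 0 "w + real j"] by simp
  have "summable (\<lambda>j. q powr w * q ^ j)"
    using q by (intro summable_mult summable_geometric) auto
  hence "abs_convergent_prod (\<lambda>j. 1 - q powr w * q ^ j)"
    using q by (intro summable_imp_abs_convergent_prod) (simp add: abs_mult)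
  hence conv: "convergent_prod (\<lambda>j. 1 - q powr w * q ^ j)"
    by (rule abs_convergent_prod_imp_convergent_prod)
  have nz: "qpochhammer_inf (q powr w) q \<noteq> 0"
    unfolding qpochhammer_inf_def using conv pos
    by (intro prodinf_nonzero) (auto simp: eq less_imp_neq[symmetric])
  have lim: "(\<lambda>n. \<Prod>j<n. 1 - q powr (w + real j)) \<longlonglongrightarrow> qpochhammer_inf (q powr w) q"
    using convergent_prod_LIMSEQ[OF conv] unfolding qpochhammer_inf_def eq
    by (subst LIMSEQ_lessThan_iff_atMost)
  have "0 \<le> qpochhammer_inf (q powr w) q"
    by (rule LIMSEQ_le_const[OF lim]) (auto intro!: prod_nonneg less_imp_le[OF pos])
  with nz show P: "0 < qpochhammer_inf (q powr w) q" by simp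
  have "(\<lambda>n. ln (\<Prod>j<n. 1 - q powr (w + real j))) \<longlonglongrightarrow> ln (qpochhammer_inf (q powr w) q)"
    by (rule tendsto_ln[OF lim nz])
  moreover have "ln (\<Prod>j<n. 1 - q powr (w + real j)) = (\<Sum>j<n. ln (1 - q powr (w + real j)))" for n
    by (intro ln_prod) (use pos in \<open>simp_all add: less_imp_neq[symmetric]\<close>)
  ultimately show "(\<lambda>n. \<Sum>j<n. ln (1 - q powr (w + real j))) \<longlonglongrightarrow> ln (qpochhammer_inf (q powr w) q)"
    by simp
qed

lemma ln_qpochhammer_inf_shift:
  assumes q: "0 < q" "q < 1" and w: "0 < w"
  shows "ln (qpochhammer_inf (q powr w) q) =
         ln (1 - q powr w) + ln (qpochhammer_inf (q powr (w + 1)) q)"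
proof -
  have "(\<lambda>n. ln (1 - q powr w) + (\<Sum>j<n. ln (1 - q powr (w + 1 + real j))))
        \<longlonglongrightarrow> ln (1 - q powr w) + ln (qpochhammer_inf (q powr (w + 1)) q)"
    using w by (intro tendsto_intros qpochhammer_inf_powr q) auto
  moreover have "ln (1 - q powr w) + (\<Sum>j<n. ln (1 - q powr (w + 1 + real j)))
       = (\<Sum>j<Suc n. ln (1 - q powr (w + real j)))" for n
    by (subst sum.lessThan_Suc_shift) (simp add: algebra_simps)
  ultimately have "(\<lambda>n. \<Sum>j<Suc n. ln (1 - q powr (w + real j)))
        \<longlonglongrightarrow> ln (1 - q powr w) + ln (qpochhammer_inf (q powr (w + 1)) q)" by simp
  moreover have "(\<lambda>n. \<Sum>j<Suc n. ln (1 - q powr (w + real j))) \<longlonglongrightarrow> ln (qpochhammer_inf (q powr w) q)"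
    using LIMSEQ_Suc[OF qpochhammer_inf_powr(2)[OF q w]] .
  ultimately show ?thesis by (rule LIMSEQ_unique[symmetric])
qed

lemma ln_one_minus_powr_deriv:
  fixes q w :: real
  assumes q: "0 < q" "q < 1" and w: "0 < w"
  shows "((\<lambda>w. ln (1 - q powr w)) has_real_derivative (- ln q * q powr w / (1 - q powr w))) (at w)"
  using q w powr_less_mono'[of q 0 w]
  by (auto intro!: derivative_eq_intros simp: field_simps)

text \<open>The function \<open>ln (1 - q powr w)\<close> is concave because its derivative
  decreases, so chords further to the right are flatter. The two intervals may touch
  (\<open>t \<le> x\<close>), as they do in the comparison with unit steps below.\<close>

lemma ln_one_minus_powr_slopes:
  fixes q s t x y :: real
  assumes q: "0 < q" "q < 1" and s: "0 < s" "s < t" "t \<le> x" "x < y"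
  shows "(ln (1 - q powr y) - ln (1 - q powr x)) / (y - x)
         \<le> (ln (1 - q powr t) - ln (1 - q powr s)) / (t - s)"
proof -
  let ?g = "\<lambda>w. ln (1 - q powr w)" and ?g' = "\<lambda>w. - ln q * q powr w / (1 - q powr w)"
  obtain z where z: "x < z" "z < y" "?g y - ?g x = (y - x) * ?g' z"
    using MVT2[of x y ?g ?g'] s ln_one_minus_powr_deriv[OF q] by auto
  obtain v where v: "s < v" "v < t" "?g t - ?g s = (t - s) * ?g' v"
    using MVT2[of s t ?g ?g'] s ln_one_minus_powr_deriv[OF q] by auto
  have vz: "q powr z \<le> q powr v" "q powr v < 1" "ln q \<le> 0"
    using q z v s powr_less_mono'[of q 0 v] by (auto intro!: powr_mono')
  have "?g' z \<le> ?g' v"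
    using vz by (intro frac_le mult_left_mono) (auto intro!: mult_nonpos_nonneg)
  thus ?thesis using z v s by simp
qed

text \<open>The difference is a series of increments of \<open>g w = ln (1 - q powr w)\<close> over
  length \<open>A - B\<close>. Concavity compares each of them with the unit increment of
  \<open>g\<close> just to its right (lower bound) or just to its left (upper bound), and the unit
  increments telescope because \<open>g\<close> vanishes at infinity.\<close>

lemma ln_qpochhammer_inf_diff_bounds:
  assumes q: "0 < q" "q < 1" and A: "0 < B" "B \<le> A"
  shows "- (A - B) * ln (1 - q powr (A + 1)) \<le>
           ln (qpochhammer_inf (q powr (A + 1)) q) - ln (qpochhammer_inf (q powr (B + 1)) q)"
    and "ln (qpochhammer_inf (q powr (A + 1)) q) - ln (qpochhammer_inf (q powr (B + 1)) q)
           \<le> - (A - B) * ln (1 - q powr B)"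
proof -
  let ?g = "\<lambda>w. ln (1 - q powr w)"
  have lim: "(\<lambda>n. ?g (w + real n)) \<longlonglongrightarrow> 0" for w
  proof -
    have "(\<lambda>n. q powr w * q ^ n) \<longlonglongrightarrow> q powr w * 0"
      using q by (intro tendsto_intros LIMSEQ_power_zero) auto
    hence "(\<lambda>n. ln (1 - q powr w * q ^ n)) \<longlonglongrightarrow> ln (1 - 0)"
      by (intro tendsto_intros) auto
    thus ?thesis using q by (simp add: powr_add powr_realpow)
  qed
  have S: "(\<lambda>n. (\<Sum>j<n. ?g (A + 1 + real j)) - (\<Sum>j<n. ?g (B + 1 + real j)))
     \<longlonglongrightarrow> ln (qpochhammer_inf (q powr (A + 1)) q) - ln (qpochhammer_inf (q powr (B + 1)) q)"
    using A by (intro tendsto_diff qpochhammer_inf_powr q) auto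
  have step: "(A - B) * (?g (A + 1 + real (Suc j)) - ?g (A + 1 + real j)) \<le> ?g (A + 1 + real j) - ?g (B + 1 + real j)"
       "?g (A + 1 + real j) - ?g (B + 1 + real j) \<le> (A - B) * (?g (B + real (Suc j)) - ?g (B + real j))" for j
  proof -
    consider "A = B" | "B < A" using A by linarith
    hence "(A - B) * (?g (A + 1 + real (Suc j)) - ?g (A + 1 + real j)) \<le> ?g (A + 1 + real j) - ?g (B + 1 + real j)
       \<and> ?g (A + 1 + real j) - ?g (B + 1 + real j) \<le> (A - B) * (?g (B + real (Suc j)) - ?g (B + real j))"
    proof cases
      case 2
      have "(?g (A + 1 + real (Suc j)) - ?g (A + 1 + real j)) / ((A + 1 + real (Suc j)) - (A + 1 + real j))
          \<le> (?g (A + 1 + real j) - ?g (B + 1 + real j)) / ((A + 1 + real j) - (B + 1 + real j))"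
        using 2 A by (intro ln_one_minus_powr_slopes q) auto
      moreover have "(?g (A + 1 + real j) - ?g (B + 1 + real j)) / ((A + 1 + real j) - (B + 1 + real j))
          \<le> (?g (B + real (Suc j)) - ?g (B + real j)) / ((B + real (Suc j)) - (B + real j))"
        using 2 A by (intro ln_one_minus_powr_slopes q) auto
      ultimately show ?thesis using 2 by (simp add: field_simps)
    qed auto
    thus "(A - B) * (?g (A + 1 + real (Suc j)) - ?g (A + 1 + real j)) \<le> ?g (A + 1 + real j) - ?g (B + 1 + real j)"
       "?g (A + 1 + real j) - ?g (B + 1 + real j) \<le> (A - B) * (?g (B + real (Suc j)) - ?g (B + real j))" by auto
  qed
  have lo: "(A - B) * (?g (A + 1 + real n) - ?g (A + 1)) \<le> (\<Sum>j<n. ?g (A + 1 + real j)) - (\<Sum>j<n. ?g (B + 1 + real j))" for n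
  proof -
    have "(A - B) * (?g (A + 1 + real n) - ?g (A + 1)) = (\<Sum>j<n. (A - B) * (?g (A + 1 + real (Suc j)) - ?g (A + 1 + real j)))"
      using sum_lessThan_telescope[of "\<lambda>j. ?g (A + 1 + real j)" n] by (simp only: sum_distrib_left[symmetric]) simp
    also have "\<dots> \<le> (\<Sum>j<n. ?g (A + 1 + real j) - ?g (B + 1 + real j))" by (intro sum_mono step)
    finally show ?thesis by (simp add: sum_subtractf)
  qed
  have hi: "(\<Sum>j<n. ?g (A + 1 + real j)) - (\<Sum>j<n. ?g (B + 1 + real j)) \<le> (A - B) * (?g (B + real n) - ?g B)" for n
  proof -
    have "(\<Sum>j<n. ?g (A + 1 + real j) - ?g (B + 1 + real j)) \<le> (\<Sum>j<n. (A - B) * (?g (B + real (Suc j)) - ?g (B + real j)))"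
      by (intro sum_mono step)
    also have "\<dots> = (A - B) * (?g (B + real n) - ?g B)"
      using sum_lessThan_telescope[of "\<lambda>j. ?g (B + real j)" n] by (simp only: sum_distrib_left[symmetric]) simp
    finally show ?thesis by (simp add: sum_subtractf)
  qed
  have "(\<lambda>n. (A - B) * (?g (A + 1 + real n) - ?g (A + 1))) \<longlonglongrightarrow> (A - B) * (0 - ?g (A + 1))"
    by (intro tendsto_intros lim)
  from LIMSEQ_le[OF this S] lo
  show "- (A - B) * ?g (A + 1) \<le>
           ln (qpochhammer_inf (q powr (A + 1)) q) - ln (qpochhammer_inf (q powr (B + 1)) q)"
    by (auto simp: algebra_simps)
  have "(\<lambda>n. (A - B) * (?g (B + real n) - ?g B)) \<longlonglongrightarrow> (A - B) * (0 - ?g B)"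
    by (intro tendsto_intros lim)
  from LIMSEQ_le[OF S this] hi
  show "ln (qpochhammer_inf (q powr (A + 1)) q) - ln (qpochhammer_inf (q powr (B + 1)) q)
           \<le> - (A - B) * ?g B"
    by (auto simp: algebra_simps)
qed

text \<open>Since \<open>q powr x\<close> is convex with value 1 at the origin, the chords of
  \<open>1 - q powr x\<close> from the origin flatten.\<close>

lemma one_minus_powr_ratio:
  fixes q x y :: real
  assumes q: "0 < q" "q < 1" and x: "0 < x" "x \<le> y"
  shows "(1 - q powr x) / x \<ge> (1 - q powr y) / y"
proof -
  have "convex_on {0..} (\<lambda>x::real. exp (ln q * x))"
  proof (rule f''_ge0_imp_convex[where f' = "\<lambda>x. ln q * exp (ln q * x)" and f'' = "\<lambda>x. ln q * (ln q * exp (ln q * x))"])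
    show "((\<lambda>x. exp (ln q * x)) has_real_derivative ln q * exp (ln q * x)) (at x)" for x
      by (auto intro!: derivative_eq_intros)
    show "((\<lambda>x. ln q * exp (ln q * x)) has_real_derivative ln q * (ln q * exp (ln q * x))) (at x)" for x
      by (auto intro!: derivative_eq_intros)
    show "0 \<le> ln q * (ln q * exp (ln q * x))" for x
      by (metis exp_ge_zero mult.assoc zero_le_mult_iff zero_le_square)
  qed auto
  from convex_onD[OF this, of "x / y" 0 y] x
  have "exp (ln q * x) \<le> (1 - x / y) + x / y * exp (ln q * y)" by simp
  moreover have "exp (ln q * x) = q powr x" "exp (ln q * y) = q powr y"
    using q by (auto simp: powr_def mult.commute)
  ultimately have "y * q powr x \<le> y * ((1 - x / y) + x / y * q powr y)"
    using x by (intro mult_left_mono) auto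
  also have "\<dots> = y - x + x * q powr y" using x by (simp add: field_simps)
  finally show ?thesis using x by (simp add: field_simps)
qed

text \<open>The upper bound is free of \<open>q\<close>; this keeps the estimates below uniform
  while \<open>q\<close> tends to 1.\<close>

lemma ln_one_minus_powr_diff:
  fixes q x y :: real
  assumes q: "0 < q" "q < 1" and x: "0 < x" "x \<le> y"
  shows "0 \<le> ln (1 - q powr y) - ln (1 - q powr x)"
    and "ln (1 - q powr y) - ln (1 - q powr x) \<le> (y - x) / x"
proof -
  have p: "0 < 1 - q powr x" "1 - q powr x \<le> 1 - q powr y"
    using q x powr_less_mono'[of q 0 x] by (auto intro: powr_mono')
  thus "0 \<le> ln (1 - q powr y) - ln (1 - q powr x)" by simp
  have "(1 - q powr y) \<le> (y / x) * (1 - q powr x)"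
    using one_minus_powr_ratio[OF q x] x by (simp add: field_simps)
  hence "(1 - q powr y) / (1 - q powr x) \<le> y / x" using p by (simp add: field_simps)
  hence "ln ((1 - q powr y) / (1 - q powr x)) \<le> ln (y / x)" using p x by simp
  also have "\<dots> \<le> y / x - 1" using x by (intro ln_le_minus_one) auto
  finally show "ln (1 - q powr y) - ln (1 - q powr x) \<le> (y - x) / x"
    using p x by (simp add: ln_div field_simps)
qed

lemma ln_one_minus_powr_close:
  fixes q z w K L :: real
  assumes q: "0 < q" "q < 1" and z: "0 < z" and K: "1 \<le> K" and w: "z / K \<le> w" "\<bar>w - z\<bar> \<le> L"
  shows "\<bar>ln (1 - q powr w) - ln (1 - q powr z)\<bar> \<le> L * K / z"
proof (cases "z \<le> w")
  case True
  have "(w - z) / z \<le> L * K / z"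
  proof (intro divide_right_mono)
    have "w - z \<le> L * 1" using w by auto
    also have "\<dots> \<le> L * K" using K w by (intro mult_left_mono) auto
    finally show "w - z \<le> L * K" .
  qed (use z in auto)
  thus ?thesis using ln_one_minus_powr_diff[OF q z True] by auto
next
  case False
  have w0: "0 < w" using w z K by (meson divide_pos_pos less_le_trans zero_less_one)
  have "(z - w) / w \<le> L / (z / K)" using w False z K by (intro frac_le) auto
  thus ?thesis using ln_one_minus_powr_diff[OF q w0, of z] False by auto
qed

lemma q_Gamma_pos:
  assumes "0 < q" "q < 1" "0 < x"
  shows "0 < q_Gamma q x"
  using qpochhammer_inf_powr(1)[of q x] qpochhammer_inf_powr(1)[of q 1] assms
  unfolding q_Gamma_def by (auto intro!: divide_pos_pos mult_pos_pos)

text \<open>Both fractions of \<open>interaction_H\<close> have this form, the first at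
  \<open>y - x\<close> and the second at \<open>y + x + v\<close>.\<close>

definition q_Gamma_ratio :: "real \<Rightarrow> real \<Rightarrow> real \<Rightarrow> real" where
  "q_Gamma_ratio \<theta> q z =
     q_Gamma q (z + 1) * q_Gamma q (z + \<theta>) / (q_Gamma q z * q_Gamma q (z + 1 - \<theta>))"

lemma q_Gamma_ratio_pos:
  assumes "0 < q" "q < 1" "0 < \<theta>" "\<theta> \<le> z"
  shows "0 < q_Gamma_ratio \<theta> q z"
  unfolding q_Gamma_ratio_def using assms
  by (intro divide_pos_pos mult_pos_pos q_Gamma_pos) auto

definition Gamma_ratio_const :: "real \<Rightarrow> real" where
  "Gamma_ratio_const \<theta> = (\<bar>1 - 2 * \<theta>\<bar> + 2) * ((2 + \<theta>) * max 1 \<theta>)"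

text \<open>The ratio is close to the q-number \<open>(1 - q powr z) / (1 - q)\<close> to the power
  \<open>2 * \<theta>\<close>: the quotient at \<open>z + 1\<close> and \<open>z\<close> is that
  q-number itself, and the quotient at \<open>z + \<theta>\<close> and
  \<open>z + 1 - \<theta>\<close>, whose arguments differ by \<open>2 * \<theta> - 1\<close>,
  supplies the remaining exponent. The error \<open>O(1 / z)\<close> is uniform in
  \<open>q\<close>.\<close>

lemma ln_q_Gamma_ratio:
  assumes q: "0 < q" "q < 1" and \<theta>: "0 < \<theta>" "\<theta> \<le> z"
  shows "\<bar>ln (q_Gamma_ratio \<theta> q z) - 2 * \<theta> * ln ((1 - q powr z) / (1 - q))\<bar> \<le> Gamma_ratio_const \<theta> / z"
proof -
  define \<phi> where "\<phi> w = ln (qpochhammer_inf (q powr w) q)" for w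
  define g where "g w = ln (1 - q powr w)" for w
  define A B where "A = z + 1 - \<theta>" and "B = z + \<theta>"
  \<comment> \<open>For \<theta> > 1 the argument \<open>z + 1 - \<theta>\<close> can be much
    smaller than \<open>z\<close>; the hypothesis \<open>\<theta> \<le> z\<close> keeps it above
    \<open>z / K\<close>, with equality at \<open>z = \<theta>\<close>.\<close>
  define K where "K = max 1 \<theta>"
  define e where "e = (2 + \<theta>) * K / z"
  have z: "0 < z" and A: "0 < A" and B: "0 < B" and K: "1 \<le> K" using \<theta> by (auto simp: A_def B_def K_def)
  have zK: "z / K \<le> z" using z K by (simp add: field_simps)
  have AK: "z / K \<le> A"
  proof (cases "\<theta> \<le> 1")
    case True thus ?thesis by (simp add: K_def A_def max_def)
  next
    case False
    have "(\<theta> - 1) * \<theta> \<le> (\<theta> - 1) * z" using False \<theta> by (intro mult_left_mono) auto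
    thus ?thesis using False by (simp add: K_def A_def max_def field_simps)
  qed
  have close: "\<bar>g w - g z\<bar> \<le> e" if "w \<in> {A, B, A + 1, B + 1}" for w
    unfolding g_def e_def
  proof (rule ln_one_minus_powr_close[OF q z K])
    show "z / K \<le> w" using that AK zK \<theta> by (auto simp: B_def)
    show "\<bar>w - z\<bar> \<le> 2 + \<theta>" using that \<theta> by (auto simp: A_def B_def)
  qed
  have P: "\<bar>\<phi> (x + 1) - \<phi> (y + 1) + (x - y) * g z\<bar> \<le> \<bar>x - y\<bar> * e"
    if "y \<le> x" "x \<in> {A, B}" "y \<in> {A, B}" for x y
  proof -
    have y: "0 < y" using that A B by auto
    have "- (x - y) * g (x + 1) \<le> \<phi> (x + 1) - \<phi> (y + 1)" "\<phi> (x + 1) - \<phi> (y + 1) \<le> - (x - y) * g y"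
      using ln_qpochhammer_inf_diff_bounds[OF q y that(1)] by (simp_all add: \<phi>_def g_def)
    moreover have "(x - y) * (g (x + 1) - g z) \<le> (x - y) * e" "(x - y) * (g z - g y) \<le> (x - y) * e"
      using that close[of "x + 1"] close[of y] by (intro mult_left_mono; force)+
    ultimately show ?thesis using that by (auto simp: abs_le_iff algebra_simps)
  qed
  \<comment> \<open>The bounds want the larger argument first, and
    \<open>A - B = 1 - 2 * \<theta>\<close> changes sign at \<theta> = 1/2.\<close>
  have P': "\<bar>\<phi> (A + 1) - \<phi> (B + 1) + (A - B) * g z\<bar> \<le> \<bar>A - B\<bar> * e"
  proof (cases "B \<le> A")
    case False
    hence "\<bar>\<phi> (B + 1) - \<phi> (A + 1) + (B - A) * g z\<bar> \<le> \<bar>B - A\<bar> * e" using P[of A B] by auto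
    moreover have "\<phi> (A + 1) - \<phi> (B + 1) + (A - B) * g z = - (\<phi> (B + 1) - \<phi> (A + 1) + (B - A) * g z)"
      by (simp add: algebra_simps)
    ultimately show ?thesis by (metis abs_minus_cancel abs_minus_commute)
  qed (use P in auto)
  have shift: "\<phi> w = g w + \<phi> (w + 1)" if "0 < w" for w
    using ln_qpochhammer_inf_shift[OF q that] by (simp add: \<phi>_def g_def)
  have AB: "A - B = 1 - 2 * \<theta>" by (simp add: A_def B_def)
  have "\<phi> A - \<phi> B - (2 * \<theta> - 1) * g z
      = (\<phi> (A + 1) - \<phi> (B + 1) + (A - B) * g z) + (g A - g z) - (g B - g z)"
    using shift[OF A] shift[OF B] unfolding AB by (simp add: algebra_simps)
  hence main: "\<bar>\<phi> A - \<phi> B - (2 * \<theta> - 1) * g z\<bar> \<le> \<bar>1 - 2 * \<theta>\<bar> * e + e + e"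
    using P' close[of A] close[of B] AB by auto
  have lnG: "ln (q_Gamma q x) = (1 - x) * ln (1 - q) + ln (qpochhammer_inf q q) - \<phi> x" if "0 < x" for x
    using qpochhammer_inf_powr(1)[OF q that] qpochhammer_inf_powr(1)[OF q, of 1] q
    by (simp add: q_Gamma_def \<phi>_def ln_mult ln_div ln_powr)
  have G: "0 < q_Gamma q z" "0 < q_Gamma q (z + 1)" "0 < q_Gamma q B" "0 < q_Gamma q A"
    using z A B by (auto intro!: q_Gamma_pos q)
  have "ln (q_Gamma_ratio \<theta> q z) = ln (q_Gamma q (z + 1)) + ln (q_Gamma q B) - ln (q_Gamma q z) - ln (q_Gamma q A)"
    using G unfolding q_Gamma_ratio_def A_def[symmetric] B_def[symmetric] by (simp add: ln_mult ln_div)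
  also have "\<dots> = - 2 * \<theta> * ln (1 - q) + g z + \<phi> A - \<phi> B"
    using lnG[of "z + 1"] lnG[of z] lnG[of A] lnG[of B] z A B shift[of z] by (simp add: A_def B_def algebra_simps)
  finally have "ln (q_Gamma_ratio \<theta> q z) - 2 * \<theta> * ln ((1 - q powr z) / (1 - q)) = \<phi> A - \<phi> B - (2 * \<theta> - 1) * g z"
    using q z powr_less_mono'[of q 0 z] by (simp add: ln_div g_def algebra_simps)
  moreover have "\<bar>1 - 2 * \<theta>\<bar> * e + e + e = Gamma_ratio_const \<theta> / z"
    by (simp add: e_def Gamma_ratio_const_def K_def algebra_simps add_divide_distrib)
  ultimately show ?thesis using main by simp
qed

section \<open>Logarithmic energy of distribution functions\<close>

lemma set_integrable_bounded:
  fixes g :: "'a \<Rightarrow> real"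
  assumes "A \<in> sets M" "emeasure M A < \<infinity>" "g \<in> borel_measurable M" "\<And>x. x \<in> A \<Longrightarrow> \<bar>g x\<bar> \<le> B"
  shows "set_integrable M A g"
  unfolding set_integrable_def using assms
  by (intro integrableI_bounded_set_indicator[where B = B]) auto

lemma set_integrable_bounded_Icc:
  fixes g :: "real \<Rightarrow> real"
  assumes "g \<in> borel_measurable borel" "\<And>x. x \<in> {a..b} \<Longrightarrow> \<bar>g x\<bar> \<le> B"
  shows "set_integrable lborel {a..b} g"
  using assms by (intro set_integrable_bounded[where B = B]) (auto simp: emeasure_lborel_Icc_eq)

lemma set_integral_double_sum:
  fixes f :: "'b \<Rightarrow> 'c \<Rightarrow> 'a \<Rightarrow> real"
  assumes "\<And>i j. set_integrable M A (f i j)"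
  shows "(LINT x:A|M. \<Sum>i\<in>S. \<Sum>j\<in>T. f i j x) = (\<Sum>i\<in>S. \<Sum>j\<in>T. LINT x:A|M. f i j x)"
  using assms unfolding set_lebesgue_integral_def set_integrable_def scaleR_sum_right by simp

text \<open>A point is a pair \<open>(t, z)\<close> standing for the window
  \<open>(z, z + t]\<close>. The lower bound for \<open>z\<close> is \<open>lo - (hi - lo)\<close>,
  so every window of length at most \<open>hi - lo\<close> that meets \<open>{lo..hi}\<close> has
  its left end in range. The scales below \<open>e\<close> are cut off.\<close>

definition scale_box :: "real \<Rightarrow> real \<Rightarrow> real \<Rightarrow> (real \<times> real) set" where
  "scale_box lo hi e = {e..hi - lo} \<times> {2 * lo - hi..hi}"

abbreviation plane :: "(real \<times> real) measure" where
  "plane \<equiv> lborel \<Otimes>\<^sub>M lborel"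

lemma scale_box_sets [measurable, simp]: "scale_box lo hi e \<in> sets plane"
  by (simp add: scale_box_def)

lemma emeasure_box [simp]: "emeasure plane (scale_box lo hi e) < \<infinity>"
  by (auto simp: scale_box_def lborel.emeasure_pair_measure_Times emeasure_lborel_Icc_eq ennreal_mult_less_top)

lemma set_integrable_box:
  fixes g :: "real \<times> real \<Rightarrow> real"
  assumes "g \<in> borel_measurable plane" "\<And>p. p \<in> scale_box lo hi e \<Longrightarrow> \<bar>g p\<bar> \<le> B"
  shows "set_integrable plane (scale_box lo hi e) g"
  using set_integrable_bounded[OF scale_box_sets emeasure_box assms] .

lemma integral_box_iterated:
  fixes g :: "real \<times> real \<Rightarrow> real"
  assumes "g \<in> borel_measurable plane" "\<And>p. p \<in> scale_box lo hi e \<Longrightarrow> \<bar>g p\<bar> \<le> B"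
  shows "(LINT p:scale_box lo hi e|plane. g p) = (LINT t:{e..hi - lo}|lborel. (LINT z:{2 * lo - hi..hi}|lborel. g (t, z)))"
proof -
  have "integrable plane (\<lambda>p. indicator (scale_box lo hi e) p *\<^sub>R g p)"
    using set_integrable_box[OF assms] by (simp add: set_integrable_def)
  from lborel_pair.integral_fst'[OF this]
  show ?thesis by (simp add: set_lebesgue_integral_def scale_box_def indicator_times mult.assoc)
qed

text \<open>An antiderivative of \<open>(t - d) / t\<^sup>2\<close> is \<open>ln t + d / t\<close>,
  and the integrand vanishes below \<open>d\<close>. The boundary term \<open>d / max e d\<close> is
  1 for positive \<open>d\<close> and 0 for \<open>d = 0\<close>, which explains the case
  distinction.\<close>

lemma integral_triangle_kernel:
  fixes e d R :: real
  assumes "0 < e" "e \<le> R" "d \<le> R" "d = 0 \<or> e \<le> d"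
  shows "(LINT t:{e..R}|lborel. max 0 (t - d) / t\<^sup>2) = ln (R / max e d) - 1 * (if d = 0 then 0 else 1) + d / R"
proof -
  let ?f = "\<lambda>t. max 0 (t - d) / t\<^sup>2"
  define m where "m = max e d"
  have m: "0 < m" "m \<le> R" "e \<le> m" "d \<le> m" using assms by (auto simp: m_def)
  have "set_integrable lborel {e..R} ?f"
    using assms by (intro borel_integrable_atLeastAtMost') (auto intro!: continuous_intros)
  hence 1: "(LINT t:{e..R}|lborel. ?f t) = integral {e..R} ?f"
    by (rule set_borel_integral_eq_integral)
  have "((\<lambda>t. (t - d) / t\<^sup>2) has_integral ((ln R + d / R) - (ln m + d / m))) {m..R}"
  proof (rule fundamental_theorem_of_calculus)
    fix t assume "t \<in> {m..R}"
    thus "((\<lambda>t. ln t + d / t) has_vector_derivative (t - d) / t\<^sup>2) (at t within {m..R})"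
      using m by (auto intro!: derivative_eq_intros simp: has_real_derivative_iff_has_vector_derivative[symmetric] field_simps power2_eq_square)
  qed (use m in auto)
  hence "(?f has_integral ((ln R + d / R) - (ln m + d / m))) {m..R}"
    by (rule has_integral_eq[rotated]) (use m in auto)
  moreover have "(?f has_integral 0) {e..m}"
  proof (cases "d = 0")
    case True thus ?thesis using assms by (simp add: m_def has_integral_refl)
  next
    case False
    hence "m = d" using assms by (auto simp: m_def)
    thus ?thesis by (intro has_integral_is_0) auto
  qed
  ultimately have "(?f has_integral (0 + ((ln R + d / R) - (ln m + d / m)))) {e..R}"
    using m by (intro has_integral_combine[of e m R ?f 0]) auto
  hence "integral {e..R} ?f = (ln R + d / R) - (ln m + d / m)" by (simp add: integral_unique)
  with 1 have "(LINT t:{e..R}|lborel. ?f t) = (ln R + d / R) - (ln m + d / m)" by simp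
  moreover have "d / m = (if d = 0 then 0 else 1)" using assms by (auto simp: m_def max_def)
  moreover have "ln (R / m) = ln R - ln m" using m by (subst ln_div) auto
  ultimately show ?thesis unfolding m_def[symmetric] by simp
qed

text \<open>Indicator that the window \<open>(z, z + t]\<close> of \<open>p = (t, z)\<close>
  contains \<open>y\<close>. The increment of an empirical distribution function over a window is
  the average of these.\<close>

definition hit :: "real \<Rightarrow> real \<times> real \<Rightarrow> real" where
  "hit y p = (if snd p < y \<and> y \<le> snd p + fst p then 1 else 0)"

lemma hit_measurable [measurable]: "hit y \<in> borel_measurable plane"
  unfolding hit_def by measurable

lemma scale_boxD:
  assumes "p \<in> scale_box lo hi e" "0 < e"
  shows "e \<le> fst p" "fst p \<le> hi - lo" "0 < fst p" "2 * lo - hi \<le> snd p" "snd p \<le> hi"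
  using assms by (auto simp: scale_box_def)

text \<open>Two points either coincide or are at least the cutoff apart, so off the diagonal the
  logarithm comes out exactly; only \<open>x = y\<close> feels \<open>e\<close>, where it replaces
  the infinite self-energy by \<open>ln ((hi - lo) / e)\<close>.\<close>

lemma integral_hit_hit:
  fixes x y e :: real
  assumes "x \<in> {lo..hi}" "y \<in> {lo..hi}" "0 < e" "e \<le> hi - lo" "x = y \<or> e \<le> \<bar>x - y\<bar>"
  shows "(LINT p:scale_box lo hi e|plane. hit x p * hit y p / (fst p)\<^sup>2) =
         ln ((hi - lo) / max e \<bar>x - y\<bar>) - (if x = y then 0 else 1) + \<bar>x - y\<bar> / (hi - lo)"
proof -
  let ?R = "hi - lo" and ?g = "\<lambda>p. hit x p * hit y p / (fst p)\<^sup>2"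
  have bnd: "\<bar>?g p\<bar> \<le> 1 / e\<^sup>2" if "p \<in> scale_box lo hi e" for p
  proof -
    have "e\<^sup>2 \<le> (fst p)\<^sup>2" "0 < e\<^sup>2" using scale_boxD[OF that assms(3)] assms(3) by (auto intro: power_mono)
    hence "1 / (fst p)\<^sup>2 \<le> 1 / e\<^sup>2" by (intro frac_le) auto
    thus ?thesis by (auto simp: hit_def)
  qed
  have "(LINT p:scale_box lo hi e|plane. ?g p) =
        (LINT t:{e..?R}|lborel. (LINT z:{2 * lo - hi..hi}|lborel. ?g (t, z)))"
    by (rule integral_box_iterated[OF _ bnd]) measurable
  also have "\<dots> = (LINT t:{e..?R}|lborel. max 0 (t - \<bar>x - y\<bar>) / t\<^sup>2)"
  proof (rule set_lebesgue_integral_cong)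
    show "\<forall>t. t \<in> {e..?R} \<longrightarrow> (LINT z:{2 * lo - hi..hi}|lborel. ?g (t, z)) = max 0 (t - \<bar>x - y\<bar>) / t\<^sup>2"
    proof (intro allI impI)
      fix t assume t: "t \<in> {e..?R}"
      have mm: "min x y - max x y = - \<bar>x - y\<bar>" by auto
      have "(LINT z:{2 * lo - hi..hi}|lborel. ?g (t, z)) = (LINT z|lborel. indicator {max x y - t..<min x y} z / t\<^sup>2)"
        unfolding set_lebesgue_integral_def
        by (rule Bochner_Integration.integral_cong) (use assms t in \<open>auto simp: hit_def indicator_def\<close>)
      also have "\<dots> = measure lborel {max x y - t..<min x y} / t\<^sup>2" by simp
      also have "measure lborel {max x y - t..<min x y} = max 0 (t - \<bar>x - y\<bar>)"
      proof (cases "max x y - t \<le> min x y")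
        case True
        hence "measure lborel {max x y - t..<min x y} = min x y - (max x y - t)" by simp
        moreover have "0 \<le> t - \<bar>x - y\<bar>" using True mm by linarith
        ultimately show ?thesis using mm by linarith
      next
        case False
        hence "{max x y - t..<min x y} = {}" by (intro atLeastLessThan_empty) linarith
        moreover have "max 0 (t - \<bar>x - y\<bar>) = 0" using False mm by linarith
        ultimately show ?thesis by (simp only: measure_empty)
      qed
      finally show "(LINT z:{2 * lo - hi..hi}|lborel. ?g (t, z)) = max 0 (t - \<bar>x - y\<bar>) / t\<^sup>2" .
    qed
  qed simp
  also have "\<dots> = ln (?R / max e \<bar>x - y\<bar>) - 1 * (if \<bar>x - y\<bar> = 0 then 0 else 1) + \<bar>x - y\<bar> / ?R"
    using assms by (intro integral_triangle_kernel) auto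
  finally show ?thesis by simp
qed

definition increment_energy :: "real \<Rightarrow> real \<Rightarrow> real \<Rightarrow> (real \<Rightarrow> real) \<Rightarrow> real" where
  "increment_energy lo hi e F = (LINT p:scale_box lo hi e|plane. ((F (snd p + fst p) - F (snd p)) / fst p)\<^sup>2)"

text \<open>The increment term carries an unwanted mean distance
  \<open>\<bar>x - y\<bar> / (hi - lo)\<close>. The second term is exactly minus that mean distance,
  so the bare logarithm remains, up to constants.\<close>

definition log_energy :: "real \<Rightarrow> real \<Rightarrow> real \<Rightarrow> (real \<Rightarrow> real) \<Rightarrow> real" where
  "log_energy lo hi e F = increment_energy lo hi e F + 2 / (hi - lo) * (LINT x:{lo..hi}|lborel. (F x)\<^sup>2 - F x)"

definition ecdf :: "nat \<Rightarrow> (nat \<Rightarrow> real) \<Rightarrow> real \<Rightarrow> real" where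
  "ecdf N y x = (\<Sum>j = 1..N. if y j \<le> x then 1 else 0) / real N"

lemma ecdf_measurable [measurable]: "ecdf N y \<in> borel_measurable borel"
  unfolding ecdf_def by measurable

lemma ecdf_mono: "mono (ecdf N y)"
  unfolding ecdf_def by (intro monoI divide_right_mono sum_mono) auto

lemma ecdf_nonneg: "0 \<le> ecdf N y x"
  unfolding ecdf_def by (intro divide_nonneg_nonneg sum_nonneg) auto

lemma ecdf_le_1: "ecdf N y x \<le> 1"
proof -
  have "(\<Sum>j = 1..N. if y j \<le> x then 1 else 0 :: real) \<le> (\<Sum>j = 1..N. 1)" by (intro sum_mono) auto
  thus ?thesis unfolding ecdf_def by (simp add: divide_le_eq)
qed

lemma increment_energy_ecdf:
  assumes N: "1 \<le> N" and e: "0 < e" "e \<le> hi - lo"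
    and y: "\<And>j. j \<in> {1..N} \<Longrightarrow> y j \<in> {lo..hi}"
    and gap: "\<And>i j. i \<in> {1..N} \<Longrightarrow> j \<in> {1..N} \<Longrightarrow> i \<noteq> j \<Longrightarrow> e \<le> \<bar>y i - y j\<bar>"
  shows "(real N)\<^sup>2 * increment_energy lo hi e (ecdf N y) =
    (\<Sum>i = 1..N. \<Sum>j = 1..N. if i = j then ln ((hi - lo) / e)
       else ln ((hi - lo) / \<bar>y i - y j\<bar>) - 1 + \<bar>y i - y j\<bar> / (hi - lo))"
proof -
  let ?B = "scale_box lo hi e"
  have bnd: "\<bar>hit (y i) p * hit (y j) p / (fst p)\<^sup>2\<bar> \<le> 1 / e\<^sup>2" if "p \<in> ?B" for p i j
  proof -
    have "e\<^sup>2 \<le> (fst p)\<^sup>2" "0 < e\<^sup>2" using scale_boxD[OF that e(1)] e(1) by (auto intro: power_mono)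
    hence "1 / (fst p)\<^sup>2 \<le> 1 / e\<^sup>2" by (intro frac_le) auto
    thus ?thesis by (auto simp: hit_def)
  qed
  have int: "set_integrable plane ?B (\<lambda>p. hit (y i) p * hit (y j) p / (fst p)\<^sup>2)" for i j
    by (rule set_integrable_box[OF _ bnd]) measurable
  have "increment_energy lo hi e (ecdf N y) =
      (LINT p:?B|plane. (\<Sum>i = 1..N. \<Sum>j = 1..N. hit (y i) p * hit (y j) p / (fst p)\<^sup>2) / (real N)\<^sup>2)"
    unfolding increment_energy_def
  proof (rule set_lebesgue_integral_cong, rule scale_box_sets, intro allI impI)
    fix p assume p: "p \<in> ?B"
    have "ecdf N y (snd p + fst p) - ecdf N y (snd p) = (\<Sum>j = 1..N. hit (y j) p) / real N"
      unfolding ecdf_def diff_divide_distrib[symmetric] sum_subtractf[symmetric] hit_def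
      by (intro arg_cong2[where f = "(/)"] sum.cong refl) (use scale_boxD[OF p e(1)] in auto)
    hence "((ecdf N y (snd p + fst p) - ecdf N y (snd p)) / fst p)\<^sup>2
        = ((\<Sum>i = 1..N. hit (y i) p) * (\<Sum>j = 1..N. hit (y j) p)) / (fst p)\<^sup>2 / (real N)\<^sup>2"
      by (simp add: power2_eq_square)
    also have "\<dots> = (\<Sum>i = 1..N. \<Sum>j = 1..N. hit (y i) p * hit (y j) p / (fst p)\<^sup>2) / (real N)\<^sup>2"
      by (simp add: sum_product sum_divide_distrib)
    finally show "((ecdf N y (snd p + fst p) - ecdf N y (snd p)) / fst p)\<^sup>2 =
       (\<Sum>i = 1..N. \<Sum>j = 1..N. hit (y i) p * hit (y j) p / (fst p)\<^sup>2) / (real N)\<^sup>2" .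
  qed
  also have "\<dots> = (LINT p:?B|plane. (\<Sum>i = 1..N. \<Sum>j = 1..N. hit (y i) p * hit (y j) p / (fst p)\<^sup>2)) / (real N)\<^sup>2"
    by simp
  also have "(LINT p:?B|plane. (\<Sum>i = 1..N. \<Sum>j = 1..N. hit (y i) p * hit (y j) p / (fst p)\<^sup>2))
      = (\<Sum>i = 1..N. \<Sum>j = 1..N. LINT p:?B|plane. hit (y i) p * hit (y j) p / (fst p)\<^sup>2)"
    by (rule set_integral_double_sum[OF int])
  also have "\<dots> = (\<Sum>i = 1..N. \<Sum>j = 1..N. if i = j then ln ((hi - lo) / e)
       else ln ((hi - lo) / \<bar>y i - y j\<bar>) - 1 + \<bar>y i - y j\<bar> / (hi - lo))"
  proof (intro sum.cong refl)
    fix i j assume ij: "i \<in> {1..N}" "j \<in> {1..N}"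
    show "(LINT p:?B|plane. hit (y i) p * hit (y j) p / (fst p)\<^sup>2) = (if i = j then ln ((hi - lo) / e)
       else ln ((hi - lo) / \<bar>y i - y j\<bar>) - 1 + \<bar>y i - y j\<bar> / (hi - lo))"
    proof (cases "i = j")
      case True thus ?thesis using integral_hit_hit[of "y i" lo hi "y j" e] y ij e by simp
    next
      case False
      with gap[OF ij] e have "e \<le> \<bar>y i - y j\<bar>" "y i \<noteq> y j" by auto
      thus ?thesis using integral_hit_hit[of "y i" lo hi "y j" e] y[OF ij(1)] y[OF ij(2)] False e by simp
    qed
  qed
  finally show ?thesis using N by simp
qed

text \<open>At a point \<open>x\<close>, \<open>F - F\<^sup>2\<close> counts the ordered pairs with
  the first particle at or left of \<open>x\<close> and the second to its right. Integrated over
  \<open>x\<close>, the pair \<open>(i, j)\<close> contributes the positive part of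
  \<open>y j - y i\<close>.\<close>

lemma integral_ecdf_variance:
  assumes N: "1 \<le> N" and y: "\<And>j. j \<in> {1..N} \<Longrightarrow> y j \<in> {lo..hi}"
  shows "(real N)\<^sup>2 * (LINT x:{lo..hi}|lborel. (ecdf N y x)\<^sup>2 - ecdf N y x) =
         - (\<Sum>i = 1..N. \<Sum>j = 1..N. \<bar>y i - y j\<bar>) / 2"
proof -
  let ?I = "\<lambda>i x. if y i \<le> x then 1 else 0 :: real"
  have eq: "(ecdf N y x)\<^sup>2 - ecdf N y x = - (\<Sum>i = 1..N. \<Sum>j = 1..N. ?I i x * (1 - ?I j x)) / (real N)\<^sup>2" for x
  proof -
    let ?S = "\<Sum>i = 1..N. ?I i x"
    have "(\<Sum>i = 1..N. \<Sum>j = 1..N. ?I i x * (1 - ?I j x)) = ?S * (real N - ?S)"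
      by (simp add: sum_product[symmetric] sum_subtractf)
    moreover have "(ecdf N y x)\<^sup>2 - ecdf N y x = - (?S * (real N - ?S)) / (real N)\<^sup>2"
      using N by (simp add: ecdf_def power2_eq_square field_simps)
    ultimately show ?thesis by simp
  qed
  have int: "set_integrable lborel {lo..hi} (\<lambda>x. ?I i x * (1 - ?I j x))" for i j
    by (rule set_integrable_bounded_Icc[where B = 1]) auto
  have "(LINT x:{lo..hi}|lborel. (ecdf N y x)\<^sup>2 - ecdf N y x)
     = - (LINT x:{lo..hi}|lborel. \<Sum>i = 1..N. \<Sum>j = 1..N. ?I i x * (1 - ?I j x)) / (real N)\<^sup>2"
    unfolding eq by (simp add: set_lebesgue_integral_def)
  also have "(LINT x:{lo..hi}|lborel. \<Sum>i = 1..N. \<Sum>j = 1..N. ?I i x * (1 - ?I j x))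
     = (\<Sum>i = 1..N. \<Sum>j = 1..N. LINT x:{lo..hi}|lborel. ?I i x * (1 - ?I j x))"
    by (rule set_integral_double_sum[OF int])
  also have "\<dots> = (\<Sum>i = 1..N. \<Sum>j = 1..N. max 0 (y j - y i))"
  proof (intro sum.cong refl)
    fix i j assume ij: "i \<in> {1..N}" "j \<in> {1..N}"
    have "(LINT x:{lo..hi}|lborel. ?I i x * (1 - ?I j x)) = (LINT x|lborel. indicator {y i..<y j} x)"
      unfolding set_lebesgue_integral_def using y[OF ij(1)] y[OF ij(2)]
      by (intro Bochner_Integration.integral_cong) (auto simp: indicator_def)
    also have "\<dots> = max 0 (y j - y i)" by (cases "y i \<le> y j") auto
    finally show "(LINT x:{lo..hi}|lborel. ?I i x * (1 - ?I j x)) = max 0 (y j - y i)" .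
  qed
  also have "\<dots> = (\<Sum>i = 1..N. \<Sum>j = 1..N. \<bar>y i - y j\<bar>) / 2"
  proof -
    have "(\<Sum>i = 1..N. \<Sum>j = 1..N. \<bar>y i - y j\<bar>)
       = (\<Sum>i = 1..N. \<Sum>j = 1..N. max 0 (y j - y i)) + (\<Sum>i = 1..N. \<Sum>j = 1..N. max 0 (y i - y j))"
      unfolding sum.distrib[symmetric] by (intro sum.cong refl) auto
    also have "(\<Sum>i = 1..N. \<Sum>j = 1..N. max 0 (y i - y j)) = (\<Sum>i = 1..N. \<Sum>j = 1..N. max 0 (y j - y i))"
      by (rule sum.swap)
    finally show ?thesis by simp
  qed
  finally show ?thesis using N by simp
qed

text \<open>An exact identity as soon as the particles are \<open>e\<close>-separated. The cutoff
  enters only through the diagonal term \<open>N * ln ((hi - lo) / e)\<close>, which is the same for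
  all configurations and is later absorbed in a constant.\<close>

lemma log_energy_ecdf:
  assumes N: "1 \<le> N" and e: "0 < e" "e \<le> hi - lo"
    and y: "\<And>j. j \<in> {1..N} \<Longrightarrow> y j \<in> {lo..hi}"
    and gap: "\<And>i j. i \<in> {1..N} \<Longrightarrow> j \<in> {1..N} \<Longrightarrow> i \<noteq> j \<Longrightarrow> e \<le> \<bar>y i - y j\<bar>"
  shows "2 * (\<Sum>(i, j)\<in>{(i, j). 1 \<le> i \<and> i < j \<and> j \<le> N}. ln \<bar>y i - y j\<bar>) =
     - (real N)\<^sup>2 * log_energy lo hi e (ecdf N y) + real N * ln ((hi - lo) / e)
     - real N * (real N - 1) * (1 - ln (hi - lo))"
proof -
  define R where "R = hi - lo"
  have R: "0 < R" using e by (simp add: R_def)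
  let ?D = "\<lambda>i j. if i = j then 0 else ln \<bar>y i - y j\<bar>"
  have "(\<Sum>i = 1..N. \<Sum>j = 1..N. if i = j then ln (R / e)
       else ln (R / \<bar>y i - y j\<bar>) - 1 + \<bar>y i - y j\<bar> / R)
     = (\<Sum>i = 1..N. \<Sum>j = 1..N. (- ?D i j + \<bar>y i - y j\<bar> / R) + ((ln R - 1) + (if i = j then ln (R / e) - (ln R - 1) else 0)))"
    using R gap e by (intro sum.cong refl) (fastforce simp: ln_div)
  also have "\<dots> = - (\<Sum>i = 1..N. \<Sum>j = 1..N. ?D i j) + (\<Sum>i = 1..N. \<Sum>j = 1..N. \<bar>y i - y j\<bar>) / R
        + ((\<Sum>i = 1..N. \<Sum>j = 1..N. ln R - 1) + (\<Sum>i = 1..N. \<Sum>j = 1..N. if i = j then ln (R / e) - (ln R - 1) else 0))"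
    by (simp only: sum.distrib sum_negf sum_divide_distrib)
  also have "(\<Sum>i = 1..N. \<Sum>j = 1..N. if i = j then ln (R / e) - (ln R - 1) else 0) = real N * (ln (R / e) - (ln R - 1))"
    by simp
  also have "(\<Sum>i = 1..N. \<Sum>j = 1..N. ln R - 1) = (real N)\<^sup>2 * (ln R - 1)"
    by (simp add: power2_eq_square)
  finally have A: "(real N)\<^sup>2 * increment_energy lo hi e (ecdf N y) = - (\<Sum>i = 1..N. \<Sum>j = 1..N. ?D i j) + (\<Sum>i = 1..N. \<Sum>j = 1..N. \<bar>y i - y j\<bar>) / R
        + ((real N)\<^sup>2 * (ln R - 1) + real N * (ln (R / e) - (ln R - 1)))"
    using increment_energy_ecdf[where y = y and N = N, OF N e y gap] unfolding R_def by simp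
  have B: "(real N)\<^sup>2 * (2 / R * (LINT x:{lo..hi}|lborel. (ecdf N y x)\<^sup>2 - ecdf N y x)) = - (\<Sum>i = 1..N. \<Sum>j = 1..N. \<bar>y i - y j\<bar>) / R"
    using integral_ecdf_variance[where y = y and N = N, OF N y] R by (simp add: field_simps)
  have "(\<Sum>i = 1..N. \<Sum>j = 1..N. ?D i j) = (\<Sum>p\<in>{1..N} \<times> {1..N}. ?D (fst p) (snd p))"
    by (simp add: sum.cartesian_product case_prod_beta)
  also have "\<dots> = (\<Sum>p\<in>{(i, j). 1 \<le> i \<and> i < j \<and> j \<le> N} \<union> {(i, j). 1 \<le> j \<and> j < i \<and> i \<le> N}. ?D (fst p) (snd p))"
    by (rule sum.mono_neutral_right) auto
  also have "\<dots> = (\<Sum>p\<in>{(i, j). 1 \<le> i \<and> i < j \<and> j \<le> N}. ?D (fst p) (snd p)) + (\<Sum>p\<in>{(i, j). 1 \<le> j \<and> j < i \<and> i \<le> N}. ?D (fst p) (snd p))"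
    by (intro sum.union_disjoint) (auto intro: finite_subset[of _ "{1..N} \<times> {1..N}"])
  also have "(\<Sum>p\<in>{(i, j). 1 \<le> j \<and> j < i \<and> i \<le> N}. ?D (fst p) (snd p)) = (\<Sum>p\<in>{(i, j). 1 \<le> i \<and> i < j \<and> j \<le> N}. ?D (fst p) (snd p))"
    by (rule sum.reindex_bij_witness[of _ prod.swap prod.swap]) (auto simp: abs_minus_commute)
  also have "(\<Sum>p\<in>{(i, j). 1 \<le> i \<and> i < j \<and> j \<le> N}. ?D (fst p) (snd p)) = (\<Sum>(i, j)\<in>{(i, j). 1 \<le> i \<and> i < j \<and> j \<le> N}. ln \<bar>y i - y j\<bar>)"
    by (intro sum.cong) auto
  finally have C: "(\<Sum>i = 1..N. \<Sum>j = 1..N. ?D i j) = 2 * (\<Sum>(i, j)\<in>{(i, j). 1 \<le> i \<and> i < j \<and> j \<le> N}. ln \<bar>y i - y j\<bar>)"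
    by simp
  have "(real N)\<^sup>2 * log_energy lo hi e (ecdf N y) =
      - (\<Sum>i = 1..N. \<Sum>j = 1..N. ?D i j) + (real N)\<^sup>2 * (ln R - 1) + real N * (ln (R / e) - (ln R - 1))"
    unfolding log_energy_def R_def[symmetric] distrib_left A B by simp
  thus ?thesis unfolding C R_def[symmetric] by (simp add: power2_eq_square algebra_simps)
qed

section \<open>Continuity, cutoff error and convexity of the energy\<close>

lemma integral_increment_le:
  fixes F :: "real \<Rightarrow> real"
  assumes F: "mono F" "\<And>x. 0 \<le> F x" "\<And>x. F x \<le> 1" and AB: "A \<le> B" and t: "0 \<le> t"
  shows "(LINT z:{A..B}|lborel. F (z + t) - F z) \<le> t"
proof -
  have [measurable]: "F \<in> borel_measurable borel" using F(1) by (rule borel_measurable_mono)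
  have int: "F integrable_on {a..b}" for a b
    using F by (intro set_borel_integral_eq_integral(1) set_integrable_bounded_Icc[where B = 1]) auto
  have s1: "set_integrable lborel {A..B} (\<lambda>z. F (z + t))" "set_integrable lborel {A..B} F"
    using F by (auto intro!: set_integrable_bounded_Icc[where B = 1])
  have "(LINT z:{A..B}|lborel. F (z + t) - F z) = (LINT z:{A..B}|lborel. F (z + t)) - (LINT z:{A..B}|lborel. F z)"
    by (rule set_integral_diff(2)[OF s1])
  also have "\<dots> = integral {A..B} (\<lambda>z. F (z + t)) - integral {A..B} F"
    using s1 by (simp add: set_borel_integral_eq_integral)
  also have "integral {A..B} (\<lambda>z. F (z + t)) = integral {A + t..B + t} F"
    using integral_shift_real_ivl[of "A + t" t "B + t" F] by simp
  also have "\<dots> - integral {A..B} F = integral {B..B + t} F - integral {A..A + t} F"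
    using Henstock_Kurzweil_Integration.integral_combine[of A "A + t" "B + t" F] Henstock_Kurzweil_Integration.integral_combine[of A B "B + t" F]
      AB t int by simp
  also have "\<dots> \<le> integral {B..B + t} (\<lambda>x. 1) - 0"
    using F int t by (intro diff_mono integral_le Henstock_Kurzweil_Integration.integral_nonneg) (auto simp: integrable_const_ivl)
  finally show ?thesis using t by simp
qed

text \<open>For fixed \<open>t\<close> a translation argument bounds the integral of the increments
  by \<open>t\<close>, whatever the monotone function. Dividing by \<open>t\<^sup>2\<close> leaves
  the integral of \<open>1 / t\<close>. This logarithm is the source of the factor
  \<open>ln N\<close> in all comparisons of energies.\<close>

lemma integral_scaled_increment_le:
  fixes F :: "real \<Rightarrow> real"
  assumes F: "mono F" "\<And>x. 0 \<le> F x" "\<And>x. F x \<le> 1" and e: "0 < e" "e \<le> hi - lo"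
  shows "set_integrable plane (scale_box lo hi e) (\<lambda>p. (F (snd p + fst p) - F (snd p)) / (fst p)\<^sup>2)"
    and "(LINT p:scale_box lo hi e|plane. (F (snd p + fst p) - F (snd p)) / (fst p)\<^sup>2) \<le> ln ((hi - lo) / e)"
proof -
  let ?g = "\<lambda>p. (F (snd p + fst p) - F (snd p)) / (fst p)\<^sup>2"
  have [measurable]: "F \<in> borel_measurable borel" using F(1) by (rule borel_measurable_mono)
  have gm: "?g \<in> borel_measurable plane" by measurable
  have bnd: "\<bar>?g p\<bar> \<le> 1 / e\<^sup>2" if "p \<in> scale_box lo hi e" for p
  proof -
    have "e\<^sup>2 \<le> (fst p)\<^sup>2" "0 < e\<^sup>2" using scale_boxD[OF that e(1)] e(1) by (auto intro: power_mono)
    moreover have "\<bar>F (snd p + fst p) - F (snd p)\<bar> \<le> 1"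
      using F(2,3)[of "snd p + fst p"] F(2,3)[of "snd p"] by auto
    ultimately show ?thesis unfolding abs_divide by (intro frac_le) auto
  qed
  show "set_integrable plane (scale_box lo hi e) ?g" by (rule set_integrable_box[OF gm bnd])
  let ?in = "\<lambda>t. LINT z:{2 * lo - hi..hi}|lborel. (F (z + t) - F z) / t\<^sup>2"
  have "(LINT p:scale_box lo hi e|plane. ?g p) = (LINT t:{e..hi - lo}|lborel. ?in t)"
    using integral_box_iterated[OF gm bnd] by simp
  also have "\<dots> \<le> (LINT t:{e..hi - lo}|lborel. 1 / t)"
  proof (rule set_integral_mono)
    have inner: "0 \<le> ?in t \<and> ?in t \<le> 1 / t" if t: "t \<in> {e..hi - lo}" for t
    proof
      have "0 \<le> (LINT z:{2 * lo - hi..hi}|lborel. F (z + t) - F z)"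
        unfolding set_lebesgue_integral_def
        by (intro Bochner_Integration.integral_nonneg) (use t e F(1) in \<open>auto simp: monoD split: split_indicator\<close>)
      thus "0 \<le> ?in t" by simp
      have "(LINT z:{2 * lo - hi..hi}|lborel. F (z + t) - F z) / t\<^sup>2 \<le> t / t\<^sup>2"
        using t e F by (intro divide_right_mono integral_increment_le) auto
      thus "?in t \<le> 1 / t" using t e by (simp add: power2_eq_square)
    qed
    show ci: "set_integrable lborel {e..hi - lo} (\<lambda>t. 1 / t)"
      using e by (intro borel_integrable_atLeastAtMost') (auto intro!: continuous_intros)
    have "?in \<in> borel_measurable borel" unfolding set_lebesgue_integral_def by measurable
    thus "set_integrable lborel {e..hi - lo} ?in"
    proof (rule set_integrable_bounded_Icc)
      fix t assume t: "t \<in> {e..hi - lo}"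
      have "1 / t \<le> 1 / e" using t e by (intro frac_le) auto
      thus "\<bar>?in t\<bar> \<le> 1 / e" using inner[OF t] by linarith
    qed
    show "\<And>t. t \<in> {e..hi - lo} \<Longrightarrow> ?in t \<le> 1 / t" using inner by auto
  qed
  also have "\<dots> = ln ((hi - lo) / e)"
  proof -
    have "((\<lambda>t. 1 / t) has_integral (ln (hi - lo) - ln e)) {e..hi - lo}"
      by (rule fundamental_theorem_of_calculus)
        (use e in \<open>auto intro!: derivative_eq_intros simp: has_real_derivative_iff_has_vector_derivative[symmetric] field_simps\<close>)
    moreover have "set_integrable lborel {e..hi - lo} (\<lambda>t. 1 / t)"
      using e by (intro borel_integrable_atLeastAtMost') (auto intro!: continuous_intros)
    ultimately show ?thesis using e by (simp add: set_borel_integral_eq_integral integral_unique ln_div)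
  qed
  finally show "(LINT p:scale_box lo hi e|plane. ?g p) \<le> ln ((hi - lo) / e)" .
qed

text \<open>Factor a difference of squares of increments as \<open>(a - b) * (a + b)\<close>: the
  first factor is at most \<open>2 * \<eta>\<close>, and the second is a sum of nonnegative
  increments controlled by \<open>integral_scaled_increment_le\<close>. Only monotonicity and range
  enter, so jumps are allowed.\<close>

lemma increment_energy_close:
  fixes F G :: "real \<Rightarrow> real"
  assumes F: "mono F" "\<And>x. 0 \<le> F x" "\<And>x. F x \<le> 1" and G: "mono G" "\<And>x. 0 \<le> G x" "\<And>x. G x \<le> 1"
    and FG: "\<And>x. \<bar>F x - G x\<bar> \<le> \<eta>" and e: "0 < e" "e \<le> hi - lo"
  shows "increment_energy lo hi e F - increment_energy lo hi e G \<le> 4 * \<eta> * ln ((hi - lo) / e)"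
proof -
  let ?B = "scale_box lo hi e"
  let ?q = "\<lambda>F p. ((F (snd p + fst p) - F (snd p)) / fst p)\<^sup>2"
  let ?l = "\<lambda>F p. (F (snd p + fst p) - F (snd p)) / (fst p)\<^sup>2"
  have [measurable]: "F \<in> borel_measurable borel" "G \<in> borel_measurable borel"
    using F(1) G(1) by (auto intro: borel_measurable_mono)
  have eta: "0 \<le> \<eta>" using FG[of 0] by linarith
  have sq: "set_integrable plane ?B (?q H)" if "H \<in> {F, G}" for H
  proof (rule set_integrable_box)
    show "?q H \<in> borel_measurable plane" using that by (elim insertE) auto
    fix p assume p: "p \<in> ?B"
    have "\<bar>H (snd p + fst p) - H (snd p)\<bar> \<le> 1"
      using that F(2,3)[of "snd p + fst p"] F(2,3)[of "snd p"] G(2,3)[of "snd p + fst p"] G(2,3)[of "snd p"] by auto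
    hence "\<bar>(H (snd p + fst p) - H (snd p)) / fst p\<bar> \<le> 1 / e"
      unfolding abs_divide using scale_boxD[OF p e(1)] e by (intro frac_le) auto
    hence "\<bar>(H (snd p + fst p) - H (snd p)) / fst p\<bar>\<^sup>2 \<le> (1 / e)\<^sup>2" by (intro power_mono) auto
    thus "\<bar>?q H p\<bar> \<le> (1 / e)\<^sup>2" by (simp only: power2_abs abs_power2)
  qed
  have "increment_energy lo hi e F - increment_energy lo hi e G = (LINT p:?B|plane. ?q F p - ?q G p)"
    unfolding increment_energy_def using sq by (intro set_integral_diff(2)[symmetric]) auto
  also have "\<dots> \<le> (LINT p:?B|plane. 2 * \<eta> * (?l F p + ?l G p))"
  proof (rule set_integral_mono)
    show "set_integrable plane ?B (\<lambda>p. ?q F p - ?q G p)" using sq by auto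
    show "set_integrable plane ?B (\<lambda>p. 2 * \<eta> * (?l F p + ?l G p))"
      using integral_scaled_increment_le(1)[OF F e] integral_scaled_increment_le(1)[OF G e] by auto
    fix p assume p: "p \<in> ?B"
    let ?a = "F (snd p + fst p) - F (snd p)" and ?b = "G (snd p + fst p) - G (snd p)"
    have ab: "0 \<le> ?a" "0 \<le> ?b" using scale_boxD[OF p e(1)] F(1) G(1) by (auto simp: monoD)
    have "\<bar>?a - ?b\<bar> \<le> 2 * \<eta>" using FG[of "snd p + fst p"] FG[of "snd p"] by linarith
    hence "(?a - ?b) * (?a + ?b) \<le> 2 * \<eta> * (?a + ?b)" using ab by (intro mult_right_mono) auto
    hence "(?a\<^sup>2 - ?b\<^sup>2) / (fst p)\<^sup>2 \<le> 2 * \<eta> * (?a + ?b) / (fst p)\<^sup>2"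
      by (intro divide_right_mono) (auto simp: power2_eq_square algebra_simps)
    thus "?q F p - ?q G p \<le> 2 * \<eta> * (?l F p + ?l G p)"
      by (simp add: power_divide diff_divide_distrib[symmetric] add_divide_distrib[symmetric])
  qed
  also have "\<dots> = 2 * \<eta> * ((LINT p:?B|plane. ?l F p) + (LINT p:?B|plane. ?l G p))"
    using integral_scaled_increment_le(1)[OF F e] integral_scaled_increment_le(1)[OF G e] by simp
  also have "\<dots> \<le> 2 * \<eta> * (ln ((hi - lo) / e) + ln ((hi - lo) / e))"
    using integral_scaled_increment_le(2)[OF F e] integral_scaled_increment_le(2)[OF G e] eta
    by (intro mult_left_mono add_mono) auto
  finally show ?thesis by simp
qed

lemma log_energy_close:
  fixes F G :: "real \<Rightarrow> real"
  assumes F: "mono F" "\<And>x. 0 \<le> F x" "\<And>x. F x \<le> 1" and G: "mono G" "\<And>x. 0 \<le> G x" "\<And>x. G x \<le> 1"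
    and FG: "\<And>x. \<bar>F x - G x\<bar> \<le> \<eta>" and e: "0 < e" "e \<le> hi - lo"
  shows "log_energy lo hi e F - log_energy lo hi e G \<le> 4 * \<eta> * ln ((hi - lo) / e) + 2 * \<eta>"
proof -
  have [measurable]: "F \<in> borel_measurable borel" "G \<in> borel_measurable borel"
    using F(1) G(1) by (auto intro: borel_measurable_mono)
  have b: "\<bar>(H::real)\<^sup>2 - H\<bar> \<le> 1" if "0 \<le> H" "H \<le> 1" for H
  proof -
    have "H\<^sup>2 \<le> 1" "0 \<le> H\<^sup>2" using that by (auto simp: abs_square_le_1 abs_le_iff)
    thus ?thesis using that by linarith
  qed
  have i: "set_integrable lborel {lo..hi} (\<lambda>x. (F x)\<^sup>2 - F x)" "set_integrable lborel {lo..hi} (\<lambda>x. (G x)\<^sup>2 - G x)"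
    using F G b by (auto intro!: set_integrable_bounded_Icc[where B = 1])
  have "(LINT x:{lo..hi}|lborel. (F x)\<^sup>2 - F x) - (LINT x:{lo..hi}|lborel. (G x)\<^sup>2 - G x)
     = (LINT x:{lo..hi}|lborel. ((F x)\<^sup>2 - F x) - ((G x)\<^sup>2 - G x))"
    by (rule set_integral_diff(2)[OF i, symmetric])
  also have "\<dots> \<le> (LINT x:{lo..hi}|lborel. \<eta>)"
  proof (rule set_integral_mono)
    fix x
    have "((F x)\<^sup>2 - F x) - ((G x)\<^sup>2 - G x) = (F x - G x) * (F x + G x - 1)"
      by (simp add: power2_eq_square algebra_simps)
    also have "\<dots> \<le> \<bar>F x - G x\<bar> * \<bar>F x + G x - 1\<bar>" by (metis abs_ge_self abs_mult)
    also have "\<dots> \<le> \<eta> * 1"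
      using FG F(2,3)[of x] G(2,3)[of x] by (intro mult_mono) (auto intro: order_trans[OF _ FG])
    finally show "((F x)\<^sup>2 - F x) - ((G x)\<^sup>2 - G x) \<le> \<eta>" by simp
  qed (use i in \<open>auto intro!: set_integrable_bounded_Icc[where B = "\<bar>\<eta>\<bar>"]\<close>)
  also have "\<dots> = (hi - lo) * \<eta>" using e by (simp add: set_integral_const)
  finally have "2 / (hi - lo) * ((LINT x:{lo..hi}|lborel. (F x)\<^sup>2 - F x) - (LINT x:{lo..hi}|lborel. (G x)\<^sup>2 - G x))
      \<le> 2 / (hi - lo) * ((hi - lo) * \<eta>)" using e by (intro mult_left_mono) auto
  also have "\<dots> = 2 * \<eta>" using e by simp
  finally show ?thesis using increment_energy_close[OF F G FG e]
    unfolding log_energy_def by (simp add: right_diff_distrib)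
qed

lemma lipschitz_increment_box:
  fixes F :: "real \<Rightarrow> real"
  assumes F: "F \<in> borel_measurable borel" and lip: "\<And>x y. \<bar>F x - F y\<bar> \<le> \<kappa> * \<bar>x - y\<bar>" and e: "0 \<le> e"
  shows "p \<in> scale_box lo hi e \<Longrightarrow> ((F (snd p + fst p) - F (snd p)) / fst p)\<^sup>2 \<le> \<kappa>\<^sup>2"
    and "set_integrable plane (scale_box lo hi e) (\<lambda>p. ((F (snd p + fst p) - F (snd p)) / fst p)\<^sup>2)"
proof -
  have k: "0 \<le> \<kappa>" using lip[of 1 0] by simp
  have *: "((F (snd p + fst p) - F (snd p)) / fst p)\<^sup>2 \<le> \<kappa>\<^sup>2" for p
  \<comment> \<open>At scale 0 the quotient is 0 by the convention for division, so the bound also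
    covers the cutoff 0.\<close>
  proof (cases "fst p = 0")
    case False
    hence "\<bar>(F (snd p + fst p) - F (snd p)) / fst p\<bar> \<le> \<kappa>"
      using lip[of "snd p + fst p" "snd p"] by (simp add: abs_divide divide_le_eq)
    hence "\<bar>(F (snd p + fst p) - F (snd p)) / fst p\<bar>\<^sup>2 \<le> \<kappa>\<^sup>2" by (intro power_mono) auto
    thus ?thesis by (simp only: power2_abs)
  qed simp
  show "p \<in> scale_box lo hi e \<Longrightarrow> ((F (snd p + fst p) - F (snd p)) / fst p)\<^sup>2 \<le> \<kappa>\<^sup>2" by (rule *)
  note [measurable] = F
  have "(\<lambda>p. ((F (snd p + fst p) - F (snd p)) / fst p)\<^sup>2) \<in> borel_measurable plane" by measurable
  thus "set_integrable plane (scale_box lo hi e) (\<lambda>p. ((F (snd p + fst p) - F (snd p)) / fst p)\<^sup>2)"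
    by (rule set_integrable_box[where B = "\<kappa>\<^sup>2"]) (use * in auto)
qed

text \<open>The integrand is nonnegative and at most \<open>\<kappa>\<^sup>2\<close>, and the strip
  of scales below \<open>e\<close> has area \<open>2 * (hi - lo) * e\<close>. This passes between
  the cut energy, which suits configurations, and the uncut one, for which the limit problem is
  posed.\<close>

lemma increment_energy_cutoff:
  fixes F :: "real \<Rightarrow> real"
  assumes F: "F \<in> borel_measurable borel" and lip: "\<And>x y. \<bar>F x - F y\<bar> \<le> \<kappa> * \<bar>x - y\<bar>" and e: "0 < e" "e \<le> hi - lo"
  shows "increment_energy lo hi e F \<le> increment_energy lo hi 0 F"
    and "increment_energy lo hi 0 F \<le> increment_energy lo hi e F + 2 * (hi - lo) * \<kappa>\<^sup>2 * e"
proof -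
  let ?S = "{0..<e} \<times> {2 * lo - hi..hi}" and ?q = "\<lambda>p. ((F (snd p + fst p) - F (snd p)) / fst p)\<^sup>2"
  have U: "scale_box lo hi 0 = scale_box lo hi e \<union> ?S" "scale_box lo hi e \<inter> ?S = {}"
    using e by (auto simp: scale_box_def)
  have S: "?S \<in> sets plane" by simp
  have SS: "?S \<subseteq> scale_box lo hi 0" using U by auto
  have i0: "set_integrable plane (scale_box lo hi 0) ?q" using lipschitz_increment_box(2)[OF F lip] by simp
  have iS: "set_integrable plane ?S ?q" by (rule set_integrable_subset[OF i0 S SS])
  have eq: "increment_energy lo hi 0 F = increment_energy lo hi e F + (LINT p:?S|plane. ?q p)"
    unfolding increment_energy_def U(1)
    using e by (intro set_integral_Un U(2) lipschitz_increment_box(2)[OF F lip] iS) auto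
  have "0 \<le> (LINT p:?S|plane. ?q p)" unfolding set_lebesgue_integral_def
    by (intro Bochner_Integration.integral_nonneg) (auto split: split_indicator)
  thus "increment_energy lo hi e F \<le> increment_energy lo hi 0 F" using eq by simp
  have em: "emeasure plane ?S = ennreal (e * (2 * (hi - lo)))"
    using e by (simp add: lborel.emeasure_pair_measure_Times ennreal_mult[symmetric])
  have "(LINT p:?S|plane. ?q p) \<le> (LINT p:?S|plane. \<kappa>\<^sup>2)"
  proof (rule set_integral_mono[OF iS])
    show "set_integrable plane ?S (\<lambda>p. \<kappa>\<^sup>2)"
    proof (rule set_integrable_bounded[OF S])
      show "emeasure plane ?S < \<infinity>" unfolding em by simp
      show "(\<lambda>p. \<kappa>\<^sup>2) \<in> borel_measurable plane" by (rule borel_measurable_const)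
      show "\<And>p. p \<in> ?S \<Longrightarrow> \<bar>\<kappa>\<^sup>2\<bar> \<le> \<kappa>\<^sup>2" by simp
    qed
    show "\<And>p. p \<in> ?S \<Longrightarrow> ?q p \<le> \<kappa>\<^sup>2" using lipschitz_increment_box(1)[OF F lip, of 0] SS by blast
  qed
  also have "\<dots> = e * (2 * (hi - lo)) * \<kappa>\<^sup>2"
  proof -
    have "measure plane ?S = e * (2 * (hi - lo))" unfolding measure_def em using e by simp
    moreover have "emeasure plane ?S \<noteq> \<infinity>" unfolding em by simp
    ultimately show ?thesis using set_integral_const[OF S, of "\<kappa>\<^sup>2"] unfolding real_scaleR_def by metis
  qed
  finally show "increment_energy lo hi 0 F \<le> increment_energy lo hi e F + 2 * (hi - lo) * \<kappa>\<^sup>2 * e"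
    using eq by (simp add: algebra_simps)
qed

text \<open>The parallelogram identity applies to both squares. The gain of the increment term is
  dropped; the gain in \<open>L\<^sup>2\<close> is a quarter of the prefactor
  \<open>2 / (hi - lo)\<close> of the term \<open>F\<^sup>2\<close>.\<close>

lemma log_energy_midpoint:
  fixes F G :: "real \<Rightarrow> real"
  assumes F: "F \<in> borel_measurable borel" "\<And>x y. \<bar>F x - F y\<bar> \<le> \<kappa> * \<bar>x - y\<bar>" "\<And>x. 0 \<le> F x" "\<And>x. F x \<le> 1"
    and G: "G \<in> borel_measurable borel" "\<And>x y. \<bar>G x - G y\<bar> \<le> \<kappa> * \<bar>x - y\<bar>" "\<And>x. 0 \<le> G x" "\<And>x. G x \<le> 1"
    and R: "lo < hi"
  shows "log_energy lo hi 0 (\<lambda>x. (F x + G x) / 2) \<le>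
     (log_energy lo hi 0 F + log_energy lo hi 0 G) / 2 - (LINT x:{lo..hi}|lborel. (F x - G x)\<^sup>2) / (2 * (hi - lo))"
proof -
  let ?B = "scale_box lo hi 0" and ?d = "\<lambda>F p. (F (snd p + fst p) - F (snd p)) / fst p"
  note [measurable] = F(1) G(1)
  let ?M = "\<lambda>x. (F x + G x) / 2" and ?D = "\<lambda>x. F x - G x"
  have lipM: "\<bar>?M x - ?M y\<bar> \<le> \<kappa> * \<bar>x - y\<bar>" for x y
  proof -
    have "?M x - ?M y = (F x - F y) / 2 + (G x - G y) / 2" by (simp add: field_simps)
    moreover define k where "k = \<kappa> * \<bar>x - y\<bar>"
    moreover have "\<bar>F x - F y\<bar> \<le> k" "\<bar>G x - G y\<bar> \<le> k" using F(2)[of x y] G(2)[of x y] by (simp_all add: k_def)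
    ultimately show ?thesis unfolding k_def[symmetric] abs_le_iff by (auto simp: field_simps)
  qed
  have lipD: "\<bar>?D x - ?D y\<bar> \<le> (2 * \<kappa>) * \<bar>x - y\<bar>" for x y
  proof -
    define k where "k = \<kappa> * \<bar>x - y\<bar>"
    have "\<bar>F x - F y\<bar> \<le> k" "\<bar>G x - G y\<bar> \<le> k" using F(2)[of x y] G(2)[of x y] by (simp_all add: k_def)
    hence "\<bar>?D x - ?D y\<bar> \<le> 2 * k" by linarith
    thus ?thesis by (simp add: k_def)
  qed
  have iF: "set_integrable plane ?B (\<lambda>p. (?d F p)\<^sup>2)" by (rule lipschitz_increment_box(2)[OF F(1,2)]) auto
  have iG: "set_integrable plane ?B (\<lambda>p. (?d G p)\<^sup>2)" by (rule lipschitz_increment_box(2)[OF G(1,2)]) auto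
  have iD: "set_integrable plane ?B (\<lambda>p. (?d ?D p)\<^sup>2)" by (rule lipschitz_increment_box(2)[OF _ lipD]) auto
  have "(?d ?M p)\<^sup>2 = ((?d F p)\<^sup>2 / 2 + (?d G p)\<^sup>2 / 2) - (?d ?D p)\<^sup>2 / 4" for p
  proof -
    have "?d ?M p = (?d F p + ?d G p) / 2" "?d ?D p = ?d F p - ?d G p"
      by (simp_all add: add_divide_distrib diff_divide_distrib)
    moreover have "((a + b) / 2)\<^sup>2 = (a\<^sup>2 / 2 + b\<^sup>2 / 2) - (a - b)\<^sup>2 / 4" for a b :: real
      by (simp add: power2_eq_square field_simps)
    ultimately show ?thesis by (simp only:)
  qed
  hence "increment_energy lo hi 0 ?M = (LINT p:?B|plane. ((?d F p)\<^sup>2 / 2 + (?d G p)\<^sup>2 / 2) - (?d ?D p)\<^sup>2 / 4)"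
    unfolding increment_energy_def by simp
  also have "\<dots> = increment_energy lo hi 0 F / 2 + increment_energy lo hi 0 G / 2 - increment_energy lo hi 0 ?D / 4"
    using iF iG iD unfolding increment_energy_def by simp
  also have "\<dots> \<le> increment_energy lo hi 0 F / 2 + increment_energy lo hi 0 G / 2"
    unfolding increment_energy_def set_lebesgue_integral_def by simp
  finally have 1: "increment_energy lo hi 0 ?M \<le> increment_energy lo hi 0 F / 2 + increment_energy lo hi 0 G / 2" .
  have b: "\<bar>(H::real)\<^sup>2 - H\<bar> \<le> 1" if "0 \<le> H" "H \<le> 1" for H
  proof -
    have "H\<^sup>2 \<le> 1" "0 \<le> H\<^sup>2" using that by (auto simp: abs_square_le_1 abs_le_iff)
    thus ?thesis using that by linarith
  qed
  have jF: "set_integrable lborel {lo..hi} (\<lambda>x. (F x)\<^sup>2 - F x)" and jG: "set_integrable lborel {lo..hi} (\<lambda>x. (G x)\<^sup>2 - G x)"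
    using F G b by (auto intro!: set_integrable_bounded_Icc[where B = 1])
  have jD: "set_integrable lborel {lo..hi} (\<lambda>x. (?D x)\<^sup>2)"
  proof (rule set_integrable_bounded_Icc[where B = 1])
    fix x
    have "\<bar>?D x\<bar> \<le> 1" using F(3,4)[of x] G(3,4)[of x] by auto
    thus "\<bar>(?D x)\<^sup>2\<bar> \<le> 1" by (simp add: abs_square_le_1)
  qed measurable
  have "(?M x)\<^sup>2 - ?M x = (((F x)\<^sup>2 - F x) / 2 + ((G x)\<^sup>2 - G x) / 2) - (?D x)\<^sup>2 / 4" for x
    by (simp add: power2_eq_square field_simps)
  hence "(LINT x:{lo..hi}|lborel. (?M x)\<^sup>2 - ?M x)
      = (LINT x:{lo..hi}|lborel. (((F x)\<^sup>2 - F x) / 2 + ((G x)\<^sup>2 - G x) / 2) - (?D x)\<^sup>2 / 4)" by simp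
  also have "\<dots> = (LINT x:{lo..hi}|lborel. (F x)\<^sup>2 - F x) / 2 + (LINT x:{lo..hi}|lborel. (G x)\<^sup>2 - G x) / 2
      - (LINT x:{lo..hi}|lborel. (?D x)\<^sup>2) / 4"
    by (subst set_integral_diff(2); (intro set_integrable_divide set_integral_add(1) jF jG jD)?)
      (subst set_integral_add(2); (intro set_integrable_divide jF jG)?; simp)
  finally have 2: "(LINT x:{lo..hi}|lborel. (?M x)\<^sup>2 - ?M x) = (LINT x:{lo..hi}|lborel. (F x)\<^sup>2 - F x) / 2 + (LINT x:{lo..hi}|lborel. (G x)\<^sup>2 - G x) / 2
      - (LINT x:{lo..hi}|lborel. (?D x)\<^sup>2) / 4" .
  have 3: "2 / (hi - lo) * (a / 2 + b / 2 - d / 4) = (2 / (hi - lo) * a + 2 / (hi - lo) * b) / 2 - d / (2 * (hi - lo))" for a b d :: real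
    using R by (simp add: divide_simps) (simp add: algebra_simps)
  show ?thesis using 1 unfolding log_energy_def 2 3 by argo
qed

section \<open>Limits of minimising sequences\<close>

lemma lipschitz_measurable:
  fixes F :: "real \<Rightarrow> real"
  assumes "\<And>x y. \<bar>F x - F y\<bar> \<le> \<kappa> * \<bar>x - y\<bar>"
  shows "F \<in> borel_measurable borel"
proof -
  have "0 \<le> \<kappa>" using assms[of 1 0] by simp
  hence "\<kappa>-lipschitz_on UNIV F" using assms by (auto simp: lipschitz_on_def dist_real_def)
  hence "continuous_on UNIV F" by (rule lipschitz_on_continuous_on)
  thus ?thesis by (rule borel_measurable_continuous_onI)
qed

text \<open>A difference of size \<open>h\<close> at \<open>x0\<close> stays above
  \<open>h / 2\<close> on an interval of length \<open>h / (4 * \<kappa>)\<close>. That interval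
  lies in \<open>{lo..hi}\<close> because the functions agree elsewhere, so it contributes
  \<open>h ^ 3 / (16 * \<kappa>)\<close>. Convergence in \<open>L\<^sup>2\<close> thus becomes
  uniform convergence.\<close>

lemma cube_le_integral_square:
  fixes F G :: "real \<Rightarrow> real"
  assumes lip: "\<And>x y. \<bar>F x - F y\<bar> \<le> \<kappa> * \<bar>x - y\<bar>" "\<And>x y. \<bar>G x - G y\<bar> \<le> \<kappa> * \<bar>x - y\<bar>" and \<kappa>: "0 < \<kappa>"
    and out: "\<And>x. x \<notin> {lo..hi} \<Longrightarrow> F x = G x" and bd: "\<And>x. \<bar>F x - G x\<bar> \<le> 1"
  shows "\<bar>F x0 - G x0\<bar> ^ 3 \<le> 16 * \<kappa> * (LINT x:{lo..hi}|lborel. (F x - G x)\<^sup>2)"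
proof (cases "F x0 = G x0")
  case True
  have "0 \<le> (LINT x:{lo..hi}|lborel. (F x - G x)\<^sup>2)" unfolding set_lebesgue_integral_def by simp
  thus ?thesis using True \<kappa> by simp
next
  case False
  define h where "h = \<bar>F x0 - G x0\<bar>"
  have h: "0 < h" using False by (simp add: h_def)
  note [measurable] = lipschitz_measurable[OF lip(1)] lipschitz_measurable[OF lip(2)]
  let ?J = "{x0..x0 + h / (4 * \<kappa>)}"
  have low: "h / 2 \<le> \<bar>F x - G x\<bar>" if "x \<in> ?J" for x
  proof -
    have "\<kappa> * \<bar>x - x0\<bar> \<le> \<kappa> * (h / (4 * \<kappa>))" using that \<kappa> by (intro mult_left_mono) auto
    hence "\<kappa> * \<bar>x - x0\<bar> \<le> h / 4" using \<kappa> by simp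
    moreover define k where "k = \<kappa> * \<bar>x - x0\<bar>"
    moreover have "\<bar>F x - F x0\<bar> \<le> k" "\<bar>G x - G x0\<bar> \<le> k"
      using lip(1)[of x x0] lip(2)[of x x0] by (simp_all add: k_def)
    ultimately show ?thesis unfolding h_def by argo
  qed
  have sub: "?J \<subseteq> {lo..hi}"
  proof
    fix x assume x: "x \<in> ?J"
    show "x \<in> {lo..hi}"
    proof (rule ccontr)
      assume "x \<notin> {lo..hi}"
      thus False using out[of x] low[OF x] h by auto
    qed
  qed
  have sq: "(F x - G x)\<^sup>2 \<le> 1" for x using bd[of x] by (simp add: abs_square_le_1)
  have int: "set_integrable lborel {lo..hi} (\<lambda>x. (F x - G x)\<^sup>2)"
    using sq by (intro set_integrable_bounded_Icc[where B = 1]) auto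
  have "h ^ 3 / (16 * \<kappa>) = (LINT x:?J|lborel. (h / 2)\<^sup>2)"
    using h \<kappa> by (simp add: set_integral_const emeasure_lborel_Icc_eq power2_eq_square power3_eq_cube field_simps)
  also have "\<dots> \<le> (LINT x:?J|lborel. (F x - G x)\<^sup>2)"
  proof (rule set_integral_mono)
    show "set_integrable lborel ?J (\<lambda>x. (F x - G x)\<^sup>2)" by (rule set_integrable_subset[OF int _ sub]) simp
    show "set_integrable lborel ?J (\<lambda>x. (h / 2)\<^sup>2)" by (intro set_integrable_bounded_Icc[where B = "(h/2)\<^sup>2"]) auto
    fix x assume "x \<in> ?J"
    hence "(h / 2)\<^sup>2 \<le> \<bar>F x - G x\<bar>\<^sup>2" using low h by (intro power_mono) auto
    thus "(h / 2)\<^sup>2 \<le> (F x - G x)\<^sup>2" by simp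
  qed
  also have "\<dots> \<le> (LINT x:{lo..hi}|lborel. (F x - G x)\<^sup>2)"
    unfolding set_lebesgue_integral_def
  proof (rule integral_mono)
    show "integrable lborel (\<lambda>x. indicator ?J x *\<^sub>R (F x - G x)\<^sup>2)"
      using set_integrable_subset[OF int _ sub] by (simp add: set_integrable_def)
    show "integrable lborel (\<lambda>x. indicator {lo..hi} x *\<^sub>R (F x - G x)\<^sup>2)"
      using int by (simp add: set_integrable_def)
    show "indicator ?J x *\<^sub>R (F x - G x)\<^sup>2 \<le> indicator {lo..hi} x *\<^sub>R (F x - G x)\<^sup>2" for x
      using sub by (auto split: split_indicator)
  qed
  finally have "h ^ 3 / (16 * \<kappa>) \<le> (LINT x:{lo..hi}|lborel. (F x - G x)\<^sup>2)" .
  thus ?thesis using \<kappa> unfolding h_def[symmetric] by (simp add: field_simps)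
qed

text \<open>The limit \<open>F0\<close> of a minimising sequence is not shown to be a minimiser:
  only the quadratic lower bound is needed, and it survives pointwise limits without
  semicontinuity of \<open>J\<close>.\<close>

lemma strongly_convex_limit:
  fixes C :: "(real \<Rightarrow> real) set" and J :: "(real \<Rightarrow> real) \<Rightarrow> real"
  assumes ne: "C \<noteq> {}"
    and conv: "\<And>F G. F \<in> C \<Longrightarrow> G \<in> C \<Longrightarrow> (\<lambda>x. (F x + G x) / 2) \<in> C"
    and closed: "\<And>Fn F. (\<And>n::nat. Fn n \<in> C) \<Longrightarrow> (\<And>x. (\<lambda>n. Fn n x) \<longlonglongrightarrow> F x) \<Longrightarrow> F \<in> C"
    and lip: "\<And>F x y. F \<in> C \<Longrightarrow> \<bar>F x - F y\<bar> \<le> \<kappa> * \<bar>x - y\<bar>" and \<kappa>: "0 < \<kappa>"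
    and out: "\<And>F G x. F \<in> C \<Longrightarrow> G \<in> C \<Longrightarrow> x \<notin> {lo..hi} \<Longrightarrow> F x = G x"
    and rng: "\<And>F x. F \<in> C \<Longrightarrow> 0 \<le> F x \<and> F x \<le> 1"
    and bdd: "\<And>F. F \<in> C \<Longrightarrow> - B \<le> J F"
    and c: "0 < c"
    and mid: "\<And>F G. F \<in> C \<Longrightarrow> G \<in> C \<Longrightarrow>
        J (\<lambda>x. (F x + G x) / 2) \<le> (J F + J G) / 2 - c * (LINT x:{lo..hi}|lborel. (F x - G x)\<^sup>2)"
  shows "\<exists>F0\<in>C. \<forall>F\<in>C. 2 * c * (LINT x:{lo..hi}|lborel. (F x - F0 x)\<^sup>2) \<le> J F - (INF G\<in>C. J G)"
proof -
  define m where "m = (INF G\<in>C. J G)"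
  have bdd': "bdd_below (J ` C)" using bdd by (intro bdd_belowI[of _ "- B"]) auto
  have mle: "m \<le> J F" if "F \<in> C" for F unfolding m_def using bdd' that by (rule cINF_lower)
  have "\<exists>F\<in>C. J F < m + 1 / real (Suc n)" for n
    using cINF_less_iff[OF ne bdd', of "m + 1 / real (Suc n)"] unfolding m_def by simp
  then obtain Fn where Fn: "\<And>n. Fn n \<in> C" "\<And>n. J (Fn n) < m + 1 / real (Suc n)" by metis
  \<comment> \<open>The value at the midpoint is at least the infimum \<open>m\<close>, so two
    functions with small excess over \<open>m\<close> are close in \<open>L\<^sup>2\<close>.\<close>
  have quad: "2 * c * (LINT x:{lo..hi}|lborel. (F x - G x)\<^sup>2) \<le> (J F - m) + (J G - m)"
    if "F \<in> C" "G \<in> C" for F G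
    using mid[OF that] mle[OF conv[OF that]] by argo
  have diff1: "\<bar>F x - G x\<bar> \<le> 1" if "F \<in> C" "G \<in> C" for F G x
    using rng[OF that(1), of x] rng[OF that(2), of x] by auto
  have cauchy: "Cauchy (\<lambda>n. Fn n x)" for x
  proof (rule CauchyI)
    fix r :: real assume r: "0 < r"
    \<comment> \<open>From index \<open>K\<close> on, the excesses bound the integral by
      \<open>1 / (c * (K + 1))\<close>; this \<open>K\<close> brings the cube bound below
      \<open>r ^ 3\<close>.\<close>
    obtain K :: nat where K: "16 * \<kappa> / (c * r ^ 3) < real K" using reals_Archimedean2 by blast
    show "\<exists>M. \<forall>i\<ge>M. \<forall>j\<ge>M. norm (Fn i x - Fn j x) < r"
    proof (intro exI allI impI)
      fix i j assume ij: "K \<le> i" "K \<le> j"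
      have inv: "1 / real (Suc i) \<le> 1 / real (Suc K)" "1 / real (Suc j) \<le> 1 / real (Suc K)"
        using ij by (auto intro!: frac_le)
      have *: "2 * c * (LINT x:{lo..hi}|lborel. (Fn i x - Fn j x)\<^sup>2) \<le> 2 * (1 / real (Suc K))"
        using quad[of "Fn i" "Fn j"] Fn inv by (smt (verit))
      have I: "(LINT x:{lo..hi}|lborel. (Fn i x - Fn j x)\<^sup>2) \<le> 1 / (c * real (Suc K))"
      proof -
        from * have "c * (LINT x:{lo..hi}|lborel. (Fn i x - Fn j x)\<^sup>2) \<le> 1 / real (Suc K)" by argo
        hence "(LINT x:{lo..hi}|lborel. (Fn i x - Fn j x)\<^sup>2) \<le> 1 / real (Suc K) / c"
          unfolding pos_le_divide_eq[OF c] mult.commute[of _ c] .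
        also have "1 / real (Suc K) / c = 1 / (c * real (Suc K))" by simp
        finally show ?thesis .
      qed
      have "\<bar>Fn i x - Fn j x\<bar> ^ 3 \<le> 16 * \<kappa> * (LINT x:{lo..hi}|lborel. (Fn i x - Fn j x)\<^sup>2)"
        using lip out Fn(1) \<kappa> diff1 by (intro cube_le_integral_square) auto
      also have "\<dots> \<le> 16 * \<kappa> * (1 / (c * real (Suc K)))" using I \<kappa> by (intro mult_left_mono) auto
      also have "\<dots> < r ^ 3"
      proof -
        have "16 * \<kappa> < real K * (c * r ^ 3)" using K c r by (simp add: divide_less_eq)
        also have "\<dots> \<le> real (Suc K) * (c * r ^ 3)" using c r by (intro mult_right_mono) auto
        finally have "16 * \<kappa> < r ^ 3 * (c * real (Suc K))" by (simp only: ac_simps)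
        moreover have "0 < c * real (Suc K)" using c by simp
        ultimately show ?thesis by (simp only: mult_1_right times_divide_eq_right pos_divide_less_eq)
      qed
      finally show "norm (Fn i x - Fn j x) < r"
        using r by (metis less_imp_le power_less_imp_less_base real_norm_def)
    qed
  qed
  define F0 where "F0 x = lim (\<lambda>n. Fn n x)" for x
  have lim: "(\<lambda>n. Fn n x) \<longlonglongrightarrow> F0 x" for x
    unfolding F0_def using cauchy by (simp add: Cauchy_convergent_iff convergent_LIMSEQ_iff)
  have F0: "F0 \<in> C" using closed[of Fn F0] Fn lim by auto
  have "2 * c * (LINT x:{lo..hi}|lborel. (F x - F0 x)\<^sup>2) \<le> J F - m" if F: "F \<in> C" for F
  proof -
    note [measurable] = lipschitz_measurable[OF lip[OF F0]] lipschitz_measurable[OF lip[OF F]] lipschitz_measurable[OF lip[OF Fn(1)]]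
    have "(\<lambda>n. LINT x|lborel. indicator {lo..hi} x *\<^sub>R (F x - Fn n x)\<^sup>2) \<longlonglongrightarrow> (LINT x|lborel. indicator {lo..hi} x *\<^sub>R (F x - F0 x)\<^sup>2)"
    proof (rule integral_dominated_convergence[where w = "indicator {lo..hi}"])
      show "integrable lborel (indicator {lo..hi} :: real \<Rightarrow> real)"
        by (simp add: integrable_indicator_iff emeasure_lborel_Icc_eq)
      show "AE x in lborel. (\<lambda>n. indicator {lo..hi} x *\<^sub>R (F x - Fn n x)\<^sup>2) \<longlonglongrightarrow> indicator {lo..hi} x *\<^sub>R (F x - F0 x)\<^sup>2"
        by (intro always_eventually allI tendsto_intros lim)
      have "(F x - Fn n x)\<^sup>2 \<le> 1" for n x using diff1[OF F Fn(1)[of n], of x] by (simp add: abs_square_le_1)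
      thus "AE x in lborel. norm (indicator {lo..hi} x *\<^sub>R (F x - Fn n x)\<^sup>2) \<le> indicator {lo..hi} x" for n
        by (auto split: split_indicator)
    qed measurable
    hence L: "(\<lambda>n. 2 * c * (LINT x:{lo..hi}|lborel. (F x - Fn n x)\<^sup>2)) \<longlonglongrightarrow> 2 * c * (LINT x:{lo..hi}|lborel. (F x - F0 x)\<^sup>2)"
      unfolding set_lebesgue_integral_def by (intro tendsto_intros)
    have "(\<lambda>n. (J F - m) + 1 / real (Suc n)) \<longlonglongrightarrow> (J F - m) + 0"
      by (intro tendsto_intros LIMSEQ_Suc[OF lim_inverse_n']) 
    moreover have "2 * c * (LINT x:{lo..hi}|lborel. (F x - Fn n x)\<^sup>2) \<le> (J F - m) + 1 / real (Suc n)" for n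
      using quad[OF F Fn(1)[of n]] Fn(2)[of n] by linarith
    ultimately show ?thesis using LIMSEQ_le[OF L] by auto
  qed
  thus ?thesis using F0 unfolding m_def by blast
qed

section \<open>Measures with a Lipschitz distribution function\<close>

text \<open>Continuity of \<open>F\<close> makes single points null. Open intervals are the sets on
  which \<open>lborel_eqI\<close> tests a measure.\<close>

lemma emeasure_interval_measure_Ioo:
  fixes F :: "real \<Rightarrow> real"
  assumes mono: "mono F" and cont: "continuous_on UNIV F" and lu: "l \<le> u"
  shows "emeasure (interval_measure F) {l<..<u} = ennreal (F u - F l)"
proof (cases "l = u")
  case False
  hence lu': "l < u" using lu by simp
  have m: "\<And>x y. x \<le> y \<Longrightarrow> F x \<le> F y" using mono by (simp add: monoD)
  have r: "\<And>a. continuous (at_right a) F"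
    using cont continuous_at_imp_continuous_at_within by (auto simp: continuous_on_eq_continuous_at)
  have u0: "emeasure (interval_measure F) {u} = 0"
    using emeasure_interval_measure_Icc[OF order_refl[of u] m cont] by simp
  have "emeasure (interval_measure F) {l<..u} = emeasure (interval_measure F) ({l<..<u} \<union> {u})"
    by (rule arg_cong[where f = "emeasure (interval_measure F)"]) (use lu' in auto)
  also have "\<dots> = emeasure (interval_measure F) {l<..<u} + emeasure (interval_measure F) {u}"
    by (intro plus_emeasure[symmetric]) auto
  finally show ?thesis using emeasure_interval_measure_Ioc[OF lu m r] u0 by simp
qed simp

text \<open>If \<open>F\<close> and \<open>x - F x\<close> both increase, their Stieltjes measures
  add up to length on every interval, hence to Lebesgue measure. So the measure of \<open>F\<close>
  is dominated by Lebesgue measure, and absolute continuity is immediate.\<close>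

lemma lborel_eq_interval_measure_sum:
  fixes F :: "real \<Rightarrow> real"
  assumes mono: "mono F" and cont: "continuous_on UNIV F" and lip: "mono (\<lambda>x. x - F x)" and A: "A \<in> sets borel"
  shows "emeasure lborel A = emeasure (interval_measure F) A + emeasure (interval_measure (\<lambda>x. x - F x)) A"
proof -
  let ?M = "interval_measure F" and ?N = "interval_measure (\<lambda>x. x - F x)"
  have c2: "continuous_on UNIV (\<lambda>x. x - F x)" using cont by (intro continuous_intros)
  define S where "S = measure_of UNIV (sets borel) (\<lambda>A. emeasure ?M A + emeasure ?N A)"
  have sS: "sets S = sets borel" unfolding S_def by (metis sets.sigma_sets_eq sets_measure_of_conv space_borel top_greatest sets.space_closed Pow_UNIV)
  have eS: "emeasure S B = emeasure ?M B + emeasure ?N B" if "B \<in> sets borel" for B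
    unfolding S_def
  proof (rule emeasure_measure_of_sigma)
    show "sigma_algebra UNIV (sets borel)" by (metis sets.sigma_algebra_axioms space_borel)
    show "positive (sets borel) (\<lambda>A. emeasure ?M A + emeasure ?N A)" by (simp add: positive_def)
    show "countably_additive (sets borel) (\<lambda>A. emeasure ?M A + emeasure ?N A)"
    proof (rule countably_additiveI)
      fix B :: "nat \<Rightarrow> real set"
      assume B: "range B \<subseteq> sets borel" "disjoint_family B" "(\<Union>i. B i) \<in> sets borel"
      have "(\<Sum>i. emeasure ?M (B i) + emeasure ?N (B i)) = (\<Sum>i. emeasure ?M (B i)) + (\<Sum>i. emeasure ?N (B i))"
        by (rule suminf_add[symmetric]) auto
      also have "\<dots> = emeasure ?M (\<Union>i. B i) + emeasure ?N (\<Union>i. B i)"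
        using B by (intro arg_cong2[where f = "(+)"] suminf_emeasure) auto
      finally show "(\<Sum>i. emeasure ?M (B i) + emeasure ?N (B i)) = emeasure ?M (\<Union>i. B i) + emeasure ?N (\<Union>i. B i)" .
    qed
  qed (use that in auto)
  have "lborel = S"
  proof (rule lborel_eqI)
    fix l u :: real
    assume "\<And>b. b \<in> Basis \<Longrightarrow> l \<bullet> b \<le> u \<bullet> b"
    hence lu: "l \<le> u" by simp
    have "emeasure S (box l u) = ennreal (F u - F l) + ennreal ((u - F u) - (l - F l))"
      using emeasure_interval_measure_Ioo[OF mono cont lu] emeasure_interval_measure_Ioo[OF lip c2 lu]
      by (subst eS) (auto simp: box_real)
    also have "\<dots> = ennreal (u - l)"
      using monoD[OF mono lu] monoD[OF lip lu] by (subst ennreal_plus[symmetric]) auto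
    finally show "emeasure S (box l u) = (\<Prod>b\<in>Basis. (u - l) \<bullet> b)" by simp
  qed (simp add: sS)
  thus ?thesis using eS[OF A] by metis
qed

text \<open>Dividing by \<kappa> gives a function with Lipschitz constant 1, to which the
  decomposition of \<open>lborel\<close> applies, and Radon-Nikodym yields a density. Each point
  outside \<open>S\<close> has a null neighbourhood because \<open>F\<close> is flat there; by
  Lindelof countably many of these cover the complement of \<open>S\<close>, so the density may be
  set to 0 on all of it.\<close>

lemma lipschitz_cdf_density:
  fixes F :: "real \<Rightarrow> real"
  assumes mono: "mono F" and lip: "\<And>x y. \<bar>F x - F y\<bar> \<le> \<kappa> * \<bar>x - y\<bar>" and \<kappa>: "0 < \<kappa>"
    and lo: "\<And>x. x \<le> a \<Longrightarrow> F x = 0" and hi: "\<And>x. b \<le> x \<Longrightarrow> F x = 1"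
    and S: "S \<in> sets borel" and flat: "\<And>x. x \<notin> S \<Longrightarrow> \<exists>e>0. F (x + e) = F (x - e)"
  shows "\<exists>\<mu> :: real \<Rightarrow> real. \<mu> \<in> borel_measurable borel \<and> (\<forall>x. 0 \<le> \<mu> x) \<and>
     prob_space (density lborel (\<lambda>x. ennreal (\<mu> x))) \<and> (\<forall>x. x \<notin> S \<longrightarrow> \<mu> x = 0) \<and>
     (\<forall>x. measure (density lborel (\<lambda>x. ennreal (\<mu> x))) {..x} = F x)"
proof -
  define G where "G x = F x / \<kappa>" for x
  have mG: "mono G" using mono \<kappa> unfolding G_def by (auto simp: mono_def intro: divide_right_mono)
  have "continuous_on UNIV F"
    using lip \<kappa> by (intro lipschitz_on_continuous_on[of \<kappa>]) (auto simp: lipschitz_on_def dist_real_def)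
  hence cG: "continuous_on UNIV G" unfolding G_def using \<kappa> by (intro continuous_intros) auto
  have lG: "mono (\<lambda>x. x - G x)"
  proof (rule monoI)
    fix x y :: real assume xy: "x \<le> y"
    have "F y - F x \<le> \<kappa> * (y - x)" using lip[of y x] xy by auto
    hence "(F y - F x) / \<kappa> \<le> y - x" using \<kappa> by (simp add: divide_le_eq mult.commute)
    thus "x - G x \<le> y - G y" by (simp add: G_def diff_divide_distrib)
  qed
  let ?M = "interval_measure G"
  have m: "\<And>x y. x \<le> y \<Longrightarrow> G x \<le> G y" using mG by (simp add: monoD)
  have r: "\<And>a. continuous (at_right a) G"
    using cG continuous_at_imp_continuous_at_within by (auto simp: continuous_on_eq_continuous_at)
  have "absolutely_continuous lborel ?M"
    unfolding absolutely_continuous_def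
  proof
    fix A :: "real set" assume A: "A \<in> null_sets lborel"
    hence "emeasure ?M A + emeasure (interval_measure (\<lambda>x. x - G x)) A = 0"
      using lborel_eq_interval_measure_sum[OF mG cG lG, of A] by (auto simp: null_sets_def)
    thus "A \<in> null_sets ?M" using A by (auto simp: null_sets_def)
  qed
  then obtain f where f: "f \<in> borel_measurable lborel" "density lborel f = ?M"
    using sigma_finite_measure.Radon_Nikodym[OF lborel.sigma_finite_measure_axioms, of ?M] by auto
  have tb: "(G \<longlongrightarrow> 0) at_bot"
    by (rule tendsto_eventually) (use lo in \<open>auto simp: eventually_at_bot_linorder G_def intro: exI[of _ a]\<close>)
  have iic: "emeasure ?M {..x} = ennreal (G x)" for x
  proof -
    have "cdf ?M x = G x" using cdf_interval_measure[OF m r tb] by simp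
    moreover have "emeasure ?M {..x} < \<infinity>"
    proof -
      have "{..x} \<subseteq> {..a} \<union> {a<..max a x}" by auto
      have z: "emeasure ?M {..a} = 0"
      proof -
        have "emeasure ?M {..a} = (SUP n. emeasure ?M {a - real n<..a})"
        proof -
          have "x \<in> (\<Union>n. {a - real n<..a})" if "x \<le> a" for x
            using reals_Archimedean2[of "a - x"] that by (auto simp: algebra_simps)
          hence "{..a} = (\<Union>n. {a - real n<..a})" by auto
          thus ?thesis by (subst SUP_emeasure_incseq) (auto simp: incseq_def)
        qed
        also have "\<dots> = 0"
          using lo by (subst emeasure_interval_measure_Ioc[OF _ m r]) (auto simp: G_def)
        finally show ?thesis .
      qed
      have "emeasure ?M {..x} \<le> emeasure ?M ({..a} \<union> {a<..max a x})" by (intro emeasure_mono) auto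
      also have "\<dots> \<le> emeasure ?M {..a} + emeasure ?M {a<..max a x}" by (intro emeasure_subadditive) auto
      also have "\<dots> < \<infinity>" unfolding z by (subst emeasure_interval_measure_Ioc[OF _ m r]) auto
      finally show ?thesis .
    qed
    ultimately show ?thesis by (simp add: cdf_def emeasure_eq_ennreal_measure)
  qed
  have out0: "emeasure ?M (- S) = 0"
  proof -
    have "\<exists>e>0. emeasure ?M {x - e<..<x + e} = 0" if x: "x \<notin> S" for x
    proof -
      obtain e where e: "0 < e" "F (x + e) = F (x - e)" using flat[OF x] by auto
      have "emeasure ?M {x - e<..<x + e} = ennreal (G (x + e) - G (x - e))"
        using e by (intro emeasure_interval_measure_Ioo mG cG) auto
      thus ?thesis using e by (auto simp: G_def)
    qed
    then obtain e where e: "\<And>x. x \<notin> S \<Longrightarrow> 0 < e x" "\<And>x. x \<notin> S \<Longrightarrow> emeasure ?M {x - e x<..<x + e x} = 0"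
      by metis
    let ?U = "(\<lambda>x. {x - e x<..<x + e x}) ` (- S)"
    obtain U where U: "U \<subseteq> ?U" "countable U" "\<Union>U = \<Union>?U"
      using Lindelof[of ?U] by (metis (no_types, lifting) imageE open_greaterThanLessThan)
    have "\<Union>U \<in> null_sets ?M"
      by (rule null_sets_UN'[of U "\<lambda>x. x", simplified]) (use U e in \<open>auto simp: null_sets_def\<close>)
    moreover have "- S \<subseteq> \<Union>U" unfolding U(3) using e(1) by force
    ultimately show ?thesis by (metis (no_types, lifting) emeasure_mono le_zero_eq null_setsD1 null_setsD2)
  qed
  have fin: "AE x in lborel. f x \<noteq> \<infinity>"
  proof -
    have "emeasure ?M UNIV = (SUP n. emeasure ?M {..real n})"
    proof -
      have "UNIV = (\<Union>n. {..real n})" by (auto intro: real_arch_simple)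
      thus ?thesis by (subst SUP_emeasure_incseq) (auto simp: incseq_def)
    qed
    also have "\<dots> \<le> ennreal (1 / \<kappa>)"
    proof (rule SUP_least)
      fix n
      have "F (real n) \<le> F (max b (real n))" using mono by (simp add: monoD)
      hence "F (real n) \<le> 1" using hi by simp
      thus "emeasure ?M {..real n} \<le> ennreal (1 / \<kappa>)"
        unfolding iic G_def using \<kappa> by (intro ennreal_leI divide_right_mono) auto
    qed
    finally have "emeasure (density lborel f) UNIV < \<infinity>" unfolding f(2) using le_less_trans ennreal_less_top by (metis infinity_ennreal_def)
    hence "(\<integral>\<^sup>+x. f x \<partial>lborel) \<noteq> \<infinity>" using f(1) by (subst (asm) emeasure_density) auto
    thus ?thesis by (rule nn_integral_PInf_AE[OF f(1)])
  qed
  \<comment> \<open>The factor \<kappa> undoes the rescaling. \<open>enn2real\<close> sends an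
    infinite density to 0, which by \<open>fin\<close> happens only on a null set.\<close>
  define \<mu> where "\<mu> x = \<kappa> * enn2real (f x) * indicator S x" for x
  have mm: "\<mu> \<in> borel_measurable borel" using f(1) S unfolding \<mu>_def by measurable
  have em: "emeasure (density lborel (\<lambda>x. ennreal (\<mu> x))) A = ennreal \<kappa> * emeasure ?M A" if A: "A \<in> sets borel" for A
  proof -
    have "emeasure (density lborel (\<lambda>x. ennreal (\<mu> x))) A = (\<integral>\<^sup>+x. ennreal (\<mu> x) * indicator A x \<partial>lborel)"
      using mm A by (intro emeasure_density) auto
    also have "\<dots> = (\<integral>\<^sup>+x. ennreal \<kappa> * (f x * indicator (A \<inter> S) x) \<partial>lborel)"
      using fin by (intro nn_integral_cong_AE) (auto elim!: eventually_mono simp: \<mu>_def \<kappa> less_imp_le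
          ennreal_mult less_top[symmetric] split: split_indicator)
    also have "\<dots> = ennreal \<kappa> * emeasure (density lborel f) (A \<inter> S)"
      using f(1) A S by (subst nn_integral_cmult) (auto simp: emeasure_density)
    also have "emeasure (density lborel f) (A \<inter> S) = emeasure ?M A"
    proof -
      have "emeasure ?M A \<le> emeasure ?M ((A \<inter> S) \<union> (- S))" using A S by (intro emeasure_mono) auto
      also have "\<dots> \<le> emeasure ?M (A \<inter> S) + emeasure ?M (- S)" using A S by (intro emeasure_subadditive) auto
      finally have "emeasure ?M A \<le> emeasure ?M (A \<inter> S)" using out0 by simp
      moreover have "emeasure ?M (A \<inter> S) \<le> emeasure ?M A" using A S by (intro emeasure_mono) auto
      ultimately show ?thesis unfolding f(2) by simp
    qed
    finally show ?thesis .
  qed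
  have nonneg: "0 \<le> \<mu> x" for x using \<kappa> by (simp add: \<mu>_def)
  have Fn: "0 \<le> F x" for x
    using monoD[OF mono, of "min a x" x] lo[of "min a x"] by simp
  have iic2: "emeasure (density lborel (\<lambda>x. ennreal (\<mu> x))) {..x} = ennreal (F x)" for x
    using em[of "{..x}"] iic[of x] \<kappa> Fn[of x] by (simp add: ennreal_mult[symmetric] G_def)
  have tot: "emeasure (density lborel (\<lambda>x. ennreal (\<mu> x))) UNIV = 1"
  proof -
    have "UNIV = (\<Union>n. {..b + real n})"
    proof -
      have "x \<in> (\<Union>n. {..b + real n})" for x
        using real_arch_simple[of "x - b"] by (auto simp: algebra_simps)
      thus ?thesis by blast
    qed
    hence "emeasure (density lborel (\<lambda>x. ennreal (\<mu> x))) UNIV = (SUP n. emeasure (density lborel (\<lambda>x. ennreal (\<mu> x))) {..b + real n})"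
      by (subst SUP_emeasure_incseq) (auto simp: incseq_def)
    also have "\<dots> = 1" unfolding iic2 using hi by simp
    finally show ?thesis .
  qed
  show ?thesis
  proof (intro exI[of _ \<mu>] conjI allI impI)
    show "prob_space (density lborel (\<lambda>x. ennreal (\<mu> x)))" using tot by (intro prob_spaceI) simp
    show "measure (density lborel (\<lambda>x. ennreal (\<mu> x))) {..x} = F x" for x
      using iic2 Fn by (simp add: measure_def)
  qed (use mm nonneg in \<open>auto simp: \<mu>_def\<close>)
qed

section \<open>Lipschitz test functions\<close>

text \<open>Integration by parts for a function that need not be differentiable: the average of
  \<open>g\<close> over \<open>{y..y + h}\<close> is within \<open>L * h\<close> of
  \<open>g y\<close>, and its derivative in \<open>y\<close> is the difference quotient, which is
  defined everywhere and bounded by \<open>L\<close>.\<close>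

lemma lipschitz_mollification:
  fixes g :: "real \<Rightarrow> real"
  assumes lip: "\<And>x y. \<bar>g x - g y\<bar> \<le> L * \<bar>x - y\<bar>" and h: "0 < h" and y: "lo \<le> y" "y \<le> hi"
  shows "\<bar>integral {hi..hi + h} g / h - (LINT x:{lo..hi}|lborel. (g (x + h) - g x) / h * (if y \<le> x then 1 else 0)) - g y\<bar> \<le> L * h"
proof -
  have L: "0 \<le> L" using lip[of 1 0] by simp
  have gL: "L-lipschitz_on UNIV g" using lip L by (auto simp: lipschitz_on_def dist_real_def)
  have cont: "continuous_on A g" for A
    using lipschitz_on_continuous_on[OF gL] continuous_on_subset by blast
  have int: "g integrable_on {a..b}" for a b using cont by (rule integrable_continuous_real)
  have i2: "(\<lambda>x. g (x + h)) integrable_on {a..b}" for a b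
    by (intro integrable_continuous_real continuous_on_compose2[OF cont[of UNIV]]) (auto intro!: continuous_intros)
  have "(LINT x:{lo..hi}|lborel. (g (x + h) - g x) / h * (if y \<le> x then 1 else 0)) = (LINT x:{y..hi}|lborel. (g (x + h) - g x) / h)"
    unfolding set_lebesgue_integral_def by (rule Bochner_Integration.integral_cong) (use y in \<open>auto simp: indicator_def\<close>)
  also have "\<dots> = integral {y..hi} (\<lambda>x. (g (x + h) - g x) / h)"
    using h by (intro set_borel_integral_eq_integral(2) borel_integrable_atLeastAtMost' continuous_intros
        continuous_on_compose2[OF cont[of UNIV]]) auto
  also have "\<dots> = (integral {y..hi} (\<lambda>x. g (x + h)) - integral {y..hi} g) / h"
    using Henstock_Kurzweil_Integration.integral_diff[OF i2 int, of y hi] by simp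
  also have "integral {y..hi} (\<lambda>x. g (x + h)) = integral {y + h..hi + h} g"
    using integral_shift_real_ivl[of "y + h" h "hi + h" g] by simp
  also have "\<dots> - integral {y..hi} g = integral {hi..hi + h} g - integral {y..y + h} g"
    using Henstock_Kurzweil_Integration.integral_combine[of y "y + h" "hi + h" g] Henstock_Kurzweil_Integration.integral_combine[of y hi "hi + h" g]
      y h int by simp
  finally have eq: "integral {hi..hi + h} g / h - (LINT x:{lo..hi}|lborel. (g (x + h) - g x) / h * (if y \<le> x then 1 else 0)) - g y
     = (integral {y..y + h} g - h * g y) / h"
    using h by (simp add: diff_divide_distrib)
  have "integral {y..y + h} g - h * g y = integral {y..y + h} (\<lambda>x. g x - g y)"
    using Henstock_Kurzweil_Integration.integral_diff[OF int integrable_const_ivl, of y "y + h" "g y"] h by simp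
  also have "\<bar>\<dots>\<bar> \<le> L * h * (y + h - y)"
    unfolding real_norm_def[symmetric]
  proof (rule integral_bound)
    fix t assume t: "t \<in> {y..y + h}"
    have "L * \<bar>t - y\<bar> \<le> L * h" using t L by (intro mult_left_mono) auto
    thus "norm (g t - g y) \<le> L * h" using lip[of t y] by simp
  qed (use h in \<open>auto intro!: continuous_intros cont\<close>)
  finally have "\<bar>integral {y..y + h} g - h * g y\<bar> \<le> L * h * h" by simp
  hence "\<bar>(integral {y..y + h} g - h * g y) / h\<bar> \<le> L * h" using h by (simp add: divide_le_eq)
  thus ?thesis using eq by simp
qed

text \<open>Averaging the indicators of \<open>y j \<le> x\<close> over the particles produces the
  empirical distribution function. The measure is kept general because test functions are integrated
  over \<open>lborel\<close> and the potential over \<open>lebesgue\<close>.\<close>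

lemma average_integral_indicator:
  fixes D :: "real \<Rightarrow> real"
  assumes D: "set_integrable M A D" and M: "\<And>z. {z..} \<in> sets M" and N: "1 \<le> N"
  shows "(\<Sum>j = 1..N. c - (LINT x:A|M. D x * (if y j \<le> x then 1 else 0))) / real N = c - (LINT x:A|M. D x * ecdf N y x)"
proof -
  have int: "set_integrable M A (\<lambda>x. D x * (if z \<le> x then 1 else 0))" for z
  proof -
    note i = integrable_mult_indicator[OF M D[unfolded set_integrable_def]]
    have "(\<lambda>x. indicator A x *\<^sub>R (D x * (if z \<le> x then 1 else 0))) = (\<lambda>x. indicator {z..} x *\<^sub>R (indicator A x *\<^sub>R D x))"
      by (auto simp: fun_eq_iff indicator_def)
    thus ?thesis unfolding set_integrable_def using i[of z] by (simp only:)
  qed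
  have "(LINT x:A|M. D x * ecdf N y x) = (LINT x:A|M. (\<Sum>j = 1..N. D x * (if y j \<le> x then 1 else 0)) / real N)"
    by (simp add: ecdf_def sum_distrib_left)
  also have "\<dots> = (LINT x:A|M. (\<Sum>j = 1..N. D x * (if y j \<le> x then 1 else 0))) / real N" by simp
  also have "(LINT x:A|M. (\<Sum>j = 1..N. D x * (if y j \<le> x then 1 else 0))) = (\<Sum>j = 1..N. LINT x:A|M. D x * (if y j \<le> x then 1 else 0))"
    unfolding set_lebesgue_integral_def scaleR_sum_right
    by (rule Bochner_Integration.integral_sum) (use int in \<open>simp only: set_integrable_def\<close>)
  finally show ?thesis using N by (simp add: sum_subtractf field_simps)
qed

text \<open>The counterpart of \<open>average_integral_indicator\<close> for the limit law, by
  Fubini on the product with the interval \<open>{lo..hi}\<close>.\<close>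

lemma expectation_integral_indicator:
  fixes D :: "real \<Rightarrow> real"
  assumes nu: "prob_space \<nu>" "sets \<nu> = sets borel" and D: "D \<in> borel_measurable borel" "\<And>x. \<bar>D x\<bar> \<le> L"
  shows "integrable \<nu> (\<lambda>y. LINT x:{lo..hi}|lborel. D x * (if y \<le> x then 1 else 0))"
    and "(LINT y|\<nu>. (LINT x:{lo..hi}|lborel. D x * (if y \<le> x then 1 else 0))) = (LINT x:{lo..hi}|lborel. D x * measure \<nu> {..x})"
proof -
  interpret prob_space \<nu> by (rule nu)
  note [measurable_cong] = nu(2)
  note [measurable] = D(1)
  interpret P: pair_sigma_finite \<nu> lborel ..
  let ?f = "\<lambda>y x. indicator {lo..hi} x *\<^sub>R (D x * (if y \<le> x then 1 else 0)) :: real"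
  have sp: "space \<nu> = UNIV" using sets_eq_imp_space_eq[OF nu(2)] by simp
  have A: "space \<nu> \<times> {lo..hi} \<in> sets (\<nu> \<Otimes>\<^sub>M lborel)" by simp
  have eA: "emeasure (\<nu> \<Otimes>\<^sub>M lborel) (space \<nu> \<times> {lo..hi}) < \<infinity>"
    by (subst lborel.emeasure_pair_measure_Times) (auto simp: emeasure_space_1 emeasure_lborel_Icc_eq ennreal_mult_less_top)
  have m: "case_prod ?f \<in> borel_measurable (\<nu> \<Otimes>\<^sub>M lborel)" by measurable
  have "0 \<le> L" using D(2)[of 0] by linarith
  have int: "integrable (\<nu> \<Otimes>\<^sub>M lborel) (case_prod ?f)"
    by (rule integrableI_bounded_set[OF A m eA, of L]; intro AE_I2)
      (use D(2) \<open>0 \<le> L\<close> sp in \<open>auto simp: indicator_def split: if_splits\<close>)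
  show "integrable \<nu> (\<lambda>y. LINT x:{lo..hi}|lborel. D x * (if y \<le> x then 1 else 0))"
    using P.integrable_fst'[OF int] by (simp add: set_lebesgue_integral_def)
  have "(LINT y|\<nu>. (LINT x:{lo..hi}|lborel. D x * (if y \<le> x then 1 else 0))) = (LINT x|lborel. (LINT y|\<nu>. ?f y x))"
    unfolding set_lebesgue_integral_def using P.Fubini_integral[OF int] by simp
  also have "\<dots> = (LINT x:{lo..hi}|lborel. D x * measure \<nu> {..x})"
    unfolding set_lebesgue_integral_def
  proof (rule Bochner_Integration.integral_cong[OF refl])
    fix x
    have "(LINT y|\<nu>. ?f y x) = (LINT y|\<nu>. indicator {..x} y * (indicator {lo..hi} x * D x))"
      by (rule Bochner_Integration.integral_cong) (auto simp: indicator_def)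
    also have "\<dots> = measure \<nu> {..x} * (indicator {lo..hi} x * D x)"
      using sp by simp
    finally show "(LINT y|\<nu>. ?f y x) = indicator {lo..hi} x *\<^sub>R (D x * measure \<nu> {..x})" by simp
  qed
  finally show "(LINT y|\<nu>. (LINT x:{lo..hi}|lborel. D x * (if y \<le> x then 1 else 0))) = (LINT x:{lo..hi}|lborel. D x * measure \<nu> {..x})" .
qed

text \<open>In dimension one the Wasserstein distance is the \<open>L\<^sup>1\<close> distance of
  the distribution functions; this is the direction that follows by parts. After mollification at
  scale \<open>h\<close> both sides are integrals of a function bounded by \<open>L\<close> against
  distribution functions, and then \<open>h\<close> tends to 0.\<close>

lemma lipschitz_average_bound:
  fixes g :: "real \<Rightarrow> real"
  assumes lip: "\<And>x y. \<bar>g x - g y\<bar> \<le> L * \<bar>x - y\<bar>" and N: "1 \<le> N"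
    and y: "\<And>j. j \<in> {1..N} \<Longrightarrow> y j \<in> {lo..hi}"
    and nu: "prob_space \<nu>" "sets \<nu> = sets borel"
    and F: "\<And>x. measure \<nu> {..x} = F x" "F lo = 0" "F hi = 1"
  shows "\<bar>(\<Sum>j = 1..N. g (y j)) / real N - (LINT x|\<nu>. g x)\<bar> \<le> L * (LINT x:{lo..hi}|lborel. \<bar>ecdf N y x - F x\<bar>)"
    and "integrable \<nu> g"
proof -
  interpret prob_space \<nu> by (rule nu)
  note [measurable_cong] = nu(2)
  have [measurable]: "g \<in> borel_measurable borel" by (rule lipschitz_measurable[OF lip])
  have L: "0 \<le> L" using lip[of 1 0] by simp
  have sp: "space \<nu> = UNIV" using sets_eq_imp_space_eq[OF nu(2)] by simp
  have F01: "0 \<le> F x" "F x \<le> 1" for x using F(1)[of x] prob_le_1[of "{..x}"] measure_nonneg[of \<nu> "{..x}"] by simp_all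
  \<comment> \<open>The values 0 at \<open>lo\<close> and 1 at \<open>hi\<close> confine \<nu> to
    \<open>{lo<..hi}\<close>, where \<open>g\<close> is bounded and the mollification estimate is
    available.\<close>
  have "measure \<nu> {..hi} = measure \<nu> {..lo} + measure \<nu> {lo<..hi}"
  proof -
    have "lo \<le> hi" using y[of 1] N by auto
    hence "{..hi} = {..lo} \<union> {lo<..hi}" by auto
    thus ?thesis by (metis finite_measure_Union nu(2) atMost_borel greaterThanAtMost_borel Int_emptyI atMost_iff greaterThanAtMost_iff not_less)
  qed
  hence "prob {lo<..hi} = 1" using F by simp
  hence AE: "AE x in \<nu>. x \<in> {lo<..hi}" by (subst AE_in_set_eq_1) (auto simp: nu(2))
  show gi: "integrable \<nu> g"
  proof (rule integrable_const_bound[of _ "\<bar>g lo\<bar> + L * (hi - lo)"])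
    show "AE x in \<nu>. norm (g x) \<le> \<bar>g lo\<bar> + L * (hi - lo)"
      using AE
    proof eventually_elim
      case (elim x)
      have "L * \<bar>x - lo\<bar> \<le> L * (hi - lo)" using elim L by (intro mult_left_mono) auto
      thus ?case using lip[of x lo] by auto
    qed
  qed measurable
  define E where "E = (LINT x:{lo..hi}|lborel. \<bar>ecdf N y x - F x\<bar>)"
  have Fm: "F \<in> borel_measurable borel"
  proof (rule borel_measurable_mono, rule monoI)
    fix x z :: real assume "x \<le> z"
    thus "F x \<le> F z" unfolding F(1)[symmetric] by (intro finite_measure_mono) (auto simp: nu(2))
  qed
  note [measurable] = Fm
  have step: "\<bar>(\<Sum>j = 1..N. g (y j)) / real N - (LINT x|\<nu>. g x)\<bar> \<le> L * E + 2 * L * h" if h: "0 < h" for h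
  proof -
    define D where "D x = (g (x + h) - g x) / h" for x
    have Dm [measurable]: "D \<in> borel_measurable borel" unfolding D_def by measurable
    have DL: "\<bar>D x\<bar> \<le> L" for x using lip[of "x + h" x] h by (simp add: D_def divide_le_eq)
    define c where "c = integral {hi..hi + h} g / h"
    define \<Phi> where "\<Phi> z = c - (LINT x:{lo..hi}|lborel. D x * (if z \<le> x then 1 else 0))" for z
    have \<Phi>: "\<bar>\<Phi> z - g z\<bar> \<le> L * h" if "lo \<le> z" "z \<le> hi" for z
      using lipschitz_mollification[OF lip h that] unfolding \<Phi>_def c_def D_def .
    have Di: "set_integrable lborel {lo..hi} D" using DL by (intro set_integrable_bounded_Icc[where B = L]) auto
    have a1: "(\<Sum>j = 1..N. \<Phi> (y j)) / real N = c - (LINT x:{lo..hi}|lborel. D x * ecdf N y x)"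
      unfolding \<Phi>_def by (rule average_integral_indicator[OF Di _ N]) simp
    note E2 = expectation_integral_indicator[OF nu Dm DL, of lo hi]
    have \<Phi>i: "integrable \<nu> \<Phi>" unfolding \<Phi>_def using E2(1) by auto
    have a2: "(LINT z|\<nu>. \<Phi> z) = c - (LINT x:{lo..hi}|lborel. D x * F x)"
      unfolding \<Phi>_def using E2 F(1) by (simp add: prob_space)
    have "\<bar>(\<Sum>j = 1..N. \<Phi> (y j)) / real N - (\<Sum>j = 1..N. g (y j)) / real N\<bar> \<le> L * h"
    proof -
      have "\<bar>\<Sum>j = 1..N. \<Phi> (y j) - g (y j)\<bar> \<le> (\<Sum>j = 1..N. L * h)"
        using \<Phi> y by (intro order_trans[OF sum_abs] sum_mono) auto
      hence "\<bar>(\<Sum>j = 1..N. \<Phi> (y j) - g (y j)) / real N\<bar> \<le> L * h"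
        using N by (simp add: divide_le_eq mult.commute)
      thus ?thesis by (simp add: sum_subtractf diff_divide_distrib)
    qed
    moreover have "\<bar>(LINT z|\<nu>. \<Phi> z) - (LINT z|\<nu>. g z)\<bar> \<le> L * h"
    proof -
      have "(LINT z|\<nu>. \<Phi> z) - (LINT z|\<nu>. g z) = (LINT z|\<nu>. \<Phi> z - g z)"
        using \<Phi>i gi by simp
      also have "\<bar>\<dots>\<bar> \<le> (LINT z|\<nu>. \<bar>\<Phi> z - g z\<bar>)" by (rule integral_abs_bound)
      also have "\<dots> \<le> (LINT z|\<nu>. L * h)"
      proof (rule integral_mono_AE)
        show "AE z in \<nu>. \<bar>\<Phi> z - g z\<bar> \<le> L * h" using AE by eventually_elim (use \<Phi> in auto)
      qed (use \<Phi>i gi in auto)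
      finally show ?thesis by (simp add: prob_space)
    qed
    moreover have "\<bar>(LINT x:{lo..hi}|lborel. D x * ecdf N y x) - (LINT x:{lo..hi}|lborel. D x * F x)\<bar> \<le> L * E"
    proof -
      have b1: "\<bar>D x * ecdf N y x\<bar> \<le> L" "\<bar>D x * F x\<bar> \<le> L" for x
        using DL[of x] ecdf_nonneg[of N y x] ecdf_le_1[of N y x] F01[of x] L
        by (auto simp: abs_mult intro!: mult_mono[of _ L _ 1, simplified])
      have i1: "set_integrable lborel {lo..hi} (\<lambda>x. D x * ecdf N y x)" "set_integrable lborel {lo..hi} (\<lambda>x. D x * F x)"
        using b1 by (auto intro!: set_integrable_bounded_Icc[where B = L])
      have b2: "\<bar>ecdf N y x - F x\<bar> \<le> 1" for x
        using ecdf_nonneg[of N y x] ecdf_le_1[of N y x] F01[of x] by auto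
      have i2: "set_integrable lborel {lo..hi} (\<lambda>x. \<bar>ecdf N y x - F x\<bar>)"
        using b2 by (auto intro!: set_integrable_bounded_Icc[where B = 1])
      have "(LINT x:{lo..hi}|lborel. D x * ecdf N y x) - (LINT x:{lo..hi}|lborel. D x * F x) = (LINT x:{lo..hi}|lborel. D x * ecdf N y x - D x * F x)"
        by (rule set_integral_diff(2)[OF i1, symmetric])
      also have "\<bar>\<dots>\<bar> \<le> (LINT x:{lo..hi}|lborel. \<bar>D x * ecdf N y x - D x * F x\<bar>)"
        unfolding set_lebesgue_integral_def by (rule order_trans[OF integral_abs_bound]) (simp add: abs_mult)
      also have "\<dots> \<le> (LINT x:{lo..hi}|lborel. L * \<bar>ecdf N y x - F x\<bar>)"
      proof (rule set_integral_mono)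
        show "set_integrable lborel {lo..hi} (\<lambda>x. \<bar>D x * ecdf N y x - D x * F x\<bar>)"
          using i1 by (intro set_integrable_abs set_integral_diff(1))
        show "set_integrable lborel {lo..hi} (\<lambda>x. L * \<bar>ecdf N y x - F x\<bar>)" using i2 by auto
        fix x
        have "\<bar>D x * ecdf N y x - D x * F x\<bar> = \<bar>D x\<bar> * \<bar>ecdf N y x - F x\<bar>"
          by (simp add: abs_mult[symmetric] right_diff_distrib)
        thus "\<bar>D x * ecdf N y x - D x * F x\<bar> \<le> L * \<bar>ecdf N y x - F x\<bar>"
          using DL[of x] by (auto intro: mult_right_mono)
      qed
      finally show ?thesis by (simp add: E_def)
    qed
    ultimately show ?thesis unfolding a1 a2 by linarith
  qed
  have "\<bar>(\<Sum>j = 1..N. g (y j)) / real N - (LINT x|\<nu>. g x)\<bar> \<le> L * E"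
  proof (rule field_le_epsilon)
    fix e :: real assume e: "0 < e"
    \<comment> \<open>The summand 1 keeps the mollification scale well defined and positive when
      \<open>L = 0\<close>.\<close>
    have "2 * L * (e / (2 * L + 1)) \<le> e" using L e by (simp add: field_simps)
    thus "\<bar>(\<Sum>j = 1..N. g (y j)) / real N - (LINT x|\<nu>. g x)\<bar> \<le> L * E + e"
      using step[of "e / (2 * L + 1)"] L e by (simp add: add_nonneg_pos)
  qed
  thus "\<bar>(\<Sum>j = 1..N. g (y j)) / real N - (LINT x|\<nu>. g x)\<bar> \<le> L * (LINT x:{lo..hi}|lborel. \<bar>ecdf N y x - F x\<bar>)"
    by (simp add: E_def)
qed

text \<open>Cauchy-Schwarz, obtained by integrating
  \<open>2 * t * \<bar>f x\<bar> \<le> (f x)\<^sup>2 + t\<^sup>2\<close> and choosing the optimal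
  \<open>t\<close>, the mean of \<open>\<bar>f\<bar>\<close>.\<close>

lemma integral_abs_le_sqrt:
  fixes f :: "real \<Rightarrow> real"
  assumes f: "f \<in> borel_measurable borel" "\<And>x. \<bar>f x\<bar> \<le> 1" and R: "lo \<le> hi"
  shows "(LINT x:{lo..hi}|lborel. \<bar>f x\<bar>) \<le> sqrt ((hi - lo) * (LINT x:{lo..hi}|lborel. (f x)\<^sup>2))"
proof -
  note [measurable] = f(1)
  define I where "I = (LINT x:{lo..hi}|lborel. \<bar>f x\<bar>)"
  define Q where "Q = (LINT x:{lo..hi}|lborel. (f x)\<^sup>2)"
  have i1: "set_integrable lborel {lo..hi} (\<lambda>x. \<bar>f x\<bar>)" using f by (auto intro!: set_integrable_bounded_Icc[where B = 1])
  have i2: "set_integrable lborel {lo..hi} (\<lambda>x. (f x)\<^sup>2)" using f by (auto intro!: set_integrable_bounded_Icc[where B = 1] simp: abs_square_le_1)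
  have i3: "set_integrable lborel {lo..hi} (\<lambda>x. c)" for c :: real
    by (auto intro!: set_integrable_bounded_Icc[where B = "\<bar>c\<bar>"])
  have I0: "0 \<le> I" unfolding I_def set_lebesgue_integral_def by simp
  have key: "2 * t * I \<le> Q + t\<^sup>2 * (hi - lo)" for t
  proof -
    have "2 * t * I = (LINT x:{lo..hi}|lborel. 2 * t * \<bar>f x\<bar>)" unfolding I_def by simp
    also have "\<dots> \<le> (LINT x:{lo..hi}|lborel. (f x)\<^sup>2 + t\<^sup>2)"
    proof (rule set_integral_mono)
      show "set_integrable lborel {lo..hi} (\<lambda>x. (f x)\<^sup>2 + t\<^sup>2)" using i2 i3 by (rule set_integral_add(1))
      fix x
      have "0 \<le> (\<bar>f x\<bar> - t)\<^sup>2" by simp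
      thus "2 * t * \<bar>f x\<bar> \<le> (f x)\<^sup>2 + t\<^sup>2" by (simp add: power2_diff mult.commute mult.left_commute)
    qed (use i1 in auto)
    also have "\<dots> = Q + t\<^sup>2 * (hi - lo)"
      using i2 i3 R by (subst set_integral_add(2)) (auto simp: Q_def set_integral_const emeasure_lborel_Icc_eq)
    finally show ?thesis .
  qed
  have "I\<^sup>2 \<le> (hi - lo) * Q"
  proof (cases "hi = lo")
    case True
    have "2 * t * I \<le> Q" for t using key[of t] True by simp
    \<comment> \<open>On a degenerate interval the bound holds for every \<open>t\<close>; a nonzero
      \<open>I\<close> would give \<open>Q + 1 \<le> Q\<close> at this value.\<close>
    from this[of "(Q + 1) / (2 * I)"] have "I = 0" by (cases "I = 0") auto
    thus ?thesis using True by simp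
  next
    case False
    define d where "d = hi - lo"
    have d: "0 < d" using False R by (simp add: d_def)
    have "2 * (I / d) * I \<le> Q + (I / d)\<^sup>2 * d" using key[of "I / d"] by (simp add: d_def)
    moreover have "(I / d)\<^sup>2 * d = I\<^sup>2 / d" "2 * (I / d) * I = 2 * (I\<^sup>2 / d)"
      using d by (simp_all add: power2_eq_square)
    ultimately have "I\<^sup>2 / d \<le> Q" by linarith
    thus ?thesis using d by (simp add: divide_le_eq d_def mult.commute)
  qed
  hence "I \<le> sqrt ((hi - lo) * Q)" using I0 by (simp add: real_le_rsqrt)
  thus ?thesis by (simp add: I_def Q_def)
qed

section \<open>The external potential\<close>

text \<open>Only the origin is delicate. There \<open>ln s \<le> s - 1\<close> at
  \<open>s = 1 / sqrt \<bar>x\<bar>\<close> squeezes the function by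
  \<open>2 * sqrt \<bar>x\<bar>\<close>.\<close>

lemma continuous_on_mult_ln_abs: "continuous_on UNIV (\<lambda>x::real. x * ln \<bar>x\<bar>)"
proof -
  have bnd: "\<bar>x * ln \<bar>x\<bar>\<bar> \<le> 2 * sqrt \<bar>x\<bar>" if "\<bar>x\<bar> \<le> 1" for x :: real
  proof (cases "x = 0")
    case False
    let ?t = "\<bar>x\<bar>"
    have t: "0 < ?t" "?t \<le> 1" using False that by auto
    have "ln (1 / sqrt ?t) \<le> 1 / sqrt ?t - 1" using t by (intro ln_le_minus_one) auto
    hence "- ln ?t \<le> 2 / sqrt ?t" using t by (simp add: ln_div ln_sqrt)
    hence "?t * (- ln ?t) \<le> ?t * (2 / sqrt ?t)" using t by (intro mult_left_mono) auto
    also have "\<dots> = 2 * (?t / sqrt ?t)" by simp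
    also have "\<dots> = 2 * sqrt ?t" using t by (subst real_div_sqrt) auto
    finally show ?thesis using t by (simp add: abs_mult)
  qed simp
  have "isCont (\<lambda>x::real. x * ln \<bar>x\<bar>) x" for x
  proof (cases "x = 0")
    case True
    have "((\<lambda>x::real. 2 * sqrt \<bar>x\<bar>) \<longlongrightarrow> 2 * sqrt \<bar>0\<bar>) (at 0)" by (intro tendsto_intros)
    hence g: "((\<lambda>x::real. 2 * sqrt \<bar>x\<bar>) \<longlongrightarrow> 0) (at 0)" by simp
    have ev: "\<forall>\<^sub>F x in at 0. norm (x * ln \<bar>x\<bar>) \<le> 2 * sqrt \<bar>x\<bar>"
      unfolding eventually_at using bnd by (intro exI[of _ 1]) auto
    have "((\<lambda>x::real. x * ln \<bar>x\<bar>) \<longlongrightarrow> 0) (at 0)" by (rule Lim_null_comparison[OF ev g])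
    thus ?thesis using True by (simp add: isCont_def)
  next
    case False
    thus ?thesis by (intro continuous_intros) auto
  qed
  thus ?thesis by (simp add: continuous_on_eq_continuous_at)
qed

text \<open>The primitive \<open>(s - p) * ln \<bar>s - p\<bar> - (s - p)\<close> is continuous
  across the singularity, so the fundamental theorem applies with one exceptional point.\<close>

lemma integrable_abs_ln_abs:
  fixes p :: real
  assumes ab: "a \<le> b"
  shows "(\<lambda>s. \<bar>ln \<bar>s - p\<bar>\<bar>) integrable_on {a..b}"
proof -
  have "((\<lambda>s. ln \<bar>s - p\<bar>) has_integral
      (((b - p) * ln \<bar>b - p\<bar> - (b - p)) - ((a - p) * ln \<bar>a - p\<bar> - (a - p)))) {a..b}"
  proof (rule fundamental_theorem_of_calculus_interior_strong[of "{p}"])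
    fix x assume x: "x \<in> {a<..<b} - {p}"
    have "((\<lambda>s. (s - p) * ln \<bar>s - p\<bar> - (s - p)) has_real_derivative ln \<bar>x - p\<bar>) (at x)"
    proof (cases "p < x")
      case True
      have "((\<lambda>s. (s - p) * ln (s - p) - (s - p)) has_real_derivative ln (x - p)) (at x)"
        using True by (auto intro!: derivative_eq_intros)
      moreover have "\<forall>\<^sub>F s in nhds x. (s - p) * ln (s - p) - (s - p) = (s - p) * ln \<bar>s - p\<bar> - (s - p)"
        using eventually_nhds_in_open[of "{p<..}" x] True by (auto elim!: eventually_mono)
      ultimately show ?thesis using True by (subst (asm) DERIV_cong_ev[OF refl _ refl]) auto
    next
      case False
      hence xp: "x < p" using x by auto
      have "((\<lambda>s. (s - p) * ln (p - s) - (s - p)) has_real_derivative (1 * ln (p - x) + (- 1 / (p - x)) * (x - p)) - 1) (at x)"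
        using xp by (auto intro!: derivative_eq_intros)
      moreover have "(- 1 / (p - x)) * (x - p) = 1" using xp by (simp add: field_simps)
      ultimately have "((\<lambda>s. (s - p) * ln (p - s) - (s - p)) has_real_derivative ln (p - x)) (at x)" by simp
      moreover have "\<forall>\<^sub>F s in nhds x. (s - p) * ln (p - s) - (s - p) = (s - p) * ln \<bar>s - p\<bar> - (s - p)"
        using eventually_nhds_in_open[of "{..<p}" x] xp by (auto elim!: eventually_mono)
      ultimately show ?thesis using xp by (subst (asm) DERIV_cong_ev[OF refl _ refl]) auto
    qed
    thus "((\<lambda>s. (s - p) * ln \<bar>s - p\<bar> - (s - p)) has_vector_derivative ln \<bar>x - p\<bar>) (at x)"
      by (simp add: has_real_derivative_iff_has_vector_derivative)
  next
    have "continuous_on {a..b} (\<lambda>s. (s - p) * ln \<bar>s - p\<bar>)"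
      by (rule continuous_on_compose2[OF continuous_on_mult_ln_abs]) (auto intro!: continuous_intros)
    thus "continuous_on {a..b} (\<lambda>s. (s - p) * ln \<bar>s - p\<bar> - (s - p))"
      by (intro continuous_on_diff continuous_on_id continuous_on_const)
  qed (use ab in auto)
  hence 1: "(\<lambda>s. ln \<bar>s - p\<bar>) integrable_on {a..b}" by blast
  have 2: "(\<lambda>s. ln (max 1 \<bar>s - p\<bar>)) integrable_on {a..b}"
    by (rule integrable_continuous_real) (auto intro!: continuous_intros)
  \<comment> \<open>The absolute value is twice the positive part minus the function, and the
    positive part \<open>ln (max 1 \<bar>s - p\<bar>)\<close> is continuous. At \<open>s = p\<close>
    both sides vanish since \<open>ln 0 = 0\<close>.\<close>
  have "\<bar>ln \<bar>s - p\<bar>\<bar> = 2 * ln (max 1 \<bar>s - p\<bar>) - ln \<bar>s - p\<bar>" for s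
  proof (cases "s = p")
    case False
    thus ?thesis by (cases "1 \<le> \<bar>s - p\<bar>") (auto simp: max_def)
  qed simp
  thus ?thesis
    using Henstock_Kurzweil_Integration.integrable_diff[OF integrable_on_cmult_left[OF 2, of 2] 1] by simp
qed

text \<open>The derivative may be unbounded, but its majorant has logarithmic singularities only and
  is integrable. The fundamental theorem makes the derivative Henstock-Kurzweil integrable, and
  domination upgrades this to absolute integrability over \<open>lebesgue\<close>. The indicator
  form is the one that summation by parts needs.\<close>

lemma potential_density:
  fixes V :: "real \<Rightarrow> real" and ah bh :: "nat \<Rightarrow> real"
  assumes lt: "lo \<le> tp" and cont: "continuous_on {lo..tp} V"
    and der: "\<And>s. s \<in> {lo..tp} - (ah ` K \<union> bh ` K) \<Longrightarrow>
       \<exists>D. (V has_real_derivative D) (at s within {lo..tp}) \<and>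
             \<bar>D\<bar> \<le> A * (1 + (\<Sum>i\<in>K. \<bar>ln \<bar>s - ah i\<bar>\<bar> + \<bar>ln \<bar>s - bh i\<bar>\<bar>))"
    and K: "finite K" and A: "0 < A"
  shows "\<exists>D. set_integrable lebesgue {lo..tp} D \<and>
     (\<forall>y\<in>{lo..tp}. V y = V tp - (LINT x:{lo..tp}|lebesgue. D x * (if y \<le> x then 1 else 0)))"
proof -
  let ?E = "ah ` K \<union> bh ` K" and ?g = "\<lambda>s. A * (1 + (\<Sum>i\<in>K. \<bar>ln \<bar>s - ah i\<bar>\<bar> + \<bar>ln \<bar>s - bh i\<bar>\<bar>))"
  have "\<exists>D0. \<forall>s\<in>{lo..tp} - ?E. (V has_real_derivative D0 s) (at s within {lo..tp}) \<and> \<bar>D0 s\<bar> \<le> ?g s"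
    using der by (intro bchoice) auto
  then obtain D0 where D0a: "\<forall>s\<in>{lo..tp} - ?E. (V has_real_derivative D0 s) (at s within {lo..tp}) \<and> \<bar>D0 s\<bar> \<le> ?g s" ..
  have D0: "\<And>s. s \<in> {lo..tp} - ?E \<Longrightarrow> (V has_real_derivative D0 s) (at s within {lo..tp})"
      "\<And>s. s \<in> {lo..tp} - ?E \<Longrightarrow> \<bar>D0 s\<bar> \<le> ?g s"
    using D0a by blast+
  \<comment> \<open>The value 0 at the finitely many exceptional points is arbitrary; it lets the
    domination hold everywhere.\<close>
  define D where "D s = (if s \<in> ?E then 0 else D0 s)" for s
  have ftc: "(D has_integral (V tp - V y)) {y..tp}" if y: "y \<in> {lo..tp}" for y
  proof (rule fundamental_theorem_of_calculus_interior_strong[of ?E])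
    fix x assume x: "x \<in> {y<..<tp} - ?E"
    hence "(V has_real_derivative D0 x) (at x within {lo..tp})" using y by (intro D0(1)) auto
    moreover have "at x within {lo..tp} = at x" using x y by (intro at_within_interior) auto
    ultimately show "(V has_vector_derivative D x) (at x)"
      using x by (simp add: D_def has_real_derivative_iff_has_vector_derivative)
  qed (use y K cont in \<open>auto intro: continuous_on_subset\<close>)
  have "?g integrable_on {lo..tp}"
    by (intro integrable_on_mult_right Henstock_Kurzweil_Integration.integrable_add integrable_const_ivl
        Henstock_Kurzweil_Integration.integrable_sum integrable_abs_ln_abs K lt)
  moreover have "D integrable_on {lo..tp}" using ftc[of lo] lt by auto
  moreover have "norm (D s) \<le> ?g s" if "s \<in> {lo..tp}" for s
  proof (cases "s \<in> ?E")
    case True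
    have "0 \<le> ?g s" using A by (intro mult_nonneg_nonneg add_nonneg_nonneg sum_nonneg) auto
    thus ?thesis using True by (simp add: D_def)
  next
    case False thus ?thesis using D0(2)[of s] that by (simp add: D_def)
  qed
  ultimately have D: "D absolutely_integrable_on {lo..tp}"
    by (intro absolutely_integrable_integrable_bound[where g = ?g]) auto
  show ?thesis
  proof (intro exI[of _ D] conjI ballI D)
    fix y assume y: "y \<in> {lo..tp}"
    have Dy: "D absolutely_integrable_on {y..tp}"
      using y by (intro set_integrable_subset[OF D]) auto
    have "(LINT x:{lo..tp}|lebesgue. D x * (if y \<le> x then 1 else 0)) = (LINT x:{y..tp}|lebesgue. D x)"
      unfolding set_lebesgue_integral_def by (rule Bochner_Integration.integral_cong) (use y in \<open>auto simp: indicator_def\<close>)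
    also have "\<dots> = integral {y..tp} D" by (rule set_lebesgue_integral_eq_integral(2)[OF Dy])
    also have "\<dots> = V tp - V y" using ftc[OF y] by (rule integral_unique)
    finally show "V y = V tp - (LINT x:{lo..tp}|lebesgue. D x * (if y \<le> x then 1 else 0))" by simp
  qed
qed

text \<open>By parts, the average of the potential over the particles is \<open>V tp\<close> minus
  this functional of their distribution function. Being linear in \<open>F\<close>, it does not
  affect strong convexity.\<close>

definition potential_term :: "real \<Rightarrow> real \<Rightarrow> (real \<Rightarrow> real) \<Rightarrow> (real \<Rightarrow> real) \<Rightarrow> real" where
  "potential_term lo tp D F = (LINT x:{lo..tp}|lebesgue. D x * F x)"

lemma potential_term_integrable:
  fixes D F :: "real \<Rightarrow> real"
  assumes D: "set_integrable lebesgue {lo..tp} D" and F: "F \<in> borel_measurable borel" "\<And>x. \<bar>F x\<bar> \<le> B"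
  shows "set_integrable lebesgue {lo..tp} (\<lambda>x. D x * F x)"
proof -
  have "F \<in> borel_measurable lborel" using F(1) by simp
  hence Fm: "F \<in> borel_measurable lebesgue" by (rule measurable_completion)
  have "integrable lebesgue (\<lambda>x. F x * (indicator {lo..tp} x *\<^sub>R D x))"
  proof (rule Bochner_Integration.integrable_bound)
    show "integrable lebesgue (\<lambda>x. B * (indicator {lo..tp} x *\<^sub>R D x))"
      using D unfolding set_integrable_def by simp
    have Dm: "(\<lambda>x. indicator {lo..tp} x *\<^sub>R D x) \<in> borel_measurable lebesgue"
      using D unfolding set_integrable_def by (rule borel_measurable_integrable)
    show "(\<lambda>x. F x * (indicator {lo..tp} x *\<^sub>R D x)) \<in> borel_measurable lebesgue"
      by (rule borel_measurable_times[OF Fm Dm])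
    have "0 \<le> B" using F(2)[of 0] by linarith
    thus "AE x in lebesgue. norm (F x * (indicator {lo..tp} x *\<^sub>R D x)) \<le> norm (B * (indicator {lo..tp} x *\<^sub>R D x))"
      using F(2) by (intro AE_I2) (auto simp: abs_mult intro!: mult_right_mono)
  qed
  moreover have "(\<lambda>x. F x * (indicator {lo..tp} x *\<^sub>R D x)) = (\<lambda>x. indicator {lo..tp} x *\<^sub>R (D x * F x))"
    by (auto simp: fun_eq_iff)
  ultimately show ?thesis unfolding set_integrable_def by (simp only:)
qed

lemma potential_term_midpoint:
  assumes D: "set_integrable lebesgue {lo..tp} D"
    and F: "F \<in> borel_measurable borel" "\<And>x. \<bar>F x\<bar> \<le> 1" and G: "G \<in> borel_measurable borel" "\<And>x. \<bar>G x\<bar> \<le> 1"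
  shows "potential_term lo tp D (\<lambda>x. (F x + G x) / 2) = (potential_term lo tp D F + potential_term lo tp D G) / 2"
proof -
  have "potential_term lo tp D (\<lambda>x. (F x + G x) / 2) = (LINT x:{lo..tp}|lebesgue. (D x * F x + D x * G x) / 2)"
    unfolding potential_term_def by (simp add: distrib_left)
  also have "\<dots> = (LINT x:{lo..tp}|lebesgue. D x * F x + D x * G x) / 2" by simp
  also have "(LINT x:{lo..tp}|lebesgue. D x * F x + D x * G x) = potential_term lo tp D F + potential_term lo tp D G"
    unfolding potential_term_def
    by (rule set_integral_add(2)[OF potential_term_integrable[OF D F] potential_term_integrable[OF D G]])
  finally show ?thesis .
qed

lemma potential_term_close:
  assumes D: "set_integrable lebesgue {lo..tp} D"
    and F: "F \<in> borel_measurable borel" "\<And>x. \<bar>F x\<bar> \<le> 1" and G: "G \<in> borel_measurable borel" "\<And>x. \<bar>G x\<bar> \<le> 1"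
    and FG: "\<And>x. \<bar>F x - G x\<bar> \<le> \<eta>"
  shows "\<bar>potential_term lo tp D F - potential_term lo tp D G\<bar> \<le> \<eta> * (LINT x:{lo..tp}|lebesgue. \<bar>D x\<bar>)"
proof -
  note i = potential_term_integrable[OF D F] potential_term_integrable[OF D G]
  have "potential_term lo tp D F - potential_term lo tp D G = (LINT x:{lo..tp}|lebesgue. D x * F x - D x * G x)"
    unfolding potential_term_def by (rule set_integral_diff(2)[OF i, symmetric])
  also have "\<bar>\<dots>\<bar> \<le> (LINT x:{lo..tp}|lebesgue. \<bar>D x * F x - D x * G x\<bar>)"
    unfolding set_lebesgue_integral_def by (rule order_trans[OF integral_abs_bound]) (simp add: abs_mult)
  also have "\<dots> \<le> (LINT x:{lo..tp}|lebesgue. \<eta> * \<bar>D x\<bar>)"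
  proof (rule set_integral_mono)
    show "set_integrable lebesgue {lo..tp} (\<lambda>x. \<bar>D x * F x - D x * G x\<bar>)"
      by (rule set_integrable_abs[OF set_integral_diff(1)[OF i]])
    show "set_integrable lebesgue {lo..tp} (\<lambda>x. \<eta> * \<bar>D x\<bar>)"
      using set_integrable_abs[OF D] by simp
    fix x
    have "\<bar>D x * F x - D x * G x\<bar> = \<bar>F x - G x\<bar> * \<bar>D x\<bar>"
      by (simp add: abs_mult[symmetric] right_diff_distrib mult.commute)
    thus "\<bar>D x * F x - D x * G x\<bar> \<le> \<eta> * \<bar>D x\<bar>"
      using FG[of x] by (auto intro: mult_right_mono)
  qed
  finally show ?thesis by simp
qed

section \<open>Distribution functions with prescribed values\<close>

text \<open>The slope bound \<open>1 / \<theta>\<close> is the packing constraint: a particle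
  carries mass 1 / N and keeps a distance of at least \<theta> / N in the rescaled lattice
  coordinate.\<close>

definition mono_lip :: "real \<Rightarrow> (real \<Rightarrow> real) \<Rightarrow> bool" where
  "mono_lip \<theta> G \<longleftrightarrow> (\<forall>s t. s \<le> t \<longrightarrow> G s \<le> G t \<and> G t - G s \<le> (t - s) / \<theta>)"

lemma mono_lipD:
  assumes "mono_lip \<theta> G" "s \<le> t"
  shows "G s \<le> G t" "G t - G s \<le> (t - s) / \<theta>"
  using assms by (auto simp: mono_lip_def)

lemma mono_lip_const: "0 < \<theta> \<Longrightarrow> mono_lip \<theta> (\<lambda>s. c)"
  by (auto simp: mono_lip_def)

lemma mono_lip_max: "mono_lip \<theta> F \<Longrightarrow> mono_lip \<theta> G \<Longrightarrow> mono_lip \<theta> (\<lambda>s. max (F s) (G s))"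
  unfolding mono_lip_def by (smt (verit))

lemma mono_lip_min: "mono_lip \<theta> F \<Longrightarrow> mono_lip \<theta> G \<Longrightarrow> mono_lip \<theta> (\<lambda>s. min (F s) (G s))"
  unfolding mono_lip_def by (smt (verit))

lemma mono_lip_Max:
  assumes "finite A" "A \<noteq> {}" "\<And>a. a \<in> A \<Longrightarrow> mono_lip \<theta> (f a)"
  shows "mono_lip \<theta> (\<lambda>s. Max ((\<lambda>a. f a s) ` A))"
  using assms
proof (induction A rule: finite_ne_induct)
  case (insert x A)
  thus ?case using mono_lip_max[of \<theta> "f x" "\<lambda>s. Max ((\<lambda>a. f a s) ` A)"] by simp
qed simp

lemma mono_lip_Min:
  assumes "finite A" "A \<noteq> {}" "\<And>a. a \<in> A \<Longrightarrow> mono_lip \<theta> (f a)"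
  shows "mono_lip \<theta> (\<lambda>s. Min ((\<lambda>a. f a s) ` A))"
  using assms
proof (induction A rule: finite_ne_induct)
  case (insert x A)
  thus ?case using mono_lip_min[of \<theta> "f x" "\<lambda>s. Min ((\<lambda>a. f a s) ` A)"] by simp
qed simp

lemma mono_lip_ramp_up:
  assumes "0 < \<theta>" shows "mono_lip \<theta> (\<lambda>s. v + max 0 (s - p) / \<theta>)"
proof -
  have "(v + max 0 (s - p) / \<theta> \<le> v + max 0 (t - p) / \<theta>) \<and>
     (v + max 0 (t - p) / \<theta>) - (v + max 0 (s - p) / \<theta>) \<le> (t - s) / \<theta>" if "s \<le> t" for s t
    using assms that by (simp add: diff_divide_distrib[symmetric] divide_right_mono)
  thus ?thesis by (auto simp: mono_lip_def)
qed

lemma mono_lip_ramp_down: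
  assumes "0 < \<theta>" shows "mono_lip \<theta> (\<lambda>s. v - max 0 (p - s) / \<theta>)"
proof -
  have "(v - max 0 (p - s) / \<theta> \<le> v - max 0 (p - t) / \<theta>) \<and>
     (v - max 0 (p - t) / \<theta>) - (v - max 0 (p - s) / \<theta>) \<le> (t - s) / \<theta>" if "s \<le> t" for s t
    using assms that by (simp add: diff_divide_distrib[symmetric] divide_right_mono)
  thus ?thesis by (auto simp: mono_lip_def)
qed

definition cdf_class :: "real \<Rightarrow> (real \<times> real) set \<Rightarrow> (real \<Rightarrow> real) set" where
  "cdf_class \<theta> Dt = {G. mono_lip \<theta> G \<and> (\<forall>s. 0 \<le> G s \<and> G s \<le> 1) \<and> (\<forall>(p, v)\<in>Dt. G p = v)}"

text \<open>The condition is necessary for a \<open>mono_lip\<close> function through the data: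
  levels may not drop from left to right nor rise faster than \<open>1 / \<theta>\<close>. When
  \<open>p' \<le> p\<close> it says \<open>v' \<le> v\<close>, so two data at one point must agree.
  It also makes the lower and the upper envelope meet at each datum.\<close>

definition compatible :: "real \<Rightarrow> (real \<times> real) set \<Rightarrow> bool" where
  "compatible \<theta> Dt \<longleftrightarrow> (\<forall>(p, v)\<in>Dt. 0 \<le> v \<and> v \<le> 1) \<and> (\<forall>(p, v)\<in>Dt. \<forall>(p', v')\<in>Dt. v' - v \<le> max 0 (p' - p) / \<theta>)"

text \<open>The interpolant is the smallest extension of the points \<open>(s\<^sub>j, j / N)\<close>, truncated
  between the lower and upper envelopes of the data.\<close>

lemma cdf_class_interpolate:
  fixes s :: "nat \<Rightarrow> real"
  assumes \<theta>: "0 < \<theta>" and Dt: "finite Dt" "Dt \<noteq> {}" "compatible \<theta> Dt" and N: "1 \<le> N"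
    and gap: "\<And>i j. 1 \<le> i \<Longrightarrow> i \<le> j \<Longrightarrow> j \<le> N \<Longrightarrow> (real j - real i) * \<theta> / real N \<le> s j - s i"
    and up: "\<And>j p v. j \<in> {1..N} \<Longrightarrow> (p, v) \<in> Dt \<Longrightarrow> real j / real N \<le> v + max 0 (s j - p) / \<theta> + \<eta>"
    and lo: "\<And>j p v. j \<in> {1..N} \<Longrightarrow> (p, v) \<in> Dt \<Longrightarrow> v - max 0 (p - s j) / \<theta> - \<eta> \<le> real j / real N"
    and \<eta>: "0 \<le> \<eta>"
  shows "\<exists>G\<in>cdf_class \<theta> Dt. \<forall>j\<in>{1..N}. \<bar>G (s j) - real j / real N\<bar> \<le> \<eta>"
proof -
  define lof where "lof d t = snd d - max 0 (fst d - t) / \<theta>" for d :: "real \<times> real" and t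
  define upf where "upf d t = snd d + max 0 (t - fst d) / \<theta>" for d :: "real \<times> real" and t
  define gf where "gf j t = real j / real N - max 0 (s j - t) / \<theta>" for j t
  define Lo where "Lo t = Max ((\<lambda>d. lof d t) ` Dt)" for t
  define Up where "Up t = Min ((\<lambda>d. upf d t) ` Dt)" for t
  define G1 where "G1 t = Max ((\<lambda>j. gf j t) ` {1..N})" for t
  define G where "G t = max 0 (min 1 (max (Lo t) (min (Up t) (G1 t))))" for t
  have ml: "mono_lip \<theta> G"
    unfolding G_def[abs_def] Lo_def Up_def G1_def lof_def upf_def gf_def using \<theta> Dt N
    by (intro mono_lip_max mono_lip_min mono_lip_const mono_lip_Max mono_lip_Min mono_lip_ramp_up mono_lip_ramp_down) auto
  have LoUp: "Lo p = v \<and> Up p = v" if pv: "(p, v) \<in> Dt" for p v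
  proof
    have c: "v' - v \<le> max 0 (p' - p) / \<theta>" "v - v' \<le> max 0 (p - p') / \<theta>" if "(p', v') \<in> Dt" for p' v'
      using Dt(3) that pv unfolding compatible_def by blast+
    show "Lo p = v" unfolding Lo_def
    proof (rule Max_eqI)
      fix y assume "y \<in> (\<lambda>d. lof d p) ` Dt"
      then obtain p' v' where "(p', v') \<in> Dt" "y = lof (p', v') p" by auto
      thus "y \<le> v" using c(1) by (force simp: lof_def)
    next
      show "v \<in> (\<lambda>d. lof d p) ` Dt" using pv by (intro image_eqI[of _ _ "(p, v)"]) (auto simp: lof_def)
    qed (use Dt in auto)
    show "Up p = v" unfolding Up_def
    proof (rule Min_eqI)
      fix y assume "y \<in> (\<lambda>d. upf d p) ` Dt"
      then obtain p' v' where "(p', v') \<in> Dt" "y = upf (p', v') p" by auto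
      thus "v \<le> y" using c(2) by (force simp: upf_def)
    next
      show "v \<in> (\<lambda>d. upf d p) ` Dt" using pv by (intro image_eqI[of _ _ "(p, v)"]) (auto simp: upf_def)
    qed (use Dt in auto)
  qed
  have Gp: "G p = v" if pv: "(p, v) \<in> Dt" for p v
  proof -
    have "0 \<le> v" "v \<le> 1" using Dt(3) pv unfolding compatible_def by auto
    thus ?thesis using LoUp[OF pv] by (simp add: G_def)
  qed
  have Gs: "\<bar>G (s j) - real j / real N\<bar> \<le> \<eta>" if j: "j \<in> {1..N}" for j
  proof -
    have G1: "G1 (s j) = real j / real N" unfolding G1_def
    proof (rule Max_eqI)
      fix y assume "y \<in> (\<lambda>i. gf i (s j)) ` {1..N}"
      then obtain i where i: "i \<in> {1..N}" "y = gf i (s j)" by auto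
      show "y \<le> real j / real N"
      proof (cases "i \<le> j")
        case True
        have "real i / real N \<le> real j / real N" using True by (intro divide_right_mono) auto
        moreover have "0 \<le> max 0 (s i - s j) / \<theta>" using \<theta> by simp
        ultimately show ?thesis unfolding i(2) gf_def by linarith
      next
        case False
        hence "(real i - real j) * \<theta> / real N \<le> s i - s j" using i j by (intro gap) auto
        hence "(real i - real j) / real N * \<theta> \<le> max 0 (s i - s j)" by simp
        hence "(real i - real j) / real N \<le> max 0 (s i - s j) / \<theta>" using \<theta> by (simp add: le_divide_eq)
        thus ?thesis unfolding i(2) gf_def by (simp add: diff_divide_distrib)
      qed
    next
      show "real j / real N \<in> (\<lambda>i. gf i (s j)) ` {1..N}" using j by (intro image_eqI[of _ _ j]) (auto simp: gf_def)
    qed simp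
    \<comment> \<open>At \<open>s j\<close> the interpolant is exact and each envelope misses
      \<open>j / N\<close> by at most \<eta> on the wrong side, so truncation moves the value by at
      most \<eta>.\<close>
    have L: "Lo (s j) \<le> real j / real N + \<eta>"
    proof -
      have "lof d (s j) \<le> real j / real N + \<eta>" if "d \<in> Dt" for d
        using lo[OF j, of "fst d" "snd d"] that by (simp add: lof_def)
      thus ?thesis unfolding Lo_def using Dt by (subst Max_le_iff) auto
    qed
    have U: "real j / real N - \<eta> \<le> Up (s j)"
    proof -
      have "real j / real N - \<eta> \<le> upf d (s j)" if "d \<in> Dt" for d
        using up[OF j, of "fst d" "snd d"] that by (simp add: upf_def)
      thus ?thesis unfolding Up_def using Dt by (subst Min_ge_iff) auto
    qed
    have "0 \<le> real j / real N" "real j / real N \<le> 1" using j by auto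
    thus ?thesis using L U \<eta> unfolding G_def G1 by linarith
  qed
  have "G \<in> cdf_class \<theta> Dt" unfolding cdf_class_def using ml Gp by (auto simp: G_def)
  thus ?thesis using Gs by blast
qed

text \<open>Outside \<open>{pa..pb}\<close> the function is continued with slope
  \<open>1 / \<theta>\<close>, so every level is attained. This matters for levels
  \<open>j / N\<close> that, by an error in the block fractions, lie outside the range of
  \<open>G\<close> on their block.\<close>

lemma extended_quantile:
  assumes \<theta>: "0 < \<theta>" and G: "mono_lip \<theta> G" and p: "pa \<le> pb"
  shows "\<exists>t. G (max pa (min pb t)) + (t - max pa (min pb t)) / \<theta> = y"
proof -
  let ?c = "\<lambda>t. max pa (min pb t)"
  let ?E = "\<lambda>t. G (?c t) + (t - ?c t) / \<theta>"
  have lip: "(1 / \<theta>)-lipschitz_on UNIV G"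
  proof (rule lipschitz_onI)
    fix x y
    have "\<bar>G x - G y\<bar> \<le> \<bar>x - y\<bar> / \<theta>"
    proof (cases "x \<le> y")
      case True thus ?thesis using mono_lipD[OF G True] by (auto simp: abs_if)
    next
      case False
      hence "y \<le> x" by simp
      thus ?thesis using mono_lipD[OF G \<open>y \<le> x\<close>] by (auto simp: abs_if)
    qed
    thus "dist (G x) (G y) \<le> 1 / \<theta> * dist x y" by (simp add: dist_real_def)
  qed (use \<theta> in auto)
  have cE: "continuous_on UNIV ?E"
    by (intro continuous_intros continuous_on_compose2[OF lipschitz_on_continuous_on[OF lip]]) (use \<theta> in auto)
  \<comment> \<open>These ends bracket the level: on the affine continuations, a level difference
    \<open>y - G pa\<close> or \<open>y - G pb\<close> is made up by a displacement \<theta> times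
    as large.\<close>
  define lo where "lo = min pa (pa + \<theta> * (y - G pa))"
  define hi where "hi = max pb (pb + \<theta> * (y - G pb))"
  have "?E lo \<le> y"
  proof -
    have "?c lo = pa" using p by (auto simp: lo_def)
    moreover have "(lo - pa) / \<theta> \<le> (\<theta> * (y - G pa)) / \<theta>" using \<theta> by (intro divide_right_mono) (auto simp: lo_def)
    ultimately show ?thesis using \<theta> by simp
  qed
  moreover have "y \<le> ?E hi"
  proof -
    have "?c hi = pb" using p by (auto simp: hi_def)
    moreover have "(\<theta> * (y - G pb)) / \<theta> \<le> (hi - pb) / \<theta>" using \<theta> by (intro divide_right_mono) (auto simp: hi_def)
    ultimately show ?thesis using \<theta> by simp
  qed
  moreover have "lo \<le> hi" using p by (auto simp: lo_def hi_def)
  ultimately have "\<exists>t. lo \<le> t \<and> t \<le> hi \<and> ?E t = y"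
    by (intro IVT') (auto intro: continuous_on_subset[OF cE])
  thus ?thesis by blast
qed

section \<open>Particle blocks\<close>

definition blk :: "(nat \<Rightarrow> nat) \<Rightarrow> nat \<Rightarrow> nat" where
  "blk n j = (LEAST i. j \<le> block_end n i)"

lemma block_end_0 [simp]: "block_end n 0 = 0"
  by (simp add: block_end_def)

lemma block_end_mono: "i \<le> i' \<Longrightarrow> block_end n i \<le> block_end n i'"
  unfolding block_end_def by (intro sum_mono2) auto

lemma blk_props:
  assumes "1 \<le> j" "j \<le> block_end n k"
  shows "1 \<le> blk n j" "blk n j \<le> k" "block_end n (blk n j - 1) < j" "j \<le> block_end n (blk n j)"
proof -
  show le: "j \<le> block_end n (blk n j)" unfolding blk_def by (rule LeastI[of _ k]) (rule assms)
  show "blk n j \<le> k" unfolding blk_def by (rule Least_le) (rule assms)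
  show 1: "1 \<le> blk n j" using le assms(1) by (cases "blk n j") auto
  have "\<not> j \<le> block_end n (blk n j - 1)"
    unfolding blk_def by (rule not_less_Least) (use 1 in \<open>simp add: blk_def\<close>)
  thus "block_end n (blk n j - 1) < j" by simp
qed

lemma blk_le: "j \<le> block_end n i \<Longrightarrow> blk n j \<le> i"
  unfolding blk_def by (rule Least_le)

lemma blk_gt: "1 \<le> j \<Longrightarrow> j \<le> block_end n k \<Longrightarrow> block_end n i < j \<Longrightarrow> i < blk n j"
  using blk_props(4)[of j n k] block_end_mono[of "blk n j" i n] by (meson le_less_linear order.strict_trans1 order_less_irrefl)

lemma blk_mono:
  assumes "1 \<le> j" "j \<le> j'" "j' \<le> block_end n k" shows "blk n j \<le> blk n j'"
  using assms blk_props(4)[of j' n k] by (intro blk_le) auto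

lemma blk_eqI:
  assumes "1 \<le> i" "block_end n (i - 1) < j" "j \<le> block_end n i" shows "blk n j = i"
  using blk_le[OF assms(3)] blk_gt[of j n i "i - 1"] assms by linarith

definition config_ok :: "nat \<Rightarrow> nat \<Rightarrow> (nat \<Rightarrow> nat) \<Rightarrow> (nat \<Rightarrow> int) \<Rightarrow> (nat \<Rightarrow> int) \<Rightarrow> (nat \<Rightarrow> int) \<Rightarrow> bool" where
  "config_ok k N n a b x \<longleftrightarrow> (\<forall>i\<in>{1..N}. \<forall>j\<in>{1..N}. i \<le> j \<longrightarrow> x i \<le> x j) \<and>
     (\<forall>j\<in>{1..k}. \<forall>i\<in>{block_end n (j - 1) + 1..block_end n j}. a j \<le> x i \<and> x i \<le> b j - 1)"

text \<open>The points \<open>pa i\<close>, \<open>pb i\<close> and levels \<open>c i\<close> are the limits of the rescaled block ends and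
  of the rescaled particle numbers.\<close>

locale block_system =
  fixes k N :: nat and \<theta> :: real and n :: "nat \<Rightarrow> nat" and a b :: "nat \<Rightarrow> int"
    and pa pb c :: "nat \<Rightarrow> real" and \<eta> :: real
  assumes \<theta>: "0 < \<theta>" and N: "1 \<le> N" and total: "block_end n k = N"
    and ab: "\<And>i. i \<in> {1..k} \<Longrightarrow> a i \<le> b i - 1"
    and ba: "\<And>i. i \<in> {1..<k} \<Longrightarrow> b i \<le> a (i + 1)"
    and pa: "\<And>i. i \<in> {1..k} \<Longrightarrow> \<bar>pa i - (of_int (a i) + real (block_end n (i - 1)) * \<theta>) / real N\<bar> \<le> \<eta>"
    and pb: "\<And>i. i \<in> {1..k} \<Longrightarrow> \<bar>pb i - (of_int (b i) + (real (block_end n i) - 1) * \<theta>) / real N\<bar> \<le> \<eta>"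
    and c: "\<And>i. i \<le> k \<Longrightarrow> \<bar>real (block_end n i) / real N - c i\<bar> \<le> \<eta>"
begin

text \<open>No particle sits between two blocks, so the level \<open>c i\<close> is attained both at
  the right end of block \<open>i\<close> and at the left end of the next one.\<close>

definition data :: "(real \<times> real) set" where
  "data = (\<lambda>i. (pa i, c (i - 1))) ` {1..k} \<union> (\<lambda>i. (pb i, c i)) ` {1..k}"

lemma \<eta>: "0 \<le> \<eta>" using c[of 0] by simp

lemma a_mono: "1 \<le> i \<Longrightarrow> i \<le> j \<Longrightarrow> j \<le> k \<Longrightarrow> a i \<le> a j"
proof (induction j)
  case (Suc j)
  show ?case
  proof (cases "i = Suc j")
    case False
    hence "a i \<le> a j" using Suc by auto
    thus ?thesis using False Suc ab[of j] ba[of j] by auto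
  qed simp
qed simp

lemma b_le_a: "1 \<le> i \<Longrightarrow> i < j \<Longrightarrow> j \<le> k \<Longrightarrow> b i \<le> a j"
  using ba[of i] a_mono[of "i + 1" j] by auto

lemma b_mono: "1 \<le> i \<Longrightarrow> i \<le> j \<Longrightarrow> j \<le> k \<Longrightarrow> b i \<le> b j"
  using b_le_a[of i j] ab[of j] by (cases "i = j") auto

lemma config_block:
  assumes "config_ok k N n a b x" "j \<in> {1..N}"
  shows "a (blk n j) \<le> x j" "x j \<le> b (blk n j) - 1"
proof -
  note p = blk_props[of j n k]
  have "blk n j \<in> {1..k}" "j \<in> {block_end n (blk n j - 1) + 1..block_end n (blk n j)}"
    using p assms(2) total by auto
  thus "a (blk n j) \<le> x j" "x j \<le> b (blk n j) - 1" using assms(1) unfolding config_ok_def by blast+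
qed

text \<open>Order between different blocks is automatic, since \<open>b i \<le> a j\<close> for
  blocks \<open>i < j\<close>.\<close>

lemma config_okI:
  assumes "\<And>i j. 1 \<le> i \<Longrightarrow> i \<le> j \<Longrightarrow> j \<le> N \<Longrightarrow> blk n i = blk n j \<Longrightarrow> x i \<le> x j"
    and "\<And>j. j \<in> {1..N} \<Longrightarrow> a (blk n j) \<le> x j \<and> x j \<le> b (blk n j) - 1"
  shows "config_ok k N n a b x"
  unfolding config_ok_def
proof (intro conjI ballI impI)
  fix i j assume ij: "i \<in> {1..N}" "j \<in> {1..N}" "i \<le> j"
  show "x i \<le> x j"
  proof (cases "blk n i = blk n j")
    case True thus ?thesis using assms(1) ij by auto
  next
    case False
    hence "blk n i < blk n j" using blk_mono[of i j n k] ij total by auto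
    moreover have "1 \<le> blk n i" "blk n j \<le> k" using blk_props[of i n k] blk_props[of j n k] ij total by auto
    ultimately have "b (blk n i) \<le> a (blk n j)" by (intro b_le_a)
    thus ?thesis using assms(2)[OF ij(1)] assms(2)[OF ij(2)] by linarith
  qed
next
  fix i j assume ij: "i \<in> {1..k}" "j \<in> {block_end n (i - 1) + 1..block_end n i}"
  hence "blk n j = i" by (intro blk_eqI) auto
  moreover have "j \<in> {1..N}" using ij block_end_mono[of i k n] total by auto
  ultimately show "a i \<le> x j" "x j \<le> b i - 1" using assms(2) by auto
qed

text \<open>Left and right ends are put into one form: a datum is, up to rounding, a barrier
  \<open>e\<close> of rank \<open>r\<close>, which in every configuration has the first
  \<open>r\<close> particles at or below it and the others at or above it.\<close>

lemma data_near:
  assumes "(p, v) \<in> data"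
  shows "\<exists>e r. r \<le> N \<and> \<bar>p - (of_int e + real r * \<theta>) / real N\<bar> \<le> \<eta> + \<theta> / real N \<and> \<bar>v - real r / real N\<bar> \<le> \<eta> \<and>
     (\<forall>x. config_ok k N n a b x \<longrightarrow> (\<forall>j\<in>{1..N}. (j \<le> r \<longrightarrow> x j \<le> e) \<and> (r < j \<longrightarrow> e \<le> x j)))"
proof -
  have pos: "0 \<le> \<theta> / real N" using \<theta> by simp
  consider i where "i \<in> {1..k}" "p = pa i" "v = c (i - 1)" | i where "i \<in> {1..k}" "p = pb i" "v = c i"
    using assms unfolding data_def by auto
  thus ?thesis
  proof cases
    case (1 i)
    show ?thesis
    proof (intro exI[of _ "a i"] exI[of _ "block_end n (i - 1)"] conjI allI impI ballI)
      show "block_end n (i - 1) \<le> N" using block_end_mono[of "i - 1" k n] total 1 by auto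
      show "\<bar>p - (of_int (a i) + real (block_end n (i - 1)) * \<theta>) / real N\<bar> \<le> \<eta> + \<theta> / real N"
        using pa[OF 1(1)] 1(2) pos by linarith
      show "\<bar>v - real (block_end n (i - 1)) / real N\<bar> \<le> \<eta>"
        using c[of "i - 1"] 1 by (auto simp: abs_minus_commute)
      fix x j assume x: "config_ok k N n a b x" "j \<in> {1..N}"
      have bj: "1 \<le> blk n j" "blk n j \<le> k" using blk_props[of j n k] x total by auto
      { assume "j \<le> block_end n (i - 1)"
        hence "blk n j \<le> i - 1" by (rule blk_le)
        hence "b (blk n j) \<le> a i" using bj 1 by (intro b_le_a) auto
        thus "x j \<le> a i" using config_block[OF x] by linarith }
      { assume "block_end n (i - 1) < j"
        hence "i - 1 < blk n j" using x total by (intro blk_gt[of j n k]) auto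
        hence "a i \<le> a (blk n j)" using bj 1 by (intro a_mono) auto
        thus "a i \<le> x j" using config_block[OF x] by linarith }
    qed
  next
    case (2 i)
    show ?thesis
    proof (intro exI[of _ "b i"] exI[of _ "block_end n i"] conjI allI impI ballI)
      show "block_end n i \<le> N" using block_end_mono[of i k n] total 2 by auto
      \<comment> \<open>The right end of a block is defined with shift
        \<open>(block_end n i - 1) * \<theta>\<close>, one particle short of the rank; this is the
        \<theta> / N in the error.\<close>
      have "(of_int (b i) + real (block_end n i) * \<theta>) / real N
          = (of_int (b i) + (real (block_end n i) - 1) * \<theta>) / real N + \<theta> / real N"
        by (simp add: add_divide_distrib[symmetric] algebra_simps)
      thus "\<bar>p - (of_int (b i) + real (block_end n i) * \<theta>) / real N\<bar> \<le> \<eta> + \<theta> / real N"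
        using pb[OF 2(1)] 2(2) pos by linarith
      show "\<bar>v - real (block_end n i) / real N\<bar> \<le> \<eta>"
        using c[of i] 2 by (auto simp: abs_minus_commute)
      fix x j assume x: "config_ok k N n a b x" "j \<in> {1..N}"
      have bj: "1 \<le> blk n j" "blk n j \<le> k" using blk_props[of j n k] x total by auto
      { assume "j \<le> block_end n i"
        hence "blk n j \<le> i" by (rule blk_le)
        hence "b (blk n j) \<le> b i" using bj 2 by (intro b_mono) auto
        thus "x j \<le> b i" using config_block[OF x] by linarith }
      { assume "block_end n i < j"
        hence "i < blk n j" using x total by (intro blk_gt[of j n k]) auto
        hence "b i \<le> a (blk n j)" using bj 2 by (intro b_le_a) auto
        thus "b i \<le> x j" using config_block[OF x] by linarith }
    qed
  qed
qed

lemma base_config: "config_ok k N n a b (\<lambda>j. a (blk n j))"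
proof (rule config_okI)
  fix j assume "j \<in> {1..N}"
  hence "blk n j \<in> {1..k}" using blk_props[of j n k] total by auto
  thus "a (blk n j) \<le> a (blk n j) \<and> a (blk n j) \<le> b (blk n j) - 1" using ab by auto
qed auto

text \<open>If \<open>r < r'\<close>, particle \<open>r'\<close> of any configuration lies between
  the two barriers, so \<open>e \<le> e'\<close>, and the positions then differ by at least
  \<open>(r' - r) * \<theta> / N\<close> up to rounding. Existence of one configuration therefore
  implies the slope condition.\<close>

lemma data_compatible_approx:
  assumes d: "(p, v) \<in> data" "(p', v') \<in> data"
  shows "v' - v \<le> max 0 (p' - p) / \<theta> + 2 * (\<eta> + (\<eta> + \<theta> / real N) / \<theta>)"
proof -
  obtain e r where 1: "r \<le> N" "\<bar>p - (of_int e + real r * \<theta>) / real N\<bar> \<le> \<eta> + \<theta> / real N" "\<bar>v - real r / real N\<bar> \<le> \<eta>"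
     "\<And>x j. config_ok k N n a b x \<Longrightarrow> j \<in> {1..N} \<Longrightarrow> (j \<le> r \<longrightarrow> x j \<le> e) \<and> (r < j \<longrightarrow> e \<le> x j)"
    using data_near[OF d(1)] by metis
  obtain e' r' where 2: "r' \<le> N" "\<bar>p' - (of_int e' + real r' * \<theta>) / real N\<bar> \<le> \<eta> + \<theta> / real N" "\<bar>v' - real r' / real N\<bar> \<le> \<eta>"
     "\<And>x j. config_ok k N n a b x \<Longrightarrow> j \<in> {1..N} \<Longrightarrow> (j \<le> r' \<longrightarrow> x j \<le> e') \<and> (r' < j \<longrightarrow> e' \<le> x j)"
    using data_near[OF d(2)] by metis
  define h where "h = \<eta> + \<theta> / real N"
  have h: "0 \<le> h / \<theta>" using \<eta> \<theta> by (simp add: h_def)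
  have m: "0 \<le> max 0 (p' - p) / \<theta>" using \<theta> by simp
  show ?thesis
  proof (cases "r < r'")
    case False
    hence "real r' / real N \<le> real r / real N" by (intro divide_right_mono) auto
    thus ?thesis using 1(3) 2(3) h m unfolding h_def[symmetric] by argo
  next
    case True
    have "e \<le> e'"
      using 1(4)[OF base_config, of r'] 2(4)[OF base_config, of r'] True 2(1) by force
    hence "(of_int e' + real r' * \<theta>) / real N - (of_int e + real r * \<theta>) / real N \<ge> (real r' - real r) * \<theta> / real N"
      unfolding diff_divide_distrib[symmetric] by (intro divide_right_mono) (auto simp: algebra_simps)
    hence "(real r' - real r) / real N * \<theta> \<le> max 0 (p' - p) + 2 * h"
      using 1(2) 2(2) unfolding h_def[symmetric] by (simp add: algebra_simps)
    hence "(real r' - real r) / real N \<le> (max 0 (p' - p) + 2 * h) / \<theta>" using \<theta> by (simp add: le_divide_eq)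
    also have "\<dots> = max 0 (p' - p) / \<theta> + 2 * (h / \<theta>)" by (simp add: add_divide_distrib)
    finally show ?thesis using 1(3) 2(3) unfolding h_def[symmetric] diff_divide_distrib by argo
  qed
qed

text \<open>The points \<open>(s j, j / N)\<close> of a configuration satisfy the slope bound
  exactly, but the prescribed values only up to rounding. The barriers quantify this defect and the
  truncated interpolant absorbs it.\<close>

lemma config_to_class:
  assumes x: "config_ok k N n a b x" and comp: "compatible \<theta> data" and k: "1 \<le> k"
  shows "\<exists>G\<in>cdf_class \<theta> data. \<forall>j\<in>{1..N}.
     \<bar>G ((of_int (x j) + (real j - 1) * \<theta>) / real N) - real j / real N\<bar> \<le> \<eta> + (\<eta> + \<theta> / real N) / \<theta> + 1 / real N"
proof (rule cdf_class_interpolate[OF \<theta> _ _ comp N])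
  define h where "h = \<eta> + \<theta> / real N"
  have h: "0 \<le> h / \<theta>" "0 \<le> 1 / real N" using \<eta> \<theta> by (auto simp: h_def)
  let ?s = "\<lambda>j. (of_int (x j) + (real j - 1) * \<theta>) / real N"
  show "finite data" "data \<noteq> {}" unfolding data_def using k by auto
  show "0 \<le> \<eta> + (\<eta> + \<theta> / real N) / \<theta> + 1 / real N" using h \<eta> unfolding h_def by linarith
  fix i j :: nat assume ij: "1 \<le> i" "i \<le> j" "j \<le> N"
  have "x i \<le> x j" using x ij unfolding config_ok_def by auto
  thus "(real j - real i) * \<theta> / real N \<le> ?s j - ?s i"
    unfolding diff_divide_distrib[symmetric] by (intro divide_right_mono) (auto simp: algebra_simps)
next
  define h where "h = \<eta> + \<theta> / real N"
  have h: "0 \<le> h / \<theta>" "0 \<le> 1 / real N" using \<eta> \<theta> by (auto simp: h_def)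
  let ?s = "\<lambda>j. (of_int (x j) + (real j - 1) * \<theta>) / real N"
  fix j p v assume j: "j \<in> {1..N}" and d: "(p, v) \<in> data"
  obtain e r where 1: "r \<le> N" "\<bar>p - (of_int e + real r * \<theta>) / real N\<bar> \<le> h" "\<bar>v - real r / real N\<bar> \<le> \<eta>"
     "(j \<le> r \<longrightarrow> x j \<le> e) \<and> (r < j \<longrightarrow> e \<le> x j)"
    using data_near[OF d] x j unfolding h_def by metis
  have m: "0 \<le> max 0 (p - ?s j) / \<theta>" "0 \<le> max 0 (?s j - p) / \<theta>" using \<theta> by auto
  have "real j / real N \<le> v + max 0 (?s j - p) / \<theta> + (\<eta> + h / \<theta> + 1 / real N) \<and>
        v - max 0 (p - ?s j) / \<theta> - (\<eta> + h / \<theta> + 1 / real N) \<le> real j / real N"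
  proof (cases "j \<le> r")
    case True
    have jr: "real j / real N \<le> real r / real N" using True by (intro divide_right_mono) auto
    have "x j \<le> e" using 1(4) True by simp
    hence "(real r - real j) * \<theta> / real N \<le> (of_int e + real r * \<theta>) / real N - ?s j"
      unfolding diff_divide_distrib[symmetric] using \<theta> by (intro divide_right_mono) (auto simp: algebra_simps)
    hence "(real r - real j) / real N * \<theta> \<le> max 0 (p - ?s j) + h" using 1(2) by (simp only: times_divide_eq_left) argo
    hence "(real r - real j) / real N \<le> (max 0 (p - ?s j) + h) / \<theta>" using \<theta> by (simp add: le_divide_eq)
    hence "real r / real N - real j / real N \<le> max 0 (p - ?s j) / \<theta> + h / \<theta>"
      by (simp only: add_divide_distrib diff_divide_distrib)
    thus ?thesis using jr 1(3) m h \<eta> by argo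
  next
    case False
    have jr: "real r / real N \<le> real j / real N" using False by (intro divide_right_mono) auto
    have "e \<le> x j" using 1(4) False by simp
    \<comment> \<open>Particle \<open>j\<close> is shifted by \<open>(j - 1) * \<theta>\<close>, but
      the barrier of rank \<open>r\<close> by \<open>r * \<theta>\<close>; the missing unit is the
      term 1 / N of the error.\<close>
    hence "(real j - 1 - real r) * \<theta> / real N \<le> ?s j - (of_int e + real r * \<theta>) / real N"
      unfolding diff_divide_distrib[symmetric] by (intro divide_right_mono) (auto simp: algebra_simps)
    hence "(real j - 1 - real r) / real N * \<theta> \<le> max 0 (?s j - p) + h" using 1(2) by (simp only: times_divide_eq_left) argo
    hence "(real j - 1 - real r) / real N \<le> (max 0 (?s j - p) + h) / \<theta>" using \<theta> by (simp add: le_divide_eq)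
    hence "real j / real N - 1 / real N - real r / real N \<le> max 0 (?s j - p) / \<theta> + h / \<theta>"
      by (simp only: add_divide_distrib diff_divide_distrib)
    thus ?thesis using jr 1(3) m h \<eta> by argo
  qed
  thus "real j / real N \<le> v + max 0 (?s j - p) / \<theta> + (\<eta> + (\<eta> + \<theta> / real N) / \<theta> + 1 / real N)"
    "v - max 0 (p - ?s j) / \<theta> - (\<eta> + (\<eta> + \<theta> / real N) / \<theta> + 1 / real N) \<le> real j / real N"
    unfolding h_def by auto
qed

text \<open>Particle \<open>j\<close> is put at the quantile of level \<open>j / N\<close>, computed
  with the continuation of \<open>G\<close> beyond its own block, then rounded down and clamped to
  the range allowed by the block. The prescribed levels at the block ends ensure that clamping moves
  it by a small distance only.\<close>

lemma class_to_config:
  assumes G: "G \<in> cdf_class \<theta> data" and papb: "\<And>i. i \<in> {1..k} \<Longrightarrow> pa i \<le> pb i"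
  shows "\<exists>x. config_ok k N n a b x \<and> (\<forall>j\<in>{1..N}.
     \<bar>G ((of_int (x j) + (real j - 1) * \<theta>) / real N) - real j / real N\<bar> \<le> ((1 + \<theta>) * \<eta> + 1 / real N) / \<theta> + \<eta>)"
proof -
  have ml: "mono_lip \<theta> G" using G by (simp add: cdf_class_def)
  have GD: "G p = v" if "(p, v) \<in> data" for p v
    using G that unfolding cdf_class_def by auto
  have Ga: "G (pa i) = c (i - 1)" and Gb: "G (pb i) = c i" if "i \<in> {1..k}" for i
    using that by (auto intro!: GD simp: data_def)
  have N0: "0 < real N" using N by simp
  let ?cl = "\<lambda>i t. max (pa i) (min (pb i) t)"
  let ?E = "\<lambda>i t. G (?cl i t) + (t - ?cl i t) / \<theta>"
  have "\<exists>t. ?E (blk n j) t = real j / real N" if "j \<in> {1..N}" for j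
    using blk_props[of j n k] that total by (intro extended_quantile \<theta> ml papb) auto
  then obtain t where t: "\<And>j. j \<in> {1..N} \<Longrightarrow> ?E (blk n j) (t j) = real j / real N" by metis
  \<comment> \<open>This is the real lattice position behind the quantile. The slope bound keeps the
    quantiles of successive particles \<theta> / N apart, so \<open>r\<close> does not decrease
    within a block and its floor gives an admissible order.\<close>
  define r where "r j = real N * t j - (real j - 1) * \<theta>" for j
  define x where "x j = max (a (blk n j)) (min (b (blk n j) - 1) \<lfloor>r j\<rfloor>)" for j
  have Emono: "?E i s \<le> ?E i s' \<and> ?E i s' - ?E i s \<le> (s' - s) / \<theta>" if "s \<le> s'" "i \<in> {1..k}" for i s s'
  proof -
    have cl: "?cl i s \<le> ?cl i s'" "?cl i s' - ?cl i s \<le> s' - s" using that papb[OF that(2)] by auto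
    have "G (?cl i s) \<le> G (?cl i s')" "G (?cl i s') - G (?cl i s) \<le> (?cl i s' - ?cl i s) / \<theta>"
      using mono_lipD[OF ml cl(1)] by auto
    moreover have "(s - ?cl i s) / \<theta> \<le> (s' - ?cl i s') / \<theta>" using \<theta> cl by (intro divide_right_mono) auto
    ultimately show ?thesis by (simp only: diff_divide_distrib) argo
  qed
  have rmono: "r i \<le> r j" if "1 \<le> i" "i \<le> j" "j \<le> N" "blk n i = blk n j" for i j
  proof -
    have B: "blk n j \<in> {1..k}" using blk_props[of j n k] that total by auto
    have ti: "?E (blk n j) (t i) = real i / real N" "?E (blk n j) (t j) = real j / real N"
      using t[of i] t[of j] that by auto
    show ?thesis
    proof (cases "t i \<le> t j")
      case True
      have "real j / real N - real i / real N \<le> (t j - t i) / \<theta>"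
        using Emono[OF True B] ti by linarith
      hence "(real j - real i) * \<theta> \<le> real N * (t j - t i)"
        using \<theta> N0 by (simp add: field_simps)
      thus ?thesis by (simp add: r_def algebra_simps)
    next
      case False
      hence "t j \<le> t i" by simp
      from Emono[OF this B] have "real j / real N \<le> real i / real N" using ti by linarith
      hence "j \<le> i" using N0 by (simp add: divide_le_cancel)
      hence "i = j" using that by simp
      thus ?thesis by simp
    qed
  qed
  have ok: "config_ok k N n a b x"
  proof (rule config_okI)
    fix i j assume ij: "1 \<le> i" "i \<le> j" "j \<le> N" "blk n i = blk n j"
    have "\<lfloor>r i\<rfloor> \<le> \<lfloor>r j\<rfloor>" using rmono[OF ij] by (rule floor_mono)
    thus "x i \<le> x j" using ij by (auto simp: x_def)
  next
    fix j assume "j \<in> {1..N}"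
    hence "blk n j \<in> {1..k}" using blk_props[of j n k] total by auto
    thus "a (blk n j) \<le> x j \<and> x j \<le> b (blk n j) - 1" using ab[of "blk n j"] by (auto simp: x_def)
  qed
  have close: "\<bar>G ((of_int (x j) + (real j - 1) * \<theta>) / real N) - real j / real N\<bar> \<le> ((1 + \<theta>) * \<eta> + 1 / real N) / \<theta> + \<eta>"
    if j: "j \<in> {1..N}" for j
  proof -
    define i where "i = blk n j"
    note bp = blk_props[of j n k]
    have i: "i \<in> {1..k}" and Ni: "block_end n (i - 1) < j" "j \<le> block_end n i"
      using bp j total unfolding i_def by auto
    have E: "?E i (t j) = real j / real N" using t[OF j] by (simp add: i_def)
    have p: "pa i \<le> pb i" by (rule papb[OF i])
    \<comment> \<open>Since the continuation rises at most at rate \<open>1 / \<theta>\<close> from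
      level \<open>c (i - 1)\<close> at \<open>pa i\<close>, the quantile is at least this far
      right; on the affine part left of \<open>pa i\<close> there is equality.\<close>
    have lowt: "pa i + \<theta> * (real j / real N - c (i - 1)) \<le> t j \<and> (t j < pa i \<longrightarrow> t j = pa i + \<theta> * (real j / real N - c (i - 1)))"
    proof (cases "t j < pa i")
      case True
      hence "real j / real N - c (i - 1) = (t j - pa i) / \<theta>" using E p Ga[OF i] by simp
      hence "\<theta> * (real j / real N - c (i - 1)) = t j - pa i" using \<theta> by simp
      thus ?thesis by linarith
    next
      case False
      have "?E i (pa i) = c (i - 1)" using p Ga[OF i] by simp
      hence "real j / real N - c (i - 1) \<le> (t j - pa i) / \<theta>" using Emono[of "pa i" "t j" i] False i E by auto
      hence "\<theta> * (real j / real N - c (i - 1)) \<le> t j - pa i" using \<theta> by (simp add: le_divide_eq mult.commute)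
      thus ?thesis using False by linarith
    qed
    have upt: "t j \<le> pb i - \<theta> * (c i - real j / real N) \<and> (pb i < t j \<longrightarrow> t j = pb i - \<theta> * (c i - real j / real N))"
    proof (cases "pb i < t j")
      case True
      hence "real j / real N - c i = (t j - pb i) / \<theta>" using E p Gb[OF i] by simp
      hence "\<theta> * (real j / real N - c i) = t j - pb i" using \<theta> by simp
      thus ?thesis by (simp add: algebra_simps)
    next
      case False
      have "?E i (pb i) = c i" using p Gb[OF i] by simp
      hence "c i - real j / real N \<le> (pb i - t j) / \<theta>" using Emono[of "t j" "pb i" i] False i E by auto
      hence "\<theta> * (c i - real j / real N) \<le> pb i - t j" using \<theta> by (simp add: le_divide_eq mult.commute)
      thus ?thesis using False by linarith
    qed
    have ci: "real (block_end n (i - 1)) / real N - c (i - 1) \<ge> - \<eta>" "real (block_end n (i - 1)) / real N - c (i - 1) \<le> \<eta>"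
       "real (block_end n i) / real N - c i \<ge> - \<eta>" "real (block_end n i) / real N - c i \<le> \<eta>"
    proof -
      have "i - 1 \<le> k" "i \<le> k" using i by auto
      from c[OF this(1)] c[OF this(2)]
      show "real (block_end n (i - 1)) / real N - c (i - 1) \<ge> - \<eta>" "real (block_end n (i - 1)) / real N - c (i - 1) \<le> \<eta>"
       "real (block_end n i) / real N - c i \<ge> - \<eta>" "real (block_end n i) / real N - c i \<le> \<eta>" by linarith+
    qed
    have Nj: "real (block_end n (i - 1)) / real N \<le> real j / real N" "real j / real N \<le> real (block_end n i) / real N"
      using Ni by (auto intro!: divide_right_mono)
    have mulN: "real N * (y / real N) = y" for y using N0 by simp
    have pai: "of_int (a i) + real (block_end n (i - 1)) * \<theta> - real N * \<eta> \<le> real N * pa i"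
    proof -
      have "(of_int (a i) + real (block_end n (i - 1)) * \<theta>) / real N - \<eta> \<le> pa i" using pa[OF i] by linarith
      hence "real N * ((of_int (a i) + real (block_end n (i - 1)) * \<theta>) / real N - \<eta>) \<le> real N * pa i" using N0 by (intro mult_left_mono) auto
      thus ?thesis unfolding right_diff_distrib mulN .
    qed
    have pbi: "real N * pb i \<le> of_int (b i) + (real (block_end n i) - 1) * \<theta> + real N * \<eta>"
    proof -
      have "pb i \<le> (of_int (b i) + (real (block_end n i) - 1) * \<theta>) / real N + \<eta>" using pb[OF i] by linarith
      hence "real N * pb i \<le> real N * ((of_int (b i) + (real (block_end n i) - 1) * \<theta>) / real N + \<eta>)" using N0 by (intro mult_left_mono) auto
      thus ?thesis unfolding distrib_left mulN .
    qed
    \<comment> \<open>\<open>K\<close> bounds, in lattice units, how far \<open>r j\<close> can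
      leave the interval from \<open>a i\<close> to \<open>b i\<close>: one \<eta> for the position
      of an end and \<theta> * \<eta> for its level. Clamping at \<open>b i - 1\<close> and the
      floor together add at most one more unit.\<close>
    define K where "K = real N * ((1 + \<theta>) * \<eta>)"
    have rlo: "of_int (a i) - K \<le> r j"
    proof -
      have "real N * (pa i + \<theta> * (real j / real N - c (i - 1))) \<le> real N * t j" using lowt N0 by (intro mult_left_mono) auto
      moreover have "real N * (pa i + \<theta> * (real j / real N - c (i - 1))) = real N * pa i + \<theta> * (real j - real N * c (i - 1))"
        using N0 by (simp add: algebra_simps)
      moreover have "\<theta> * (real N * c (i - 1)) \<le> \<theta> * (real (block_end n (i - 1)) + real N * \<eta>)"
      proof (intro mult_left_mono)
        have "c (i - 1) \<le> real (block_end n (i - 1)) / real N + \<eta>" using ci by linarith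
        hence "real N * c (i - 1) \<le> real N * (real (block_end n (i - 1)) / real N + \<eta>)" using N0 by (intro mult_left_mono) auto
        thus "real N * c (i - 1) \<le> real (block_end n (i - 1)) + real N * \<eta>" unfolding distrib_left mulN .
      qed (use \<theta> in auto)
      ultimately have "of_int (a i) - real N * \<eta> - \<theta> * (real N * \<eta>) + \<theta> \<le> real N * t j - \<theta> * real j + \<theta>"
        using pai by (simp add: algebra_simps)
      thus ?thesis using \<theta> by (simp add: r_def K_def algebra_simps)
    qed
    have rup: "r j \<le> of_int (b i) + K"
    proof -
      have "real N * t j \<le> real N * (pb i - \<theta> * (c i - real j / real N))" using upt N0 by (intro mult_left_mono) auto
      moreover have "real N * (pb i - \<theta> * (c i - real j / real N)) = real N * pb i - \<theta> * (real N * c i) + \<theta> * real j"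
        using N0 by (simp add: algebra_simps)
      moreover have "\<theta> * (real (block_end n i) - real N * \<eta>) \<le> \<theta> * (real N * c i)"
      proof (intro mult_left_mono)
        have "real (block_end n i) / real N - \<eta> \<le> c i" using ci by linarith
        hence "real N * (real (block_end n i) / real N - \<eta>) \<le> real N * c i" using N0 by (intro mult_left_mono) auto
        thus "real (block_end n i) - real N * \<eta> \<le> real N * c i" unfolding right_diff_distrib mulN .
      qed (use \<theta> in auto)
      ultimately have "real N * t j - \<theta> * real j + \<theta> \<le> of_int (b i) + real N * \<eta> + \<theta> * (real N * \<eta>)"
        using pbi by (simp add: algebra_simps)
      thus ?thesis by (simp add: r_def K_def algebra_simps)
    qed
    have K: "0 \<le> K" using \<theta> \<eta> by (simp add: K_def)
    have "\<bar>of_int (x j) - r j\<bar> \<le> K + 1"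
      unfolding x_def i_def[symmetric] using rlo rup K ab[OF i] by (simp add: max_def min_def abs_le_iff) linarith
    hence "\<bar>of_int (x j) - r j\<bar> / real N \<le> (K + 1) / real N" using N0 by (intro divide_right_mono) auto
    moreover have "(of_int (x j) + (real j - 1) * \<theta>) / real N - t j = (of_int (x j) - r j) / real N"
      using N0 by (simp add: r_def field_simps)
    moreover have "(K + 1) / real N = (1 + \<theta>) * \<eta> + 1 / real N" using N0 by (simp add: K_def add_divide_distrib)
    ultimately have st: "\<bar>(of_int (x j) + (real j - 1) * \<theta>) / real N - t j\<bar> \<le> (1 + \<theta>) * \<eta> + 1 / real N"
      using N0 by (simp add: abs_divide)
    have G1: "\<bar>G s - G s'\<bar> \<le> \<bar>s - s'\<bar> / \<theta>" for s s'
    proof (cases "s \<le> s'")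
      case True thus ?thesis using mono_lipD[OF ml True] by auto
    next
      case False
      hence "s' \<le> s" by simp
      thus ?thesis using mono_lipD[OF ml \<open>s' \<le> s\<close>] by auto
    qed
    let ?s = "(of_int (x j) + (real j - 1) * \<theta>) / real N"
    have "\<bar>G ?s - G (t j)\<bar> \<le> ((1 + \<theta>) * \<eta> + 1 / real N) / \<theta>"
      using order_trans[OF G1 divide_right_mono[OF st]] \<theta> by simp
    \<comment> \<open>The quantile solves the equation for the continuation, not for
      \<open>G\<close>. Where it falls outside the block, \<open>G (t j)\<close> lies between
      \<open>j / N\<close> and the level at the nearest end, and these differ by at most
      \<eta>.\<close>
    moreover have "\<bar>G (t j) - real j / real N\<bar> \<le> \<eta>"
    proof -
      consider "t j < pa i" | "pb i < t j" | "pa i \<le> t j" "t j \<le> pb i" by linarith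
      thus ?thesis
      proof cases
        case 1
        hence "real j / real N = c (i - 1) + (t j - pa i) / \<theta>" using E p Ga[OF i] by simp
        moreover have "G (t j) \<le> c (i - 1)" "c (i - 1) - G (t j) \<le> (pa i - t j) / \<theta>"
          using mono_lipD[OF ml, of "t j" "pa i"] 1 Ga[OF i] by auto
        moreover have "(t j - pa i) / \<theta> = - ((pa i - t j) / \<theta>)" by (simp add: minus_divide_left)
        ultimately show ?thesis using ci Nj \<eta> by (simp only: abs_le_iff) linarith
      next
        case 2
        hence "real j / real N = c i + (t j - pb i) / \<theta>" using E p Gb[OF i] by simp
        moreover have "c i \<le> G (t j)" "G (t j) - c i \<le> (t j - pb i) / \<theta>"
          using mono_lipD[OF ml, of "pb i" "t j"] 2 Gb[OF i] by auto
        ultimately show ?thesis using ci Nj \<eta> by (simp only: abs_le_iff) linarith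
      next
        case 3 thus ?thesis using E \<eta> by simp
      qed
    qed
    ultimately show ?thesis by linarith
  qed
  show ?thesis using ok close by blast
qed

end

section \<open>Gibbs weights\<close>

text \<open>Closeness at the particles suffices: a monotone function at \<open>x\<close> is squeezed
  between its values at the two neighbouring particles, whose levels differ by 1 / N.\<close>

lemma ecdf_close:
  fixes F :: "real \<Rightarrow> real" and y :: "nat \<Rightarrow> real"
  assumes F: "mono F" "\<And>x. 0 \<le> F x" "\<And>x. F x \<le> 1" and N: "1 \<le> N"
    and y: "\<And>i j. 1 \<le> i \<Longrightarrow> i \<le> j \<Longrightarrow> j \<le> N \<Longrightarrow> y i \<le> y j"
    and close: "\<And>j. j \<in> {1..N} \<Longrightarrow> \<bar>F (y j) - real j / real N\<bar> \<le> \<eta>"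
  shows "\<bar>F x - ecdf N y x\<bar> \<le> \<eta> + 1 / real N"
proof -
  define A where "A = {j \<in> {1..N}. y j \<le> x}"
  define c where "c = card A"
  have fin: "finite A" by (simp add: A_def)
  have "card A \<le> card {1..N}" by (intro card_mono) (auto simp: A_def)
  hence cN: "c \<le> N" by (simp add: c_def)
  have ec: "ecdf N y x = real c / real N"
  proof -
    have "(\<Sum>j = 1..N. if y j \<le> x then 1 else 0 :: real) = real (card A)"
      unfolding A_def by (simp add: sum.If_cases Int_def)
    thus ?thesis by (simp add: ecdf_def c_def)
  qed
  \<comment> \<open>Sortedness makes the particles at or left of \<open>x\<close> an initial
    segment, so their number is also the index of the last one.\<close>
  have Aeq: "A = {1..c}"
  proof (cases "A = {}")
    case False
    define m where "m = Max A"
    have m: "m \<in> A" using fin False unfolding m_def by (rule Max_in)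
    have "A = {1..m}"
    proof (intro equalityI subsetI)
      fix j assume "j \<in> A" thus "j \<in> {1..m}" using fin by (auto simp: A_def m_def)
    next
      fix j assume "j \<in> {1..m}"
      hence "y j \<le> y m" using m by (intro y) (auto simp: A_def)
      thus "j \<in> A" using m \<open>j \<in> {1..m}\<close> by (auto simp: A_def)
    qed
    thus ?thesis by (simp add: c_def)
  qed (simp add: c_def)
  have eta: "0 \<le> \<eta>" using close[of 1] N by auto
  have n1: "0 \<le> 1 / real N" by simp
  have lo: "real c / real N - \<eta> \<le> F x"
  proof (cases "c = 0")
    case True thus ?thesis using F(2)[of x] eta by simp
  next
    case False
    hence "c \<in> A" using Aeq by auto
    hence "F (y c) \<le> F x" using F(1) by (auto simp: A_def monoD)
    thus ?thesis using close[of c] False cN by (auto simp: abs_le_iff)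
  qed
  have up: "F x \<le> real c / real N + 1 / real N + \<eta>"
  proof (cases "c = N")
    case True
    hence "real c / real N = 1" using N by simp
    thus ?thesis using F(3)[of x] eta n1 by linarith
  next
    case False
    hence cc: "Suc c \<in> {1..N}" using cN by auto
    have "Suc c \<notin> A" using Aeq by auto
    hence "x \<le> y (Suc c)" using cc by (auto simp: A_def)
    hence "F x \<le> F (y (Suc c))" using F(1) by (auto simp: monoD)
    also have "\<dots> \<le> real (Suc c) / real N + \<eta>" using close[OF cc] by linarith
    finally show ?thesis by (simp add: add_divide_distrib)
  qed
  show ?thesis unfolding ec using lo up eta n1 by linarith
qed

lemma quad_lattice_diff:
  assumes "0 < q"
  shows "quad_lattice q u y - quad_lattice q u x = q powr (- y) * (1 - q powr (y - x)) * (1 - u * q powr (x + y))"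
proof -
  have "q powr (- y) * q powr (y - x) = q powr (- x)" by (simp add: powr_add[symmetric])
  moreover have "q powr (- y) * q powr (x + y) = q powr x" by (simp add: powr_add[symmetric])
  moreover have "q powr (- x) * q powr (x + y) = q powr y" by (simp add: powr_add[symmetric])
  ultimately show ?thesis unfolding quad_lattice_def by (simp add: algebra_simps)
qed

text \<open>\<open>quad_lattice_diff\<close> factors a difference of lattice values into
  \<open>q powr (- y)\<close>, \<open>1 - q powr (y - x)\<close> and
  \<open>1 - u * q powr (x + y)\<close>. Up to powers of \<open>1 - q\<close>, the three factors of
  the interaction approximate their powers with exponent \<open>2 * \<theta>\<close>; the last
  matches because \<open>u = q powr v\<close>. For \<open>u = 0\<close> it is trivial and only one
  power of \<open>1 - q\<close> occurs.\<close>

lemma ln_interaction_H: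
  assumes q: "0 < q" "q < 1" and u: "0 \<le> u" "u < 1" and \<theta>: "0 < \<theta>" and x: "0 \<le> x" "x + \<theta> \<le> y"
  shows "0 < interaction_H \<theta> q u (quad_lattice q u x) (quad_lattice q u y)"
    and "\<bar>ln (interaction_H \<theta> q u (quad_lattice q u x) (quad_lattice q u y))
          - 2 * \<theta> * ln (quad_lattice q u y - quad_lattice q u x) + 2 * \<theta> * (if u = 0 then 1 else 2) * ln (1 - q)\<bar>
         \<le> Gamma_ratio_const \<theta> / (y - x) + (if u = 0 then 0 else Gamma_ratio_const \<theta> / log q u)"
proof -
  define v where "v = log q u"
  define H2 where "H2 = (if u = 0 then 1 else q_Gamma_ratio \<theta> q (y + x + v))"
  have H: "interaction_H \<theta> q u (quad_lattice q u x) (quad_lattice q u y)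
     = q powr (- 2 * \<theta> * y) * q_Gamma_ratio \<theta> q (y - x) * H2"
    using q u \<theta> x by (simp add: interaction_H_def Let_def quad_lattice_inv_quad_lattice q_Gamma_ratio_def H2_def v_def)
  have d: "\<theta> \<le> y - x" using x by simp
  have v: "0 < v" "q powr v = u" if "u \<noteq> 0"
    using that q u unfolding v_def log_def by (auto simp: powr_def divide_neg_neg)
  have H1pos: "0 < q_Gamma_ratio \<theta> q (y - x)" by (rule q_Gamma_ratio_pos[OF q \<theta> d])
  have z: "\<theta> \<le> y + x + v" if "u \<noteq> 0" using v(1)[OF that] x by simp
  have H2pos: "0 < H2" unfolding H2_def using q_Gamma_ratio_pos[OF q \<theta> z] by auto
  show "0 < interaction_H \<theta> q u (quad_lattice q u x) (quad_lattice q u y)"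
    unfolding H using q H1pos H2pos by simp
  have p1: "0 < 1 - q powr (y - x)" using powr_less_mono'[of q 0 "y - x"] q d \<theta> by simp
  have p2: "0 < 1 - u * q powr (x + y)"
  proof -
    have "q powr (x + y) \<le> 1" using q x \<theta> by (intro powr_le1) auto
    hence "u * q powr (x + y) \<le> u * 1" using u by (intro mult_left_mono) auto
    thus ?thesis using u by simp
  qed
  have lnD: "ln (quad_lattice q u y - quad_lattice q u x) = - y * ln q + ln (1 - q powr (y - x)) + ln (1 - u * q powr (x + y))"
    unfolding quad_lattice_diff[OF q(1)] using q p1 p2 by (simp add: ln_mult_pos ln_powr)
  have lnH: "ln (interaction_H \<theta> q u (quad_lattice q u x) (quad_lattice q u y)) = - 2 * \<theta> * y * ln q + ln (q_Gamma_ratio \<theta> q (y - x)) + ln H2"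
    unfolding H using q H1pos H2pos by (simp add: ln_mult ln_powr)
  have e1: "\<bar>ln (q_Gamma_ratio \<theta> q (y - x)) - 2 * \<theta> * (ln (1 - q powr (y - x)) - ln (1 - q))\<bar> \<le> Gamma_ratio_const \<theta> / (y - x)"
    using ln_q_Gamma_ratio[OF q \<theta> d] p1 q by (simp add: ln_divide_pos)
  have G0: "0 \<le> Gamma_ratio_const \<theta>" unfolding Gamma_ratio_const_def using \<theta> by simp
  have e2: "\<bar>ln H2 - 2 * \<theta> * ln (1 - u * q powr (x + y)) + 2 * \<theta> * (if u = 0 then 0 else 1) * ln (1 - q)\<bar>
     \<le> (if u = 0 then 0 else Gamma_ratio_const \<theta> / log q u)"
  proof (cases "u = 0")
    case False
    have "q powr (y + x + v) = u * q powr (x + y)" using v(2)[OF False] by (simp add: powr_add algebra_simps)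
    hence "\<bar>ln H2 - 2 * \<theta> * (ln (1 - u * q powr (x + y)) - ln (1 - q))\<bar> \<le> Gamma_ratio_const \<theta> / (y + x + v)"
      using ln_q_Gamma_ratio[OF q \<theta> z[OF False]] False p2 q by (simp add: H2_def ln_divide_pos)
    also have "\<dots> \<le> Gamma_ratio_const \<theta> / v" using v(1)[OF False] G0 x \<theta> by (intro divide_left_mono) auto
    finally show ?thesis using False by (simp add: v_def algebra_simps)
  qed (simp add: H2_def)
  have "ln (interaction_H \<theta> q u (quad_lattice q u x) (quad_lattice q u y))
          - 2 * \<theta> * ln (quad_lattice q u y - quad_lattice q u x) + 2 * \<theta> * (if u = 0 then 1 else 2) * ln (1 - q)
     = (ln (q_Gamma_ratio \<theta> q (y - x)) - 2 * \<theta> * (ln (1 - q powr (y - x)) - ln (1 - q)))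
     + (ln H2 - 2 * \<theta> * ln (1 - u * q powr (x + y)) + 2 * \<theta> * (if u = 0 then 0 else 1) * ln (1 - q))"
    unfolding lnH lnD by (simp add: algebra_simps)
  thus "\<bar>ln (interaction_H \<theta> q u (quad_lattice q u x) (quad_lattice q u y))
          - 2 * \<theta> * ln (quad_lattice q u y - quad_lattice q u x) + 2 * \<theta> * (if u = 0 then 1 else 2) * ln (1 - q)\<bar>
         \<le> Gamma_ratio_const \<theta> / (y - x) + (if u = 0 then 0 else Gamma_ratio_const \<theta> / log q u)"
    using e1 e2 by linarith
qed

text \<open>Harmonic sums: errors inversely proportional to the gap of a pair add up to
  \<open>O (N ln N)\<close>, negligible against the scale \<open>N\<^sup>2\<close> of the
  energy.\<close>

lemma sum_pairs_inverse_gap: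
  assumes N: "1 \<le> N"
  shows "(\<Sum>(i, j)\<in>{(i, j). 1 \<le> i \<and> i < j \<and> j \<le> N}. 1 / (real j - real i)) \<le> real N * (1 + ln (real N))"
proof -
  have S: "{(i, j). 1 \<le> i \<and> i < j \<and> j \<le> N} = Sigma {1..N} (\<lambda>i. {i<..N})" by auto
  have "(\<Sum>(i, j)\<in>{(i, j). 1 \<le> i \<and> i < j \<and> j \<le> N}. 1 / (real j - real i)) = (\<Sum>i = 1..N. \<Sum>j\<in>{i<..N}. 1 / (real j - real i))"
    unfolding S by (rule sum.Sigma[symmetric]) auto
  also have "\<dots> \<le> (\<Sum>i = 1..N. 1 + ln (real N))"
  proof (intro sum_mono)
    fix i assume i: "i \<in> {1..N}"
    have "(\<Sum>j\<in>{i<..N}. 1 / (real j - real i)) = (\<Sum>d = 1..N - i. 1 / real d)"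
      by (rule sum.reindex_bij_witness[of _ "\<lambda>d. d + i" "\<lambda>j. j - i"]) auto
    also have "\<dots> \<le> (\<Sum>d = 1..N. 1 / real d)" by (intro sum_mono2) auto
    also have "\<dots> = harm N" by (simp add: harm_def inverse_eq_divide)
    also have "\<dots> \<le> ln (real N) + 1"
      using decseqD[OF decseq_harm_diff_ln, of 0 "N - 1"] N by (simp add: harm_expand)
    finally show "(\<Sum>j\<in>{i<..N}. 1 / (real j - real i)) \<le> 1 + ln (real N)" by simp
  qed
  also have "\<dots> = real N * (1 + ln (real N))" by simp
  finally show ?thesis .
qed

lemma card_pairs_le: "card {(i, j). 1 \<le> i \<and> i < j \<and> j \<le> (N::nat)} \<le> N * N"
proof -
  have "card {(i, j). 1 \<le> i \<and> i < j \<and> j \<le> N} \<le> card ({1..N} \<times> {1..N})" by (intro card_mono) auto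
  thus ?thesis by simp
qed

lemma finite_pairs: "finite {(i, j). 1 \<le> i \<and> i < j \<and> j \<le> (N::nat)}"
  by (rule finite_subset[of _ "{1..N} \<times> {1..N}"]) auto

text \<open>The constant \<open>W\<close> depends on the system but not on the configuration, so it cancels in
  ratios of weights.\<close>

lemma ln_gibbs_weight:
  fixes s :: "nat \<Rightarrow> real"
  assumes q: "0 < q" "q < 1" and u: "0 \<le> u" "u < 1" and \<theta>: "0 < \<theta>" and N: "1 \<le> N"
    and s0: "\<And>j. j \<in> {1..N} \<Longrightarrow> 0 \<le> s j"
    and gap: "\<And>i j. 1 \<le> i \<Longrightarrow> i < j \<Longrightarrow> j \<le> N \<Longrightarrow> (real j - real i) * \<theta> \<le> s j - s i"
    and v: "u \<noteq> 0 \<Longrightarrow> real N \<le> Cv * log q u" and Cv: "0 < Cv"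
    and l: "\<And>j. j \<in> {1..N} \<Longrightarrow> l j = quad_lattice q u (s j)"
    and w: "\<And>j. j \<in> {1..N} \<Longrightarrow> 0 < w (l j)"
    and W: "W = 2 * \<theta> * (if u = 0 then 1 else 2) * ln (1 - q) * real (card {(i, j). 1 \<le> i \<and> i < j \<and> j \<le> N})"
  shows "0 < gibbs_weight \<theta> N q u w l"
    and "\<bar>ln (gibbs_weight \<theta> N q u w l) + W
      - 2 * \<theta> * (\<Sum>(i, j)\<in>{(i, j). 1 \<le> i \<and> i < j \<and> j \<le> N}. ln \<bar>l i - l j\<bar>) - (\<Sum>j = 1..N. ln (w (l j)))\<bar>
      \<le> Gamma_ratio_const \<theta> * (1 / \<theta> + Cv) * real N * (1 + ln (real N))"
proof -
  let ?P = "{(i, j). 1 \<le> i \<and> i < j \<and> j \<le> N}"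
  let ?G = "Gamma_ratio_const \<theta>"
  let ?K = "2 * \<theta> * (if u = 0 then 1 else 2) * ln (1 - q)"
  have G0: "0 \<le> ?G" unfolding Gamma_ratio_const_def using \<theta> by simp
  have pr: "0 < interaction_H \<theta> q u (l i) (l j) \<and>
      \<bar>ln (interaction_H \<theta> q u (l i) (l j)) - 2 * \<theta> * ln \<bar>l i - l j\<bar> + ?K\<bar> \<le> ?G / \<theta> * (1 / (real j - real i)) + ?G * Cv / real N"
    if ij: "1 \<le> i" "i < j" "j \<le> N" for i j
  proof -
    have d: "(real j - real i) * \<theta> \<le> s j - s i" by (rule gap[OF ij])
    have "1 * \<theta> \<le> (real j - real i) * \<theta>" using ij \<theta> by (intro mult_right_mono) auto
    hence sij: "s i + \<theta> \<le> s j" using d by linarith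
    have l2: "l i = quad_lattice q u (s i)" "l j = quad_lattice q u (s j)" using l ij by auto
    have si: "0 \<le> s i" using s0 ij by auto
    note H = ln_interaction_H[OF q u \<theta> si sij]
    have "quad_lattice q u (s i) < quad_lattice q u (s j)"
      using strict_mono_onD[OF quad_lattice_strict_mono[OF q u], of "s i" "s j"] si sij \<theta> by auto
    hence abs: "\<bar>l i - l j\<bar> = quad_lattice q u (s j) - quad_lattice q u (s i)" by (simp add: l2)
    have "?G / (s j - s i) \<le> ?G / ((real j - real i) * \<theta>)" using d ij \<theta> G0 by (intro frac_le) auto
    \<comment> \<open>The argument of the second fraction is at least \<open>log q u\<close>, which
      is of order \<open>N\<close>; its error is \<open>O(1 / N)\<close> per pair and
      \<open>O(N)\<close> altogether.\<close>
    moreover have "(if u = 0 then 0 else ?G / log q u) \<le> ?G * Cv / real N"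
    proof (cases "u = 0")
      case False
      have N0: "0 < real N" using N by simp
      have lp: "0 < log q u" using v[OF False] N0 Cv by (metis less_le_trans zero_less_mult_pos)
      have "1 / log q u \<le> Cv / real N" using v[OF False] lp N0 by (simp add: field_simps)
      hence "?G * (1 / log q u) \<le> ?G * (Cv / real N)" using G0 by (intro mult_left_mono)
      thus ?thesis using False by simp
    qed (use G0 Cv in simp)
    ultimately show ?thesis using H unfolding abs l2[symmetric] by (auto simp: mult.commute)
  qed
  have Hpos: "0 < (\<Prod>(i, j)\<in>?P. interaction_H \<theta> q u (l i) (l j))" using pr by (intro prod_pos) auto
  have wpos: "0 < (\<Prod>j = 1..N. w (l j))" using w by (intro prod_pos) auto
  show "0 < gibbs_weight \<theta> N q u w l" unfolding gibbs_weight_def using Hpos wpos by simp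
  have "ln (gibbs_weight \<theta> N q u w l) = ln (\<Prod>(i, j)\<in>?P. interaction_H \<theta> q u (l i) (l j)) + ln (\<Prod>j = 1..N. w (l j))"
    unfolding gibbs_weight_def by (rule ln_mult_pos[OF Hpos wpos])
  also have "ln (\<Prod>j = 1..N. w (l j)) = (\<Sum>j = 1..N. ln (w (l j)))"
    using w by (intro ln_prod) (auto simp: less_imp_neq[symmetric])
  also have "ln (\<Prod>(i, j)\<in>?P. interaction_H \<theta> q u (l i) (l j)) = (\<Sum>p\<in>?P. ln (interaction_H \<theta> q u (l (fst p)) (l (snd p))))"
  proof -
    have "ln (\<Prod>p\<in>?P. interaction_H \<theta> q u (l (fst p)) (l (snd p))) = (\<Sum>p\<in>?P. ln (interaction_H \<theta> q u (l (fst p)) (l (snd p))))"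
    proof (rule ln_prod[OF finite_pairs])
      fix p assume "p \<in> ?P"
      hence "1 \<le> fst p" "fst p < snd p" "snd p \<le> N" by auto
      hence "0 < interaction_H \<theta> q u (l (fst p)) (l (snd p))" using pr by blast
      thus "interaction_H \<theta> q u (l (fst p)) (l (snd p)) \<noteq> 0" by simp
    qed
    thus ?thesis unfolding case_prod_unfold .
  qed
  finally have eq: "ln (gibbs_weight \<theta> N q u w l) + W
      - 2 * \<theta> * (\<Sum>(i, j)\<in>?P. ln \<bar>l i - l j\<bar>) - (\<Sum>j = 1..N. ln (w (l j)))
      = (\<Sum>p\<in>?P. ln (interaction_H \<theta> q u (l (fst p)) (l (snd p))) - 2 * \<theta> * ln \<bar>l (fst p) - l (snd p)\<bar> + ?K)"
    unfolding W by (simp add: sum.distrib sum_subtractf sum_distrib_left case_prod_beta)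
  have "\<bar>\<Sum>p\<in>?P. ln (interaction_H \<theta> q u (l (fst p)) (l (snd p))) - 2 * \<theta> * ln \<bar>l (fst p) - l (snd p)\<bar> + ?K\<bar> \<le> (\<Sum>p\<in>?P. ?G / \<theta> * (1 / (real (snd p) - real (fst p))) + ?G * Cv / real N)"
    using pr by (intro order_trans[OF sum_abs] sum_mono) auto
  also have "\<dots> = ?G / \<theta> * (\<Sum>(i, j)\<in>?P. 1 / (real j - real i)) + real (card ?P) * (?G * Cv / real N)"
    by (simp add: sum.distrib sum_distrib_left case_prod_beta)
  also have "\<dots> \<le> ?G / \<theta> * (real N * (1 + ln (real N))) + (real N * real N) * (?G * Cv / real N)"
    using sum_pairs_inverse_gap[OF N] G0 \<theta> Cv card_pairs_le[of N]
    by (intro add_mono mult_left_mono mult_right_mono) (auto simp flip: of_nat_mult)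
  also have "\<dots> = ?G / \<theta> * (real N * (1 + ln (real N))) + ?G * Cv * real N * 1" using N by simp
  also have "\<dots> \<le> ?G / \<theta> * (real N * (1 + ln (real N))) + ?G * Cv * real N * (1 + ln (real N))"
    using G0 Cv N by (intro add_left_mono mult_left_mono) auto
  also have "\<dots> = ?G * (1 / \<theta> + Cv) * real N * (1 + ln (real N))" by (simp add: algebra_simps add_divide_distrib)
  finally show "\<bar>ln (gibbs_weight \<theta> N q u w l) + W
      - 2 * \<theta> * (\<Sum>(i, j)\<in>?P. ln \<bar>l i - l j\<bar>) - (\<Sum>j = 1..N. ln (w (l j)))\<bar>
      \<le> ?G * (1 / \<theta> + Cv) * real N * (1 + ln (real N))" unfolding eq .
qed

section \<open>The limiting lattice\<close>

lemma ln_diff_le: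
  fixes x y :: real
  assumes "0 < m" "m \<le> x" "m \<le> y"
  shows "\<bar>ln x - ln y\<bar> \<le> \<bar>x - y\<bar> / m"
proof -
  have *: "ln y - ln x \<le> (y - x) / m" if "x \<le> y" "m \<le> x" for x y :: real
  proof -
    have "ln (y / x) \<le> y / x - 1" using that assms by (intro ln_le_minus_one) auto
    hence "ln y - ln x \<le> (y - x) / x" using that assms by (simp add: ln_divide_pos diff_divide_distrib)
    also have "\<dots> \<le> (y - x) / m" using that assms by (intro divide_left_mono) auto
    finally show ?thesis .
  qed
  show ?thesis
  proof (cases "x \<le> y")
    case True
    hence "ln x \<le> ln y" using assms by simp
    thus ?thesis using *[OF True] assms True by auto
  next
    case False
    hence yx: "y \<le> x" by simp
    hence "ln y \<le> ln x" using assms by simp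
    thus ?thesis using *[OF yx] assms yx by auto
  qed
qed

lemma exp_diff_le:
  fixes a b :: real
  assumes "a \<le> m" "b \<le> m"
  shows "\<bar>exp a - exp b\<bar> \<le> \<bar>a - b\<bar> * exp m"
proof -
  have *: "exp a - exp b \<le> (a - b) * exp m" if "b \<le> a" "a \<le> m" for a b
  proof -
    have "exp a * (1 + (b - a)) \<le> exp a * exp (b - a)" by (intro mult_left_mono exp_ge_add_one_self) auto
    hence "exp a - exp b \<le> (a - b) * exp a" by (simp add: exp_diff algebra_simps)
    also have "\<dots> \<le> (a - b) * exp m" using that by (intro mult_left_mono) auto
    finally show ?thesis .
  qed
  show ?thesis
  proof (cases "b \<le> a")
    case True thus ?thesis using *[OF True] assms by simp
  next
    case False
    hence "a \<le> b" by simp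
    thus ?thesis using *[OF \<open>a \<le> b\<close>] assms by simp
  qed
qed

text \<open>From \<open>exp t \<ge> 1 + t\<close> for the first two factors of the difference and
  \<open>u * q powr (x + y) \<le> u\<close> for the third. It makes the inverse of the limit lattice
  Lipschitz and keeps particles apart by a multiple of 1 / N.\<close>

lemma quad_lattice_gap:
  assumes q: "0 < q" "q < 1" and u: "0 \<le> u" "u < 1" and x: "0 \<le> x" "x \<le> y"
  shows "(y - x) * (- ln q) * (1 - u) \<le> quad_lattice q u y - quad_lattice q u x"
proof -
  have eq: "q powr (- y) * (1 - q powr (y - x)) = q powr (- x) * (q powr (- (y - x)) - 1)"
    using q by (simp add: algebra_simps powr_add[symmetric])
  have ge: "q powr (- x) * (q powr (- (y - x)) - 1) \<ge> 1 * (exp ((y - x) * (- ln q)) - 1)"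
  proof (intro mult_mono)
    have "q powr (- x) = exp (x * (- ln q))" using q by (simp add: powr_def)
    thus "1 \<le> q powr (- x)" using q x by (simp add: mult_nonneg_nonpos)
    show "exp ((y - x) * - ln q) - 1 \<le> q powr - (y - x) - 1" using q by (simp add: powr_def algebra_simps)
    show "0 \<le> exp ((y - x) * - ln q) - 1" using q x by (simp add: mult_nonneg_nonpos)
  qed (use q in auto)
  have e: "(y - x) * (- ln q) \<le> exp ((y - x) * (- ln q)) - 1"
    using exp_ge_add_one_self[of "(y - x) * (- ln q)"] by simp
  have 1: "(y - x) * (- ln q) \<le> q powr (- y) * (1 - q powr (y - x))"
    by (rule order_trans[OF e]) (use ge in \<open>simp only: eq mult_1_left\<close>)
  have "q powr (x + y) \<le> 1" using q x by (intro powr_le1) auto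
  hence "u * q powr (x + y) \<le> u * 1" using u by (intro mult_left_mono) auto
  hence "1 - u \<le> 1 - u * q powr (x + y)" by simp
  hence "((y - x) * (- ln q)) * (1 - u) \<le> (q powr (- y) * (1 - q powr (y - x))) * (1 - u * q powr (x + y))"
  proof (intro mult_mono[OF 1])
    have "0 \<le> (y - x) * (- ln q)" using q x by (intro mult_nonneg_nonneg) auto
    thus "0 \<le> q powr (- y) * (1 - q powr (y - x))" using 1 by linarith
  qed (use u in auto)
  thus ?thesis unfolding quad_lattice_diff[OF q(1)] .
qed

lemma quad_lattice_mono:
  assumes "0 < q" "q < 1" "0 \<le> u" "u < 1" "0 \<le> x" "x \<le> y"
  shows "quad_lattice q u x \<le> quad_lattice q u y"
  using strict_mono_onD[OF quad_lattice_strict_mono[OF assms(1-4)], of x y] assms by (cases "x = y") auto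

lemma quad_lattice_surj:
  assumes q: "0 < q" "q < 1" and u: "0 \<le> u" and x: "1 + u \<le> x"
  shows "\<exists>s\<ge>0. quad_lattice q u s = x"
proof -
  define S where "S = ln x / (- ln q)"
  have S: "0 \<le> S" using q x u by (auto simp: S_def intro!: divide_nonneg_neg)
  have "q powr (- S) = x" using q x u by (simp add: S_def powr_def)
  hence "x \<le> quad_lattice q u S" using u q by (simp add: quad_lattice_def)
  moreover have "quad_lattice q u 0 \<le> x" using x q by (simp add: quad_lattice_def)
  moreover have "continuous_on {0..S} (quad_lattice q u)"
    unfolding quad_lattice_def[abs_def] using q by (intro continuous_intros) auto
  ultimately show ?thesis using IVT'[of "quad_lattice q u" 0 x S] S by auto
qed

text \<open>Clamping at \<open>1 + u\<close>, the lattice value at 0, gives a monotone Lipschitz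
  function on the whole line. Particles of the finite system can lie slightly below
  \<open>1 + uh\<close>, since their parameter \<open>u\<close> only approximates
  \<open>uh\<close>.\<close>

definition lattice_coord :: "real \<Rightarrow> real \<Rightarrow> real \<Rightarrow> real" where
  "lattice_coord q u x = quad_lattice_inv q u (max x (1 + u))"

locale limit_lattice =
  fixes qh uh :: real
  assumes qh: "0 < qh" "qh < 1" and uh: "0 \<le> uh" "uh < 1"
begin

abbreviation "\<sigma> \<equiv> quad_lattice qh uh"
abbreviation "\<tau> \<equiv> lattice_coord qh uh"

lemma \<tau>: "0 \<le> \<tau> x" "\<sigma> (\<tau> x) = max x (1 + uh)"
proof -
  obtain s where s: "0 \<le> s" "\<sigma> s = max x (1 + uh)"
    using quad_lattice_surj[OF qh uh(1), of "max x (1 + uh)"] by auto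
  hence "\<tau> x = s" unfolding lattice_coord_def using quad_lattice_inv_quad_lattice[OF qh uh, of s] by simp
  thus "0 \<le> \<tau> x" "\<sigma> (\<tau> x) = max x (1 + uh)" using s by auto
qed

lemma \<tau>\<sigma>: "0 \<le> s \<Longrightarrow> \<tau> (\<sigma> s) = s"
proof -
  assume s: "0 \<le> s"
  have "\<sigma> 0 \<le> \<sigma> s" using quad_lattice_mono[OF qh uh, of 0 s] s by simp
  hence "1 + uh \<le> \<sigma> s" using qh by (simp add: quad_lattice_def)
  thus ?thesis unfolding lattice_coord_def using quad_lattice_inv_quad_lattice[OF qh uh s] by (simp add: max_def)
qed

definition lipc :: real where "lipc = 1 / ((- ln qh) * (1 - uh))"

lemma lipc_pos: "0 < lipc"
  unfolding lipc_def using qh uh by (auto intro!: divide_pos_pos mult_neg_pos)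

lemma \<tau>_mono: "x \<le> y \<Longrightarrow> \<tau> x \<le> \<tau> y"
proof -
  assume xy: "x \<le> y"
  show ?thesis
  proof (rule ccontr)
    assume "\<not> \<tau> x \<le> \<tau> y"
    hence "\<sigma> (\<tau> y) < \<sigma> (\<tau> x)" using \<tau>(1)
      by (intro strict_mono_onD[OF quad_lattice_strict_mono[OF qh uh]]) auto
    thus False using xy unfolding \<tau>(2) by auto
  qed
qed

lemma \<tau>_lip: "\<bar>\<tau> x - \<tau> y\<bar> \<le> lipc * \<bar>x - y\<bar>"
proof -
  have *: "\<tau> y - \<tau> x \<le> lipc * (y - x)" if "x \<le> y" for x y
  proof -
    define d where "d = (- ln qh) * (1 - uh)"
    have c: "0 < d" unfolding d_def using qh uh by (auto intro!: mult_neg_pos)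
    have "(\<tau> y - \<tau> x) * d \<le> \<sigma> (\<tau> y) - \<sigma> (\<tau> x)"
      using quad_lattice_gap[OF qh uh \<tau>(1) \<tau>_mono[OF that]] by (simp add: mult.assoc d_def)
    also have "\<dots> \<le> y - x" using that unfolding \<tau>(2) by auto
    finally show ?thesis using c unfolding lipc_def d_def[symmetric] by (simp add: le_divide_eq)
  qed
  show ?thesis
  proof (cases "x \<le> y")
    case True thus ?thesis using *[OF True] \<tau>_mono[OF True] by simp
  next
    case False
    hence yx: "y \<le> x" by simp
    show ?thesis using *[OF yx] \<tau>_mono[OF yx] yx by simp
  qed
qed

lemma ln_q_close:
  assumes N: "1 \<le> N" "2 * A / qh \<le> real N" and q: "0 < q" and close: "(real N)\<^sup>2 * \<bar>q - qh powr (1 / real N)\<bar> \<le> A"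
  shows "\<bar>ln q - ln qh / real N\<bar> \<le> 2 * A / qh / (real N)\<^sup>2"
proof -
  define r where "r = qh powr (1 / real N)"
  have N0: "0 < real N" "real N \<le> (real N)\<^sup>2" using N by (auto simp: power2_eq_square)
  have "qh powr 1 \<le> r" unfolding r_def using qh N by (intro powr_mono') auto
  hence r: "qh \<le> r" using qh by simp
  have qr: "\<bar>q - r\<bar> \<le> A / (real N)\<^sup>2" using close N0 by (simp add: r_def le_divide_eq mult.commute)
  have "A / (real N)\<^sup>2 \<le> qh / 2"
  proof -
    have "2 * A \<le> real N * qh" using N qh by (simp add: divide_le_eq)
    also have "\<dots> \<le> (real N)\<^sup>2 * qh" using N0 qh by (intro mult_right_mono) auto
    finally show ?thesis using N0 by (simp add: divide_le_eq field_simps)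
  qed
  hence ql: "qh / 2 \<le> q" using qr r by linarith
  have "\<bar>ln q - ln r\<bar> \<le> \<bar>q - r\<bar> / (qh / 2)" using ql r qh by (intro ln_diff_le) auto
  also have "\<dots> \<le> (A / (real N)\<^sup>2) / (qh / 2)" using qr qh by (intro divide_right_mono) auto
  finally show ?thesis using qh by (simp add: r_def ln_powr field_simps)
qed

text \<open>The exponent \<open>y\<close> is of order \<open>N\<close> and the error in
  \<open>ln q\<close> of order \<open>1 / N\<^sup>2\<close>, so the exponents
  \<open>y * ln q\<close> differ by \<open>O(1 / N)\<close>; the error in \<open>u\<close>
  contributes the same order.\<close>

lemma quad_lattice_close:
  assumes N: "1 \<le> N" and q: "0 < q" "q < 1" and u: "0 \<le> u" "u < 1"
    and C: "0 \<le> C" "\<bar>ln q - ln qh / real N\<bar> \<le> C / (real N)\<^sup>2" and uA: "real N * \<bar>u - uh\<bar> \<le> A"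
    and y: "0 \<le> y" "y \<le> L * real N" and L: "0 \<le> L"
  shows "\<bar>quad_lattice q u y - \<sigma> (y / real N)\<bar> \<le> (L * C * exp (L * (C - ln qh)) + L * C + A) / real N"
    and "quad_lattice q u y \<le> exp (L * (C - ln qh)) + 1"
proof -
  have N0: "0 < real N" "1 \<le> real N" "real N \<le> (real N)\<^sup>2" using N by (auto simp: power2_eq_square)
  let ?a = "- y * ln q" and ?b = "- (y / real N) * ln qh"
  have ab: "\<bar>?a - ?b\<bar> \<le> L * C / real N"
  proof -
    have "\<bar>?a - ?b\<bar> = y * \<bar>ln q - ln qh / real N\<bar>"
    proof -
      have "?a - ?b = - (y * (ln q - ln qh / real N))" by (simp add: algebra_simps)
      thus ?thesis using y by (simp add: abs_mult)
    qed
    also have "\<dots> \<le> (L * real N) * (C / (real N)\<^sup>2)" using y C L by (intro mult_mono) auto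
    also have "\<dots> = L * C / real N" using N0 by (simp add: power2_eq_square)
    finally show ?thesis .
  qed
  have LC: "L * C / real N \<le> L * C" using L C N0 by (simp add: divide_le_eq mult_left_mono[of 1 "real N" "L * C", simplified])
  have b: "?b \<le> L * (- ln qh)"
  proof -
    have "y / real N \<le> L" using y N0 by (simp add: divide_le_eq)
    hence "(y / real N) * (- ln qh) \<le> L * (- ln qh)" using qh by (intro mult_right_mono) auto
    thus ?thesis by simp
  qed
  have am: "?a \<le> L * (C - ln qh)" using ab LC b by (simp add: right_diff_distrib abs_le_iff)
  have LC0: "0 \<le> L * C" using L C by simp
  have bm: "?b \<le> L * (C - ln qh)" using b LC0 by (simp add: right_diff_distrib)
  have pq: "q powr (- y) = exp ?a" "qh powr (- (y / real N)) = exp ?b" "q powr y = exp (- ?a)" "qh powr (y / real N) = exp (- ?b)"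
    using q qh by (auto simp: powr_def)
  have e1: "\<bar>exp ?a - exp ?b\<bar> \<le> L * C / real N * exp (L * (C - ln qh))"
    by (rule order_trans[OF exp_diff_le[OF am bm]]) (use ab in \<open>intro mult_right_mono, auto\<close>)
  have n0: "- ?a \<le> 0" "- ?b \<le> 0" using mult_nonneg_nonpos[of y "ln q"] mult_nonneg_nonpos[of "y / real N" "ln qh"] y q qh N0 by auto
  have e2: "\<bar>exp (- ?a) - exp (- ?b)\<bar> \<le> L * C / real N"
    using exp_diff_le[OF n0] ab by (simp add: abs_minus_commute)
  have "\<bar>u * exp (- ?a) - uh * exp (- ?b)\<bar> \<le> A / real N + L * C / real N"
  proof -
    have "u * exp (- ?a) - uh * exp (- ?b) = (u - uh) * exp (- ?a) + uh * (exp (- ?a) - exp (- ?b))" by (simp add: algebra_simps)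
    also have "\<bar>\<dots>\<bar> \<le> \<bar>u - uh\<bar> * exp (- ?a) + uh * \<bar>exp (- ?a) - exp (- ?b)\<bar>"
      using uh by (intro order_trans[OF abs_triangle_ineq]) (simp add: abs_mult)
    also have "\<dots> \<le> \<bar>u - uh\<bar> * 1 + 1 * \<bar>exp (- ?a) - exp (- ?b)\<bar>"
      using n0 uh by (intro add_mono mult_mono) auto
    also have "\<dots> \<le> A / real N + L * C / real N"
    proof -
      have "\<bar>u - uh\<bar> \<le> A / real N" using uA N0 by (simp add: le_divide_eq mult.commute)
      thus ?thesis using e2 by simp
    qed
    finally show ?thesis .
  qed
  thus "\<bar>quad_lattice q u y - \<sigma> (y / real N)\<bar> \<le> (L * C * exp (L * (C - ln qh)) + L * C + A) / real N"
    unfolding quad_lattice_def pq using e1 by (simp add: add_divide_distrib)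
  have "u * exp (- ?a) \<le> 1 * 1" using u n0 by (intro mult_mono) auto
  thus "quad_lattice q u y \<le> exp (L * (C - ln qh)) + 1"
    unfolding quad_lattice_def pq using am by (intro add_mono) auto
qed

end

section \<open>The energy problem\<close>

text \<open>The partition function is bounded below by the single weight of a reference state
  \<open>l0\<close>, so the unknown constant \<open>K\<close> cancels. Each of the two compared
  weights costs one \<open>err\<close>, and a union bound gives the cardinality.\<close>

lemma gibbs_ratio_bound:
  fixes W E :: "'a \<Rightarrow> real"
  assumes fin: "finite \<Omega>" and W: "\<And>l. l \<in> \<Omega> \<Longrightarrow> 0 < W l"
    and E: "\<And>l. l \<in> \<Omega> \<Longrightarrow> \<bar>ln (W l) + K + A * E l\<bar> \<le> err"
    and l0: "l0 \<in> \<Omega>" and B: "B \<subseteq> \<Omega>" "\<And>l. l \<in> B \<Longrightarrow> g \<le> E l - E l0" and A: "0 \<le> A"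
  shows "(\<Sum>l\<in>B. W l / (\<Sum>l\<in>\<Omega>. W l)) \<le> real (card \<Omega>) * exp (2 * err - A * g)"
proof -
  let ?Z = "\<Sum>l\<in>\<Omega>. W l"
  have Z: "W l0 \<le> ?Z" using fin W l0 by (intro member_le_sum) (auto intro: less_imp_le)
  have "W l / ?Z \<le> exp (2 * err - A * g)" if l: "l \<in> B" for l
  proof -
    have lO: "l \<in> \<Omega>" using l B by auto
    have "A * g \<le> A * (E l - E l0)" using B(2)[OF l] A by (rule mult_left_mono)
    hence "ln (W l) - ln (W l0) \<le> 2 * err - A * g"
      using E[OF lO] E[OF l0] by (simp add: abs_le_iff right_diff_distrib)
    hence "exp (ln (W l) - ln (W l0)) \<le> exp (2 * err - A * g)" by simp
    hence "W l / W l0 \<le> exp (2 * err - A * g)" using W[OF lO] W[OF l0] by (simp add: exp_diff)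
    moreover have "W l / ?Z \<le> W l / W l0" using W[OF lO] W[OF l0] Z by (intro divide_left_mono) auto
    ultimately show ?thesis by linarith
  qed
  hence "(\<Sum>l\<in>B. W l / ?Z) \<le> real (card B) * exp (2 * err - A * g)"
    using sum_bounded_above[of B "\<lambda>l. W l / ?Z"] by simp
  also have "\<dots> \<le> real (card \<Omega>) * exp (2 * err - A * g)"
    using card_mono[OF fin B(1)] by (intro mult_right_mono) auto
  finally show ?thesis .
qed

text \<open>What the variational argument needs of the admissible functions, detached from the
  lattice. Closure under midpoints serves convexity, closure under pointwise limits serves existence
  of the limit.\<close>

locale energy_problem =
  fixes lo hi lo0 tp \<kappa> \<theta> :: real and D :: "real \<Rightarrow> real" and C :: "(real \<Rightarrow> real) set"
  assumes lohi: "lo < hi" and \<theta>: "0 < \<theta>" and \<kappa>: "0 < \<kappa>" and D: "set_integrable lebesgue {lo0..tp} D"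
    and C_mono: "\<And>F. F \<in> C \<Longrightarrow> mono F"
    and C_rng: "\<And>F x. F \<in> C \<Longrightarrow> 0 \<le> F x \<and> F x \<le> 1"
    and C_lip: "\<And>F x y. F \<in> C \<Longrightarrow> \<bar>F x - F y\<bar> \<le> \<kappa> * \<bar>x - y\<bar>"
    and C_out: "\<And>F G x. F \<in> C \<Longrightarrow> G \<in> C \<Longrightarrow> x \<notin> {lo..hi} \<Longrightarrow> F x = G x"
    and C_conv: "\<And>F G. F \<in> C \<Longrightarrow> G \<in> C \<Longrightarrow> (\<lambda>x. (F x + G x) / 2) \<in> C"
    and C_closed: "\<And>Fn F. (\<And>n::nat. Fn n \<in> C) \<Longrightarrow> (\<And>x. (\<lambda>n. Fn n x) \<longlonglongrightarrow> F x) \<Longrightarrow> F \<in> C"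
    and C_ne: "C \<noteq> {}"
begin

text \<open>The cutoff is 0 for the limit problem on the class \<open>C\<close> and comparable to
  the particle spacing for configurations.\<close>

definition J :: "real \<Rightarrow> (real \<Rightarrow> real) \<Rightarrow> real" where
  "J e F = \<theta> * log_energy lo hi e F - potential_term lo0 tp D F"

definition absD :: real where "absD = (LINT x:{lo0..tp}|lebesgue. \<bar>D x\<bar>)"

definition minJ :: real where "minJ = (INF F\<in>C. J 0 F)"

lemma C_abs: "F \<in> C \<Longrightarrow> \<bar>F x\<bar> \<le> 1"
  using C_rng[of F x] by auto

lemma C_meas: "F \<in> C \<Longrightarrow> F \<in> borel_measurable borel"
  using C_mono by (rule borel_measurable_mono)

lemma J_bounded_below:
  assumes F: "F \<in> C" shows "- (2 * \<theta> + absD) \<le> J 0 F"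
proof -
  note [measurable] = C_meas[OF F]
  have b: "- 1 \<le> (F x)\<^sup>2 - F x" "\<bar>(F x)\<^sup>2 - F x\<bar> \<le> 1" for x
  proof -
    have "(F x)\<^sup>2 \<le> 1" "0 \<le> (F x)\<^sup>2" using C_abs[OF F, of x] by (auto simp: abs_square_le_1)
    thus "- 1 \<le> (F x)\<^sup>2 - F x" "\<bar>(F x)\<^sup>2 - F x\<bar> \<le> 1" using C_rng[OF F, of x] by linarith+
  qed
  have "(LINT x:{lo..hi}|lborel. - 1) \<le> (LINT x:{lo..hi}|lborel. (F x)\<^sup>2 - F x)"
    using b by (intro set_integral_mono) (auto intro!: set_integrable_bounded_Icc[where B = 1])
  hence "- (hi - lo) \<le> (LINT x:{lo..hi}|lborel. (F x)\<^sup>2 - F x)"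
    using lohi by (simp add: set_integral_const emeasure_lborel_Icc_eq)
  hence "2 / (hi - lo) * (- (hi - lo)) \<le> 2 / (hi - lo) * (LINT x:{lo..hi}|lborel. (F x)\<^sup>2 - F x)"
    using lohi by (intro mult_left_mono) auto
  moreover have "2 / (hi - lo) * (- (hi - lo)) = - 2" using lohi by (simp add: field_simps)
  moreover have "0 \<le> increment_energy lo hi 0 F" unfolding increment_energy_def set_lebesgue_integral_def by simp
  ultimately have "- 2 \<le> log_energy lo hi 0 F" unfolding log_energy_def by linarith
  hence "\<theta> * (- 2) \<le> \<theta> * log_energy lo hi 0 F" using \<theta> by (intro mult_left_mono) auto
  moreover have "\<bar>potential_term lo0 tp D F - potential_term lo0 tp D (\<lambda>x. 0)\<bar> \<le> 1 * absD"
    unfolding absD_def using C_abs[OF F] C_meas[OF F] by (intro potential_term_close[OF D]) auto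
  hence "potential_term lo0 tp D F \<le> absD" by (auto simp: potential_term_def)
  ultimately show ?thesis unfolding J_def by linarith
qed

lemma minimiser_limit:
  obtains F0 where "F0 \<in> C"
    "\<And>F. F \<in> C \<Longrightarrow> \<theta> / (hi - lo) * (LINT x:{lo..hi}|lborel. (F x - F0 x)\<^sup>2) \<le> J 0 F - minJ"
proof -
  \<comment> \<open>This is \<theta> times the convexity gain \<open>1 / (2 * (hi - lo))\<close> of
    \<open>log_energy_midpoint\<close>; the potential is linear and contributes none.\<close>
  define c where "c = \<theta> / (2 * (hi - lo))"
  have "\<exists>F0\<in>C. \<forall>F\<in>C. 2 * c * (LINT x:{lo..hi}|lborel. (F x - F0 x)\<^sup>2) \<le> J 0 F - (INF G\<in>C. J 0 G)"
  proof (rule strongly_convex_limit[where C = C and J = "J 0" and \<kappa> = \<kappa> and B = "2 * \<theta> + absD" and c = c and lo = lo and hi = hi])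
    show "C \<noteq> {}" by (rule C_ne)
    show "(\<lambda>x. (F x + G x) / 2) \<in> C" if "F \<in> C" "G \<in> C" for F G by (rule C_conv[OF that])
    show "F \<in> C" if "\<And>n. Fn n \<in> C" "\<And>x. (\<lambda>n. Fn n x) \<longlonglongrightarrow> F x" for Fn :: "nat \<Rightarrow> real \<Rightarrow> real" and F
      by (rule C_closed[OF that])
    show "\<bar>F x - F y\<bar> \<le> \<kappa> * \<bar>x - y\<bar>" if "F \<in> C" for F x y by (rule C_lip[OF that])
    show "0 < \<kappa>" by (rule \<kappa>)
    show "F x = G x" if "F \<in> C" "G \<in> C" "x \<notin> {lo..hi}" for F G x by (rule C_out[OF that])
    show "0 \<le> F x \<and> F x \<le> 1" if "F \<in> C" for F x by (rule C_rng[OF that])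
    show "- (2 * \<theta> + absD) \<le> J 0 F" if "F \<in> C" for F by (rule J_bounded_below[OF that])
    show "0 < c" using lohi \<theta> by (simp add: c_def)
    fix F G assume FG: "F \<in> C" "G \<in> C"
    have "\<theta> * log_energy lo hi 0 (\<lambda>x. (F x + G x) / 2)
      \<le> \<theta> * ((log_energy lo hi 0 F + log_energy lo hi 0 G) / 2 - (LINT x:{lo..hi}|lborel. (F x - G x)\<^sup>2) / (2 * (hi - lo)))"
      using C_meas C_lip C_rng FG lohi \<theta> by (intro mult_left_mono log_energy_midpoint) auto
    also have "\<dots> = (\<theta> * log_energy lo hi 0 F + \<theta> * log_energy lo hi 0 G) / 2 - c * (LINT x:{lo..hi}|lborel. (F x - G x)\<^sup>2)"
      by (simp add: c_def algebra_simps add_divide_distrib)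
    finally show "J 0 (\<lambda>x. (F x + G x) / 2) \<le> (J 0 F + J 0 G) / 2 - c * (LINT x:{lo..hi}|lborel. (F x - G x)\<^sup>2)"
      unfolding J_def potential_term_midpoint[OF D C_meas[OF FG(1)] C_abs[OF FG(1)] C_meas[OF FG(2)] C_abs[OF FG(2)]]
      by argo
  qed
  moreover have "2 * c = \<theta> / (hi - lo)" using lohi by (simp add: c_def divide_simps)
  ultimately show ?thesis using that unfolding minJ_def by auto
qed

lemma J_close:
  assumes F: "mono F" "\<And>x. 0 \<le> F x" "\<And>x. F x \<le> 1" and G: "mono G" "\<And>x. 0 \<le> G x" "\<And>x. G x \<le> 1"
    and FG: "\<And>x. \<bar>F x - G x\<bar> \<le> \<eta>" and e: "0 < e" "e \<le> hi - lo"
  shows "J e F - J e G \<le> \<eta> * (\<theta> * (4 * ln ((hi - lo) / e) + 2) + absD)"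
proof -
  have m: "F \<in> borel_measurable borel" "G \<in> borel_measurable borel" using F(1) G(1) by (auto intro: borel_measurable_mono)
  have a: "\<bar>F x\<bar> \<le> 1" "\<bar>G x\<bar> \<le> 1" for x using F(2,3)[of x] G(2,3)[of x] by auto
  have "\<bar>potential_term lo0 tp D F - potential_term lo0 tp D G\<bar> \<le> \<eta> * absD"
    unfolding absD_def by (rule potential_term_close[OF D m(1) a(1) m(2) a(2) FG])
  moreover have "\<theta> * (log_energy lo hi e F - log_energy lo hi e G) \<le> \<theta> * (4 * \<eta> * ln ((hi - lo) / e) + 2 * \<eta>)"
    using \<theta> by (intro mult_left_mono log_energy_close[OF F G FG e]) auto
  ultimately show ?thesis unfolding J_def by (simp add: algebra_simps abs_le_iff)
qed

lemma J_cutoff: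
  assumes F: "F \<in> C" and e: "0 < e" "e \<le> hi - lo"
  shows "J e F \<le> J 0 F" "J 0 F \<le> J e F + 2 * \<theta> * (hi - lo) * \<kappa>\<^sup>2 * e"
proof -
  note c = increment_energy_cutoff[OF C_meas[OF F] C_lip[OF F] e]
  have "\<theta> * increment_energy lo hi e F \<le> \<theta> * increment_energy lo hi 0 F" using c(1) \<theta> by (intro mult_left_mono) auto
  moreover have "\<theta> * increment_energy lo hi 0 F \<le> \<theta> * (increment_energy lo hi e F + 2 * (hi - lo) * \<kappa>\<^sup>2 * e)" using c(2) \<theta> by (intro mult_left_mono) auto
  ultimately show "J e F \<le> J 0 F" "J 0 F \<le> J e F + 2 * \<theta> * (hi - lo) * \<kappa>\<^sup>2 * e"
    unfolding J_def log_energy_def by (simp_all add: algebra_simps)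
qed

lemma near_minimiser:
  assumes "0 < \<delta>" obtains F where "F \<in> C" "J 0 F \<le> minJ + \<delta>"
proof -
  have "bdd_below (J 0 ` C)" using J_bounded_below by (intro bdd_belowI[of _ "- (2 * \<theta> + absD)"]) auto
  hence "\<exists>F\<in>C. J 0 F < minJ + \<delta>" using cINF_less_iff[OF C_ne, of "J 0" "minJ + \<delta>"] assms unfolding minJ_def by simp
  thus ?thesis using that by fastforce
qed

text \<open>\<open>H\<close> is a deviating configuration and \<open>H'\<close> the reference. Both
  are replaced by members of the class at cutoff \<open>e\<close>, then the cutoff is removed. The
  first condition on \<rho> ensures that at least \<rho> / 2 of the deviation survives the
  replacement of \<open>H\<close> by \<open>F\<close>; Cauchy-Schwarz and the quadratic lower bound
  turn it into the leading term.\<close>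

lemma energy_gap:
  assumes F0: "F0 \<in> C" "\<And>F. F \<in> C \<Longrightarrow> \<theta> / (hi - lo) * (LINT x:{lo..hi}|lborel. (F x - F0 x)\<^sup>2) \<le> J 0 F - minJ"
    and H: "mono H" "\<And>x. 0 \<le> H x" "\<And>x. H x \<le> 1" and F: "F \<in> C" "\<And>x. \<bar>F x - H x\<bar> \<le> \<eta>"
    and H': "mono H'" "\<And>x. 0 \<le> H' x" "\<And>x. H' x \<le> 1" and F': "F' \<in> C" "\<And>x. \<bar>F' x - H' x\<bar> \<le> \<eta>" "J 0 F' \<le> minJ + \<delta>"
    and e: "0 < e" "e \<le> hi - lo"
    and \<rho>: "2 * \<eta> * (hi - lo) \<le> \<rho>" "\<rho> \<le> (LINT x:{lo..hi}|lborel. \<bar>H x - F0 x\<bar>)"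
  shows "\<theta> * \<rho>\<^sup>2 / (4 * (hi - lo)\<^sup>2) - 2 * \<theta> * (hi - lo) * \<kappa>\<^sup>2 * e - 2 * (\<eta> * (\<theta> * (4 * ln ((hi - lo) / e) + 2) + absD)) - \<delta> \<le> J e H - J e H'"
proof -
  define R where "R = hi - lo"
  have R: "0 < R" using lohi by (simp add: R_def)
  have eta: "0 \<le> \<eta>" using F(2)[of 0] by linarith
  have Hm: "H \<in> borel_measurable borel" using H(1) by (rule borel_measurable_mono)
  note [measurable] = Hm C_meas[OF F0(1)] C_meas[OF F(1)]
  have i1: "set_integrable lborel {lo..hi} (\<lambda>x. \<bar>F x - F0 x\<bar>)"
    and i2: "set_integrable lborel {lo..hi} (\<lambda>x. \<bar>H x - F0 x\<bar>)"
    using C_rng[OF F(1)] C_rng[OF F0(1)] H(2,3)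
    by (auto intro!: set_integrable_bounded_Icc[where B = 1] simp: abs_le_iff) (smt (verit))+
  have i3: "set_integrable lborel {lo..hi} (\<lambda>x. \<eta>)" using eta by (auto intro!: set_integrable_bounded_Icc[where B = \<eta>])
  have "(LINT x:{lo..hi}|lborel. \<bar>H x - F0 x\<bar>) \<le> (LINT x:{lo..hi}|lborel. \<bar>F x - F0 x\<bar> + \<eta>)"
  proof (rule set_integral_mono[OF i2])
    show "set_integrable lborel {lo..hi} (\<lambda>x. \<bar>F x - F0 x\<bar> + \<eta>)" by (rule set_integral_add(1)[OF i1 i3])
    show "\<bar>H x - F0 x\<bar> \<le> \<bar>F x - F0 x\<bar> + \<eta>" for x using F(2)[of x] by linarith
  qed
  also have "\<dots> = (LINT x:{lo..hi}|lborel. \<bar>F x - F0 x\<bar>) + R * \<eta>"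
    using lohi by (subst set_integral_add(2)[OF i1 i3]) (simp add: set_integral_const emeasure_lborel_Icc_eq R_def)
  finally have I: "\<rho> / 2 \<le> (LINT x:{lo..hi}|lborel. \<bar>F x - F0 x\<bar>)" using \<rho> by (simp add: R_def algebra_simps)
  have \<rho>0: "0 \<le> \<rho>" using \<rho>(1) eta lohi by (smt (verit) mult_nonneg_nonneg)
  have ff: "\<bar>F x - F0 x\<bar> \<le> 1" for x using C_rng[OF F(1), of x] C_rng[OF F0(1), of x] by auto
  have Q0: "0 \<le> (LINT x:{lo..hi}|lborel. (F x - F0 x)\<^sup>2)" unfolding set_lebesgue_integral_def by simp
  have "\<rho> / 2 \<le> sqrt (R * (LINT x:{lo..hi}|lborel. (F x - F0 x)\<^sup>2))"
    unfolding R_def by (rule order_trans[OF I]) (rule integral_abs_le_sqrt, use ff lohi in auto)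
  hence "(\<rho> / 2)\<^sup>2 \<le> R * (LINT x:{lo..hi}|lborel. (F x - F0 x)\<^sup>2)"
    using \<rho>0 R Q0 by (metis (no_types, lifting) divide_nonneg_nonneg mult_nonneg_nonneg order_less_imp_le power_mono real_sqrt_pow2 zero_le_numeral)
  hence "\<theta> / R\<^sup>2 * (\<rho> / 2)\<^sup>2 \<le> \<theta> / R\<^sup>2 * (R * (LINT x:{lo..hi}|lborel. (F x - F0 x)\<^sup>2))"
    using \<theta> by (intro mult_left_mono) auto
  also have "\<dots> = \<theta> / R * (LINT x:{lo..hi}|lborel. (F x - F0 x)\<^sup>2)" using R by (simp add: power2_eq_square)
  also have "\<dots> \<le> J 0 F - minJ" unfolding R_def by (rule F0(2)[OF F(1)])
  finally have A: "\<theta> * \<rho>\<^sup>2 / (4 * R\<^sup>2) \<le> J 0 F - minJ" by (simp add: power_divide)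
  have Fp: "mono F" "\<And>x. 0 \<le> F x" "\<And>x. F x \<le> 1" using C_mono[OF F(1)] C_rng[OF F(1)] by auto
  have Fp': "mono F'" "\<And>x. 0 \<le> F' x" "\<And>x. F' x \<le> 1" using C_mono[OF F'(1)] C_rng[OF F'(1)] by auto
  have "J e F - J e H \<le> \<eta> * (\<theta> * (4 * ln ((hi - lo) / e) + 2) + absD)" by (rule J_close[OF Fp H F(2) e])
  moreover have "J e H' - J e F' \<le> \<eta> * (\<theta> * (4 * ln ((hi - lo) / e) + 2) + absD)"
    by (rule J_close[OF H' Fp' _ e]) (use F'(2) in \<open>simp add: abs_minus_commute\<close>)
  ultimately show ?thesis using A J_cutoff(2)[OF F(1) e] J_cutoff(1)[OF F'(1) e] F'(3) unfolding R_def by linarith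
qed

end

section \<open>Lattice gases\<close>

text \<open>Counts the few particles that overshoot the interval on which the potential is
  represented by its derivative.\<close>

lemma card_separated_points:
  fixes y :: "nat \<Rightarrow> real"
  assumes e: "0 < e" and gap: "\<And>i j. 1 \<le> i \<Longrightarrow> i < j \<Longrightarrow> j \<le> N \<Longrightarrow> (real j - real i) * e \<le> y j - y i"
    and S: "S \<subseteq> {1..N}" "\<And>j. j \<in> S \<Longrightarrow> A \<le> y j \<and> y j \<le> A + d" and d: "0 \<le> d"
  shows "real (card S) \<le> d / e + 1"
proof (cases "S = {}")
  case True thus ?thesis using e d by simp
next
  case False
  have fin: "finite S" using S(1) finite_subset by blast
  define i j where "i = Min S" and "j = Max S"
  have ij: "i \<in> S" "j \<in> S" "i \<le> j" using fin False by (auto simp: i_def j_def)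
  have "S \<subseteq> {i..j}" using fin by (auto simp: i_def j_def)
  hence "card S \<le> card {i..j}" by (intro card_mono) auto
  hence c: "real (card S) \<le> (real j - real i) + 1" using ij(3) by simp
  have "(real j - real i) * e \<le> d"
  proof (cases "i = j")
    case False
    hence "(real j - real i) * e \<le> y j - y i" using ij S(1) by (intro gap) auto
    thus ?thesis using S(2)[OF ij(1)] S(2)[OF ij(2)] by linarith
  qed (use d in simp)
  hence "real j - real i \<le> d / e" using e by (simp add: le_divide_eq)
  thus ?thesis using c by linarith
qed

locale lattice_gas = limit_lattice qh uh for qh uh :: real +
  fixes k :: nat and \<theta> :: real
    and q u :: "nat \<Rightarrow> real" and M :: "nat \<Rightarrow> nat"
    and n :: "nat \<Rightarrow> nat \<Rightarrow> nat" and a b :: "nat \<Rightarrow> nat \<Rightarrow> int"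
    and w VN :: "nat \<Rightarrow> real \<Rightarrow> real"
    and Mh :: real and ah bh \<nu> :: "nat \<Rightarrow> real"
    and V :: "real \<Rightarrow> real" and I :: "real set"
    and A1 A2 A3 A4 A5 A6 A7 :: real
  assumes k: "1 \<le> k" and \<theta>: "0 < \<theta>"
    and fs: "\<forall>N\<ge>1. finite_system k \<theta> N (q N) (M N) (u N) (n N) (a N) (b N) (w N)"
    and Mh: "1 \<le> Mh" and A1: "0 < A1"
      "\<forall>N\<ge>1. max (max ((real N)\<^sup>2 * \<bar>q N - qh powr (1 / real N)\<bar>) \<bar>real (M N) - real N * Mh\<bar>)
                 (real N * \<bar>u N - uh\<bar>) \<le> A1"
    and ends: "1 + uh \<le> ah 1" "\<forall>i\<in>{1..k}. ah i < bh i"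
      "\<forall>i\<in>{1..<k}. bh i < ah (i + 1)" "bh k \<le> quad_lattice qh uh (Mh + \<theta> - 1)"
    and A2: "0 < A2"
      "\<forall>N\<ge>2. \<forall>i\<in>{1..k}. \<bar>alpha_pt \<theta> (q N) (u N) (n N) (a N) i - ah i\<bar> \<le> A2 * ln (real N) / real N \<and>
                           \<bar>beta_pt \<theta> (q N) (u N) (n N) (b N) i - bh i\<bar> \<le> A2 * ln (real N) / real N"
    and weights: "\<forall>N\<ge>1. \<forall>i\<in>{1..k}. \<forall>x\<in>{alpha_pt \<theta> (q N) (u N) (n N) (a N) i..beta_minus_pt \<theta> (q N) (u N) (n N) (b N) i}.
          w N x = exp (- real N * VN N x)"
    and A3: "0 < A3"
      "\<forall>N\<ge>2. \<forall>i\<in>{1..k}. \<forall>x\<in>{alpha_pt \<theta> (q N) (u N) (n N) (a N) i..beta_minus_pt \<theta> (q N) (u N) (n N) (b N) i}.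
          \<bar>VN N x - V x\<bar> \<le> A3 * ln (real N) / real N"
    and I: "{1 + uh..quad_lattice qh uh (Mh + \<theta> - 1)} \<subseteq> I"
      "\<forall>N\<ge>1. \<forall>i\<in>{1..k}. {alpha_pt \<theta> (q N) (u N) (n N) (a N) i..beta_minus_pt \<theta> (q N) (u N) (n N) (b N) i} \<subseteq> I"
    and V: "continuous_on I V" "0 < A4" "\<forall>x\<in>I. \<bar>V x\<bar> \<le> A4" "0 < A5"
      "\<forall>s\<in>{1 + uh..quad_lattice qh uh (Mh + \<theta> - 1)} - (ah ` {1..k} \<union> bh ` {1..k}).
         \<exists>D. (V has_real_derivative D) (at s within {1 + uh..quad_lattice qh uh (Mh + \<theta> - 1)}) \<and>
             \<bar>D\<bar> \<le> A5 * (1 + (\<Sum>i = 1..k. \<bar>ln \<bar>s - ah i\<bar>\<bar> + \<bar>ln \<bar>s - bh i\<bar>\<bar>))"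
    and A6: "0 < A6" "\<forall>\<^sub>F N in sequentially. \<forall>i\<in>{1..k}. A6 < real (n N i) / real N"
    and filling: "0 < A7" "\<forall>i\<in>{1..k}. 0 < \<nu> i" "(\<Sum>i = 1..k. \<nu> i) = 1"
      "\<forall>N\<ge>2. \<forall>i\<in>{1..k}. \<bar>real (n N i) / real N - \<nu> i\<bar> \<le> A7 * ln (real N) / real N"
begin

section \<open>Constants, and the finite lattice compared with its limit\<close>

definition tp :: real where "tp = \<sigma> (Mh + \<theta> - 1)"
definition pa :: "nat \<Rightarrow> real" where "pa i = \<tau> (ah i)"
definition pb :: "nat \<Rightarrow> real" where "pb i = \<tau> (bh i)"
definition c :: "nat \<Rightarrow> real" where "c i = (\<Sum>j = 1..i. \<nu> j)"
text \<open>For large \<open>N\<close>, the coordinates of all particles and block ends are at most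
  \<open>L * N\<close>, \<open>Cq / N\<^sup>2\<close> is the error in \<open>ln q\<close>,
  \<open>hi\<close> lies above every particle, \<open>Cl / N\<close> is the distance of the lattice
  from its limit, and \<open>cg / N\<close> bounds the particle spacing from below. The two halves
  in \<open>cg\<close> leave room for replacing \<open>q N\<close> and \<open>u N\<close> by their
  limits.\<close>

definition L :: real where "L = Mh + A1 + 2 + \<theta>"
definition Cq :: real where "Cq = 2 * A1 / qh"
definition hi :: real where "hi = exp (L * (Cq - ln qh)) + 2"
definition Cl :: real where "Cl = L * Cq * exp (L * (Cq - ln qh)) + L * Cq + A1"
definition cg :: real where "cg = \<theta> * (- ln qh / 2) * ((1 - uh) / 2)"
definition eN :: "nat \<Rightarrow> real" where "eN N = cg / real N"
definition r :: "nat \<Rightarrow> real" where "r N = ln (real N) / real N"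
definition Ce :: real where "Ce = lipc * (Cl + A2) + real k * A7"

text \<open>All lower bounds on \<open>N\<close> in one predicate. \<open>3 \<le> N\<close> gives
  \<open>1 \<le> ln N\<close>, so that 1 / N is at most \<open>r N\<close>; nonempty blocks make the
  coordinate at the right end of a block nonnegative.\<close>

definition big :: "nat \<Rightarrow> bool" where
  "big N \<longleftrightarrow> 3 \<le> N \<and> Cq \<le> real N \<and> 2 * Cq / (- ln qh) \<le> real N \<and> 2 * A1 / (1 - uh) \<le> real N \<and> cg \<le> real N \<and>
     (\<forall>i\<in>{1..k}. 0 < n N i)"

lemma lnqh: "0 < - ln qh" using qh by simp

lemma const_pos: "0 < L" "0 < Cq" "0 < cg" "0 \<le> Cl" "2 < hi" "0 < Ce" "0 < hi"
proof -
  show L: "0 < L" using Mh A1 \<theta> by (simp add: L_def)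
  show Cq: "0 < Cq" using A1 qh by (simp add: Cq_def)
  show "0 < cg" unfolding cg_def using \<theta> lnqh uh by (intro mult_pos_pos) auto
  show Cl: "0 \<le> Cl" unfolding Cl_def using L Cq A1 by (intro add_nonneg_nonneg mult_nonneg_nonneg) auto
  show "2 < hi" "0 < hi" by (auto simp: hi_def add_pos_pos)
  have "0 < Cl + A2" using Cl A2(1) by simp
  hence "0 < lipc * (Cl + A2)" using lipc_pos by (intro mult_pos_pos)
  moreover have "0 \<le> real k * A7" using filling(1) by simp
  ultimately show "0 < Ce" unfolding Ce_def by linarith
qed

lemma eventually_big: "\<forall>\<^sub>F N in sequentially. big N"
proof -
  have *: "\<forall>\<^sub>F N in sequentially. x \<le> real N" for x
    using filterlim_real_sequentially by (auto simp: filterlim_at_top)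
  have n: "\<forall>\<^sub>F N in sequentially. \<forall>i\<in>{1..k}. 0 < n N i"
    using A6(2)
  proof eventually_elim
    case (elim N)
    show ?case
    proof
      fix i assume "i \<in> {1..k}"
      hence "0 < real (n N i) / real N" using elim A6(1) by force
      thus "0 < n N i" by (auto simp: zero_less_divide_iff)
    qed
  qed
  show ?thesis unfolding big_def
    by (intro eventually_conj eventually_ge_at_top * n)
qed

lemma lattice_params:
  assumes "1 \<le> N"
  shows "0 < q N" "q N < 1" "0 \<le> u N" "u N < 1" "block_end (n N) k = N" "int N - 1 \<le> int (M N)"
    "\<And>i. i \<in> {1..k} \<Longrightarrow> 0 \<le> a N i \<and> a N i \<le> b N i - 1 \<and> b N i - 1 \<le> int (M N) - int N + 1"
    "\<And>i. i \<in> {1..<k} \<Longrightarrow> b N i \<le> a N (i + 1)"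
    "(real N)\<^sup>2 * \<bar>q N - qh powr (1 / real N)\<bar> \<le> A1" "\<bar>real (M N) - real N * Mh\<bar> \<le> A1" "real N * \<bar>u N - uh\<bar> \<le> A1"
  using fs A1(2) assms unfolding finite_system_def by (auto simp: max_def split: if_splits)

lemma r_bounds:
  assumes "big N" shows "1 / real N \<le> r N" "0 < r N" "1 \<le> ln (real N)"
proof -
  have "exp 1 \<le> (3::real)" using exp_le by simp
  also have "\<dots> \<le> real N" using assms by (auto simp: big_def)
  finally have "exp 1 \<le> real N" .
  thus l: "1 \<le> ln (real N)" using assms by (subst ln_ge_iff) (auto simp: big_def)
  show "1 / real N \<le> r N" unfolding r_def using l by (intro divide_right_mono) auto
  show "0 < r N" unfolding r_def using l assms by (intro divide_pos_pos) (auto simp: big_def)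
qed

lemma ln_q:
  assumes "big N" shows "\<bar>ln (q N) - ln qh / real N\<bar> \<le> Cq / (real N)\<^sup>2"
    "- ln qh / 2 / real N \<le> - ln (q N)" "- ln (q N) \<le> 2 * (- ln qh) / real N"
proof -
  have N: "1 \<le> N" "0 < real N" using assms by (auto simp: big_def)
  note p = lattice_params[OF N(1)]
  show 1: "\<bar>ln (q N) - ln qh / real N\<bar> \<le> Cq / (real N)\<^sup>2"
    using ln_q_close[OF N(1) _ p(1) p(9)] assms unfolding Cq_def big_def by auto
  have "Cq \<le> (- ln qh / 2) * real N" using assms lnqh unfolding big_def by (auto simp: field_simps)
  hence "Cq / (real N)\<^sup>2 \<le> (- ln qh / 2) * real N / (real N)\<^sup>2" by (intro divide_right_mono) auto
  also have "\<dots> = (- ln qh / real N) / 2" using N by (simp add: power2_eq_square)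
  finally have qb: "Cq / (real N)\<^sup>2 \<le> (- ln qh / real N) / 2" .
  define X where "X = - ln qh / real N"
  have 2: "Cq / (real N)\<^sup>2 \<le> X / 2" using qb by (simp only: X_def)
  have 3: "0 < X" unfolding X_def using N lnqh by (intro divide_pos_pos)
  have 4: "- ln qh / 2 / real N = X / 2" "2 * (- ln qh) / real N = 2 * X" "ln qh / real N = - X"
    by (simp_all add: X_def)
  have 5: "\<bar>ln (q N) + X\<bar> \<le> Cq / (real N)\<^sup>2" using 1 unfolding 4 by simp
  show "- ln qh / 2 / real N \<le> - ln (q N)" unfolding 4 using 5 2 3 by linarith
  show "- ln (q N) \<le> 2 * (- ln qh) / real N" unfolding 4 using 5 2 3 by linarith
qed

lemma u_bound: assumes "big N" shows "u N \<le> (1 + uh) / 2"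
proof -
  have N: "1 \<le> N" "0 < real N" using assms by (auto simp: big_def)
  have "\<bar>u N - uh\<bar> \<le> A1 / real N" using lattice_params(11)[OF N(1)] N by (simp add: le_divide_eq mult.commute)
  also have "\<dots> \<le> (1 - uh) / 2" using assms uh N unfolding big_def by (simp add: divide_le_eq field_simps)
  finally have "u N - uh \<le> (1 - uh) / 2" by linarith
  thus ?thesis by (simp add: field_simps)
qed

lemma quad_close:
  assumes N: "big N" and y: "0 \<le> y" "y \<le> L * real N"
  shows "\<bar>quad_lattice (q N) (u N) y - \<sigma> (y / real N)\<bar> \<le> Cl / real N"
    and "quad_lattice (q N) (u N) y \<le> hi" and "1 \<le> quad_lattice (q N) (u N) y" and "uh + 1 - A1 / real N \<le> quad_lattice (q N) (u N) y"
proof -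
  have N1: "1 \<le> N" and N0: "0 < real N" using N by (auto simp: big_def)
  note p = lattice_params[OF N1]
  note qc = quad_lattice_close[OF N1 p(1-4) less_imp_le[OF const_pos(2)] ln_q(1)[OF N] p(11) y less_imp_le[OF const_pos(1)]]
  show "\<bar>quad_lattice (q N) (u N) y - \<sigma> (y / real N)\<bar> \<le> Cl / real N" using qc(1) unfolding Cl_def .
  show "quad_lattice (q N) (u N) y \<le> hi" using qc(2) unfolding hi_def by simp
  have "quad_lattice (q N) (u N) 0 \<le> quad_lattice (q N) (u N) y" using p y by (intro quad_lattice_mono) auto
  hence 1: "1 + u N \<le> quad_lattice (q N) (u N) y" using p by (simp add: quad_lattice_def)
  thus "1 \<le> quad_lattice (q N) (u N) y" using p by simp
  have "\<bar>u N - uh\<bar> \<le> A1 / real N" using p(11) N0 by (simp add: le_divide_eq mult.commute)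
  thus "uh + 1 - A1 / real N \<le> quad_lattice (q N) (u N) y" using 1 by linarith
qed

lemma coord_close:
  assumes N: "big N" and y: "0 \<le> y" "y \<le> L * real N"
  shows "\<bar>\<tau> (quad_lattice (q N) (u N) y) - y / real N\<bar> \<le> lipc * Cl / real N"
proof -
  have "0 \<le> y / real N" using y by simp
  hence "\<bar>\<tau> (quad_lattice (q N) (u N) y) - y / real N\<bar> = \<bar>\<tau> (quad_lattice (q N) (u N) y) - \<tau> (\<sigma> (y / real N))\<bar>"
    by (simp add: \<tau>\<sigma>)
  also have "\<dots> \<le> lipc * \<bar>quad_lattice (q N) (u N) y - \<sigma> (y / real N)\<bar>" by (rule \<tau>_lip)
  also have "\<dots> \<le> lipc * (Cl / real N)" using quad_close(1)[OF N y] lipc_pos by (intro mult_left_mono) auto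
  finally show ?thesis by simp
qed

lemma point_bound:
  assumes N: "big N" and i: "i \<in> {1..k}" and e: "0 \<le> e" "e \<le> b N i" and j: "0 \<le> m" "m \<le> real N"
  shows "0 \<le> of_int e + m * \<theta>" "of_int e + m * \<theta> \<le> L * real N"
proof -
  have N1: "1 \<le> N" using N by (auto simp: big_def)
  note p = lattice_params[OF N1]
  have "e \<le> int (M N) - int N + 2" using p(7)[OF i] e by linarith
  hence "real_of_int e \<le> real (M N) - real N + 2" by linarith
  also have "\<dots> \<le> real N * Mh + A1 + 1" using p(10) N1 by (simp add: abs_le_iff)
  also have "\<dots> \<le> real N * Mh + real N * A1 + real N * 2"
    using A1(1) N1 by (intro add_mono) (auto simp: mult_le_cancel_right1)
  finally have "real_of_int e \<le> real N * (Mh + A1 + 2)" by (simp add: algebra_simps)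
  moreover have "m * \<theta> \<le> real N * \<theta>" using j \<theta> by (intro mult_right_mono) auto
  ultimately show "of_int e + m * \<theta> \<le> L * real N" unfolding L_def by (simp add: algebra_simps)
  show "0 \<le> of_int e + m * \<theta>" using e j \<theta> by simp
qed

lemma block_end_c:
  assumes N: "big N" and i: "i \<le> k"
  shows "\<bar>real (block_end (n N) i) / real N - c i\<bar> \<le> real k * A7 * r N"
proof -
  have N2: "2 \<le> N" using N by (auto simp: big_def)
  have "real (block_end (n N) i) / real N - c i = (\<Sum>j = 1..i. real (n N j) / real N - \<nu> j)"
    by (simp add: block_end_def c_def sum_divide_distrib sum_subtractf)
  also have "\<bar>\<dots>\<bar> \<le> (\<Sum>j = 1..i. A7 * r N)"
    using filling(4) N2 i by (intro order_trans[OF sum_abs] sum_mono) (auto simp: r_def)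
  also have "\<dots> = real i * (A7 * r N)" by simp
  also have "\<dots> \<le> real k * (A7 * r N)" using i filling(1) r_bounds(2)[OF N] by (intro mult_right_mono) auto
  finally show ?thesis by (simp add: mult.assoc)
qed

lemma end_close:
  assumes N: "big N" and y: "0 \<le> y" "y \<le> L * real N" and cl: "\<bar>quad_lattice (q N) (u N) y - z\<bar> \<le> A2 * r N"
  shows "\<bar>\<tau> z - y / real N\<bar> \<le> Ce * r N"
proof -
  have "\<bar>\<tau> z - \<tau> (quad_lattice (q N) (u N) y)\<bar> \<le> lipc * \<bar>z - quad_lattice (q N) (u N) y\<bar>" by (rule \<tau>_lip)
  also have "\<dots> \<le> lipc * (A2 * r N)" using cl lipc_pos by (intro mult_left_mono) (auto simp: abs_minus_commute)
  finally have 1: "\<bar>\<tau> z - \<tau> (quad_lattice (q N) (u N) y)\<bar> \<le> lipc * (A2 * r N)" .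
  have "lipc * Cl * (1 / real N) \<le> lipc * Cl * r N" using r_bounds[OF N] lipc_pos const_pos by (intro mult_left_mono) auto
  hence "\<bar>\<tau> z - y / real N\<bar> \<le> lipc * (A2 * r N) + lipc * Cl * r N" using 1 coord_close[OF N y] by simp
  also have "\<dots> \<le> Ce * r N"
  proof -
    have "0 \<le> real k * A7 * r N" using filling r_bounds[OF N] by simp
    thus ?thesis unfolding Ce_def by (simp add: algebra_simps)
  qed
  finally show ?thesis .
qed

text \<open>The hypotheses on block ends concern lattice values; the Lipschitz map
  \<open>\<tau>\<close> transfers them to rescaled coordinates. \<open>Ce\<close> bounds the errors
  of positions and of levels simultaneously.\<close>

lemma system:
  assumes N: "big N" shows "block_system k N \<theta> (n N) (a N) (b N) pa pb c (Ce * r N)"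
proof
  have N1: "1 \<le> N" "2 \<le> N" using N by (auto simp: big_def)
  note p = lattice_params[OF N1(1)]
  show "0 < \<theta>" "1 \<le> N" "block_end (n N) k = N" using \<theta> N1 p by auto
  show "a N i \<le> b N i - 1" if "i \<in> {1..k}" for i using p(7)[OF that] by simp
  show "b N i \<le> a N (i + 1)" if "i \<in> {1..<k}" for i using p(8)[OF that] .
  show "\<bar>pa i - (of_int (a N i) + real (block_end (n N) (i - 1)) * \<theta>) / real N\<bar> \<le> Ce * r N" if i: "i \<in> {1..k}" for i
    unfolding pa_def
  proof (rule end_close[OF N])
    have "block_end (n N) (i - 1) \<le> N" using block_end_mono[of "i - 1" k "n N"] i p(5) by auto
    thus "0 \<le> of_int (a N i) + real (block_end (n N) (i - 1)) * \<theta>"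
      "of_int (a N i) + real (block_end (n N) (i - 1)) * \<theta> \<le> L * real N"
      using point_bound[OF N i, of "a N i"] p(7)[OF i] by auto
    show "\<bar>quad_lattice (q N) (u N) (of_int (a N i) + real (block_end (n N) (i - 1)) * \<theta>) - ah i\<bar> \<le> A2 * r N"
      using A2(2) N1(2) i unfolding alpha_pt_def r_def by auto
  qed
  show "\<bar>pb i - (of_int (b N i) + (real (block_end (n N) i) - 1) * \<theta>) / real N\<bar> \<le> Ce * r N" if i: "i \<in> {1..k}" for i
    unfolding pb_def
  proof (rule end_close[OF N])
    have 1: "block_end (n N) i \<le> N" using block_end_mono[of i k "n N"] i p(5) by auto
    have "n N i \<le> block_end (n N) i" unfolding block_end_def using i by (intro member_le_sum) auto
    moreover have "0 < n N i" using N i by (auto simp: big_def)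
    ultimately have "1 \<le> block_end (n N) i" by linarith
    thus "0 \<le> of_int (b N i) + (real (block_end (n N) i) - 1) * \<theta>"
      "of_int (b N i) + (real (block_end (n N) i) - 1) * \<theta> \<le> L * real N"
      using point_bound[OF N i, of "b N i" "real (block_end (n N) i) - 1"] p(7)[OF i] 1 by auto
    show "\<bar>quad_lattice (q N) (u N) (of_int (b N i) + (real (block_end (n N) i) - 1) * \<theta>) - bh i\<bar> \<le> A2 * r N"
      using A2(2) N1(2) i unfolding beta_pt_def r_def by auto
  qed
  show "\<bar>real (block_end (n N) i) / real N - c i\<bar> \<le> Ce * r N" if i: "i \<le> k" for i
  proof -
    have "0 \<le> lipc * (Cl + A2) * r N" using lipc_pos const_pos A2 r_bounds[OF N] by simp
    thus ?thesis using block_end_c[OF N i] unfolding Ce_def by (simp add: distrib_right)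
  qed
qed

text \<open>The data of the block system, restated because they do not depend on \<open>N\<close>
  and are wanted without fixing one.\<close>

definition Dt :: "(real \<times> real) set" where
  "Dt = (\<lambda>i. (pa i, c (i - 1))) ` {1..k} \<union> (\<lambda>i. (pb i, c i)) ` {1..k}"

lemma data_Dt: "big N \<Longrightarrow> block_system.data k pa pb c = Dt"
  using block_system.data_def[OF system] by (simp add: Dt_def)

lemma r_tendsto: "r \<longlonglongrightarrow> 0"
  unfolding r_def[abs_def] using lim_ln_over_n by simp

lemma c_bounds: assumes "i \<le> k" shows "0 \<le> c i" "c i \<le> 1"
proof -
  show "0 \<le> c i" unfolding c_def using filling assms by (intro sum_nonneg) (auto intro: less_imp_le)
  have "c i \<le> c k" unfolding c_def using filling assms by (intro sum_mono2) (auto intro: less_imp_le)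
  thus "c i \<le> 1" using filling by (simp add: c_def)
qed

text \<open>The data are fixed, while every large finite system shows that they are compatible up to
  \<open>O (r N)\<close>. Letting \<open>N\<close> grow removes the defect.\<close>

lemma compatible_Dt: "compatible \<theta> Dt"
  unfolding compatible_def
proof (intro conjI ballI)
  fix x assume "x \<in> Dt"
  thus "case x of (p, v) \<Rightarrow> 0 \<le> v \<and> v \<le> 1" using c_bounds by (auto simp: Dt_def)
next
  have "v' - v \<le> max 0 (p' - p) / \<theta>" if d: "(p, v) \<in> Dt" "(p', v') \<in> Dt" for p v p' v'
  proof -
    have lim: "(\<lambda>N. max 0 (p' - p) / \<theta> + 2 * (Ce * r N + (Ce * r N + \<theta> / real N) / \<theta>)) \<longlonglongrightarrow>
       max 0 (p' - p) / \<theta> + 2 * (Ce * 0 + (Ce * 0 + 0) / \<theta>)"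
      using \<theta> by (intro tendsto_intros r_tendsto lim_const_over_n) auto
    have "\<forall>\<^sub>F N in sequentially. v' - v \<le> max 0 (p' - p) / \<theta> + 2 * (Ce * r N + (Ce * r N + \<theta> / real N) / \<theta>)"
      using eventually_big
    proof eventually_elim
      case (elim N)
      show ?case using block_system.data_compatible_approx[OF system[OF elim]] d data_Dt[OF elim] by simp
    qed
    from tendsto_lowerbound[OF lim this] show ?thesis by simp
  qed
  thus "case x of (p, v) \<Rightarrow> \<forall>(p', v')\<in>Dt. v' - v \<le> max 0 (p' - p) / \<theta>" if "x \<in> Dt" for x using that by auto
qed


section \<open>The class of admissible limiting distribution functions\<close>

definition CC :: "(real \<Rightarrow> real) set" where
  "CC = (\<lambda>G x. G (\<tau> x)) ` cdf_class \<theta> Dt"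

definition D :: "real \<Rightarrow> real" where
  "D = (SOME D. set_integrable lebesgue {1 + uh..tp} D \<and>
     (\<forall>y\<in>{1 + uh..tp}. V y = V tp - (LINT x:{1 + uh..tp}|lebesgue. D x * (if y \<le> x then 1 else 0))))"

lemma ah_mono: "1 \<le> i \<Longrightarrow> i \<le> j \<Longrightarrow> j \<le> k \<Longrightarrow> ah i \<le> ah j"
proof (induction j)
  case (Suc j)
  show ?case
  proof (cases "i = Suc j")
    case False
    hence "ah i \<le> ah j" using Suc by auto
    moreover have "ah j < bh j" "bh j < ah (Suc j)" using ends False Suc by auto
    ultimately show ?thesis by linarith
  qed simp
qed simp

lemma bh_le: assumes "i \<in> {1..k}" shows "bh i \<le> bh k"
proof (cases "i = k")
  case False
  hence "bh i < ah (i + 1)" using ends assms by auto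
  moreover have "ah (i + 1) \<le> ah k" using assms False by (intro ah_mono) auto
  moreover have "ah k < bh k" using ends k by auto
  ultimately show ?thesis by linarith
qed simp

lemma lo_tp: "1 + uh < tp"
proof -
  have "ah 1 < bh 1" "bh 1 \<le> bh k" using ends bh_le[of 1] k by auto
  thus ?thesis using ends unfolding tp_def by linarith
qed

lemma tp_hi: "tp < hi"
proof -
  have S: "0 \<le> Mh + \<theta> - 1" "Mh + \<theta> - 1 \<le> L" using Mh \<theta> A1 by (auto simp: L_def)
  have "qh powr (- (Mh + \<theta> - 1)) = exp ((Mh + \<theta> - 1) * (- ln qh))" using qh by (simp add: powr_def algebra_simps)
  also have "\<dots> \<le> exp (L * (Cq - ln qh))"
    using S lnqh const_pos by (simp only: exp_le_cancel_iff, intro mult_mono) auto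
  finally have "qh powr (- (Mh + \<theta> - 1)) \<le> exp (L * (Cq - ln qh))" .
  moreover have "uh * qh powr (Mh + \<theta> - 1) \<le> 1 * 1" using qh uh S by (intro mult_mono powr_le1) auto
  ultimately show ?thesis unfolding tp_def quad_lattice_def hi_def by linarith
qed

lemma D: "set_integrable lebesgue {1 + uh..tp} D"
   "y \<in> {1 + uh..tp} \<Longrightarrow> V y = V tp - (LINT x:{1 + uh..tp}|lebesgue. D x * (if y \<le> x then 1 else 0))"
proof -
  have "\<exists>D. set_integrable lebesgue {1 + uh..tp} D \<and>
     (\<forall>y\<in>{1 + uh..tp}. V y = V tp - (LINT x:{1 + uh..tp}|lebesgue. D x * (if y \<le> x then 1 else 0)))"
  proof (rule potential_density)
    show "1 + uh \<le> tp" using lo_tp by simp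
    show "continuous_on {1 + uh..tp} V" using V(1) I(1) unfolding tp_def by (rule continuous_on_subset)
    show "finite {1..k}" "0 < A5" using V(4) by auto
    fix s assume "s \<in> {1 + uh..tp} - (ah ` {1..k} \<union> bh ` {1..k})"
    thus "\<exists>D. (V has_real_derivative D) (at s within {1 + uh..tp}) \<and>
             \<bar>D\<bar> \<le> A5 * (1 + (\<Sum>i = 1..k. \<bar>ln \<bar>s - ah i\<bar>\<bar> + \<bar>ln \<bar>s - bh i\<bar>\<bar>))"
      using V(5) unfolding tp_def by blast
  qed
  note someI_ex[OF this, folded D_def]
  thus "set_integrable lebesgue {1 + uh..tp} D"
   "y \<in> {1 + uh..tp} \<Longrightarrow> V y = V tp - (LINT x:{1 + uh..tp}|lebesgue. D x * (if y \<le> x then 1 else 0))"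
    by blast+
qed

lemma cdf_classD:
  assumes "G \<in> cdf_class \<theta> Dt"
  shows "mono_lip \<theta> G" "0 \<le> G s" "G s \<le> 1" "i \<in> {1..k} \<Longrightarrow> G (pa i) = c (i - 1)" "i \<in> {1..k} \<Longrightarrow> G (pb i) = c i"
proof -
  have GD: "G p = v" if "(p, v) \<in> Dt" for p v using assms that unfolding cdf_class_def by auto
  show "i \<in> {1..k} \<Longrightarrow> G (pa i) = c (i - 1)" "i \<in> {1..k} \<Longrightarrow> G (pb i) = c i"
    by (auto intro!: GD simp: Dt_def)
qed (use assms in \<open>auto simp: cdf_class_def\<close>)

lemma mono_lip_abs:
  assumes "mono_lip \<theta> G" shows "\<bar>G s - G t\<bar> \<le> \<bar>s - t\<bar> / \<theta>"
proof (cases "s \<le> t")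
  case True thus ?thesis using mono_lipD[OF assms True] by auto
next
  case False
  hence "t \<le> s" by simp
  thus ?thesis using mono_lipD[OF assms \<open>t \<le> s\<close>] by auto
qed

lemma CC_basic:
  assumes "F \<in> CC"
  shows "mono F" "0 \<le> F x" "F x \<le> 1" "\<bar>F x - F y\<bar> \<le> lipc / \<theta> * \<bar>x - y\<bar>"
    "i \<in> {1..k} \<Longrightarrow> F (ah i) = c (i - 1)" "i \<in> {1..k} \<Longrightarrow> F (bh i) = c i"
    "x \<le> ah 1 \<Longrightarrow> F x = 0" "bh k \<le> x \<Longrightarrow> F x = 1"
proof -
  obtain G where G: "G \<in> cdf_class \<theta> Dt" "F = (\<lambda>x. G (\<tau> x))" using assms by (auto simp: CC_def)
  note g = cdf_classD[OF G(1)]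
  show m: "mono F" unfolding G(2) using mono_lipD(1)[OF g(1) \<tau>_mono] by (auto simp: mono_def)
  show 01: "0 \<le> F x" "F x \<le> 1" for x unfolding G(2) using g by auto
  have "\<bar>F x - F y\<bar> \<le> \<bar>\<tau> x - \<tau> y\<bar> / \<theta>" unfolding G(2) by (rule mono_lip_abs[OF g(1)])
  also have "\<dots> \<le> (lipc * \<bar>x - y\<bar>) / \<theta>" using \<theta> \<tau>_lip by (intro divide_right_mono) auto
  finally show "\<bar>F x - F y\<bar> \<le> lipc / \<theta> * \<bar>x - y\<bar>" by simp
  show ca: "i \<in> {1..k} \<Longrightarrow> F (ah i) = c (i - 1)" for i using g(4) by (simp add: G(2) pa_def)
  show cb: "i \<in> {1..k} \<Longrightarrow> F (bh i) = c i" for i using g(5) by (simp add: G(2) pb_def)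
  show "F x = 0" if "x \<le> ah 1"
    using monoD[OF m that] ca[of 1] k 01[of x] by (simp add: c_def)
  show "F x = 1" if "bh k \<le> x"
    using monoD[OF m that] cb[of k] k 01[of x] filling by (simp add: c_def)
qed

text \<open>Interpolating one actual configuration of a large system already gives a function that
  meets the limit data exactly.\<close>

lemma CC_nonempty: "CC \<noteq> {}"
proof -
  obtain N where N: "big N" using eventually_big eventually_happens sequentially_bot by blast
  interpret B: block_system k N \<theta> "n N" "a N" "b N" pa pb c "Ce * r N" by (rule system[OF N])
  show ?thesis using B.config_to_class[OF B.base_config _ k] compatible_Dt unfolding data_Dt[OF N] CC_def by blast
qed

text \<open>The limit is known only on the range of \<open>\<tau>\<close>, that is, for nonnegative
  coordinates. It is continued by a constant to negative ones, which keeps monotonicity and the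
  slope bound; all data points are nonnegative.\<close>

lemma CC_closed:
  fixes Fn :: "nat \<Rightarrow> real \<Rightarrow> real"
  assumes Fn: "\<And>m. Fn m \<in> CC" and lim: "\<And>x. (\<lambda>m. Fn m x) \<longlonglongrightarrow> F x"
  shows "F \<in> CC"
proof -
  have "\<forall>m. \<exists>G. G \<in> cdf_class \<theta> Dt \<and> Fn m = (\<lambda>x. G (\<tau> x))" using Fn unfolding CC_def by blast
  then obtain G where G: "\<And>m. G m \<in> cdf_class \<theta> Dt" "\<And>m. Fn m = (\<lambda>x. G m (\<tau> x))" by metis
  define H where "H s = F (\<sigma> (max 0 s))" for s
  have HL: "(\<lambda>m. G m (max 0 s)) \<longlonglongrightarrow> H s" for s
    using lim[of "\<sigma> (max 0 s)"] unfolding H_def G(2) by (simp add: \<tau>\<sigma>)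
  have "mono_lip \<theta> H"
    unfolding mono_lip_def
  proof (intro allI impI conjI)
    fix s t :: real assume st: "s \<le> t"
    hence m: "max 0 s \<le> max 0 t" by simp
    show "H s \<le> H t"
      by (rule LIMSEQ_le[OF HL HL]) (use mono_lipD(1)[OF cdf_classD(1)[OF G(1)] m] in auto)
    have "(\<lambda>m. G m (max 0 t) - G m (max 0 s)) \<longlonglongrightarrow> H t - H s" by (intro tendsto_intros HL)
    moreover have "G m (max 0 t) - G m (max 0 s) \<le> (t - s) / \<theta>" for m
    proof -
      have "G m (max 0 t) - G m (max 0 s) \<le> (max 0 t - max 0 s) / \<theta>"
        by (rule mono_lipD(2)[OF cdf_classD(1)[OF G(1)] m])
      also have "\<dots> \<le> (t - s) / \<theta>" using st \<theta> by (intro divide_right_mono) auto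
      finally show ?thesis .
    qed
    ultimately show "H t - H s \<le> (t - s) / \<theta>" by (intro LIMSEQ_le_const2) auto
  qed
  moreover have "0 \<le> H s \<and> H s \<le> 1" for s
    using LIMSEQ_le_const[OF HL, of 0 s] LIMSEQ_le_const2[OF HL, of s 1] cdf_classD(2,3)[OF G(1)] by auto
  moreover have "H p = v" if "(p, v) \<in> Dt" for p v
  proof -
    have "0 \<le> p" using that \<tau>(1) by (auto simp: Dt_def pa_def pb_def)
    moreover have "G m p = v" for m using G(1)[of m] that unfolding cdf_class_def by auto
    ultimately have "(\<lambda>m. v) \<longlonglongrightarrow> H p" using HL[of p] by (simp add: max_def)
    thus ?thesis by (simp add: LIMSEQ_const_iff)
  qed
  ultimately have "H \<in> cdf_class \<theta> Dt" unfolding cdf_class_def by auto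
  moreover have "F = (\<lambda>x. H (\<tau> x))"
  proof
    fix x
    have "(\<lambda>m. Fn m x) \<longlonglongrightarrow> H (\<tau> x)" using HL[of "\<tau> x"] \<tau>(1)[of x] unfolding G(2) by simp
    thus "F x = H (\<tau> x)" using lim LIMSEQ_unique by blast
  qed
  ultimately show ?thesis unfolding CC_def by blast
qed

lemma CC_convex:
  assumes "F \<in> CC" "F' \<in> CC" shows "(\<lambda>x. (F x + F' x) / 2) \<in> CC"
proof -
  obtain G where G: "G \<in> cdf_class \<theta> Dt" "F = (\<lambda>x. G (\<tau> x))" using assms by (auto simp: CC_def)
  obtain G' where G': "G' \<in> cdf_class \<theta> Dt" "F' = (\<lambda>x. G' (\<tau> x))" using assms by (auto simp: CC_def)
  have "mono_lip \<theta> (\<lambda>s. (G s + G' s) / 2)"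
    unfolding mono_lip_def
  proof (intro allI impI conjI)
    fix s t :: real assume st: "s \<le> t"
    note m = mono_lipD[OF cdf_classD(1)[OF G(1)] st] mono_lipD[OF cdf_classD(1)[OF G'(1)] st]
    show "(G s + G' s) / 2 \<le> (G t + G' t) / 2" using m by simp
    have "(G t + G' t) / 2 - (G s + G' s) / 2 = ((G t - G s) + (G' t - G' s)) / 2" by (simp add: field_simps)
    also have "\<dots> \<le> (t - s) / \<theta>"
    proof -
      define X where "X = (t - s) / \<theta>"
      show ?thesis using m(2,4) unfolding X_def[symmetric] by (simp add: field_simps)
    qed
    finally show "(G t + G' t) / 2 - (G s + G' s) / 2 \<le> (t - s) / \<theta>" .
  qed
  moreover have "0 \<le> (G s + G' s) / 2 \<and> (G s + G' s) / 2 \<le> 1" for s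
    using cdf_classD(2,3)[OF G(1), of s] cdf_classD(2,3)[OF G'(1), of s] by simp
  moreover have "(G p + G' p) / 2 = v" if "(p, v) \<in> Dt" for p v
    using that G(1) G'(1) unfolding cdf_class_def by fastforce
  ultimately have "(\<lambda>s. (G s + G' s) / 2) \<in> cdf_class \<theta> Dt" unfolding cdf_class_def by auto
  thus ?thesis unfolding CC_def G(2) G'(2) by (intro image_eqI[of _ _ "\<lambda>s. (G s + G' s) / 2"]) auto
qed

text \<open>The interval \<open>{0..hi}\<close> is larger than the hull of the limiting blocks, so
  that it contains all particles of the finite systems. Members of the class agree outside it since
  they are 0 up to \<open>ah 1\<close> and 1 from \<open>bh k\<close> on.\<close>

sublocale E: energy_problem 0 hi "1 + uh" tp "lipc / \<theta>" \<theta> D CC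
proof
  show "0 < hi" "0 < \<theta>" "0 < lipc / \<theta>" using const_pos \<theta> lipc_pos by auto
  show "set_integrable lebesgue {1 + uh..tp} D" by (rule D(1))
  show "F x = G x" if FG: "F \<in> CC" "G \<in> CC" and x: "x \<notin> {0..hi}" for F G x
  proof (cases "x < 0")
    case True
    hence "x \<le> ah 1" using ends(1) uh by linarith
    thus ?thesis using CC_basic(7)[OF FG(1)] CC_basic(7)[OF FG(2)] by simp
  next
    case False
    hence "bh k \<le> x" using x tp_hi ends(4) unfolding tp_def by auto
    thus ?thesis using CC_basic(8)[OF FG(1)] CC_basic(8)[OF FG(2)] by simp
  qed
  show "F \<in> CC" if "\<And>m. Fn m \<in> CC" "\<And>x. (\<lambda>m. Fn m x) \<longlonglongrightarrow> F x" for Fn :: "nat \<Rightarrow> real \<Rightarrow> real" and F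
    by (rule CC_closed[OF that])
  show "CC \<noteq> {}" by (rule CC_nonempty)
qed (use CC_basic CC_convex in auto)

section \<open>Configurations and their empirical distribution functions\<close>

definition \<Omega> :: "nat \<Rightarrow> (nat \<Rightarrow> real) set" where
  "\<Omega> N = state_space k \<theta> N (q N) (u N) (n N) (a N) (b N)"

definition lam :: "(nat \<Rightarrow> int) \<Rightarrow> nat \<Rightarrow> real" where
  "lam x j = of_int (x j) + (real j - 1) * \<theta>"

definition state :: "nat \<Rightarrow> (nat \<Rightarrow> int) \<Rightarrow> nat \<Rightarrow> real" where
  "state N x = restrict (\<lambda>i. quad_lattice (q N) (u N) (lam x i)) {1..N}"

lemma \<Omega>_eq: "\<Omega> N = {state N x | x. config_ok k N (n N) (a N) (b N) x}"
  unfolding \<Omega>_def state_space_def config_ok_def state_def lam_def by simp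

lemma state_facts:
  assumes N: "big N" and x: "config_ok k N (n N) (a N) (b N) x" and j: "j \<in> {1..N}"
  shows "0 \<le> lam x j" "lam x j \<le> L * real N" "state N x j = quad_lattice (q N) (u N) (lam x j)"
    "1 \<le> state N x j" "state N x j \<le> hi"
    "blk (n N) j \<in> {1..k}"
    "alpha_pt \<theta> (q N) (u N) (n N) (a N) (blk (n N) j) \<le> state N x j"
    "state N x j \<le> beta_minus_pt \<theta> (q N) (u N) (n N) (b N) (blk (n N) j)"
    "beta_minus_pt \<theta> (q N) (u N) (n N) (b N) (blk (n N) j) \<le> beta_pt \<theta> (q N) (u N) (n N) (b N) (blk (n N) j)"
    "0 \<le> x j"
proof -
  have N1: "1 \<le> N" using N by (auto simp: big_def)
  note p = lattice_params[OF N1]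
  interpret B: block_system k N \<theta> "n N" "a N" "b N" pa pb c "Ce * r N" by (rule system[OF N])
  note bp = blk_props[of j "n N" k]
  show i: "blk (n N) j \<in> {1..k}" using bp j p(5) by auto
  have xj: "a N (blk (n N) j) \<le> x j" "x j \<le> b N (blk (n N) j) - 1" using B.config_block[OF x j] by auto
  have a0: "0 \<le> a N (blk (n N) j)" using p(7)[OF i] by auto
  show x0: "0 \<le> x j" using xj a0 by linarith
  show lam: "0 \<le> lam x j" "lam x j \<le> L * real N"
    unfolding lam_def using point_bound[OF N i, of "x j" "real j - 1"] xj x0 j by auto
  show st: "state N x j = quad_lattice (q N) (u N) (lam x j)" using j by (simp add: state_def)
  show "1 \<le> state N x j" "state N x j \<le> hi" unfolding st using quad_close[OF N lam] by auto
  have jb: "real (block_end (n N) (blk (n N) j - 1)) \<le> real j - 1" "real j \<le> real (block_end (n N) (blk (n N) j))"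
    using bp j p(5) by auto
  show "alpha_pt \<theta> (q N) (u N) (n N) (a N) (blk (n N) j) \<le> state N x j"
    unfolding st alpha_pt_def lam_def
  proof (rule quad_lattice_mono[OF p(1-4)])
    show "0 \<le> of_int (a N (blk (n N) j)) + real (block_end (n N) (blk (n N) j - 1)) * \<theta>" using a0 \<theta> by simp
    show "of_int (a N (blk (n N) j)) + real (block_end (n N) (blk (n N) j - 1)) * \<theta> \<le> of_int (x j) + (real j - 1) * \<theta>"
      using xj jb \<theta> by (intro add_mono mult_right_mono) auto
  qed
  show "state N x j \<le> beta_minus_pt \<theta> (q N) (u N) (n N) (b N) (blk (n N) j)"
    unfolding st beta_minus_pt_def beta_pt_def
  proof (rule quad_lattice_mono[OF p(1-4) lam(1)])
    have "real_of_int (x j) \<le> real_of_int (b N (blk (n N) j) - 1)" using xj by simp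
    thus "lam x j \<le> of_int (b N (blk (n N) j) - 1) + (real (block_end (n N) (blk (n N) j)) - 1) * \<theta>"
      unfolding lam_def using jb \<theta> by (intro add_mono mult_right_mono) auto
  qed
  show "beta_minus_pt \<theta> (q N) (u N) (n N) (b N) (blk (n N) j) \<le> beta_pt \<theta> (q N) (u N) (n N) (b N) (blk (n N) j)"
    unfolding beta_minus_pt_def beta_pt_def
  proof (rule quad_lattice_mono[OF p(1-4)])
    have "1 \<le> real (block_end (n N) (blk (n N) j))" using jb j by auto
    thus "0 \<le> of_int (b N (blk (n N) j) - 1) + (real (block_end (n N) (blk (n N) j)) - 1) * \<theta>"
      using xj x0 \<theta> by (intro add_nonneg_nonneg mult_nonneg_nonneg) auto
  qed simp
qed

lemma lam_gap:
  assumes N: "big N" and x: "config_ok k N (n N) (a N) (b N) x" and ij: "1 \<le> i" "i \<le> j" "j \<le> N"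
  shows "(real j - real i) * \<theta> \<le> lam x j - lam x i"
    and "(real j - real i) * eN N \<le> state N x j - state N x i"
proof -
  have N1: "1 \<le> N" and N0: "0 < real N" using N by (auto simp: big_def)
  note p = lattice_params[OF N1]
  have "x i \<le> x j" using x ij unfolding config_ok_def by auto
  thus g: "(real j - real i) * \<theta> \<le> lam x j - lam x i" unfolding lam_def by (simp add: algebra_simps)
  have i: "i \<in> {1..N}" and j: "j \<in> {1..N}" using ij by auto
  have d: "0 \<le> real j - real i" using ij by simp
  have le: "lam x i \<le> lam x j" using g d \<theta> by (smt (verit) mult_nonneg_nonneg)
  have u2: "(1 - uh) / 2 \<le> 1 - u N" using u_bound[OF N] by (simp add: field_simps)
  have "(real j - real i) * eN N = ((real j - real i) * \<theta>) * (- ln qh / 2 / real N) * ((1 - uh) / 2)"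
    unfolding eN_def cg_def by simp
  also have "\<dots> \<le> (lam x j - lam x i) * (- ln (q N)) * (1 - u N)"
  proof (intro mult_mono g ln_q(2)[OF N] u2)
    show "0 \<le> lam x j - lam x i" using le by auto
    show "0 \<le> - ln qh / 2 / real N" using lnqh N0 by (intro divide_nonneg_pos) auto
    show "0 \<le> (lam x j - lam x i) * (- ln (q N))" using le p by (intro mult_nonneg_nonneg) auto
    show "0 \<le> (1 - uh) / 2" using uh by simp
  qed
  also have "\<dots> \<le> state N x j - state N x i"
    unfolding state_facts(3)[OF N x i] state_facts(3)[OF N x j]
    by (rule quad_lattice_gap[OF p(1-4) state_facts(1)[OF N x i] le])
  finally show "(real j - real i) * eN N \<le> state N x j - state N x i" .
qed

lemma eN: assumes "big N" shows "0 < eN N" "eN N \<le> hi - 0"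
proof -
  have N0: "0 < real N" "cg \<le> real N" using assms by (auto simp: big_def)
  show "0 < eN N" unfolding eN_def using const_pos N0 by simp
  have "eN N \<le> 1" unfolding eN_def using N0 by (simp add: divide_le_eq)
  thus "eN N \<le> hi - 0" using const_pos by linarith
qed

text \<open>The first four summands majorise the errors of both \<open>config_to_class\<close> and
  \<open>class_to_config\<close>, so one constant serves both directions. The other two come from
  replacing the lattice by its limit and from the jump 1 / N.\<close>

definition C2 :: real where
  "C2 = 2 * Ce + Ce / \<theta> + 1 / \<theta> + 2 + lipc * Cl / \<theta> + 1"

lemma ecdf_state_close:
  assumes N: "big N" and x: "config_ok k N (n N) (a N) (b N) x" and G: "G \<in> cdf_class \<theta> Dt"
    and close: "\<forall>j\<in>{1..N}. \<bar>G ((of_int (x j) + (real j - 1) * \<theta>) / real N) - real j / real N\<bar> \<le> (2 * Ce + Ce / \<theta> + 1 / \<theta> + 2) * r N"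
  shows "\<bar>G (\<tau> z) - ecdf N (state N x) z\<bar> \<le> C2 * r N"
proof -
  have N1: "1 \<le> N" using N by (auto simp: big_def)
  define \<eta> where "\<eta> = (2 * Ce + Ce / \<theta> + 1 / \<theta> + 2) * r N + lipc * Cl / real N / \<theta>"
  have "\<bar>G (\<tau> z) - ecdf N (state N x) z\<bar> \<le> \<eta> + 1 / real N"
  proof (rule ecdf_close[of "\<lambda>z. G (\<tau> z)"])
    show "mono (\<lambda>z. G (\<tau> z))" using mono_lipD(1)[OF cdf_classD(1)[OF G] \<tau>_mono] by (auto simp: mono_def)
    show "0 \<le> G (\<tau> z)" "G (\<tau> z) \<le> 1" for z using cdf_classD(2,3)[OF G] by auto
    show "state N x i \<le> state N x j" if "1 \<le> i" "i \<le> j" "j \<le> N" for i j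
      using lam_gap(2)[OF N x that] eN(1)[OF N] that by (smt (verit) mult_nonneg_nonneg of_nat_mono)
    show "\<bar>G (\<tau> (state N x j)) - real j / real N\<bar> \<le> \<eta>" if j: "j \<in> {1..N}" for j
    proof -
      have "\<bar>G (\<tau> (state N x j)) - G (lam x j / real N)\<bar> \<le> \<bar>\<tau> (state N x j) - lam x j / real N\<bar> / \<theta>"
        by (rule mono_lip_abs[OF cdf_classD(1)[OF G]])
      also have "\<dots> \<le> lipc * Cl / real N / \<theta>"
        using coord_close[OF N state_facts(1,2)[OF N x j]] \<theta> unfolding state_facts(3)[OF N x j]
        by (intro divide_right_mono) auto
      finally show ?thesis using close j unfolding \<eta>_def lam_def by force
    qed
  qed (use N1 in auto)
  also have "\<dots> = (2 * Ce + Ce / \<theta> + 1 / \<theta> + 2) * r N + (lipc * Cl / \<theta> + 1) * (1 / real N)"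
    by (simp add: \<eta>_def algebra_simps)
  also have "\<dots> \<le> (2 * Ce + Ce / \<theta> + 1 / \<theta> + 2) * r N + (lipc * Cl / \<theta> + 1) * r N"
    using r_bounds(1)[OF N] lipc_pos const_pos \<theta> by (intro add_left_mono mult_left_mono) auto
  also have "\<dots> = C2 * r N" by (simp add: C2_def algebra_simps)
  finally show ?thesis .
qed

lemma state_to_class:
  assumes N: "big N" and l: "l \<in> \<Omega> N"
  shows "\<exists>F\<in>CC. \<forall>z. \<bar>F z - ecdf N l z\<bar> \<le> C2 * r N"
proof -
  obtain x where x: "config_ok k N (n N) (a N) (b N) x" "l = state N x" using l by (auto simp: \<Omega>_eq)
  interpret B: block_system k N \<theta> "n N" "a N" "b N" pa pb c "Ce * r N" by (rule system[OF N])
  obtain G where G: "G \<in> cdf_class \<theta> Dt" "\<forall>j\<in>{1..N}. \<bar>G ((of_int (x j) + (real j - 1) * \<theta>) / real N) - real j / real N\<bar>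
      \<le> Ce * r N + (Ce * r N + \<theta> / real N) / \<theta> + 1 / real N"
    using B.config_to_class[OF x(1) _ k] compatible_Dt unfolding data_Dt[OF N] by blast
  have "Ce * r N + (Ce * r N + \<theta> / real N) / \<theta> + 1 / real N = (Ce + Ce / \<theta>) * r N + 2 * (1 / real N)"
    using \<theta> by (simp add: field_simps)
  also have "\<dots> \<le> (Ce + Ce / \<theta>) * r N + 2 * r N" using r_bounds[OF N] by (intro add_left_mono mult_left_mono) auto
  also have "\<dots> = (Ce + Ce / \<theta> + 2) * r N" by (simp add: algebra_simps)
  also have "\<dots> \<le> (2 * Ce + Ce / \<theta> + 1 / \<theta> + 2) * r N"
    using const_pos \<theta> r_bounds[OF N] by (intro mult_right_mono) auto
  finally have le: "Ce * r N + (Ce * r N + \<theta> / real N) / \<theta> + 1 / real N \<le> (2 * Ce + Ce / \<theta> + 1 / \<theta> + 2) * r N" .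
  have "\<bar>G (\<tau> z) - ecdf N (state N x) z\<bar> \<le> C2 * r N" for z
    by (rule ecdf_state_close[OF N x(1) G(1)]) (use G(2) le in \<open>meson order_trans\<close>)
  thus ?thesis using G(1) unfolding CC_def x(2) by (intro bexI[of _ "\<lambda>z. G (\<tau> z)"]) auto
qed

lemma pa_le_pb: "i \<in> {1..k} \<Longrightarrow> pa i \<le> pb i"
  unfolding pa_def pb_def using ends by (intro \<tau>_mono) (auto intro: less_imp_le)

lemma class_to_state:
  assumes N: "big N" and F: "F \<in> CC"
  shows "\<exists>l\<in>\<Omega> N. \<forall>z. \<bar>F z - ecdf N l z\<bar> \<le> C2 * r N"
proof -
  obtain G where G: "G \<in> cdf_class \<theta> Dt" "F = (\<lambda>x. G (\<tau> x))" using F by (auto simp: CC_def)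
  interpret B: block_system k N \<theta> "n N" "a N" "b N" pa pb c "Ce * r N" by (rule system[OF N])
  obtain x where x: "config_ok k N (n N) (a N) (b N) x" "\<forall>j\<in>{1..N}. \<bar>G ((of_int (x j) + (real j - 1) * \<theta>) / real N) - real j / real N\<bar>
      \<le> ((1 + \<theta>) * (Ce * r N) + 1 / real N) / \<theta> + Ce * r N"
    using B.class_to_config[of G] G(1) pa_le_pb unfolding data_Dt[OF N] by blast
  have "((1 + \<theta>) * (Ce * r N) + 1 / real N) / \<theta> + Ce * r N = (2 * Ce + Ce / \<theta>) * r N + 1 / \<theta> * (1 / real N)"
    using \<theta> by (simp add: field_simps)
  also have "\<dots> \<le> (2 * Ce + Ce / \<theta>) * r N + 1 / \<theta> * r N" using r_bounds[OF N] \<theta> by (intro add_left_mono mult_left_mono) auto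
  also have "\<dots> = (2 * Ce + Ce / \<theta> + 1 / \<theta>) * r N" by (simp add: algebra_simps)
  also have "\<dots> \<le> (2 * Ce + Ce / \<theta> + 1 / \<theta> + 2) * r N" using r_bounds[OF N] by (intro mult_right_mono) auto
  finally have le: "((1 + \<theta>) * (Ce * r N) + 1 / real N) / \<theta> + Ce * r N \<le> (2 * Ce + Ce / \<theta> + 1 / \<theta> + 2) * r N" .
  have "\<bar>G (\<tau> z) - ecdf N (state N x) z\<bar> \<le> C2 * r N" for z
    by (rule ecdf_state_close[OF N x(1) G(1)]) (use x(2) le in \<open>meson order_trans\<close>)
  thus ?thesis using x(1) unfolding \<Omega>_eq G(2) by blast
qed

text \<open>A crude count by integer coordinates, each taking at most \<open>L * N + 1\<close>
  values, is enough: its logarithm is \<open>O (N ln N)\<close>.\<close>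

lemma card_\<Omega>:
  assumes N: "big N"
  shows "finite (\<Omega> N)" "real (card (\<Omega> N)) \<le> exp (real N * ln (L * real N + 1))"
proof -
  let ?S = "PiE {1..N} (\<lambda>_. {0..\<lfloor>L * real N\<rfloor>})"
  have sub: "\<Omega> N \<subseteq> state N ` ?S"
  proof
    fix l assume "l \<in> \<Omega> N"
    then obtain x where x: "config_ok k N (n N) (a N) (b N) x" "l = state N x" by (auto simp: \<Omega>_eq)
    have "x j \<in> {0..\<lfloor>L * real N\<rfloor>}" if j: "j \<in> {1..N}" for j
    proof -
      have "0 \<le> (real j - 1) * \<theta>" using j \<theta> by simp
      hence "of_int (x j) \<le> L * real N" using state_facts(2)[OF N x(1) j] unfolding lam_def by linarith
      thus ?thesis using state_facts(10)[OF N x(1) j] by (simp add: le_floor_iff)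
    qed
    hence "restrict x {1..N} \<in> ?S" by auto
    moreover have "state N x = state N (restrict x {1..N})" by (auto simp: state_def lam_def)
    ultimately show "l \<in> state N ` ?S" using x(2) by blast
  qed
  have fin: "finite (state N ` ?S)" by (intro finite_imageI finite_PiE) auto
  show "finite (\<Omega> N)" using finite_subset[OF sub fin] .
  have LN: "0 \<le> L * real N" using const_pos by simp
  have "card (\<Omega> N) \<le> card ?S" using card_mono[OF fin sub] card_image_le[of ?S "state N"] by (simp add: finite_PiE)
  also have "\<dots> = nat (\<lfloor>L * real N\<rfloor> + 1) ^ N" by (simp add: card_PiE)
  finally have "real (card (\<Omega> N)) \<le> real (nat (\<lfloor>L * real N\<rfloor> + 1)) ^ N" by (metis of_nat_le_iff of_nat_power)
  also have "\<dots> \<le> (L * real N + 1) ^ N"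
  proof (rule power_mono)
    have "0 \<le> \<lfloor>L * real N\<rfloor>" using LN by simp
    hence "real (nat (\<lfloor>L * real N\<rfloor> + 1)) = of_int \<lfloor>L * real N\<rfloor> + 1" by simp
    thus "real (nat (\<lfloor>L * real N\<rfloor> + 1)) \<le> L * real N + 1" using of_int_floor_le[of "L * real N"] by linarith
  qed simp
  also have "\<dots> = exp (real N * ln (L * real N + 1))"
    using LN by (simp add: exp_of_nat_mult)
  finally show "real (card (\<Omega> N)) \<le> exp (real N * ln (L * real N + 1))" .
qed

section \<open>Concentration\<close>


text \<open>\<open>A3\<close> accounts for the approximation of the potential. The rest pays
  \<open>2 * A4\<close> for each particle outside \<open>{1 + uh..tp}\<close>, of which there are at
  most \<open>((A1 + A2) / cg + 2) * ln N\<close>.\<close>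

definition CV :: real where "CV = A3 + 2 * A4 * ((A1 + A2) / cg + 2)"
definition Cv :: real where "Cv = 2 * (- ln qh) / (- ln ((1 + uh) / 2))"
definition CE :: real where "CE = 2 * (Gamma_ratio_const \<theta> * (1 / \<theta> + Cv)) + CV"
definition W :: "nat \<Rightarrow> (nat \<Rightarrow> real) \<Rightarrow> real" where "W N l = gibbs_weight \<theta> N (q N) (u N) (w N) l"

text \<open>Everything in the logarithm of a weight that is common to all configurations: powers of
  \<open>1 - q\<close>, the diagonal of the cut energy, the normalisation of distances by
  \<open>hi\<close>, and \<open>V tp\<close>.\<close>

definition weight_const :: "nat \<Rightarrow> real" where
  "weight_const N = 2 * \<theta> * (if u N = 0 then 1 else 2) * ln (1 - q N) * real (card {(i, j). 1 \<le> i \<and> i < j \<and> j \<le> N})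
     - \<theta> * real N * ln (hi / eN N) + \<theta> * (real N * (real N - 1) * (1 - ln hi)) + (real N)\<^sup>2 * V tp"

text \<open>The integral formula read for every \<open>y\<close>: it equals the potential on
  \<open>{1 + uh..tp}\<close> and is constant on either side. The average of \<open>Vhat\<close>,
  unlike that of \<open>V\<close>, is always an exact functional of the empirical distribution
  function.\<close>

definition Vhat :: "real \<Rightarrow> real" where
  "Vhat y = V tp - (LINT x:{1 + uh..tp}|lebesgue. D x * (if y \<le> x then 1 else 0))"

lemma Vhat_eq: "y \<in> {1 + uh..tp} \<Longrightarrow> Vhat y = V y"
  using D(2)[of y] by (simp add: Vhat_def)

lemma Vhat_bound: "\<bar>Vhat y\<bar> \<le> A4"
proof -
  have I: "x \<in> {1 + uh..tp} \<Longrightarrow> \<bar>V x\<bar> \<le> A4" for x using I(1) V(3) unfolding tp_def by blast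
  consider "y \<in> {1 + uh..tp}" | "y < 1 + uh" | "tp < y" by fastforce
  thus ?thesis
  proof cases
    case 1 thus ?thesis using I Vhat_eq by simp
  next
    case 2
    have "Vhat y = Vhat (1 + uh)" unfolding Vhat_def set_lebesgue_integral_def
      by (intro arg_cong2[where f = "(-)"] refl Bochner_Integration.integral_cong) (use 2 in \<open>auto simp: indicator_def\<close>)
    thus ?thesis using I[of "1 + uh"] Vhat_eq[of "1 + uh"] lo_tp by simp
  next
    case 3
    have "Vhat y = V tp - (LINT x:{1 + uh..tp}|lebesgue. 0)" unfolding Vhat_def set_lebesgue_integral_def
      by (intro arg_cong2[where f = "(-)"] refl Bochner_Integration.integral_cong) (use 3 in \<open>auto simp: indicator_def\<close>)
    thus ?thesis using I[of tp] lo_tp by simp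
  qed
qed

text \<open>Replacing \<open>VN\<close> by \<open>Vhat\<close> costs \<open>A3 * r N\<close> per
  particle, plus a bounded amount for the stray particles, where \<open>Vhat\<close> and
  \<open>V\<close> may differ. After that, summation by parts is exact.\<close>

lemma weight_sum:
  assumes N: "big N" and x: "config_ok k N (n N) (a N) (b N) x"
  shows "\<And>j. j \<in> {1..N} \<Longrightarrow> 0 < w N (state N x j)"
    and "\<bar>(\<Sum>j = 1..N. ln (w N (state N x j))) + (real N)\<^sup>2 * (V tp - potential_term (1 + uh) tp D (ecdf N (state N x)))\<bar> \<le> CV * real N * ln (real N)"
proof -
  let ?l = "state N x"
  have N1: "1 \<le> N" "2 \<le> N" and N0: "0 < real N" using N by (auto simp: big_def)
  note p = lattice_params[OF N1(1)]
  note sf = state_facts[OF N x]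
  have mem: "?l j \<in> {alpha_pt \<theta> (q N) (u N) (n N) (a N) (blk (n N) j)..beta_minus_pt \<theta> (q N) (u N) (n N) (b N) (blk (n N) j)}"
    if "j \<in> {1..N}" for j using sf(7,8)[OF that] by auto
  have w: "w N (?l j) = exp (- real N * VN N (?l j))" if "j \<in> {1..N}" for j
    using weights N1(1) sf(6)[OF that] mem[OF that] by blast
  thus "\<And>j. j \<in> {1..N} \<Longrightarrow> 0 < w N (?l j)" by simp
  define S where "S = {j \<in> {1..N}. ?l j \<notin> {1 + uh..tp}}"
  have A4: "\<bar>V (?l j)\<bar> \<le> A4" if "j \<in> {1..N}" for j
    using I(2) V(3) N1(1) sf(6)[OF that] mem[OF that] by blast
  have gap: "(real j - real i) * eN N \<le> ?l j - ?l i" if "1 \<le> i" "i < j" "j \<le> N" for i j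
    using lam_gap(2)[OF N x, of i j] that by auto
  \<comment> \<open>Stray particles lie in a window of length \<open>A1 / N\<close> below
    \<open>1 + uh\<close> or \<open>A2 * r N\<close> above \<open>tp\<close>. With spacing
    \<open>eN N\<close>, of order 1 / N, the windows hold \<open>O(1)\<close> and
    \<open>O(ln N)\<close> of them.\<close>
  have cS: "real (card S) \<le> (A1 / real N / eN N + 1) + (A2 * r N / eN N + 1)"
  proof -
    let ?S1 = "{j \<in> {1..N}. ?l j < 1 + uh}" and ?S2 = "{j \<in> {1..N}. tp < ?l j}"
    have "real (card ?S1) \<le> A1 / real N / eN N + 1"
    proof (rule card_separated_points[OF eN(1)[OF N] gap])
      fix j assume "j \<in> ?S1"
      thus "uh + 1 - A1 / real N \<le> ?l j \<and> ?l j \<le> uh + 1 - A1 / real N + A1 / real N"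
        using quad_close(4)[OF N sf(1,2)] sf(3) by auto
    qed (use A1 in auto)
    moreover have "real (card ?S2) \<le> A2 * r N / eN N + 1"
    proof (rule card_separated_points[OF eN(1)[OF N] gap])
      fix j assume j: "j \<in> ?S2"
      hence j1: "j \<in> {1..N}" by auto
      have "\<bar>beta_pt \<theta> (q N) (u N) (n N) (b N) (blk (n N) j) - bh (blk (n N) j)\<bar> \<le> A2 * ln (real N) / real N"
        using A2(2) N1(2) sf(6)[OF j1] by blast
      hence "beta_pt \<theta> (q N) (u N) (n N) (b N) (blk (n N) j) \<le> bh (blk (n N) j) + A2 * r N" by (simp add: r_def abs_le_iff)
      thus "tp \<le> ?l j \<and> ?l j \<le> tp + A2 * r N"
        using sf(8,9)[OF j1] bh_le[OF sf(6)[OF j1]] ends(4) j unfolding tp_def by auto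
    qed (use A2 r_bounds[OF N] in auto)
    moreover have "S = ?S1 \<union> ?S2" by (auto simp: S_def)
    moreover have "card (?S1 \<union> ?S2) \<le> card ?S1 + card ?S2" by (rule card_Un_le)
    ultimately show ?thesis by (smt (verit) of_nat_add of_nat_mono)
  qed
  have each: "\<bar>VN N (?l j) - Vhat (?l j)\<bar> \<le> A3 * r N + (if j \<in> S then 2 * A4 else 0)" if j: "j \<in> {1..N}" for j
  proof -
    have 1: "\<bar>VN N (?l j) - V (?l j)\<bar> \<le> A3 * ln (real N) / real N"
      using A3(2) N1(2) sf(6)[OF j] mem[OF j] by blast
    have 2: "\<bar>V (?l j) - Vhat (?l j)\<bar> \<le> (if j \<in> S then 2 * A4 else 0)"
      using A4[OF j] Vhat_bound[of "?l j"] Vhat_eq[of "?l j"] j by (auto simp: S_def)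
    show ?thesis using 1 2 unfolding r_def by simp
  qed
  have sV: "(\<Sum>j = 1..N. Vhat (?l j)) = real N * (V tp - potential_term (1 + uh) tp D (ecdf N ?l))"
  proof -
    have "(\<Sum>j = 1..N. Vhat (?l j)) / real N = V tp - potential_term (1 + uh) tp D (ecdf N ?l)"
      unfolding Vhat_def potential_term_def by (rule average_integral_indicator[OF D(1) _ N1(1)]) auto
    thus ?thesis using N0 by (simp add: field_simps)
  qed
  have lw: "(\<Sum>j = 1..N. ln (w N (?l j))) = - real N * (\<Sum>j = 1..N. VN N (?l j))"
    using w by (simp add: sum_distrib_left sum_negf)
  have "(\<Sum>j = 1..N. ln (w N (?l j))) + (real N)\<^sup>2 * (V tp - potential_term (1 + uh) tp D (ecdf N ?l))
     = - real N * (\<Sum>j = 1..N. VN N (?l j) - Vhat (?l j))"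
    unfolding lw sum_subtractf sV by (simp add: power2_eq_square algebra_simps)
  hence "\<bar>(\<Sum>j = 1..N. ln (w N (?l j))) + (real N)\<^sup>2 * (V tp - potential_term (1 + uh) tp D (ecdf N ?l))\<bar>
     = real N * \<bar>\<Sum>j = 1..N. VN N (?l j) - Vhat (?l j)\<bar>" by (simp add: abs_mult)
  also have "\<dots> \<le> real N * (\<Sum>j = 1..N. A3 * r N + (if j \<in> S then 2 * A4 else 0))"
    using each by (intro mult_left_mono order_trans[OF sum_abs] sum_mono) auto
  also have "(\<Sum>j = 1..N. A3 * r N + (if j \<in> S then 2 * A4 else 0)) = real N * (A3 * r N) + real (card S) * (2 * A4)"
  proof -
    have "(\<Sum>j = 1..N. if j \<in> S then 2 * A4 else 0) = (\<Sum>j\<in>{1..N} \<inter> S. 2 * A4)"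
      by (rule sum.inter_restrict[symmetric]) simp
    moreover have "{1..N} \<inter> S = S" by (auto simp: S_def)
    ultimately have "(\<Sum>j = 1..N. if j \<in> S then 2 * A4 else 0) = real (card S) * (2 * A4)" by simp
    thus ?thesis by (simp add: sum.distrib)
  qed
  also have "real N * (real N * (A3 * r N) + real (card S) * (2 * A4)) \<le> CV * real N * ln (real N)"
  proof -
    have rl: "real N * r N = ln (real N)" using N0 by (simp add: r_def)
    have e1: "A1 / real N / eN N = A1 / cg" using N0 by (simp add: eN_def)
    have e2: "A2 * r N / eN N = A2 / cg * ln (real N)" using N0 by (simp add: eN_def r_def)
    have l1: "1 \<le> ln (real N)" using r_bounds(3)[OF N] .
    have "real (card S) \<le> A1 / cg + A2 / cg * ln (real N) + 2" using cS unfolding e1 e2 by simp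
    also have "\<dots> \<le> A1 / cg * ln (real N) + A2 / cg * ln (real N) + 2 * ln (real N)"
    proof (intro add_mono)
      have "A1 / cg * 1 \<le> A1 / cg * ln (real N)" using l1 A1(1) const_pos by (intro mult_left_mono) auto
      thus "A1 / cg \<le> A1 / cg * ln (real N)" by simp
    qed (use l1 in auto)
    also have "\<dots> = ((A1 + A2) / cg + 2) * ln (real N)" by (simp add: algebra_simps add_divide_distrib)
    finally have "real (card S) * (2 * A4) \<le> ((A1 + A2) / cg + 2) * ln (real N) * (2 * A4)"
      using V(2) by (intro mult_right_mono) auto
    hence "real N * (A3 * r N) + real (card S) * (2 * A4) \<le> A3 * (real N * r N) + ((A1 + A2) / cg + 2) * ln (real N) * (2 * A4)"
      by (simp add: algebra_simps)
    also have "\<dots> = CV * ln (real N)" unfolding rl CV_def by (simp add: algebra_simps)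
    finally have "real N * (real N * (A3 * r N) + real (card S) * (2 * A4)) \<le> real N * (CV * ln (real N))" by (intro mult_left_mono) auto
    thus ?thesis by (simp add: algebra_simps)
  qed
  finally show "\<bar>(\<Sum>j = 1..N. ln (w N (?l j))) + (real N)\<^sup>2 * (V tp - potential_term (1 + uh) tp D (ecdf N ?l))\<bar> \<le> CV * real N * ln (real N)" .
qed

lemma Cv_pos: "0 < Cv"
proof -
  have "ln ((1 + uh) / 2) < 0" using uh by simp
  thus ?thesis unfolding Cv_def using lnqh by (intro divide_pos_pos mult_pos_pos) auto
qed

lemma log_q_u:
  assumes N: "big N" and un: "u N \<noteq> 0" shows "real N \<le> Cv * log (q N) (u N)"
proof -
  have N1: "1 \<le> N" and N0: "0 < real N" using N by (auto simp: big_def)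
  note p = lattice_params[OF N1]
  define v where "v = - ln ((1 + uh) / 2)"
  have v: "0 < v" unfolding v_def using uh by simp
  have "ln (u N) \<le> ln ((1 + uh) / 2)" using u_bound[OF N] p un by (subst ln_le_cancel_iff) auto
  hence 1: "v \<le> - ln (u N)" by (simp add: v_def)
  have q0: "0 < - ln (q N)" using p by simp
  have "log (q N) (u N) = (- ln (u N)) / (- ln (q N))" by (simp add: log_def)
  also have "\<dots> \<ge> v / (2 * (- ln qh) / real N)"
    using 1 v q0 ln_q(3)[OF N] by (intro frac_le) auto
  finally have "v * real N / (2 * (- ln qh)) \<le> log (q N) (u N)" by simp
  hence "Cv * (v * real N / (2 * (- ln qh))) \<le> Cv * log (q N) (u N)" using Cv_pos by (intro mult_left_mono) auto
  moreover have "Cv * (v * real N / (2 * (- ln qh))) = real N"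
    using v lnqh unfolding Cv_def v_def[symmetric] by simp
  ultimately show ?thesis by simp
qed

lemma state_weight:
  assumes N: "big N" and l: "l \<in> \<Omega> N"
  shows "0 < W N l"
    and "\<bar>ln (W N l) + weight_const N + (real N)\<^sup>2 * E.J (eN N) (ecdf N l)\<bar> \<le> CE * real N * ln (real N)"
    and "\<And>j. j \<in> {1..N} \<Longrightarrow> l j \<in> {0..hi}"
proof -
  obtain x where x: "config_ok k N (n N) (a N) (b N) x" and lx: "l = state N x" using l by (auto simp: \<Omega>_eq)
  have N1: "1 \<le> N" and N0: "0 < real N" using N by (auto simp: big_def)
  note p = lattice_params[OF N1]
  note sf = state_facts[OF N x]
  show rng: "\<And>j. j \<in> {1..N} \<Longrightarrow> l j \<in> {0..hi}" using sf(4,5) unfolding lx by force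
  let ?P = "{(i, j). 1 \<le> i \<and> i < j \<and> j \<le> N}"
  define W0 where "W0 = 2 * \<theta> * (if u N = 0 then 1 else 2) * ln (1 - q N) * real (card ?P)"
  define T where "T = (\<Sum>(i, j)\<in>?P. ln \<bar>l i - l j\<bar>)"
  have gw: "0 < gibbs_weight \<theta> N (q N) (u N) (w N) l \<and>
     \<bar>ln (gibbs_weight \<theta> N (q N) (u N) (w N) l) + W0 - 2 * \<theta> * T - (\<Sum>j = 1..N. ln (w N (l j)))\<bar>
      \<le> Gamma_ratio_const \<theta> * (1 / \<theta> + Cv) * real N * (1 + ln (real N))"
  proof -
    have gap: "(real j - real i) * \<theta> \<le> lam x j - lam x i" if "1 \<le> i" "i < j" "j \<le> N" for i j
      using that by (intro lam_gap(1)[OF N x]) auto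
    note G = ln_gibbs_weight[where q = "q N" and u = "u N" and N = N and \<theta> = \<theta> and s = "lam x" and l = "state N x"
        and w = "w N" and Cv = Cv and W = W0, OF p(1-4) \<theta> N1 sf(1) gap log_q_u[OF N] Cv_pos sf(3) weight_sum(1)[OF N x] W0_def]
    show ?thesis using G unfolding T_def lx by blast
  qed
  thus "0 < W N l" by (simp add: W_def)
  have sep: "eN N \<le> \<bar>l i - l j\<bar>" if ij: "i \<in> {1..N}" "j \<in> {1..N}" "i \<noteq> j" for i j
  proof -
    have *: "eN N \<le> l j - l i" if "i < j" "i \<in> {1..N}" "j \<in> {1..N}" for i j
    proof -
      have "1 * eN N \<le> (real j - real i) * eN N" using that eN(1)[OF N] by (intro mult_right_mono) auto
      also have "\<dots> \<le> l j - l i" unfolding lx using that by (intro lam_gap(2)[OF N x]) auto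
      finally show ?thesis by simp
    qed
    show ?thesis using *[of i j] *[of j i] ij by (cases "i < j") auto
  qed
  have le: "2 * T = - (real N)\<^sup>2 * log_energy 0 hi (eN N) (ecdf N l) + real N * ln (hi / eN N) - real N * (real N - 1) * (1 - ln hi)"
    unfolding T_def using log_energy_ecdf[where y = l and N = N and lo = 0 and hi = hi, OF N1 eN[OF N] rng sep] by simp
  define X where "X = log_energy 0 hi (eN N) (ecdf N l)"
  define Y where "Y = potential_term (1 + uh) tp D (ecdf N l)"
  define SW where "SW = (\<Sum>j = 1..N. ln (w N (l j)))"
  have sw: "\<bar>SW + (real N)\<^sup>2 * (V tp - Y)\<bar> \<le> CV * real N * ln (real N)"
    unfolding SW_def Y_def lx by (rule weight_sum(2)[OF N x])
  have T2: "2 * \<theta> * T = \<theta> * (- (real N)\<^sup>2 * X + real N * ln (hi / eN N) - real N * (real N - 1) * (1 - ln hi))"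
    using le unfolding X_def by simp
  have "ln (W N l) + weight_const N + (real N)\<^sup>2 * E.J (eN N) (ecdf N l)
     = (ln (W N l) + W0 - 2 * \<theta> * T - SW) + (SW + (real N)\<^sup>2 * (V tp - Y))"
    unfolding weight_const_def W0_def[symmetric] T2 E.J_def X_def[symmetric] Y_def[symmetric] by (simp add: algebra_simps)
  hence "\<bar>ln (W N l) + weight_const N + (real N)\<^sup>2 * E.J (eN N) (ecdf N l)\<bar>
    \<le> Gamma_ratio_const \<theta> * (1 / \<theta> + Cv) * real N * (1 + ln (real N)) + CV * real N * ln (real N)"
    using gw sw unfolding W_def SW_def by (smt (verit))
  also have "\<dots> \<le> Gamma_ratio_const \<theta> * (1 / \<theta> + Cv) * real N * (ln (real N) + ln (real N)) + CV * real N * ln (real N)"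
    using r_bounds(3)[OF N] \<theta> Cv_pos unfolding Gamma_ratio_const_def
    by (intro add_right_mono mult_left_mono mult_nonneg_nonneg) auto
  also have "\<dots> = CE * real N * ln (real N)" unfolding CE_def by (simp add: algebra_simps)
  finally show "\<bar>ln (W N l) + weight_const N + (real N)\<^sup>2 * E.J (eN N) (ecdf N l)\<bar> \<le> CE * real N * ln (real N)" .
qed

definition dev :: "(real \<Rightarrow> real) \<Rightarrow> nat \<Rightarrow> (nat \<Rightarrow> real) \<Rightarrow> real" where
  "dev F0 N l = (LINT x:{0..hi}|lborel. \<bar>ecdf N l x - F0 x\<bar>)"

text \<open>The summands stem, in order, from the error in the weights, the removal of the cutoff,
  the sup-norm comparison with the class, the slack of the near-minimiser, and the number of
  configurations. Each is scaled to a multiple of \<open>N * (ln N)\<^sup>2\<close>.\<close>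

definition C3 :: real where
  "C3 = 2 * CE + 2 * \<theta> * hi * (lipc / \<theta>)\<^sup>2 * cg + 2 * C2 * (\<theta> * (4 * (\<bar>ln (hi / cg)\<bar> + 1) + 2) + E.absD) + 1 + (\<bar>ln (L + 1)\<bar> + 1)"

lemma absD_nonneg: "0 \<le> E.absD"
  unfolding E.absD_def set_lebesgue_integral_def by simp

lemma C2_pos: "0 < C2"
  unfolding C2_def using const_pos lipc_pos \<theta> by (intro add_nonneg_pos add_nonneg_nonneg) auto

lemma concentration_fixed:
  assumes F0: "F0 \<in> CC" "\<And>F. F \<in> CC \<Longrightarrow> \<theta> / (hi - 0) * (LINT x:{0..hi}|lborel. (F x - F0 x)\<^sup>2) \<le> E.J 0 F - E.minJ"
    and N: "big N" and \<rho>: "2 * (C2 * r N) * hi \<le> \<rho>"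
  shows "(\<Sum>l\<in>{l \<in> \<Omega> N. \<rho> \<le> dev F0 N l}. W N l / (\<Sum>l\<in>\<Omega> N. W N l))
     \<le> exp (C3 * real N * (ln (real N))\<^sup>2 - \<theta> / (4 * hi\<^sup>2) * ((real N)\<^sup>2 * \<rho>\<^sup>2))"
proof -
  have N1: "1 \<le> N" and N0: "0 < real N" using N by (auto simp: big_def)
  have l1: "1 \<le> ln (real N)" using r_bounds(3)[OF N] .
  define lN where "lN = ln (real N)"
  have lN: "1 \<le> lN" "lN \<le> lN\<^sup>2" "1 \<le> lN\<^sup>2" using l1 unfolding lN_def by (auto simp: power2_eq_square mult_le_cancel_left1 intro: order_trans[OF l1])
  \<comment> \<open>A slack of 1 / N in the energy costs only \<open>N\<close> in the
    exponent.\<close>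
  define \<delta> where "\<delta> = 1 / real N"
  obtain F' where F': "F' \<in> CC" "E.J 0 F' \<le> E.minJ + \<delta>" using E.near_minimiser[of \<delta>] N0 by (auto simp: \<delta>_def)
  obtain l0 where l0: "l0 \<in> \<Omega> N" "\<And>z. \<bar>F' z - ecdf N l0 z\<bar> \<le> C2 * r N" using class_to_state[OF N F'(1)] by blast
  define g where "g = \<theta> * \<rho>\<^sup>2 / (4 * (hi - 0)\<^sup>2) - 2 * \<theta> * (hi - 0) * (lipc / \<theta>)\<^sup>2 * eN N
     - 2 * (C2 * r N * (\<theta> * (4 * ln ((hi - 0) / eN N) + 2) + E.absD)) - \<delta>"
  have "(\<Sum>l\<in>{l \<in> \<Omega> N. \<rho> \<le> dev F0 N l}. W N l / (\<Sum>l\<in>\<Omega> N. W N l))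
     \<le> real (card (\<Omega> N)) * exp (2 * (CE * real N * ln (real N)) - (real N)\<^sup>2 * g)"
  proof (rule gibbs_ratio_bound[OF card_\<Omega>(1)[OF N] state_weight(1)[OF N] state_weight(2)[OF N] l0(1)])
    fix l assume l: "l \<in> {l \<in> \<Omega> N. \<rho> \<le> dev F0 N l}"
    obtain F where F: "F \<in> CC" "\<And>z. \<bar>F z - ecdf N l z\<bar> \<le> C2 * r N" using state_to_class[OF N, of l] l by blast
    show "g \<le> E.J (eN N) (ecdf N l) - E.J (eN N) (ecdf N l0)"
      unfolding g_def
    proof (rule E.energy_gap[OF F0 ecdf_mono ecdf_nonneg ecdf_le_1 F ecdf_mono ecdf_nonneg ecdf_le_1 F'(1) l0(2) F'(2) eN[OF N]])
      show "2 * (C2 * r N) * (hi - 0) \<le> \<rho>" using \<rho> by simp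
      show "\<rho> \<le> (LINT x:{0..hi}|lborel. \<bar>ecdf N l x - F0 x\<bar>)" using l by (simp add: dev_def)
    qed
  qed auto
  also have "\<dots> \<le> exp (real N * ln (L * real N + 1)) * exp (2 * (CE * real N * ln (real N)) - (real N)\<^sup>2 * g)"
    by (intro mult_right_mono card_\<Omega>(2)[OF N]) auto
  also have "\<dots> = exp (real N * ln (L * real N + 1) + 2 * (CE * real N * ln (real N)) - (real N)\<^sup>2 * g)"
    by (simp add: exp_add[symmetric])
  also have "\<dots> \<le> exp (C3 * real N * (ln (real N))\<^sup>2 - \<theta> / (4 * hi\<^sup>2) * ((real N)\<^sup>2 * \<rho>\<^sup>2))"
  proof (subst exp_le_cancel_iff)
    have CE0: "0 \<le> CE" unfolding CE_def CV_def Gamma_ratio_const_def using \<theta> Cv_pos A3(1) V(2) A1(1) A2(1) const_pos(3)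
      by (intro add_nonneg_nonneg mult_nonneg_nonneg) auto
    have t1: "real N * ln (L * real N + 1) \<le> real N * ((\<bar>ln (L + 1)\<bar> + 1) * lN\<^sup>2)"
    proof (intro mult_left_mono)
      have "L * real N + 1 \<le> (L + 1) * real N" using N1 by (simp add: algebra_simps)
      hence "ln (L * real N + 1) \<le> ln ((L + 1) * real N)" using const_pos N0 by (subst ln_le_cancel_iff) (auto intro!: add_pos_pos mult_pos_pos)
      also have "\<dots> = ln (L + 1) + lN" using const_pos N0 by (simp add: ln_mult_pos lN_def)
      also have "\<dots> \<le> \<bar>ln (L + 1)\<bar> * lN\<^sup>2 + 1 * lN\<^sup>2"
      proof (intro add_mono)
        have "\<bar>ln (L + 1)\<bar> * 1 \<le> \<bar>ln (L + 1)\<bar> * lN\<^sup>2" using lN by (intro mult_left_mono) auto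
        thus "ln (L + 1) \<le> \<bar>ln (L + 1)\<bar> * lN\<^sup>2" by linarith
      qed (use lN in auto)
      finally show "ln (L * real N + 1) \<le> (\<bar>ln (L + 1)\<bar> + 1) * lN\<^sup>2" by (simp add: distrib_right)
    qed simp
    have t2: "2 * (CE * real N * lN) \<le> real N * (2 * CE * lN\<^sup>2)"
    proof -
      have "(2 * CE * real N) * lN \<le> (2 * CE * real N) * lN\<^sup>2" using lN CE0 N0 by (intro mult_left_mono) auto
      thus ?thesis by (simp add: algebra_simps)
    qed
    define B1 where "B1 = 2 * \<theta> * hi * (lipc / \<theta>)\<^sup>2 * cg"
    have B1: "0 \<le> B1" unfolding B1_def using \<theta> const_pos by (intro mult_nonneg_nonneg) auto
    have t3: "(real N)\<^sup>2 * (2 * \<theta> * hi * (lipc / \<theta>)\<^sup>2 * eN N) \<le> real N * (B1 * lN\<^sup>2)"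
    proof -
      have "(real N)\<^sup>2 * (2 * \<theta> * hi * (lipc / \<theta>)\<^sup>2 * eN N) = real N * (B1 * 1)"
        using N0 by (simp add: eN_def B1_def power2_eq_square)
      also have "\<dots> \<le> real N * (B1 * lN\<^sup>2)" using B1 lN by (intro mult_left_mono) auto
      finally show ?thesis .
    qed
    define B2 where "B2 = \<theta> * (4 * (\<bar>ln (hi / cg)\<bar> + 1) + 2) + E.absD"
    have t4: "(real N)\<^sup>2 * (2 * (C2 * r N * (\<theta> * (4 * ln (hi / eN N) + 2) + E.absD))) \<le> real N * (2 * C2 * B2 * lN\<^sup>2)"
    proof -
      have "ln (hi / eN N) = ln (hi / cg) + lN"
      proof -
        have "hi / eN N = (hi / cg) * real N" by (simp add: eN_def)
        moreover have "ln ((hi / cg) * real N) = ln (hi / cg) + ln (real N)"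
          by (rule ln_mult_pos) (use const_pos N0 in auto)
        ultimately show ?thesis by (simp only: lN_def)
      qed
      also have "\<dots> \<le> \<bar>ln (hi / cg)\<bar> * lN + 1 * lN"
      proof (intro add_mono)
        have "\<bar>ln (hi / cg)\<bar> * 1 \<le> \<bar>ln (hi / cg)\<bar> * lN" using lN by (intro mult_left_mono) auto
        thus "ln (hi / cg) \<le> \<bar>ln (hi / cg)\<bar> * lN" by linarith
      qed simp
      finally have "ln (hi / eN N) \<le> (\<bar>ln (hi / cg)\<bar> + 1) * lN" by (simp add: distrib_right)
      hence "4 * ln (hi / eN N) + 2 \<le> 4 * ((\<bar>ln (hi / cg)\<bar> + 1) * lN) + 2 * lN" using lN by linarith
      hence "\<theta> * (4 * ln (hi / eN N) + 2) \<le> \<theta> * (4 * ((\<bar>ln (hi / cg)\<bar> + 1) * lN) + 2 * lN)" using \<theta> by (intro mult_left_mono) auto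
      moreover have "E.absD * 1 \<le> E.absD * lN" using absD_nonneg lN by (intro mult_left_mono) auto
      ultimately have "\<theta> * (4 * ln (hi / eN N) + 2) + E.absD \<le> B2 * lN" unfolding B2_def by (simp add: algebra_simps)
      hence "2 * C2 * (real N * lN) * (\<theta> * (4 * ln (hi / eN N) + 2) + E.absD) \<le> 2 * C2 * (real N * lN) * (B2 * lN)"
        using C2_pos N0 lN by (intro mult_left_mono) auto
      moreover have rN: "(real N)\<^sup>2 * r N = real N * lN" using N0 by (simp add: r_def lN_def power2_eq_square)
      have "n2 * (2 * (c' * rr * X)) = 2 * c' * (n2 * rr) * X" for n2 c' rr X :: real by (simp add: algebra_simps)
      hence "(real N)\<^sup>2 * (2 * (C2 * r N * (\<theta> * (4 * ln (hi / eN N) + 2) + E.absD)))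
         = 2 * C2 * (real N * lN) * (\<theta> * (4 * ln (hi / eN N) + 2) + E.absD)"
        by (simp only: rN)
      ultimately show ?thesis by (simp add: power2_eq_square algebra_simps)
    qed
    have t5: "(real N)\<^sup>2 * \<delta> \<le> real N * (1 * lN\<^sup>2)"
    proof -
      have "(real N)\<^sup>2 * \<delta> = real N * 1" using N0 by (simp add: \<delta>_def power2_eq_square)
      also have "\<dots> \<le> real N * (1 * lN\<^sup>2)" using lN by (intro mult_left_mono) auto
      finally show ?thesis .
    qed
    have geq: "(real N)\<^sup>2 * g = \<theta> / (4 * hi\<^sup>2) * ((real N)\<^sup>2 * \<rho>\<^sup>2) - (real N)\<^sup>2 * (2 * \<theta> * hi * (lipc / \<theta>)\<^sup>2 * eN N)
       - (real N)\<^sup>2 * (2 * (C2 * r N * (\<theta> * (4 * ln (hi / eN N) + 2) + E.absD))) - (real N)\<^sup>2 * \<delta>"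
      unfolding g_def by (simp only: diff_zero right_diff_distrib) simp
    have C3eq: "C3 = (\<bar>ln (L + 1)\<bar> + 1) + 2 * CE + B1 + 2 * C2 * B2 + 1" unfolding C3_def B1_def B2_def by simp
    have Csum: "C3 * real N * lN\<^sup>2 = real N * ((\<bar>ln (L + 1)\<bar> + 1) * lN\<^sup>2) + real N * (2 * CE * lN\<^sup>2) + real N * (B1 * lN\<^sup>2)
        + real N * (2 * C2 * B2 * lN\<^sup>2) + real N * (1 * lN\<^sup>2)"
    proof -
      have "(x1 + x2 + x3 + x4 + 1) * n * t = n * (x1 * t) + n * (x2 * t) + n * (x3 * t) + n * (x4 * t) + n * (1 * t)"
        for x1 x2 x3 x4 n t :: real by (simp add: algebra_simps)
      thus ?thesis unfolding C3eq .
    qed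
    show "real N * ln (L * real N + 1) + 2 * (CE * real N * ln (real N)) - (real N)\<^sup>2 * g
      \<le> C3 * real N * (ln (real N))\<^sup>2 - \<theta> / (4 * hi\<^sup>2) * ((real N)\<^sup>2 * \<rho>\<^sup>2)"
      using t1 t2 t3 t4 t5 unfolding geq lN_def[symmetric] Csum by linarith
  qed
  finally show ?thesis .
qed

lemma eventually_ln_power:
  assumes e: "0 < e" and c: "0 < c0"
  shows "\<forall>\<^sub>F N in sequentially. C * (ln (real N))\<^sup>2 \<le> c0 * real N powr (2 * e)"
proof -
  define C' where "C' = \<bar>C\<bar> + 1"
  have C': "0 < C'" "C \<le> C'" by (auto simp: C'_def)
  have "(\<lambda>N. ln (real N) / real N powr e) \<longlonglongrightarrow> 0" using lim_ln_over_power[OF e] .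
  hence "(\<lambda>N. (ln (real N) / real N powr e)\<^sup>2) \<longlonglongrightarrow> 0\<^sup>2" by (rule tendsto_power)
  hence "(\<lambda>N. (ln (real N) / real N powr e)\<^sup>2) \<longlonglongrightarrow> 0" by simp
  hence "\<forall>\<^sub>F N in sequentially. (ln (real N) / real N powr e)\<^sup>2 < c0 / C'"
    by (rule order_tendstoD(2)) (use c C' in simp)
  thus ?thesis using eventually_gt_at_top[of 0]
  proof eventually_elim
    case (elim N)
    have pp: "0 < real N powr e" using elim by simp
    have "(ln (real N))\<^sup>2 / (real N powr e)\<^sup>2 < c0 / C'" using elim by (simp add: power_divide)
    hence "C' * (ln (real N))\<^sup>2 \<le> c0 * (real N powr e)\<^sup>2" using pp C' by (simp add: field_simps)
    moreover have "(real N powr e)\<^sup>2 = real N powr (2 * e)" by (simp add: power2_eq_square powr_add[symmetric])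
    moreover have "C * (ln (real N))\<^sup>2 \<le> C' * (ln (real N))\<^sup>2" using C' by (intro mult_right_mono) auto
    ultimately show ?case by simp
  qed
qed

text \<open>At this radius \<rho>, \<open>N\<^sup>2 * \<rho>\<^sup>2\<close> equals
  \<open>N powr (1 + 2 * e)\<close>, which beats both \<open>N * (ln N)\<^sup>2\<close> and
  \<open>N\<close>, while \<rho> still exceeds the resolution \<open>r N\<close> of the
  approximation.\<close>

lemma concentration:
  assumes F0: "F0 \<in> CC" "\<And>F. F \<in> CC \<Longrightarrow> \<theta> / (hi - 0) * (LINT x:{0..hi}|lborel. (F x - F0 x)\<^sup>2) \<le> E.J 0 F - E.minJ"
    and e: "0 < e"
  shows "\<forall>\<^sub>F N in sequentially. (\<Sum>l\<in>{l \<in> \<Omega> N. real N powr (e - 1 / 2) \<le> dev F0 N l}. W N l / (\<Sum>l\<in>\<Omega> N. W N l)) \<le> exp (- real N)"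
proof -
  have c: "0 < \<theta> / (4 * hi\<^sup>2)" using \<theta> const_pos by simp
  have "\<forall>\<^sub>F N in sequentially. 2 * C2 * hi * (ln (real N))\<^sup>2 \<le> 1 * real N powr (2 * (1 / 4 + e / 2))"
    using e by (intro eventually_ln_power) auto
  moreover have "\<forall>\<^sub>F N in sequentially. (C3 + 1) * (ln (real N))\<^sup>2 \<le> \<theta> / (4 * hi\<^sup>2) * real N powr (2 * e)"
    by (rule eventually_ln_power[OF e c])
  ultimately show ?thesis using eventually_big
  proof eventually_elim
    case (elim N)
    have N: "big N" by fact
    have N0: "0 < real N" using N by (auto simp: big_def)
    have l1: "1 \<le> ln (real N)" using r_bounds(3)[OF N] .
    define \<rho> where "\<rho> = real N powr (e - 1 / 2)"
    have l2: "ln (real N) \<le> (ln (real N))\<^sup>2" "1 \<le> (ln (real N))\<^sup>2"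
      using l1 by (auto simp: power2_eq_square mult_le_cancel_left1 intro: order_trans[OF l1])
    have \<rho>1: "2 * (C2 * r N) * hi \<le> \<rho>"
    proof -
      have "2 * C2 * hi * ln (real N) \<le> 2 * C2 * hi * (ln (real N))\<^sup>2" using l2 C2_pos const_pos by (intro mult_left_mono) auto
      \<comment> \<open>The exponent \<open>1 / 4 + e / 2\<close> was taken so that its double is
        \<open>(e - 1 / 2) + 1\<close>; dividing by \<open>N\<close> then leaves \<rho>.\<close>
      also have "\<dots> \<le> real N powr (1 / 2 + e)" using elim(1) by (simp add: algebra_simps)
      also have "1 / 2 + e = (e - 1 / 2) + 1" by simp
      also have "real N powr ((e - 1 / 2) + 1) = \<rho> * real N" using N0 by (simp only: powr_add \<rho>_def powr_one)
      finally have "2 * C2 * hi * ln (real N) / real N \<le> \<rho>" using N0 by (simp add: divide_le_eq)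
      thus ?thesis by (simp add: r_def algebra_simps)
    qed
    have \<rho>2: "(real N)\<^sup>2 * \<rho>\<^sup>2 = real N * real N powr (2 * e)"
    proof -
      have "real N * \<rho> = real N powr (e + 1 / 2)"
      proof -
        have "real N * \<rho> = real N powr 1 * real N powr (e - 1 / 2)" using N0 by (simp add: \<rho>_def)
        also have "\<dots> = real N powr (e + 1 / 2)" by (subst powr_add[symmetric]) (simp add: add.commute)
        finally show ?thesis .
      qed
      hence "(real N * \<rho>)\<^sup>2 = real N powr (1 + 2 * e)" by (simp add: power2_eq_square powr_add[symmetric] add.commute)
      also have "\<dots> = real N * real N powr (2 * e)" using N0 by (simp add: powr_add)
      finally show ?thesis by (simp add: power_mult_distrib)
    qed
    have "(\<Sum>l\<in>{l \<in> \<Omega> N. \<rho> \<le> dev F0 N l}. W N l / (\<Sum>l\<in>\<Omega> N. W N l))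
     \<le> exp (C3 * real N * (ln (real N))\<^sup>2 - \<theta> / (4 * hi\<^sup>2) * ((real N)\<^sup>2 * \<rho>\<^sup>2))"
      by (rule concentration_fixed[OF F0 N \<rho>1])
    also have "\<dots> \<le> exp (- real N)"
    proof (subst exp_le_cancel_iff)
      have "real N * ((C3 + 1) * (ln (real N))\<^sup>2) \<le> real N * (\<theta> / (4 * hi\<^sup>2) * real N powr (2 * e))"
        using elim(2) by (intro mult_left_mono) auto
      moreover have "real N * 1 \<le> real N * (ln (real N))\<^sup>2" using l2 by (intro mult_left_mono) auto
      ultimately show "C3 * real N * (ln (real N))\<^sup>2 - \<theta> / (4 * hi\<^sup>2) * ((real N)\<^sup>2 * \<rho>\<^sup>2) \<le> - real N"
        unfolding \<rho>2 by (simp add: algebra_simps)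
    qed
    finally show ?case unfolding \<rho>_def .
  qed
qed

end

section \<open>The law of large numbers\<close>

text \<open>The McShane extension by an infimum of cones. The test function is Lipschitz only on
  \<open>U\<close>, whereas integration by parts runs over a whole interval, including the gaps
  between blocks.\<close>

lemma lipschitz_extension:
  fixes f :: "real \<Rightarrow> real"
  assumes f: "L-lipschitz_on U f" and U: "U \<noteq> {}"
  shows "\<exists>g. (\<forall>x\<in>U. g x = f x) \<and> (\<forall>x y. \<bar>g x - g y\<bar> \<le> L * \<bar>x - y\<bar>)"
proof -
  define g where "g x = (INF y\<in>U. f y + L * \<bar>x - y\<bar>)" for x
  have L: "0 \<le> L" using f by (rule lipschitz_on_nonneg)
  have lip: "\<bar>f x - f y\<bar> \<le> L * \<bar>x - y\<bar>" if "x \<in> U" "y \<in> U" for x y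
    using lipschitz_onD[OF f that] by (simp add: dist_real_def)
  have tri: "L * \<bar>x - z\<bar> \<le> L * \<bar>x - y\<bar> + L * \<bar>y - z\<bar>" for x y z
    using L by (simp flip: distrib_left) (intro mult_left_mono, auto)
  obtain y0 where y0: "y0 \<in> U" using U by blast
  have bdd: "bdd_below ((\<lambda>y. f y + L * \<bar>x - y\<bar>) ` U)" for x
  proof (rule bdd_belowI2)
    fix y assume y: "y \<in> U"
    show "f y0 - L * \<bar>x - y0\<bar> \<le> f y + L * \<bar>x - y\<bar>"
      using lip[OF y0 y] tri[of y0 y x] by (simp add: abs_minus_commute abs_le_iff)
  qed
  have "g x = f x" if x: "x \<in> U" for x
  proof (rule antisym)
    show "g x \<le> f x" unfolding g_def using cINF_lower[OF bdd x, of x] by simp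
    have "f x \<le> f y + L * \<bar>x - y\<bar>" if "y \<in> U" for y using lip[OF x that] by linarith
    thus "f x \<le> g x" unfolding g_def by (intro cINF_greatest U)
  qed
  moreover have le: "g x - g y \<le> L * \<bar>x - y\<bar>" for x y
  proof -
    have "g x - L * \<bar>x - y\<bar> \<le> f z + L * \<bar>y - z\<bar>" if z: "z \<in> U" for z
    proof -
      have "g x \<le> f z + L * \<bar>x - z\<bar>" unfolding g_def by (rule cINF_lower[OF bdd z])
      thus ?thesis using tri[of x z y] by linarith
    qed
    hence "g x - L * \<bar>x - y\<bar> \<le> g y" unfolding g_def[of y] by (intro cINF_greatest U)
    thus ?thesis by linarith
  qed
  have "\<bar>g x - g y\<bar> \<le> L * \<bar>x - y\<bar>" for x y
    using le[of x y] le[of y x] by (simp add: abs_le_iff abs_minus_commute)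
  ultimately show ?thesis by blast
qed

lemma expectation_empirical:
  fixes f :: "real \<Rightarrow> real"
  assumes "1 \<le> N"
  shows "measure_pmf.expectation (empirical_measure N l) f = (\<Sum>j = 1..N. f (l j)) / real N"
  unfolding empirical_measure_def using assms by (simp add: integral_pmf_of_set)

context lattice_gas
begin

definition support :: "real set" where "support = (\<Union>i\<in>{1..k}. {ah i..bh i})"

text \<open>Across a gap between blocks both ends carry the same prescribed level
  \<open>c i\<close>, so monotonicity makes the function constant there; beyond the extreme blocks
  it is 0 or 1.\<close>

lemma CC_flat:
  assumes F: "F \<in> CC" and x: "x \<notin> support"
  shows "\<exists>e>0. F (x + e) = F (x - e)"
proof -
  consider "x < ah 1" | "bh k < x" | "ah 1 \<le> x" "x \<le> bh k" by linarith
  thus ?thesis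
  proof cases
    case 1
    have "F (x + (ah 1 - x)) = F (x - (ah 1 - x))"
      using CC_basic(7)[OF F, of "x + (ah 1 - x)"] CC_basic(7)[OF F, of "x - (ah 1 - x)"] 1 by simp
    thus ?thesis using 1 by (intro exI[of _ "ah 1 - x"]) auto
  next
    case 2
    have "F (x + (x - bh k)) = F (x - (x - bh k))"
      using CC_basic(8)[OF F, of "x + (x - bh k)"] CC_basic(8)[OF F, of "x - (x - bh k)"] 2 by simp
    thus ?thesis using 2 by (intro exI[of _ "x - bh k"]) auto
  next
    case 3
    define A where "A = {i \<in> {1..k}. ah i \<le> x}"
    have A: "finite A" "A \<noteq> {}" using 3 k by (auto simp: A_def)
    define i where "i = Max A"
    have i: "i \<in> {1..k}" "ah i \<le> x" using Max_in[OF A] unfolding i_def[symmetric] by (auto simp: A_def)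
    have bx: "bh i < x" using x i unfolding support_def by (meson UN_I atLeastAtMost_iff not_less)
    have ik: "i \<noteq> k" using bx 3 by auto
    have i1: "i + 1 \<in> {1..k}" using i ik by auto
    have xa: "x < ah (i + 1)"
    proof (rule ccontr)
      assume "\<not> x < ah (i + 1)"
      hence "i + 1 \<in> A" using i1 by (auto simp: A_def)
      hence "i + 1 \<le> i" unfolding i_def using A(1) by (intro Max_ge)
      thus False by simp
    qed
    define e where "e = min (x - bh i) (ah (i + 1) - x)"
    have e: "0 < e" using bx xa by (simp add: e_def)
    have val: "F z = c i" if "bh i \<le> z" "z \<le> ah (i + 1)" for z
      using monoD[OF CC_basic(1)[OF F] that(1)] monoD[OF CC_basic(1)[OF F] that(2)]
        CC_basic(5)[OF F i1] CC_basic(6)[OF F i(1)] by simp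
    have "F (x + e) = F (x - e)" using val[of "x + e"] val[of "x - e"] e by (simp add: e_def min_def split: if_splits)
    thus ?thesis using e by blast
  qed
qed

lemma dev_le:
  assumes F0: "F0 \<in> CC" shows "0 \<le> dev F0 N l" "dev F0 N l \<le> hi"
proof -
  show "0 \<le> dev F0 N l" unfolding dev_def set_lebesgue_integral_def by simp
  have b: "\<bar>ecdf N l x - F0 x\<bar> \<le> 1" for x
    using ecdf_nonneg[of N l x] ecdf_le_1[of N l x] CC_basic(2,3)[OF F0, of x] by auto
  have [measurable]: "F0 \<in> borel_measurable borel" using CC_basic(1)[OF F0] by (rule borel_measurable_mono)
  have "dev F0 N l \<le> (LINT x:{0..hi}|lborel. 1)"
    unfolding dev_def using b by (intro set_integral_mono set_integrable_bounded_Icc[where B = 1]) auto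
  also have "\<dots> = hi" using const_pos by (simp add: set_integral_const emeasure_lborel_Icc_eq)
  finally show "dev F0 N l \<le> hi" .
qed

text \<open>Compactness of the support gives a uniform margin inside \<open>U\<close>, while
  particles overshoot their limiting block by at most \<open>A2 * r N\<close>.\<close>

lemma eventually_in_nhd:
  assumes U: "open U" "support \<subseteq> U"
  shows "\<forall>\<^sub>F N in sequentially. \<forall>l\<in>\<Omega> N. \<forall>j\<in>{1..N}. l j \<in> U"
proof -
  have "compact support" unfolding support_def by (intro compact_UN) auto
  then obtain e where e: "0 < e" "(\<Union>x\<in>support. ball x e) \<subseteq> U"
    using compact_subset_open_imp_ball_epsilon_subset[OF _ U] by blast
  have "(\<lambda>N. A2 * r N) \<longlonglongrightarrow> A2 * 0" by (intro tendsto_intros r_tendsto)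
  hence "\<forall>\<^sub>F N in sequentially. A2 * r N < e" by (rule order_tendstoD) (use e in simp)
  thus ?thesis using eventually_big
  proof eventually_elim
    case (elim N)
    have N: "big N" by fact
    have N2: "2 \<le> N" using N by (auto simp: big_def)
    show ?case
    proof (intro ballI)
      fix l j assume l: "l \<in> \<Omega> N" and j: "j \<in> {1..N}"
      obtain x where x: "config_ok k N (n N) (a N) (b N) x" and lx: "l = state N x" using l by (auto simp: \<Omega>_eq)
      note sf = state_facts[OF N x j]
      define i where "i = blk (n N) j"
      have i: "i \<in> {1..k}" using sf(6) by (simp add: i_def)
      have "\<bar>alpha_pt \<theta> (q N) (u N) (n N) (a N) i - ah i\<bar> \<le> A2 * r N" "\<bar>beta_pt \<theta> (q N) (u N) (n N) (b N) i - bh i\<bar> \<le> A2 * r N"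
        using A2(2) N2 i unfolding r_def by auto
      hence lj: "ah i - A2 * r N \<le> l j" "l j \<le> bh i + A2 * r N"
        using sf(7,8,9) unfolding lx i_def[symmetric] by linarith+
      define z where "z = max (ah i) (min (bh i) (l j))"
      have "ah i < bh i" using ends(2) i by blast
      hence "z \<in> {ah i..bh i}" "dist z (l j) < e" using lj elim(1) A2(1) r_bounds(2)[OF N]
        unfolding z_def dist_real_def by (auto simp: max_def min_def abs_less_iff) (smt (verit) mult_pos_pos)+
      hence "l j \<in> (\<Union>x\<in>support. ball x e)" using i unfolding support_def by fastforce
      thus "l j \<in> U" using e(2) by blast
    qed
  qed
qed

lemma exp_minus_tendsto: "(\<lambda>N. exp (- real N)) \<longlonglongrightarrow> 0"
proof -
  have "(\<lambda>N. exp (- 1 :: real) ^ N) \<longlonglongrightarrow> 0" by (intro LIMSEQ_power_zero) simp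
  moreover have "exp (- 1 :: real) ^ N = exp (- real N)" for N by (simp add: exp_of_nat_mult[symmetric])
  ultimately show ?thesis by simp
qed

text \<open>Off an event of probability at most \<open>exp (- N)\<close> the variable is at most
  \<open>Lf * N powr (- \<epsilon> / 2)\<close>, which gives convergence in probability. On the
  event it is bounded by a multiple of \<open>N\<close>, so its contribution to any moment is a
  power of \<open>N\<close> times \<open>exp (- N)\<close>.\<close>

lemma limit_law:
  assumes F0: "F0 \<in> CC" "\<And>F. F \<in> CC \<Longrightarrow> \<theta> / (hi - 0) * (LINT x:{0..hi}|lborel. (F x - F0 x)\<^sup>2) \<le> E.J 0 F - E.minJ"
    and f: "Lf-lipschitz_on U f" "open U" "support \<subseteq> U" and \<epsilon>: "0 < \<epsilon>"
    and \<mu>: "\<mu> \<in> borel_measurable borel" "\<And>x. 0 \<le> \<mu> x" "prob_space (density lborel (\<lambda>x. ennreal (\<mu> x)))"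
      "\<And>x. x \<notin> support \<Longrightarrow> \<mu> x = 0" "\<And>x. measure (density lborel (\<lambda>x. ennreal (\<mu> x))) {..x} = F0 x"
    and X: "X = (\<lambda>N l. real N powr (1 / 2 - \<epsilon>) *
                  \<bar>measure_pmf.expectation (empirical_measure N l) f - (LINT x|lborel. f x * \<mu> x)\<bar>)"
    and P: "P = (\<lambda>N. ensemble k \<theta> N (q N) (u N) (n N) (a N) (b N) (w N))"
  shows "0 < \<delta> \<Longrightarrow> (\<lambda>N. measure (P N) {l \<in> space (P N). \<delta> < X N l}) \<longlonglongrightarrow> 0"
    and "1 \<le> m \<Longrightarrow> (\<lambda>N. LINT l|P N. X N l ^ m) \<longlonglongrightarrow> 0"
proof -
  have Lf: "0 \<le> Lf" using f(1) by (rule lipschitz_on_nonneg)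
  have "support \<noteq> {}" unfolding support_def using ends(2) k by force
  hence "U \<noteq> {}" using f(3) by blast
  then obtain g where g: "\<And>x. x \<in> U \<Longrightarrow> g x = f x" "\<And>x y. \<bar>g x - g y\<bar> \<le> Lf * \<bar>x - y\<bar>"
    using lipschitz_extension[OF f(1)] by blast
  define law where "law = density lborel (\<lambda>x. ennreal (\<mu> x))"
  \<comment> \<open>Off the support the density vanishes, and on it the extension agrees with
    \<open>f\<close>; this permits arbitrary values of \<open>f\<close> outside
    \<open>U\<close>.\<close>
  have eqf: "f x * \<mu> x = \<mu> x * g x" for x using \<mu>(4)[of x] g(1)[of x] f(3) by (cases "x \<in> support") auto
  have gm: "g \<in> borel_measurable borel" by (rule lipschitz_measurable[OF g(2)])
  hence int: "(LINT x|lborel. f x * \<mu> x) = (LINT x|law. g x)"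
    unfolding law_def eqf using \<mu>(1,2) by (subst integral_density) auto
  define Z where "Z N = (\<Sum>l\<in>\<Omega> N. W N l)" for N
  define p where "p N l = W N l / Z N" for N l
  have PN: "P N = point_measure (\<Omega> N) (\<lambda>l. ennreal (p N l))" for N
    unfolding P ensemble_def \<Omega>_def[symmetric] p_def Z_def W_def partition_fun_def by simp
  \<comment> \<open>Half of \<epsilon> is spent on the radius of concentration; the other half makes
    \<open>Bd\<close> tend to 0.\<close>
  define e where "e = \<epsilon> / 2"
  have e: "0 < e" using \<epsilon> by (simp add: e_def)
  define bad where "bad N = {l \<in> \<Omega> N. real N powr (e - 1 / 2) \<le> dev F0 N l}" for N
  define Bd where "Bd N = Lf * real N powr (- e)" for N
  have Bd0: "Bd \<longlonglongrightarrow> 0"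
  proof -
    have "(\<lambda>N. Lf * real N powr (- e)) \<longlonglongrightarrow> Lf * 0"
      using e by (intro tendsto_intros tendsto_neg_powr filterlim_real_sequentially) auto
    thus ?thesis by (simp add: Bd_def[abs_def])
  qed
  have Xdev: "\<forall>\<^sub>F N in sequentially. \<forall>l\<in>\<Omega> N. 0 \<le> X N l \<and> X N l \<le> real N powr (1 / 2 - \<epsilon>) * (Lf * dev F0 N l)"
    using eventually_in_nhd[OF f(2,3)] eventually_big
  proof eventually_elim
    case (elim N)
    have N: "big N" by fact
    have N1: "1 \<le> N" using N by (auto simp: big_def)
    show ?case
    proof
      fix l assume l: "l \<in> \<Omega> N"
      have "(\<Sum>j = 1..N. f (l j)) = (\<Sum>j = 1..N. g (l j))"
        using elim(1) l g(1) by (intro sum.cong) auto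
      hence ex: "measure_pmf.expectation (empirical_measure N l) f = (\<Sum>j = 1..N. g (l j)) / real N"
        using expectation_empirical[OF N1] by simp
      have F00: "F0 0 = 0" using ends(1) uh by (intro CC_basic(7)[OF F0(1)]) auto
      have F0h: "F0 hi = 1" using ends(4) tp_hi unfolding tp_def by (intro CC_basic(8)[OF F0(1)]) auto
      have "\<bar>(\<Sum>j = 1..N. g (l j)) / real N - (LINT x|law. g x)\<bar> \<le> Lf * (LINT x:{0..hi}|lborel. \<bar>ecdf N l x - F0 x\<bar>)"
        unfolding law_def
        by (rule lipschitz_average_bound(1)[OF g(2) N1 state_weight(3)[OF N l] \<mu>(3) _ \<mu>(5) F00 F0h]) auto
      thus "0 \<le> X N l \<and> X N l \<le> real N powr (1 / 2 - \<epsilon>) * (Lf * dev F0 N l)"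
        unfolding X ex int dev_def by (auto intro!: mult_left_mono)
    qed
  qed
  have conc: "\<forall>\<^sub>F N in sequentially. (\<Sum>l\<in>bad N. p N l) \<le> exp (- real N)"
    unfolding bad_def p_def Z_def by (rule concentration[OF F0 e])
  have main: "\<forall>\<^sub>F N in sequentially. finite (\<Omega> N) \<and> (\<forall>l\<in>\<Omega> N. 0 \<le> p N l) \<and> (\<Sum>l\<in>\<Omega> N. p N l) \<le> 1 \<and>
      (\<Sum>l\<in>bad N. p N l) \<le> exp (- real N) \<and>
      (\<forall>l\<in>\<Omega> N. 0 \<le> X N l \<and> X N l \<le> Lf * hi * real N) \<and> (\<forall>l\<in>\<Omega> N - bad N. X N l \<le> Bd N)"
    using Xdev eventually_big conc
  proof eventually_elim
    case (elim N)
    have N: "big N" by fact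
    have N0: "1 \<le> real N" using N by (auto simp: big_def)
    have fin: "finite (\<Omega> N)" by (rule card_\<Omega>(1)[OF N])
    have Z0: "0 \<le> Z N" unfolding Z_def using state_weight(1)[OF N] by (intro sum_nonneg) (auto intro: less_imp_le)
    have p0: "0 \<le> p N l" if "l \<in> \<Omega> N" for l
      unfolding p_def using state_weight(1)[OF N that] Z0 by simp
    \<comment> \<open>The inequality drawn from this also covers \<open>Z N = 0\<close>, where the
      quotient is 0 by convention.\<close>
    have "(\<Sum>l\<in>\<Omega> N. p N l) = Z N / Z N" unfolding p_def sum_divide_distrib[symmetric] Z_def ..
    hence p1: "(\<Sum>l\<in>\<Omega> N. p N l) \<le> 1" by simp
    have pb: "(\<Sum>l\<in>bad N. p N l) \<le> exp (- real N)" by fact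
    \<comment> \<open>A crude deterministic bound from \<open>dev \<le> hi\<close>, used in the
      moments on the exceptional event.\<close>
    have Xh: "X N l \<le> Lf * hi * real N" if l: "l \<in> \<Omega> N" for l
    proof -
      have "X N l \<le> real N powr (1 / 2 - \<epsilon>) * (Lf * dev F0 N l)" using elim(1) l by blast
      also have "\<dots> \<le> real N powr 1 * (Lf * hi)"
        using N0 \<epsilon> Lf dev_le[OF F0(1)] by (intro mult_mono powr_mono mult_left_mono mult_nonneg_nonneg) auto
      finally show ?thesis using N0 by (simp add: mult.commute)
    qed
    have Xg: "X N l \<le> Bd N" if l: "l \<in> \<Omega> N - bad N" for l
    proof -
      have "dev F0 N l \<le> real N powr (e - 1 / 2)" using l unfolding bad_def by auto
      hence "real N powr (1 / 2 - \<epsilon>) * (Lf * dev F0 N l) \<le> real N powr (1 / 2 - \<epsilon>) * (Lf * real N powr (e - 1 / 2))"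
        using Lf by (intro mult_left_mono) auto
      also have "\<dots> = Lf * (real N powr (1 / 2 - \<epsilon>) * real N powr (e - 1 / 2))" by simp
      also have "real N powr (1 / 2 - \<epsilon>) * real N powr (e - 1 / 2) = real N powr (- e)"
        by (subst powr_add[symmetric]) (simp add: e_def)
      finally show ?thesis using elim(1) l unfolding Bd_def by force
    qed
    show ?case using fin p0 p1 pb Xh Xg elim(1) by blast
  qed
  have badsub: "bad N \<subseteq> \<Omega> N" for N by (auto simp: bad_def)
  show "(\<lambda>N. measure (P N) {l \<in> space (P N). \<delta> < X N l}) \<longlonglongrightarrow> 0" if \<delta>: "0 < \<delta>"
  proof (rule tendsto_sandwich[OF _ _ tendsto_const exp_minus_tendsto])
    have "\<forall>\<^sub>F N in sequentially. Bd N < \<delta>" using Bd0 \<delta> by (rule order_tendstoD(2))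
    thus "\<forall>\<^sub>F N in sequentially. measure (P N) {l \<in> space (P N). \<delta> < X N l} \<le> exp (- real N)"
      using main
    proof eventually_elim
      case (elim N)
      have sp: "space (P N) = \<Omega> N" unfolding PN by (simp add: space_point_measure)
      have sub: "{l \<in> \<Omega> N. \<delta> < X N l} \<subseteq> bad N" using elim by force
      have "measure (P N) {l \<in> space (P N). \<delta> < X N l} = (\<Sum>l\<in>{l \<in> \<Omega> N. \<delta> < X N l}. p N l)"
        unfolding sp unfolding PN using elim(2) by (subst measure_point_measure_finite_if) auto
      also have "\<dots> \<le> (\<Sum>l\<in>bad N. p N l)"
        using elim(2) badsub[of N] by (intro sum_mono2 sub) (auto intro: finite_subset)
      also have "\<dots> \<le> exp (- real N)" using elim(2) by blast
      finally show ?case .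
    qed
  qed (auto intro: always_eventually)
  show "(\<lambda>N. LINT l|P N. X N l ^ m) \<longlonglongrightarrow> 0" if m: "1 \<le> m"
  proof (rule tendsto_sandwich[OF _ _ tendsto_const])
    have eq: "\<forall>\<^sub>F N in sequentially. (LINT l|P N. X N l ^ m) = (\<Sum>l\<in>\<Omega> N. p N l * X N l ^ m)"
      using main
    proof eventually_elim
      case (elim N)
      show ?case unfolding PN using elim by (subst lebesgue_integral_point_measure_finite) auto
    qed
    show "\<forall>\<^sub>F N in sequentially. 0 \<le> (LINT l|P N. X N l ^ m)"
      using eq main
    proof eventually_elim
      case (elim N)
      show ?case unfolding elim(1) using elim(2) by (intro sum_nonneg mult_nonneg_nonneg zero_le_power) auto
    qed
    show "\<forall>\<^sub>F N in sequentially. (LINT l|P N. X N l ^ m) \<le> \<bar>Bd N\<bar> ^ m + (Lf * hi) ^ m * (real N ^ m / exp (real N))"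
      using eq main
    proof eventually_elim
      case (elim N)
      let ?K = "(Lf * hi * real N) ^ m"
      have K: "0 \<le> ?K" using Lf const_pos by simp
      have "(\<Sum>l\<in>\<Omega> N. p N l * X N l ^ m) \<le> (\<Sum>l\<in>\<Omega> N. p N l * \<bar>Bd N\<bar> ^ m + (if l \<in> bad N then p N l * ?K else 0))"
      proof (rule sum_mono)
        fix l assume l: "l \<in> \<Omega> N"
        show "p N l * X N l ^ m \<le> p N l * \<bar>Bd N\<bar> ^ m + (if l \<in> bad N then p N l * ?K else 0)"
        proof (cases "l \<in> bad N")
          case True
          have "p N l * X N l ^ m \<le> p N l * ?K" using elim(2) l by (intro mult_left_mono power_mono) auto
          moreover have "0 \<le> p N l * \<bar>Bd N\<bar> ^ m" using elim(2) l by auto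
          ultimately show ?thesis using True by simp
        next
          case False
          have "X N l \<le> \<bar>Bd N\<bar>" using elim(2) l False by (metis DiffI abs_ge_self order_trans)
          hence "p N l * X N l ^ m \<le> p N l * \<bar>Bd N\<bar> ^ m" using elim(2) l by (intro mult_left_mono power_mono) auto
          thus ?thesis using False by simp
        qed
      qed
      also have "\<dots> = (\<Sum>l\<in>\<Omega> N. p N l) * \<bar>Bd N\<bar> ^ m + (\<Sum>l\<in>\<Omega> N \<inter> bad N. p N l * ?K)"
        using elim(2) by (simp add: sum.distrib sum_distrib_right sum.inter_restrict)
      also have "\<Omega> N \<inter> bad N = bad N" using badsub by blast
      also have "(\<Sum>l\<in>bad N. p N l * ?K) = (\<Sum>l\<in>bad N. p N l) * ?K" by (simp add: sum_distrib_right)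
      also have "(\<Sum>l\<in>\<Omega> N. p N l) * \<bar>Bd N\<bar> ^ m + (\<Sum>l\<in>bad N. p N l) * ?K \<le> 1 * \<bar>Bd N\<bar> ^ m + exp (- real N) * ?K"
        using elim(2) K by (intro add_mono mult_right_mono) auto
      also have "\<dots> = \<bar>Bd N\<bar> ^ m + (Lf * hi) ^ m * (real N ^ m / exp (real N))"
        by (simp add: exp_minus power_mult_distrib field_simps)
      finally show ?case unfolding elim(1) .
    qed
    have "(\<lambda>N. \<bar>Bd N\<bar> ^ m) \<longlonglongrightarrow> \<bar>0\<bar> ^ m" by (intro tendsto_intros Bd0)
    moreover have "(\<lambda>N. (Lf * hi) ^ m * (real N ^ m / exp (real N))) \<longlonglongrightarrow> (Lf * hi) ^ m * 0"
      by (intro tendsto_intros filterlim_compose[OF tendsto_power_div_exp_0 filterlim_real_sequentially])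
    ultimately have "(\<lambda>N. \<bar>Bd N\<bar> ^ m + (Lf * hi) ^ m * (real N ^ m / exp (real N))) \<longlonglongrightarrow> \<bar>0\<bar> ^ m + (Lf * hi) ^ m * 0"
      by (rule tendsto_add)
    thus "(\<lambda>N. \<bar>Bd N\<bar> ^ m + (Lf * hi) ^ m * (real N ^ m / exp (real N))) \<longlonglongrightarrow> 0"
      using m by (simp add: zero_power)
  qed
qed

end

theorem theorem3p1p1:
  fixes k :: nat and \<theta> :: real
    and q u :: "nat \<Rightarrow> real" and M :: "nat \<Rightarrow> nat"
    and n :: "nat \<Rightarrow> nat \<Rightarrow> nat" and a b :: "nat \<Rightarrow> nat \<Rightarrow> int"
    and w VN :: "nat \<Rightarrow> real \<Rightarrow> real"
    and qh Mh uh :: real and ah bh \<nu> :: "nat \<Rightarrow> real"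
    and V :: "real \<Rightarrow> real" and I :: "real set"
    and A1 A2 A3 A4 A5 A6 A7 :: real
  defines "\<alpha> \<equiv> \<lambda>N. alpha_pt \<theta> (q N) (u N) (n N) (a N)"
    and "\<beta> \<equiv> \<lambda>N. beta_pt \<theta> (q N) (u N) (n N) (b N)"
    and "\<beta>m \<equiv> \<lambda>N. beta_minus_pt \<theta> (q N) (u N) (n N) (b N)"
    and "top_pt \<equiv> quad_lattice qh uh (Mh + \<theta> - 1)"
    and "P \<equiv> \<lambda>N. ensemble k \<theta> N (q N) (u N) (n N) (a N) (b N) (w N)"
  assumes "1 \<le> k" and "0 < \<theta>"
    and "\<forall>N\<ge>1. finite_system k \<theta> N (q N) (M N) (u N) (n N) (a N) (b N) (w N)"
    and A1: "0 < qh" "qh < 1" "1 \<le> Mh" "0 \<le> uh" "uh < 1" "0 < A1"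
      "\<forall>N\<ge>1. max (max ((real N)\<^sup>2 * \<bar>q N - qh powr (1 / real N)\<bar>) \<bar>real (M N) - real N * Mh\<bar>)
                 (real N * \<bar>u N - uh\<bar>) \<le> A1"
    and A2_endpoints: "1 + uh \<le> ah 1" "\<forall>i\<in>{1..k}. ah i < bh i"
      "\<forall>i\<in>{1..<k}. bh i < ah (i + 1)" "bh k \<le> top_pt" "0 < A2"
      "\<forall>N\<ge>2. \<forall>i\<in>{1..k}. \<bar>\<alpha> N i - ah i\<bar> \<le> A2 * ln (real N) / real N \<and>
                           \<bar>\<beta> N i - bh i\<bar> \<le> A2 * ln (real N) / real N"
    and A2_weights: "\<forall>N\<ge>1. \<forall>i\<in>{1..k}. continuous_on {\<alpha> N i..\<beta>m N i} (VN N) \<and>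
                           (\<forall>x\<in>{\<alpha> N i..\<beta>m N i}. w N x = exp (- real N * VN N x))"
      "0 < A3"
      "\<forall>N\<ge>2. \<forall>i\<in>{1..k}. \<forall>x\<in>{\<alpha> N i..\<beta>m N i}. \<bar>VN N x - V x\<bar> \<le> A3 * ln (real N) / real N"
    and A2_potential: "is_interval I" "{1 + uh..top_pt} \<subseteq> I"
      "\<forall>N\<ge>1. \<forall>i\<in>{1..k}. {\<alpha> N i..\<beta>m N i} \<subseteq> I"
      "continuous_on I V" "0 < A4" "\<forall>x\<in>I. \<bar>V x\<bar> \<le> A4" "0 < A5"
      "\<forall>s\<in>{1 + uh..top_pt} - (ah ` {1..k} \<union> bh ` {1..k}).
         \<exists>D. (V has_real_derivative D) (at s within {1 + uh..top_pt}) \<and>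
             \<bar>D\<bar> \<le> A5 * (1 + (\<Sum>i = 1..k. \<bar>ln \<bar>s - ah i\<bar>\<bar> + \<bar>ln \<bar>s - bh i\<bar>\<bar>))"
    and A3: "0 < A6"
      "\<forall>\<^sub>F N in sequentially. \<forall>i\<in>{1..k}.
         A6 < real (n N i) / real N \<and>
         real (n N i) / real N < (quad_lattice_inv qh uh (bh i) - quad_lattice_inv qh uh (ah i)) / \<theta> - A6"
    and filling: "0 < A7" "\<forall>i\<in>{1..k}. 0 < \<nu> i" "(\<Sum>i = 1..k. \<nu> i) = 1"
      "\<forall>N\<ge>2. \<forall>i\<in>{1..k}. \<bar>real (n N i) / real N - \<nu> i\<bar> \<le> A7 * ln (real N) / real N"
  shows "\<exists>\<mu> :: real \<Rightarrow> real.
    \<mu> \<in> borel_measurable borel \<and> (\<forall>x. 0 \<le> \<mu> x) \<and>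
    prob_space (density lborel (\<lambda>x. ennreal (\<mu> x))) \<and>
    (\<forall>x. x \<notin> (\<Union>i\<in>{1..k}. {ah i..bh i}) \<longrightarrow> \<mu> x = 0) \<and>
    (\<forall>(f :: real \<Rightarrow> real) U L \<epsilon>.
       open U \<longrightarrow> (\<Union>i\<in>{1..k}. {ah i..bh i}) \<subseteq> U \<longrightarrow> L-lipschitz_on U f \<longrightarrow> 0 < \<epsilon> \<longrightarrow>
       (let X = (\<lambda>N l. real N powr (1 / 2 - \<epsilon>) *
                  \<bar>measure_pmf.expectation (empirical_measure N l) f - (LINT x|lborel. f x * \<mu> x)\<bar>)
        in (\<forall>\<delta>>0. (\<lambda>N. measure (P N) {l \<in> space (P N). \<delta> < X N l}) \<longlonglongrightarrow> 0) \<and>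
           (\<forall>m\<ge>1::nat. (\<lambda>N. LINT l|P N. X N l ^ m) \<longlonglongrightarrow> 0)))"
proof -
  note hyps = assms[unfolded \<alpha>_def \<beta>_def \<beta>m_def top_pt_def]
  interpret lattice_gas qh uh k \<theta> q u M n a b w VN Mh ah bh \<nu> V I A1 A2 A3 A4 A5 A6 A7
  proof unfold_locales
    show "\<forall>\<^sub>F N in sequentially. \<forall>i\<in>{1..k}. A6 < real (n N i) / real N"
      using A3(2) by eventually_elim blast
    show "\<forall>N\<ge>1. \<forall>i\<in>{1..k}. \<forall>x\<in>{alpha_pt \<theta> (q N) (u N) (n N) (a N) i..beta_minus_pt \<theta> (q N) (u N) (n N) (b N) i}.
          w N x = exp (- real N * VN N x)"
      using A2_weights(1) unfolding \<alpha>_def \<beta>m_def by blast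
  qed (fact hyps)+
  \<comment> \<open>\<open>F0\<close> is fixed before the test function and \<epsilon>, so a single
    density serves all of them.\<close>
  obtain F0 where F0: "F0 \<in> CC"
      "\<And>F. F \<in> CC \<Longrightarrow> \<theta> / (hi - 0) * (LINT x:{0..hi}|lborel. (F x - F0 x)\<^sup>2) \<le> E.J 0 F - E.minJ"
    using E.minimiser_limit by blast
  have S: "support \<in> sets borel" unfolding support_def by (intro sets.finite_UN) auto
  obtain \<mu> where \<mu>: "\<mu> \<in> borel_measurable borel" "\<And>x. 0 \<le> \<mu> x"
      "prob_space (density lborel (\<lambda>x. ennreal (\<mu> x)))" "\<And>x. x \<notin> support \<Longrightarrow> \<mu> x = 0"
      "\<And>x. measure (density lborel (\<lambda>x. ennreal (\<mu> x))) {..x} = F0 x"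
    using lipschitz_cdf_density[OF CC_basic(1)[OF F0(1)] CC_basic(4)[OF F0(1)] E.\<kappa> CC_basic(7)[OF F0(1)] CC_basic(8)[OF F0(1)]
        S CC_flat[OF F0(1)]] by blast
  have PP: "P = (\<lambda>N. ensemble k \<theta> N (q N) (u N) (n N) (a N) (b N) (w N))" by (simp only: P_def)
  note law = limit_law[OF F0 _ _ _ _ \<mu> refl PP]
  show ?thesis
    unfolding support_def[symmetric] Let_def
    by (intro exI[of _ \<mu>] conjI allI impI \<mu> law) assumption+
qed

end
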